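(* Let $\lambda\in\mathfrak h^*$ be integral with respect to $\mathfrak s=[\mathfrak l,\mathfrak l]$ and dominant with respect to $\mathfrak b\cap\mathfrak s$. Suppose $\lambda$ satisfies Condition B. Let $\mu\in\bar{\mathfrak h}^*$ be such that $n(\mu,\lambda)>0$. Then there exists an element $\bar d$ in the center of $U(\bar{\mathfrak g})$ such that, for any (nonzero) $\bar{\mathfrak b}\cap\bar{\mathfrak l}$-singular vector $v_\mu$ in $V_\lambda(\mathfrak l)$ of $\bar{\mathfrak h}$-weight $\mu$, the vector $i(\bar d)\cdot(1\otimes_{U(\mathfrak p)}v_\mu)$ is a non-zero $\bar{\mathfrak b}$-singular vector in $M_\lambda(\mathfrak g,\mathfrak p)$.
   Context: The base field is $\mathbb C$. $\mathfrak g,\bar{\mathfrak g}$ are finite-dimensional reductive Lie algebras and $i:\bar{\mathfrak g}\hookrightarrow\mathfrak g$ is an embedding (extended to $i:U(\bar{\mathfrak g})\to U(\mathfrak g)$) such that $i(\bar{\mathfrak g})$ is reductive in $\mathfrak g$ (every irreducible finite-dimensional $\mathfrak g$-module is semisimple over $i(\bar{\mathfrak g})$). Cartan subalgebras $\bar{\mathfrak h}\subset\bar{\mathfrak g}$, $\mathfrak h\subset\mathfrak g$ with $i(\bar{\mathfrak h})\subset\mathfrak h$ and Borel subalgebras $\bar{\mathfrak b}\supset\bar{\mathfrak h}$, $\mathfrak b\supset\mathfrak h$ with $i(\bar{\mathfrak b})\subset\mathfrak b$ are fixed. $\mathfrak p\supset\mathfrak b$ is a parabolic subalgebra of $\mathfrak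 g$, and $\bar{\mathfrak p}:=i^{-1}(i(\bar{\mathfrak g})\cap\mathfrak p)$, a parabolic subalgebra of $\bar{\mathfrak g}$ containing $\bar{\mathfrak b}$. $\mathfrak l\supset\mathfrak h$ and $\bar{\mathfrak l}\supset\bar{\mathfrak h}$ are the reductive Levi parts of $\mathfrak p,\bar{\mathfrak p}$ (so $i(\bar{\mathfrak l})=\mathfrak l\cap i(\bar{\mathfrak g})$). Modules over $\mathfrak g$ and $\mathfrak l$ are regarded as modules over $\bar{\mathfrak g}$ and $\bar{\mathfrak l}$ via $i$. "$\lambda$ integral with respect to $\mathfrak s$ and dominant with respect to $\mathfrak b\cap\mathfrak s$" means $2\langle\lambda,\beta\rangle/\langle\beta,\beta\rangle\in\mathbb Z_{\ge0}$ for all positive roots $\beta$ of $\mathfrak l$; $V_\lambda(\mathfrak l)$ is the irreducible finite-dimensional $\mathfrak l$-module of highest weight $\lambda$, viewed as a $\mathfrak p$-module with trivial action of the nilradical of $\mathfrak p$, and $M_\lambda(\mathfrak g,\mathfrak p)=U(\mathfrak g)\otimes_{U(\mathfrak p)}V_\lambda(\mathfrak l)$. $n(\mu,\lambda)$ denotes the multiplicity of the irreducible finite-dimensional $\bar{\mathfrak l}$-module $V_\mu(\bar{\mathfrak l})$ of highest weight $\mu$ in the (semisimple) $\bar{\mathfrak l}$-module $V_\lambda(\mathfrak l)$. For a Lie algebra $\mathfrak t$, a vector $v$ of a $\mathfrak t$-module is $\mathfrak t$-singular if $\mathbb C v$ is preserved by $\mathfrak t$. Weights $\mu,\nu\in\bar{\mathfrak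 h}^*$ are linked if there is an element $w$ of the Weyl group of $\bar{\mathfrak g}$ with $w(\mu+\rho_{\bar{\mathfrak g}})-\rho_{\bar{\mathfrak g}}=\nu$, where $\rho_{\bar{\mathfrak g}}$ is half the sum of the positive roots of $\bar{\mathfrak g}$. $\lambda$ satisfies Condition B if any two weights $\mu\ne\nu$ in $\bar{\mathfrak h}^*$ with $n(\mu,\lambda)>0$ and $n(\nu,\lambda)>0$ are not linked. *)

theory Defs
  imports Complex_Main "HOL-Library.Poly_Mapping" "HOL-Library.Function_Algebras"
    "HOL-Library.FuncSet"
begin

section \<open>Complex vector spaces and algebras\<close>

class complex_vector = ab_group_add +
  fixes scaleC :: "complex \<Rightarrow> 'a \<Rightarrow> 'a"  (infixr \<open>*\<^sub>C\<close> 75)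
  assumes scaleC_add_right: "c *\<^sub>C (x + y) = c *\<^sub>C x + c *\<^sub>C y"
    and scaleC_add_left: "(c + d) *\<^sub>C x = c *\<^sub>C x + d *\<^sub>C x"
    and scaleC_scaleC: "c *\<^sub>C d *\<^sub>C x = (c * d) *\<^sub>C x"
    and scaleC_one: "1 *\<^sub>C x = x"

interpretation complex_vector: vector_space "scaleC :: complex \<Rightarrow> 'a \<Rightarrow> 'a::complex_vector"
  by unfold_locales
    (simp_all add: scaleC_add_right scaleC_add_left scaleC_scaleC scaleC_one)

abbreviation "csubspace \<equiv> module.subspace scaleC"
abbreviation "cspan \<equiv> module.span scaleC"
abbreviation "clinear \<equiv> Vector_Spaces.linear scaleC scaleC"

lemma clinearI:
  assumes "\<And>x y. f (x + y) = f x + f y" "\<And>c x. f (c *\<^sub>C x) = c *\<^sub>C f x"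
  shows "clinear f"
  by (intro Vector_Spaces.linear.intro module_hom.intro module_hom_axioms.intro
      complex_vector.module_axioms complex_vector.vector_space_axioms assms)

definition fin_dim :: "'a::complex_vector set \<Rightarrow> bool" where
  "fin_dim W \<longleftrightarrow> (\<exists>B. finite B \<and> W \<subseteq> cspan B)"

text \<open>The trace of an endomorphism of a finite-dimensional space, computed in some basis.\<close>

definition ctrace :: "('a::complex_vector \<Rightarrow> 'a) \<Rightarrow> complex" where
  "ctrace T = (let B = complex_vector.extend_basis {}
     in \<Sum>b\<in>B. complex_vector.representation B (T b) b)"

class complex_algebra_1 = complex_vector + ring_1 +
  assumes mult_scaleC_left: "(c *\<^sub>C x) * y = c *\<^sub>C (x * y)"
    and mult_scaleC_right: "x * (c *\<^sub>C y) = c *\<^sub>C (x * y)"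

definition alg_hom :: "('a::complex_algebra_1 \<Rightarrow> 'b::complex_algebra_1) \<Rightarrow> bool" where
  "alg_hom F \<longleftrightarrow> clinear F \<and> F 1 = 1 \<and> (\<forall>x y. F (x * y) = F x * F y)"

instantiation complex :: complex_vector
begin
definition "scaleC_complex = ((*) :: complex \<Rightarrow> complex \<Rightarrow> complex)"
instance
  by standard (simp_all add: scaleC_complex_def algebra_simps)
end

instance complex :: complex_algebra_1
  by standard (simp_all add: scaleC_complex_def)

instantiation poly_mapping :: (type, complex_vector) complex_vector
begin

lift_definition scaleC_poly_mapping :: "complex \<Rightarrow> ('a \<Rightarrow>\<^sub>0 'b) \<Rightarrow> ('a \<Rightarrow>\<^sub>0 'b)"
  is "\<lambda>c f k. c *\<^sub>C f k"
  by (rule finite_subset) auto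

instance
  by (standard; transfer)
    (simp_all add: scaleC_add_right scaleC_add_left scaleC_scaleC scaleC_one)

end

text \<open>The type \<^typ>\<open>'k \<Rightarrow>\<^sub>0 complex\<close> is the free complex vector space on
  \<^typ>\<open>'k\<close>; \<open>lin_ext f\<close> is the linear extension of a map \<open>f\<close> on the basis.\<close>

definition lin_ext :: "('k \<Rightarrow> 'a::complex_vector) \<Rightarrow> ('k \<Rightarrow>\<^sub>0 complex) \<Rightarrow> 'a" where
  "lin_ext f p = (\<Sum>k\<in>Poly_Mapping.keys p. Poly_Mapping.lookup p k *\<^sub>C f k)"

lemma lin_ext_superset:
  assumes "finite A" "Poly_Mapping.keys p \<subseteq> A"
  shows "lin_ext f p = (\<Sum>k\<in>A. Poly_Mapping.lookup p k *\<^sub>C f k)"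
  unfolding lin_ext_def using assms
  by (intro sum.mono_neutral_left) (auto simp: in_keys_iff)

lemma lin_ext_single [simp]: "lin_ext f (Poly_Mapping.single k c) = c *\<^sub>C f k"
  by (subst lin_ext_superset[of "{k}"]) auto

lemma lookup_scaleC [simp]:
  "Poly_Mapping.lookup (c *\<^sub>C p) k = c *\<^sub>C Poly_Mapping.lookup p k"
  by transfer simp

lemma linear_lin_ext: "clinear (lin_ext f)"
proof (rule clinearI)
  fix p q :: "'a \<Rightarrow>\<^sub>0 complex" and c
  let ?A = "Poly_Mapping.keys p \<union> Poly_Mapping.keys q"
  have k: "Poly_Mapping.keys (p + q) \<subseteq> ?A" by (rule Poly_Mapping.keys_add)
  show "lin_ext f (p + q) = lin_ext f p + lin_ext f q"
    using k by (simp add: lin_ext_superset[of ?A] lookup_add scaleC_add_left sum.distrib)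
  have "Poly_Mapping.keys (c *\<^sub>C p) \<subseteq> Poly_Mapping.keys p"
    by (auto simp: in_keys_iff)
  then show "lin_ext f (c *\<^sub>C p) = c *\<^sub>C lin_ext f p"
    by (simp add: lin_ext_superset[of "Poly_Mapping.keys p"] complex_vector.scale_sum_right
        scaleC_complex_def)
qed

lemma lin_ext_add: "lin_ext f (p + q) = lin_ext f p + lin_ext f q"
  and lin_ext_scaleC: "lin_ext f (c *\<^sub>C p) = c *\<^sub>C lin_ext f p"
  and lin_ext_diff: "lin_ext f (p - q) = lin_ext f p - lin_ext f q"
  and lin_ext_zero [simp]: "lin_ext f 0 = 0"
proof -
  interpret Vector_Spaces.linear scaleC scaleC "lin_ext f" by (rule linear_lin_ext)
  show "lin_ext f (p + q) = lin_ext f p + lin_ext f q" "lin_ext f (c *\<^sub>C p) = c *\<^sub>C lin_ext f p"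
    "lin_ext f (p - q) = lin_ext f p - lin_ext f q" "lin_ext f 0 = 0"
    by (rule add scale diff zero)+
qed

lemma poly_mapping_induct_single:
  assumes "P 0" "\<And>p k c. P p \<Longrightarrow> P (Poly_Mapping.single k c + p)"
  shows "P (p :: 'k \<Rightarrow>\<^sub>0 'b::ab_group_add)"
proof (induction "card (Poly_Mapping.keys p)" arbitrary: p)
  case 0
  then have "p = 0" by (intro poly_mapping_eqI) (auto simp: in_keys_iff)
  then show ?case using assms(1) by simp
next
  case (Suc n)
  then obtain k where k: "k \<in> Poly_Mapping.keys p" by (metis card.empty ex_in_conv nat.distinct(1))
  define q where "q = p - Poly_Mapping.single k (Poly_Mapping.lookup p k)"
  have "Poly_Mapping.keys q = Poly_Mapping.keys p - {k}"
    by (auto simp: q_def in_keys_iff lookup_minus lookup_single when_def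
        split: if_splits)
  then have "P q" using Suc k by (intro Suc(1)) simp
  then have "P (Poly_Mapping.single k (Poly_Mapping.lookup p k) + q)" by (rule assms(2))
  then show ?case by (simp add: q_def)
qed


section \<open>Lie algebras\<close>

class lie_algebra = complex_vector +
  fixes brk :: "'a \<Rightarrow> 'a \<Rightarrow> 'a"
  assumes brk_add_left: "brk (x + y) z = brk x z + brk y z"
    and brk_add_right: "brk x (y + z) = brk x y + brk x z"
    and brk_scaleC_left: "brk (c *\<^sub>C x) y = c *\<^sub>C brk x y"
    and brk_scaleC_right: "brk x (c *\<^sub>C y) = c *\<^sub>C brk x y"
    and brk_self: "brk x x = 0"
    and brk_jacobi: "brk x (brk y z) + brk y (brk z x) + brk z (brk x y) = 0"

definition lie_hom :: "('h::lie_algebra \<Rightarrow> 'g::lie_algebra) \<Rightarrow> bool" where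
  "lie_hom f \<longleftrightarrow> clinear f \<and> (\<forall>x y. f (brk x y) = brk (f x) (f y))"

definition brk_span :: "'g::lie_algebra set \<Rightarrow> 'g set \<Rightarrow> 'g set" where
  "brk_span A B = cspan {brk x y | x y. x \<in> A \<and> y \<in> B}"

definition lie_subalgebra :: "'g::lie_algebra set \<Rightarrow> bool" where
  "lie_subalgebra L \<longleftrightarrow> csubspace L \<and> (\<forall>x\<in>L. \<forall>y\<in>L. brk x y \<in> L)"

definition lie_ideal :: "'g::lie_algebra set \<Rightarrow> 'g set \<Rightarrow> bool" where
  "lie_ideal I L \<longleftrightarrow> csubspace I \<and> I \<subseteq> L \<and> (\<forall>x\<in>L. \<forall>y\<in>I. brk x y \<in> I)"

definition lie_center :: "'g::lie_algebra set \<Rightarrow> 'g set" where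
  "lie_center L = {x \<in> L. \<forall>y\<in>L. brk x y = 0}"

primrec derived_series :: "'g::lie_algebra set \<Rightarrow> nat \<Rightarrow> 'g set" where
  "derived_series L 0 = L"
| "derived_series L (Suc n) = brk_span (derived_series L n) (derived_series L n)"

primrec lower_central_series :: "'g::lie_algebra set \<Rightarrow> nat \<Rightarrow> 'g set" where
  "lower_central_series L 0 = L"
| "lower_central_series L (Suc n) = brk_span L (lower_central_series L n)"

definition solvable :: "'g::lie_algebra set \<Rightarrow> bool" where
  "solvable L \<longleftrightarrow> (\<exists>n. derived_series L n = {0})"

definition nilpotent :: "'g::lie_algebra set \<Rightarrow> bool" where
  "nilpotent L \<longleftrightarrow> (\<exists>n. lower_central_series L n = {0})"

text \<open>In a finite-dimensional Lie algebra the union of all solvable ideals is itself the largest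
  solvable ideal.\<close>

definition radical :: "'g::lie_algebra set \<Rightarrow> 'g set" where
  "radical L = \<Union>{I. lie_ideal I L \<and> solvable I}"

definition reductive :: "'g::lie_algebra set \<Rightarrow> bool" where
  "reductive L \<longleftrightarrow> lie_subalgebra L \<and> radical L = lie_center L"

text \<open>Subalgebras of the Lie algebra given by the whole type.\<close>

definition cartan_subalgebra :: "'g::lie_algebra set \<Rightarrow> bool" where
  "cartan_subalgebra H \<longleftrightarrow> lie_subalgebra H \<and> nilpotent H \<and>
     {x. \<forall>y\<in>H. brk x y \<in> H} = H"

definition borel_subalgebra :: "'g::lie_algebra set \<Rightarrow> bool" where
  "borel_subalgebra B \<longleftrightarrow> lie_subalgebra B \<and> solvable B \<and>
     (\<forall>C. lie_subalgebra C \<and> solvable C \<and> B \<subseteq> C \<longrightarrow> C = B)"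

definition parabolic_subalgebra :: "'g::lie_algebra set \<Rightarrow> bool" where
  "parabolic_subalgebra P \<longleftrightarrow> lie_subalgebra P \<and> (\<exists>B. borel_subalgebra B \<and> B \<subseteq> P)"


section \<open>Weights, roots and the Weyl group\<close>

text \<open>An element of the dual of a subspace \<open>H\<close> is represented by the function that is this
  functional on \<open>H\<close> and zero outside \<open>H\<close>, so that two weights are equal as
  functions iff they are equal as elements of the dual space.\<close>

definition dual :: "'g::complex_vector set \<Rightarrow> ('g \<Rightarrow> complex) set" where
  "dual H = {f. (\<forall>x\<in>H. \<forall>y\<in>H. f (x + y) = f x + f y) \<and>
     (\<forall>c. \<forall>x\<in>H. f (c *\<^sub>C x) = c * f x) \<and> (\<forall>x. x \<notin> H \<longrightarrow> f x = 0)}"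

definition root_space :: "'g::lie_algebra set \<Rightarrow> ('g \<Rightarrow> complex) \<Rightarrow> 'g set" where
  "root_space H \<beta> = {x. \<forall>h\<in>H. brk h x = \<beta> h *\<^sub>C x}"

definition roots :: "'g::lie_algebra set \<Rightarrow> ('g \<Rightarrow> complex) set" where
  "roots H = {\<beta> \<in> dual H. \<beta> \<noteq> 0 \<and> root_space H \<beta> \<noteq> {0}}"

definition pos_roots :: "'g::lie_algebra set \<Rightarrow> 'g set \<Rightarrow> ('g \<Rightarrow> complex) set" where
  "pos_roots H B = {\<beta> \<in> roots H. root_space H \<beta> \<subseteq> B}"

text \<open>For a parabolic subalgebra \<open>P\<close> containing \<open>H\<close>: its reductive Levi part containing
  \<open>H\<close>, and its nilradical (the nilpotent complement of the Levi part; it does not contain the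
  center of the ambient reductive Lie algebra).\<close>

definition levi :: "'g::lie_algebra set \<Rightarrow> 'g set \<Rightarrow> 'g set" where
  "levi H P = cspan (H \<union>
     \<Union>{root_space H \<beta> | \<beta>. \<beta> \<in> roots H \<and> root_space H \<beta> \<subseteq> P \<and> root_space H (- \<beta>) \<subseteq> P})"

definition nilrad :: "'g::lie_algebra set \<Rightarrow> 'g set \<Rightarrow> 'g set" where
  "nilrad H P = cspan
     (\<Union>{root_space H \<beta> | \<beta>. \<beta> \<in> roots H \<and> root_space H \<beta> \<subseteq> P \<and> \<not> root_space H (- \<beta>) \<subseteq> P})"

definition killing :: "'g::lie_algebra \<Rightarrow> 'g \<Rightarrow> complex" where
  "killing x y = ctrace (\<lambda>z. brk x (brk y z))"

text \<open>The Killing form of a reductive Lie algebra is degenerate on the center, but nondegenerate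
  on the intersection of \<open>H\<close> with the derived algebra, so every root \<open>\<beta>\<close> is represented by a
  unique vector there. This gives the pairing \<open>\<langle>\<lambda>, \<beta>\<rangle>\<close> of a weight with a root. The quotients
  \<open>2 \<langle>\<lambda>, \<beta>\<rangle> / \<langle>\<beta>, \<beta>\<rangle>\<close>, which are all that is used, are the same for every nondegenerate
  invariant symmetric form.\<close>

definition root_vec :: "'g::lie_algebra set \<Rightarrow> ('g \<Rightarrow> complex) \<Rightarrow> 'g" where
  "root_vec H \<beta> = (THE t. t \<in> H \<inter> brk_span UNIV UNIV \<and> (\<forall>x\<in>H. killing t x = \<beta> x))"

definition pairing :: "'g::lie_algebra set \<Rightarrow> ('g \<Rightarrow> complex) \<Rightarrow> ('g \<Rightarrow> complex) \<Rightarrow> complex" where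
  "pairing H lam \<beta> = lam (root_vec H \<beta>)"

text \<open>Here \<open>L\<close> is a Levi part containing \<open>H\<close>, so its positive roots are the positive roots
  of the ambient algebra whose root spaces lie in \<open>L\<close>.\<close>

definition dominant_integral ::
    "'g::lie_algebra set \<Rightarrow> 'g set \<Rightarrow> 'g set \<Rightarrow> ('g \<Rightarrow> complex) \<Rightarrow> bool" where
  "dominant_integral L H B lam \<longleftrightarrow> (\<forall>\<beta>\<in>pos_roots H B. root_space H \<beta> \<subseteq> L \<longrightarrow>
     (\<exists>k::nat. 2 * pairing H lam \<beta> / pairing H \<beta> \<beta> = of_nat k))"

definition reflection ::
    "'g::lie_algebra set \<Rightarrow> ('g \<Rightarrow> complex) \<Rightarrow> ('g \<Rightarrow> complex) \<Rightarrow> ('g \<Rightarrow> complex)" where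
  "reflection H \<beta> lam = lam - (\<lambda>x. 2 * pairing H lam \<beta> / pairing H \<beta> \<beta> * \<beta> x)"

inductive_set weyl_group :: "'g::lie_algebra set \<Rightarrow> (('g \<Rightarrow> complex) \<Rightarrow> ('g \<Rightarrow> complex)) set"
  for H where
  weyl_id: "id \<in> weyl_group H"
| weyl_refl: "w \<in> weyl_group H \<Longrightarrow> \<beta> \<in> roots H \<Longrightarrow> reflection H \<beta> \<circ> w \<in> weyl_group H"

definition half_sum :: "'g::lie_algebra set \<Rightarrow> 'g set \<Rightarrow> ('g \<Rightarrow> complex)" where
  "half_sum H B = (\<lambda>x. (\<Sum>\<beta>\<in>pos_roots H B. \<beta> x) / 2)"

definition linked ::
    "'g::lie_algebra set \<Rightarrow> 'g set \<Rightarrow> ('g \<Rightarrow> complex) \<Rightarrow> ('g \<Rightarrow> complex) \<Rightarrow> bool" where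
  "linked H B \<mu> \<nu> \<longleftrightarrow>
     (\<exists>w\<in>weyl_group H. w (\<mu> + half_sum H B) - half_sum H B = \<nu>)"


section \<open>Modules\<close>

text \<open>A module over the subalgebra \<open>L\<close> consists of a subspace \<open>W\<close> of the type
  \<^typ>\<open>'m\<close> and an action \<open>\<rho>\<close>, of which only the restriction to \<open>L\<close> and \<open>W\<close> matters.\<close>

definition lie_module ::
    "'g::lie_algebra set \<Rightarrow> ('g \<Rightarrow> 'm \<Rightarrow> 'm) \<Rightarrow> 'm::complex_vector set \<Rightarrow> bool" where
  "lie_module L \<rho> W \<longleftrightarrow> csubspace W \<and>
     (\<forall>x\<in>L. \<forall>v\<in>W. \<rho> x v \<in> W) \<and>
     (\<forall>x\<in>L. \<forall>u\<in>W. \<forall>v\<in>W. \<rho> x (u + v) = \<rho> x u + \<rho> x v) \<and>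
     (\<forall>x\<in>L. \<forall>c. \<forall>v\<in>W. \<rho> x (c *\<^sub>C v) = c *\<^sub>C \<rho> x v) \<and>
     (\<forall>x\<in>L. \<forall>y\<in>L. \<forall>v\<in>W. \<rho> (x + y) v = \<rho> x v + \<rho> y v) \<and>
     (\<forall>c. \<forall>x\<in>L. \<forall>v\<in>W. \<rho> (c *\<^sub>C x) v = c *\<^sub>C \<rho> x v) \<and>
     (\<forall>x\<in>L. \<forall>y\<in>L. \<forall>v\<in>W. \<rho> (brk x y) v = \<rho> x (\<rho> y v) - \<rho> y (\<rho> x v))"

definition irreducible_module ::
    "'g::lie_algebra set \<Rightarrow> ('g \<Rightarrow> 'm \<Rightarrow> 'm) \<Rightarrow> 'm::complex_vector set \<Rightarrow> bool" where
  "irreducible_module L \<rho> W \<longleftrightarrow> lie_module L \<rho> W \<and> W \<noteq> {0} \<and>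
     (\<forall>U. lie_module L \<rho> U \<and> U \<subseteq> W \<longrightarrow> U = {0} \<or> U = W)"

text \<open>\<open>W\<close> is the (internal) direct sum of the finitely many irreducible submodules in \<open>S\<close>.\<close>

definition irr_decomposition :: "'g::lie_algebra set \<Rightarrow> ('g \<Rightarrow> 'm \<Rightarrow> 'm) \<Rightarrow>
    'm::complex_vector set \<Rightarrow> 'm set set \<Rightarrow> bool" where
  "irr_decomposition L \<rho> W S \<longleftrightarrow> lie_module L \<rho> W \<and> finite S \<and>
     (\<forall>U\<in>S. irreducible_module L \<rho> U \<and> U \<subseteq> W) \<and>
     (\<forall>v\<in>W. \<exists>!f. f \<in> (\<Pi>\<^sub>E U\<in>S. U) \<and> v = (\<Sum>U\<in>S. f U))"

definition semisimple_module ::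
    "'g::lie_algebra set \<Rightarrow> ('g \<Rightarrow> 'm \<Rightarrow> 'm) \<Rightarrow> 'm::complex_vector set \<Rightarrow> bool" where
  "semisimple_module L \<rho> W \<longleftrightarrow> (\<exists>S. irr_decomposition L \<rho> W S)"

text \<open>Every finite-dimensional module is isomorphic to one carried by a subspace of
  \<^typ>\<open>nat \<Rightarrow>\<^sub>0 complex\<close>, so it suffices to quantify over these.\<close>

definition reductive_in :: "'g::lie_algebra set \<Rightarrow> bool" where
  "reductive_in K \<longleftrightarrow> (\<forall>(W :: (nat \<Rightarrow>\<^sub>0 complex) set) \<rho>.
     fin_dim W \<and> irreducible_module (UNIV :: 'g set) \<rho> W \<longrightarrow> semisimple_module K \<rho> W)"

text \<open>\<open>singular scl act T v\<close>: the line through \<open>v\<close> is preserved by \<open>T\<close>. The scalar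
  multiplication is a parameter because the generalized Verma module below is not the carrier
  of a type.\<close>

definition singular ::
    "(complex \<Rightarrow> 'm \<Rightarrow> 'm) \<Rightarrow> ('g \<Rightarrow> 'm \<Rightarrow> 'm) \<Rightarrow> 'g set \<Rightarrow> 'm \<Rightarrow> bool" where
  "singular scl act T v \<longleftrightarrow>
     (\<forall>x\<in>T. act x ` range (\<lambda>c. scl c v) \<subseteq> range (\<lambda>c. scl c v))"

definition weight_vector :: "'g set \<Rightarrow> ('g \<Rightarrow> 'm \<Rightarrow> 'm) \<Rightarrow> ('g \<Rightarrow> complex) \<Rightarrow>
    'm::complex_vector \<Rightarrow> bool" where
  "weight_vector H \<rho> lam v \<longleftrightarrow> (\<forall>x\<in>H. \<rho> x v = lam x *\<^sub>C v)"

text \<open>\<open>W\<close> is the irreducible finite-dimensional \<open>L\<close>-module \<open>V(L)\<close> of highest weight \<open>lam\<close>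
  (which determines it up to isomorphism).\<close>

definition irr_highest_weight :: "'g::lie_algebra set \<Rightarrow> 'g set \<Rightarrow> 'g set \<Rightarrow>
    ('g \<Rightarrow> 'm \<Rightarrow> 'm) \<Rightarrow> ('g \<Rightarrow> complex) \<Rightarrow> 'm::complex_vector set \<Rightarrow> bool" where
  "irr_highest_weight L H B \<rho> lam W \<longleftrightarrow> irreducible_module L \<rho> W \<and> fin_dim W \<and>
     (\<exists>v\<in>W. v \<noteq> 0 \<and> singular scaleC \<rho> (B \<inter> L) v \<and> weight_vector H \<rho> lam v)"

text \<open>The multiplicity of \<open>V\<^sub>\<mu>(L)\<close> in the semisimple module \<open>W\<close>; it does not depend on
  the decomposition.\<close>

definition multiplicity :: "'g::lie_algebra set \<Rightarrow> 'g set \<Rightarrow> 'g set \<Rightarrow>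
    ('g \<Rightarrow> 'm \<Rightarrow> 'm) \<Rightarrow> 'm::complex_vector set \<Rightarrow> ('g \<Rightarrow> complex) \<Rightarrow> nat" where
  "multiplicity L H B \<rho> W \<mu> = (THE k. \<exists>S. irr_decomposition L \<rho> W S \<and>
     k = card {U \<in> S. irr_highest_weight L H B \<rho> \<mu> U})"

text \<open>The weights \<open>\<mu>\<close> range over the dual of \<open>H\<close>; \<open>n \<mu>\<close> is the multiplicity of \<open>\<mu>\<close>.\<close>

definition condition_B ::
    "'g::lie_algebra set \<Rightarrow> 'g set \<Rightarrow> (('g \<Rightarrow> complex) \<Rightarrow> nat) \<Rightarrow> bool" where
  "condition_B H B n \<longleftrightarrow> (\<forall>\<mu>\<in>dual H. \<forall>\<nu>\<in>dual H.
     \<mu> \<noteq> \<nu> \<and> n \<mu> > 0 \<and> n \<nu> > 0 \<longrightarrow> \<not> linked H B \<mu> \<nu>)"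


section \<open>The universal enveloping algebra\<close>

text \<open>The free monoid on a set of letters, written additively, so that
  \<open>'g word \<Rightarrow>\<^sub>0 complex\<close> with the convolution product of \<^theory>\<open>HOL-Library.Poly_Mapping\<close>
  is the free associative unital algebra on the set \<^typ>\<open>'g\<close>.\<close>

datatype 'g word = Word (letters: "'g list")

instantiation word :: (type) monoid_add
begin
definition "0 = Word []"
definition "v + w = Word (letters v @ letters w)"
instance
  by standard (simp_all add: zero_word_def plus_word_def)
end

lemma scaleC_eq_mult: "c *\<^sub>C p = Poly_Mapping.single 0 c * p"
  for p :: "'k::monoid_add \<Rightarrow>\<^sub>0 complex"
proof (induction p rule: poly_mapping_induct_single)
  case (2 p k d)
  have "c *\<^sub>C Poly_Mapping.single k d = Poly_Mapping.single k (c * d)"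
    by (intro poly_mapping_eqI) (simp add: lookup_single when_def scaleC_complex_def)
  then show ?case using 2 by (simp add: scaleC_add_right distrib_left mult_single)
qed simp

lemma scaleC_eq_mult': "c *\<^sub>C p = p * Poly_Mapping.single 0 c"
  for p :: "'k::monoid_add \<Rightarrow>\<^sub>0 complex"
proof (induction p rule: poly_mapping_induct_single)
  case (2 p k d)
  have "c *\<^sub>C Poly_Mapping.single k d = Poly_Mapping.single k (d * c)"
    by (intro poly_mapping_eqI) (simp add: lookup_single when_def scaleC_complex_def)
  then show ?case using 2 by (simp add: scaleC_add_right distrib_right mult_single)
qed simp

lemma poly_scaleC_mult_left: "(c *\<^sub>C p) * q = c *\<^sub>C (p * q)"
  and poly_scaleC_mult_right: "p * (c *\<^sub>C q) = c *\<^sub>C (p * q)"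
  for p q :: "'k::monoid_add \<Rightarrow>\<^sub>0 complex"
  by (simp add: scaleC_eq_mult mult.assoc)
    (simp add: scaleC_eq_mult' flip: mult.assoc)

lemma lin_ext_mult:
  fixes f :: "'k::monoid_add \<Rightarrow> 'a::complex_algebra_1"
  assumes "\<And>v w. f (v + w) = f v * f w"
  shows "lin_ext f (p * q) = lin_ext f p * lin_ext f q"
proof -
  have *: "lin_ext f (Poly_Mapping.single k c * q) = c *\<^sub>C f k * lin_ext f q" for k c
    by (induction q rule: poly_mapping_induct_single)
      (simp_all add: distrib_left lin_ext_add mult_single assms mult_scaleC_left
        mult_scaleC_right scaleC_scaleC scaleC_add_right)
  show ?thesis
    by (induction p rule: poly_mapping_induct_single)
      (simp_all add: distrib_right lin_ext_add *)
qed

abbreviation wd :: "'g list \<Rightarrow> ('g word \<Rightarrow>\<^sub>0 complex)" where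
  "wd xs \<equiv> Poly_Mapping.single (Word xs) 1"

text \<open>The two-sided ideal generated by the linear relations, which turn the free algebra into the
  tensor algebra of the vector space \<^typ>\<open>'g\<close>, and by the relations \<open>xy - yx - [x, y]\<close>.\<close>

inductive_set uea_ideal :: "('g::lie_algebra word \<Rightarrow>\<^sub>0 complex) set" where
  "wd [x + y] - wd [x] - wd [y] \<in> uea_ideal"
| "wd [c *\<^sub>C x] - c *\<^sub>C wd [x] \<in> uea_ideal"
| "wd [x] * wd [y] - wd [y] * wd [x] - wd [brk x y] \<in> uea_ideal"
| uea_ideal_add: "a \<in> uea_ideal \<Longrightarrow> b \<in> uea_ideal \<Longrightarrow> a + b \<in> uea_ideal"
| uea_ideal_mult_left: "a \<in> uea_ideal \<Longrightarrow> b * a \<in> uea_ideal"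
| uea_ideal_mult_right: "a \<in> uea_ideal \<Longrightarrow> a * b \<in> uea_ideal"

lemma uea_ideal_zero: "0 \<in> uea_ideal"
  using uea_ideal_mult_left[OF uea_ideal.intros(1), of 0] by simp

lemma uea_ideal_uminus: "a \<in> uea_ideal \<Longrightarrow> - a \<in> uea_ideal"
  using uea_ideal_mult_left[of a "-1"] by simp

lemma uea_ideal_scaleC: "a \<in> uea_ideal \<Longrightarrow> c *\<^sub>C a \<in> uea_ideal"
  by (simp add: scaleC_eq_mult uea_ideal_mult_left)

lemma uea_ideal_diff_add:
  assumes "a - b \<in> uea_ideal" "c - d \<in> uea_ideal"
  shows "(a + c) - (b + d) \<in> uea_ideal"
  using uea_ideal_add[OF assms] by (simp add: algebra_simps)

lemma uea_ideal_diff_minus: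
  assumes "a - b \<in> uea_ideal" "c - d \<in> uea_ideal"
  shows "(a - c) - (b - d) \<in> uea_ideal"
  using uea_ideal_add[OF assms(1) uea_ideal_uminus[OF assms(2)]] by (simp add: algebra_simps)

lemma uea_ideal_diff_mult:
  assumes "a - b \<in> uea_ideal" "c - d \<in> uea_ideal"
  shows "a * c - b * d \<in> uea_ideal"
  using uea_ideal_add[OF uea_ideal_mult_right[OF assms(1), of c]
      uea_ideal_mult_left[OF assms(2), of b]]
  by (simp add: algebra_simps)

lemma uea_ideal_diff_scaleC:
  assumes "a - b \<in> uea_ideal"
  shows "c *\<^sub>C a - c *\<^sub>C b \<in> uea_ideal"
  using uea_ideal_scaleC[OF assms, of c] by (simp add: complex_vector.scale_right_diff_distrib)

lemma one_notin_uea_ideal: "1 \<notin> uea_ideal"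
proof -
  define f :: "'a word \<Rightarrow> complex" where "f w = (if letters w = [] then 1 else 0)" for w
  have f: "f (v + w) = f v * f w" for v w
    by (simp add: f_def plus_word_def)
  have "lin_ext f a = 0" if "a \<in> uea_ideal" for a
    using that
    by induction (simp_all add: lin_ext_add lin_ext_diff lin_ext_scaleC lin_ext_mult f,
        simp_all add: f_def scaleC_complex_def)
  moreover have "lin_ext f 1 = 1"
    using lin_ext_single[of f 0 1]
    by (simp add: f_def scaleC_complex_def del: lin_ext_single) (simp add: zero_word_def)
  ultimately show ?thesis by force
qed

quotient_type (overloaded) 'g uea = "'g::lie_algebra word \<Rightarrow>\<^sub>0 complex" / "\<lambda>a b. a - b \<in> uea_ideal"
proof (rule equivpI)
  show "reflp (\<lambda>a b :: 'g word \<Rightarrow>\<^sub>0 complex. a - b \<in> uea_ideal)"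
    by (simp add: reflp_def uea_ideal_zero)
  show "symp (\<lambda>a b :: 'g word \<Rightarrow>\<^sub>0 complex. a - b \<in> uea_ideal)"
    by (auto simp: symp_def dest: uea_ideal_uminus)
  show "transp (\<lambda>a b :: 'g word \<Rightarrow>\<^sub>0 complex. a - b \<in> uea_ideal)"
    by (auto simp: transp_def dest: uea_ideal_add)
qed

instantiation uea :: (lie_algebra) complex_algebra_1
begin

lift_definition zero_uea :: "'a uea" is 0 .
lift_definition one_uea :: "'a uea" is 1 .
lift_definition plus_uea :: "'a uea \<Rightarrow> 'a uea \<Rightarrow> 'a uea" is "(+)"
  by (rule uea_ideal_diff_add)
lift_definition minus_uea :: "'a uea \<Rightarrow> 'a uea \<Rightarrow> 'a uea" is "(-)"
  by (rule uea_ideal_diff_minus)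
lift_definition uminus_uea :: "'a uea \<Rightarrow> 'a uea" is uminus
  using uea_ideal_diff_minus[of 0 0] by (simp add: uea_ideal_zero)
lift_definition times_uea :: "'a uea \<Rightarrow> 'a uea \<Rightarrow> 'a uea" is "(*)"
  by (rule uea_ideal_diff_mult)
lift_definition scaleC_uea :: "complex \<Rightarrow> 'a uea \<Rightarrow> 'a uea" is scaleC
  by (rule uea_ideal_diff_scaleC)

instance
proof
  have eq: "a - b \<in> uea_ideal" if "a = b" for a b :: "'a word \<Rightarrow>\<^sub>0 complex"
    using that by (simp add: uea_ideal_zero)
  fix a b c :: "'a uea" and x y :: complex
  show "a + b + c = a + (b + c)" by (transfer, rule eq, rule add.assoc)
  show "a + b = b + a" by (transfer, rule eq, rule add.commute)
  show "0 + a = a" by (transfer, rule eq, rule add_0_left)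
  show "- a + a = 0" by (transfer, rule eq, rule left_minus)
  show "a - b = a + - b" by (transfer, rule eq, rule diff_conv_add_uminus)
  show "a * b * c = a * (b * c)" by (transfer, rule eq, rule mult.assoc)
  show "1 * a = a" by (transfer, rule eq, rule mult_1_left)
  show "a * 1 = a" by (transfer, rule eq, rule mult_1_right)
  show "(a + b) * c = a * c + b * c" by (transfer, rule eq, rule distrib_right)
  show "a * (b + c) = a * b + a * c" by (transfer, rule eq, rule distrib_left)
  show "(0 :: 'a uea) \<noteq> 1"
    by transfer (use one_notin_uea_ideal uea_ideal_uminus in force)
  show "x *\<^sub>C (a + b) = x *\<^sub>C a + x *\<^sub>C b" by (transfer, rule eq, rule scaleC_add_right)
  show "(x + y) *\<^sub>C a = x *\<^sub>C a + y *\<^sub>C a" by (transfer, rule eq, rule scaleC_add_left)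
  show "x *\<^sub>C y *\<^sub>C a = (x * y) *\<^sub>C a" by (transfer, rule eq, rule scaleC_scaleC)
  show "1 *\<^sub>C a = a" by (transfer, rule eq, rule scaleC_one)
  show "(x *\<^sub>C a) * b = x *\<^sub>C (a * b)" by (transfer, rule eq, rule poly_scaleC_mult_left)
  show "a * (x *\<^sub>C b) = x *\<^sub>C (a * b)" by (transfer, rule eq, rule poly_scaleC_mult_right)
qed

end

lift_definition uea_in :: "'g::lie_algebra \<Rightarrow> 'g uea" is "\<lambda>x. wd [x]" .


lemma uea_in_add: "uea_in (x + y) = uea_in x + uea_in y"
  and uea_in_scaleC: "uea_in (c *\<^sub>C x) = c *\<^sub>C uea_in x"
  and uea_in_brk: "uea_in (brk x y) = uea_in x * uea_in y - uea_in y * uea_in x"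
proof -
  show "uea_in (x + y) = uea_in x + uea_in y"
    by transfer (simp add: uea_ideal.intros(1) flip: diff_diff_eq)
  show "uea_in (c *\<^sub>C x) = c *\<^sub>C uea_in x"
    by transfer (rule uea_ideal.intros)
  show "uea_in (brk x y) = uea_in x * uea_in y - uea_in y * uea_in x"
    by transfer (use uea_ideal_uminus[OF uea_ideal.intros(3)] in simp)
qed

text \<open>The extension of a Lie algebra homomorphism \<open>f\<close> into an associative algebra to the
  enveloping algebra. It is evaluated on a representative; by \<open>uea_lift_hom\<close> below the result does
  not depend on it.\<close>

definition uea_lift :: "('g::lie_algebra \<Rightarrow> 'a::complex_algebra_1) \<Rightarrow> 'g uea \<Rightarrow> 'a" where
  "uea_lift f u = lin_ext (\<lambda>w. prod_list (map f (letters w))) (rep_uea u)"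

lemma uea_lift_hom:
  assumes "clinear f" "\<And>x y. f (brk x y) = f x * f y - f y * f x"
  shows "alg_hom (uea_lift f)" and "uea_lift f (uea_in x) = f x"
proof -
  interpret f: Vector_Spaces.linear scaleC scaleC f by fact
  define F where "F = (\<lambda>w. prod_list (map f (letters w)))"
  have F: "F (v + w) = F v * F w" for v w by (simp add: F_def plus_word_def)
  have ideal: "lin_ext F a = 0" if "a \<in> uea_ideal" for a
    using that
    by induction (simp_all add: lin_ext_add lin_ext_diff lin_ext_scaleC lin_ext_mult F,
        simp_all add: F_def scaleC_one f.add f.scale assms(2))
  have abs: "uea_lift f (abs_uea a) = lin_ext F a" for a
  proof -
    have "rep_uea (abs_uea a) - a \<in> uea_ideal"
      by (rule rep_abs_rsp_left[OF Quotient3_uea]) (simp add: uea_ideal_zero)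
    from ideal[OF this] show ?thesis
      by (simp add: uea_lift_def F_def lin_ext_diff)
  qed
  show "uea_lift f (uea_in x) = f x"
    by (simp add: uea_in.abs_eq abs F_def scaleC_one)
  have ex: "\<exists>a. u = abs_uea a" for u :: "'a uea"
    by (metis Quotient3_abs_rep[OF Quotient3_uea])
  have one: "uea_lift f 1 = 1"
    using lin_ext_single[of F 0 1]
    by (simp add: one_uea.abs_eq abs) (simp add: F_def zero_word_def scaleC_one)
  have add: "uea_lift f (u + v) = uea_lift f u + uea_lift f v"
    and mult: "uea_lift f (u * v) = uea_lift f u * uea_lift f v"
    and scale: "uea_lift f (c *\<^sub>C u) = c *\<^sub>C uea_lift f u" for u v c
    using ex[of u] ex[of v]
    by (auto simp: plus_uea.abs_eq times_uea.abs_eq scaleC_uea.abs_eq abs lin_ext_add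
        lin_ext_scaleC lin_ext_mult F)
  have "clinear (uea_lift f)"
    by (rule clinearI) (rule add scale)+
  then show "alg_hom (uea_lift f)" by (simp add: alg_hom_def one mult)
qed

definition uea_map :: "('h::lie_algebra \<Rightarrow> 'g::lie_algebra) \<Rightarrow> 'h uea \<Rightarrow> 'g uea" where
  "uea_map i = uea_lift (\<lambda>x. uea_in (i x))"

lemma uea_map_hom:
  assumes "lie_hom i"
  shows "alg_hom (uea_map i)" and "uea_map i (uea_in x) = uea_in (i x)"
proof -
  interpret i: Vector_Spaces.linear scaleC scaleC i using assms by (simp add: lie_hom_def)
  have "clinear (\<lambda>x. uea_in (i x))"
    by (rule clinearI) (simp_all add: i.add i.scale uea_in_add uea_in_scaleC)
  moreover have "uea_in (i (brk x y)) = uea_in (i x) * uea_in (i y) - uea_in (i y) * uea_in (i x)"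
    for x y using assms by (simp add: lie_hom_def uea_in_brk)
  ultimately show "alg_hom (uea_map i)" "uea_map i (uea_in x) = uea_in (i x)"
    unfolding uea_map_def by (rule uea_lift_hom)+
qed

definition uea_center :: "'g::lie_algebra uea set" where
  "uea_center = {z. \<forall>u. z * u = u * z}"


section \<open>Generalized Verma modules\<close>

text \<open>For a subalgebra \<open>P\<close> and a \<open>P\<close>-module with action \<open>\<rho>\<close> on the whole type \<^typ>\<open>'v\<close>, the
  tensor product of \<open>U(g)\<close> with \<^typ>\<open>'v\<close> over \<open>U(P)\<close> is the free vector space on the pairs
  \<open>(u, v)\<close> modulo the following relations. As \<open>U(P)\<close> is generated by \<open>P\<close>, the relations
  \<open>(u a, v) = (u, a v)\<close> with \<open>a \<in> U(P)\<close> follow from those with \<open>a \<in> P\<close> and those for scalars.\<close>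

abbreviation pair :: "'g::lie_algebra uea \<Rightarrow> 'v \<Rightarrow> ('g uea \<times> 'v \<Rightarrow>\<^sub>0 complex)" where
  "pair u v \<equiv> Poly_Mapping.single (u, v) 1"

definition tensor_rel :: "'g::lie_algebra set \<Rightarrow> ('g \<Rightarrow> 'v \<Rightarrow> 'v) \<Rightarrow>
    ('g uea \<times> 'v::complex_vector \<Rightarrow>\<^sub>0 complex) set" where
  "tensor_rel P \<rho> = cspan (
     {pair (u + u') v - pair u v - pair u' v | u u' v. True} \<union>
     {pair u (v + v') - pair u v - pair u v' | u v v'. True} \<union>
     {pair (c *\<^sub>C u) v - c *\<^sub>C pair u v | c u v. True} \<union>
     {pair u (c *\<^sub>C v) - c *\<^sub>C pair u v | c u v. True} \<union>
     {pair (u * uea_in x) v - pair u (\<rho> x v) | u x v. x \<in> P})"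

definition tensor_eqv :: "'g::lie_algebra set \<Rightarrow> ('g \<Rightarrow> 'v \<Rightarrow> 'v) \<Rightarrow>
    (('g uea \<times> 'v::complex_vector \<Rightarrow>\<^sub>0 complex) \<times> ('g uea \<times> 'v \<Rightarrow>\<^sub>0 complex)) set" where
  "tensor_eqv P \<rho> = {(a, b). a - b \<in> tensor_rel P \<rho>}"

type_synonym ('g, 'v) verma = "('g uea \<times> 'v \<Rightarrow>\<^sub>0 complex) set"

definition verma_module :: "'g::lie_algebra set \<Rightarrow> ('g \<Rightarrow> 'v \<Rightarrow> 'v) \<Rightarrow>
    ('g, 'v::complex_vector) verma set" where
  "verma_module P \<rho> = UNIV // tensor_eqv P \<rho>"

definition verma_zero :: "'g::lie_algebra set \<Rightarrow> ('g \<Rightarrow> 'v \<Rightarrow> 'v) \<Rightarrow>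
    ('g, 'v::complex_vector) verma" where
  "verma_zero P \<rho> = tensor_eqv P \<rho> `` {0}"

definition verma_tensor :: "'g::lie_algebra set \<Rightarrow> ('g \<Rightarrow> 'v \<Rightarrow> 'v) \<Rightarrow> 'g uea \<Rightarrow> 'v \<Rightarrow>
    ('g, 'v::complex_vector) verma" where
  "verma_tensor P \<rho> u v = tensor_eqv P \<rho> `` {pair u v}"

definition verma_scale :: "'g::lie_algebra set \<Rightarrow> ('g \<Rightarrow> 'v \<Rightarrow> 'v) \<Rightarrow> complex \<Rightarrow>
    ('g, 'v::complex_vector) verma \<Rightarrow> ('g, 'v) verma" where
  "verma_scale P \<rho> c m = tensor_eqv P \<rho> `` (scaleC c ` m)"

text \<open>The action of \<open>U(g)\<close> by left multiplication on the first factor.\<close>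

definition verma_act :: "'g::lie_algebra set \<Rightarrow> ('g \<Rightarrow> 'v \<Rightarrow> 'v) \<Rightarrow> 'g uea \<Rightarrow>
    ('g, 'v::complex_vector) verma \<Rightarrow> ('g, 'v) verma" where
  "verma_act P \<rho> u m =
     tensor_eqv P \<rho> `` (lin_ext (\<lambda>(u', v). pair (u * u') v) ` m)"

lemma equiv_tensor_eqv: "equiv UNIV (tensor_eqv P \<rho>)"
proof (rule equivI)
  show "refl (tensor_eqv P \<rho>)"
    by (simp add: refl_on_def tensor_eqv_def tensor_rel_def complex_vector.span_zero)
  show "sym (tensor_eqv P \<rho>)"
    unfolding sym_def tensor_eqv_def tensor_rel_def
    by (metis (no_types, lifting) complex_vector.span_neg case_prodD case_prodI mem_Collect_eq
        minus_diff_eq)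
  show "trans (tensor_eqv P \<rho>)"
    unfolding trans_def tensor_eqv_def tensor_rel_def
    by (metis (no_types, lifting) complex_vector.span_add case_prodD case_prodI mem_Collect_eq
        diff_add_cancel add_diff_eq)
qed auto

lemma tensor_eqv_image:
  assumes "clinear T" "T ` tensor_rel P \<rho> \<subseteq> tensor_rel P \<rho>"
  shows "tensor_eqv P \<rho> `` (T ` (tensor_eqv P \<rho> `` {a})) = tensor_eqv P \<rho> `` {T a}"
proof -
  interpret T: Vector_Spaces.linear scaleC scaleC T by fact
  have "(T a, T b) \<in> tensor_eqv P \<rho>" if "(a, b) \<in> tensor_eqv P \<rho>" for b
    using that assms(2) by (auto simp: tensor_eqv_def simp flip: T.diff)
  moreover have "(a, a) \<in> tensor_eqv P \<rho>"
    using equiv_tensor_eqv by (auto simp: equiv_def refl_on_def)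
  ultimately show ?thesis
    using equiv_class_eq[OF equiv_tensor_eqv] by blast
qed

lemma verma_scale_class:
  "verma_scale P \<rho> c (tensor_eqv P \<rho> `` {a}) = tensor_eqv P \<rho> `` {c *\<^sub>C a}"
  unfolding verma_scale_def
proof (rule tensor_eqv_image)
  show "clinear (scaleC c :: ('a uea \<times> 'b \<Rightarrow>\<^sub>0 complex) \<Rightarrow> _)"
    by (rule complex_vector.linear_scale_self)
qed (auto simp: tensor_rel_def complex_vector.span_scale)

lemma verma_act_tensor:
  "verma_act P \<rho> u (verma_tensor P \<rho> u' v) = verma_tensor P \<rho> (u * u') v"
proof -
  define T :: "('a uea \<times> 'b \<Rightarrow>\<^sub>0 complex) \<Rightarrow> _" where
    "T = lin_ext (\<lambda>(u', v). pair (u * u') v)"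
  have lin: "clinear T" unfolding T_def by (rule linear_lin_ext)
  interpret T: Vector_Spaces.linear scaleC scaleC T by fact
  have pair: "T (pair u' v) = pair (u * u') v" for u' v by (simp add: T_def scaleC_one)
  have "T ` tensor_rel P \<rho> \<subseteq> tensor_rel P \<rho>"
    unfolding tensor_rel_def T.span_image[symmetric]
    by (rule complex_vector.span_mono)
      (auto simp: T.diff T.scale pair distrib_left mult_scaleC_right mult.assoc[symmetric], blast+)
  from tensor_eqv_image[OF lin this] show ?thesis
    by (simp add: verma_act_def verma_tensor_def pair flip: T_def)
qed

end

theory Submission
 imports "HOL-Computational_Algebra.Fundamental_Theorem_Algebra" Defs
begin

text \<open>Write \<open>k\<close> for the small and \<open>g\<close> for the large reductive Lie algebra, and \<open>V\<close> for the inducing module.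
Let \<open>N\<close> be the span of the weight spaces of \<open>V\<close> that are reached from \<open>\<mu>\<close> by adding a root of the nilradical
of \<open>k \<inter> p\<close> and then further roots of \<open>k \<inter> p\<close>. It is stable under \<open>k \<inter> p\<close>, does not meet the
\<open>\<mu>\<close>-weight space, and \<open>v\<^sub>\<mu>\<close> is singular modulo \<open>N\<close>. In a chain of \<open>k \<inter> p\<close>-submodules of \<open>N\<close> every step
adds a vector that is singular modulo the previous submodule, of a weight \<open>\<nu> ~= \<mu>\<close> with \<open>n(\<nu>) > 0\<close>. If a central
\<open>d\<close> takes the value 0 at these \<open>\<nu>\<close> and 1 at \<open>\<mu>\<close>, then a power of \<open>d\<close> kills \<open>U(k)(1 \<otimes> N)\<close> and fixes
\<open>1 \<otimes> v\<^sub>\<mu>\<close> modulo that subspace, to which \<open>1 \<otimes> v\<^sub>\<mu>\<close> does not belong by the Poincare-Birkhoff-Witt theorem for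
induced modules; hence this power maps \<open>1 \<otimes> v\<^sub>\<mu>\<close> to a nonzero singular vector.

Such a \<open>d\<close> exists because central characters of unlinked weights differ. Reflecting inside Verma modules makes
central characters invariant under the dot action. Conversely, a finite-dimensional representation \<open>\<pi>\<close> whose matrix
coefficients are represented through the Killing form by elements \<open>X\<^sub>i\<^sub>j\<close> of \<open>k\<close> gives the central elements
\<open>tr X\<^sup>m\<close>, whose Harish-Chandra projections have the power sums of the weights of \<open>\<pi>\<close> as leading terms. Power sums over
Weyl group orbits span the invariant polynomials, so induction on the degree separates the orbits.\<close>

section \<open>Linear algebra over the complex numbers\<close>

text \<open>The obstacle is that the nilradical of k \<inter> p may act nontrivially on V, because
  its elements can have components in the Levi part of p. An example is the diagonal sl2 in sl2 x
  sl2 with p = sl2 x b. So 1 \<otimes> v_\<mu> itself is in general not singular, and the weights of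
  N have to be removed by the central element. The structure theory of roots is derived from two
  consequences of reductivity: the radical of the Killing form is the center, and it meets the
  derived algebra in 0. They stand in for the Levi decomposition. Harish-Chandra projections are
  stated as congruences modulo the left ideals that define Verma modules, so that neither normal
  forms nor uniqueness of the projection are needed. Separation is proved by contradiction and needs
  no surjectivity of the Harish-Chandra map: if all central elements agreed at two weights, then so
  would all invariant polynomials, but a product of affine functions tells two orbits apart.\<close>

interpretation complex_vector_pair: vector_space_pair
 "scaleC :: complex => 'a => 'a::complex_vector" "scaleC :: complex => 'b => 'b::complex_vector" by unfold_locales

lemmas subspace_0 = complex_vector.subspace_0 and subspace_scale = complex_vector.subspace_scale and subspace_add = complex_vector.subspace_add
 and subspace_diff = complex_vector.subspace_diff and subspace_sum = complex_vector.subspace_sum and subspace_neg = complex_vector.subspace_neg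
 and subspace_span = complex_vector.subspace_span and subspace_def = complex_vector.subspace_def and span_base = complex_vector.span_base
 and span_minimal = complex_vector.span_minimal and span_scale = complex_vector.span_scale and span_zero = complex_vector.span_zero
 and span_mono = complex_vector.span_mono and span_induct_alt = complex_vector.span_induct_alt and span_add = complex_vector.span_add
 and span_sum = complex_vector.span_sum and span_superset = complex_vector.span_superset
 and scale_right_diff_distrib = complex_vector.scale_right_diff_distrib and scale_left_diff_distrib = complex_vector.scale_left_diff_distrib
 and scale_sum_right = complex_vector.scale_sum_right and scale_cancel_right = complex_vector.scale_cancel_right
 and representation_scale = complex_vector.representation_scale and maximal_independent_subset = complex_vector.maximal_independent_subset
 and sum_representation_eq = complex_vector.sum_representation_eq

abbreviation "cdim \<equiv> complex_vector.dim"
abbreviation "coords \<equiv> complex_vector.representation"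

instantiation "fun" :: (type, complex_vector) complex_vector
begin
definition "scaleC_fun c f = (%x. c *\<^sub>C f x)" for f :: "'a => 'b"
instance by standard (simp_all add: scaleC_fun_def fun_eq_iff scaleC_add_right scaleC_add_left
   scaleC_scaleC scaleC_one)
end

lemma scaleC_fun_apply: "(c *\<^sub>C f) x = c *\<^sub>C f x" by (simp add: scaleC_fun_def)

lemma sum_fun_apply: "(\<Sum>i\<in>A. f i) x = (\<Sum>i\<in>A. f i x)" for f :: "'c => 'a => 'b::comm_monoid_add"
 by (induction A rule: infinite_finite_induct) simp_all

lemma scaleC_complex: "c *\<^sub>C (d::complex) = c * d" by (simp add: scaleC_complex_def)

declare scaleC_one [simp]

lemma clinear_add: "clinear f ==> f (x + y) = f x + f y" and clinear_diff: "clinear f ==> f (x - y) = f x - f y"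
 and clinear_scale: "clinear f ==> f (c *\<^sub>C x) = c *\<^sub>C f x" and clinear_zero: "clinear f ==> f 0 = 0"
 and clinear_neg: "clinear f ==> f (- x) = - f x" and clinear_sum: "clinear f ==> f (sum g A) = (\<Sum>i\<in>A. f (g i))"
 by (rule complex_vector_pair.linear_add complex_vector_pair.linear_diff
   complex_vector_pair.linear_scale complex_vector_pair.linear_0
   complex_vector_pair.linear_neg complex_vector_pair.linear_sum; assumption)+

lemma clinear_scale_complex: "clinear f ==> f (c *\<^sub>C x) = c * f x" for f :: "'a::complex_vector => complex"
 by (simp add: clinear_scale scaleC_complex)

lemmas clinC = clinear_add clinear_diff clinear_scale_complex clinear_zero clinear_neg

lemmas clin = clinear_add clinear_diff clinear_scale clinear_zero clinear_neg

lemma csubspaceI: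
 assumes "0 \<in> S" "!!x y. x \<in> S ==> y \<in> S ==> x + y \<in> S" "!!c x. x \<in> S ==> c *\<^sub>C x \<in> S" shows "csubspace S"
 using assms by (auto simp: subspace_def)

lemma clinear_span_in:
 assumes "clinear f" "csubspace S" "!!x. x \<in> B ==> f x \<in> S" "x \<in> cspan B" shows "f x \<in> S"
proof -
 have "csubspace (f -` S)" by (intro csubspaceI)
   (auto simp: clin[OF assms(1)] subspace_0 subspace_add
    subspace_scale assms(2))
 hence "cspan B <= f -` S" using assms(3) by (intro span_minimal) auto
 thus ?thesis using assms(4) by auto
qed

lemma span_in_subspace: "csubspace S ==> B <= S ==> x \<in> cspan B ==> x \<in> S" using span_minimal by blast

lemma fin_dim_subset: "fin_dim W ==> U <= W ==> fin_dim U" by (auto simp: fin_dim_def)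

lemma fin_dim_independent:
 assumes "fin_dim W" "complex_vector.independent B" "B <= W" shows "finite B"
 using assms complex_vector.independent_span_bound unfolding fin_dim_def by blast

lemma fin_dim_basis:
 assumes "fin_dim W" "csubspace W"
 obtains B where "finite B" "complex_vector.independent B" "B <= W" "cspan B = W"
proof -
 obtain B where B: "B <= W" "complex_vector.independent B" "W <= cspan B" using maximal_independent_subset by blast
 moreover have "cspan B <= W" using assms B by (intro span_minimal)
 ultimately show thesis using that fin_dim_independent[OF assms(1)] by blast
qed

lemma fin_dim_span: "finite B ==> fin_dim (cspan B)" by (auto simp: fin_dim_def)

lemma fin_dim_dim_mono:
 assumes "fin_dim W" "csubspace W" "U <= W" shows "cdim U \<le> cdim W"
proof -
 obtain B where B: "finite B" "complex_vector.independent B" "B <= W" "cspan B = W" using fin_dim_basis[OF assms(1,2)] .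
 thus ?thesis using complex_vector.dim_le_card[of U B] complex_vector.basis_card_eq_dim[of B W] assms(3) by auto
qed

lemma fin_dim_psubset_dim:
 assumes "fin_dim W" "csubspace W" "csubspace U" "U \<subset> W" shows "cdim U < cdim W"
proof -
 have "fin_dim U" using assms fin_dim_subset by blast
 then obtain B where B: "finite B" "complex_vector.independent B" "B <= U" "cspan B = U" using fin_dim_basis assms(3) by metis
 obtain w where w: "w \<in> W" "w \<notin> U" using assms(4) by blast
 have ind: "complex_vector.independent (insert w B)" using complex_vector.independent_insertI w B by metis
 have "card (insert w B) \<le> cdim W" using complex_vector.dim_eq_card_independent[OF ind] fin_dim_dim_mono[OF assms(1,2), of "insert w B"]
   w B assms(4) by auto
 moreover have "card (insert w B) = Suc (card B)" using B w span_base by (metis card_insert_disjoint)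
 moreover have "card B = cdim U" using complex_vector.basis_card_eq_dim[of B U] B by auto
 ultimately show ?thesis by simp
qed

lemma clinear_compose: "clinear f ==> clinear g ==> clinear (%x. f (g x))" by (intro clinearI) (simp_all add: clin)

lemma clinear_plus: "clinear f ==> clinear g ==> clinear (%x. f x + g x)" by (intro clinearI) (simp_all add: clin scaleC_add_right)

lemma clinear_minus: "clinear f ==> clinear g ==> clinear (%x. f x - g x)" by (intro clinearI) (simp_all add: clin scale_right_diff_distrib)

lemma clinear_scale_fun: "clinear f ==> clinear (%x. c *\<^sub>C f x)"
 by (intro clinearI) (simp_all add: clin scaleC_add_right scaleC_scaleC mult.commute)

lemma clinear_id: "clinear (%x. x)" by (intro clinearI) simp_all

lemma clinear_const_0: "clinear (%x. 0)" by (intro clinearI) simp_all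

lemma clinear_funpow: "clinear f ==> clinear (f ^^ n)" for f :: "'a::complex_vector => 'a"
proof (induction n)
 case 0
 thus ?case using clinear_id by (simp add: id_def)
next
 case (Suc n)
 thus ?case using clinear_compose[of f "f ^^ n"] by (simp add: comp_def)
qed

lemma clinear_eq_on_span:
 assumes "clinear f" "clinear g" "!!x. x \<in> B ==> f x = g x" "x \<in> cspan B" shows "f x = g x"
 using complex_vector_pair.linear_eq_on[OF assms(1,2) assms(4,3)] by blast

lemma clinear_zero_outside:
 assumes "csubspace W" "x \<notin> W"
 obtains \<phi> :: "'a::complex_vector => complex" where "clinear \<phi>" "\<phi> x = 1" "!!w. w \<in> W ==> \<phi> w = 0"
proof -
 obtain B where B: "B <= W" "complex_vector.independent B" "W <= cspan B" using maximal_independent_subset by blast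
 have x: "x \<notin> cspan B" using assms B span_minimal by blast
 hence "complex_vector.independent (insert x B)" using B complex_vector.independent_insertI by blast
 then obtain \<phi> :: "'a => complex" where p: "clinear \<phi>" "!!b. b \<in> insert x B ==> \<phi> b = (if b = x then 1 else 0)"
  using complex_vector_pair.linear_independent_extend[where f = "%b. if b = x then 1 else 0"] by metis
 have "\<phi> w = 0" if "w \<in> W" for w by (rule clinear_eq_on_span[OF p(1) clinear_const_0, of B])
   (use that B p x span_base in auto)
 thus thesis using that p by simp
qed

text \<open>Projection along \<open>W\<close> onto a complement, from a basis of \<open>W\<close>
  extended to the whole space. It stands for the quotient by \<open>W\<close> inside the same type;
  quotient modules are formed this way.\<close>

lemma clinear_with_kernel:
 fixes W :: "'a::complex_vector set"
 assumes "csubspace W"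
 obtains f :: "'a => 'a" where "clinear f" "!!x. f x = 0 \<longleftrightarrow> x \<in> W" "!!x. x - f x \<in> W"
proof -
 obtain B where B: "B <= W" "complex_vector.independent B" "W <= cspan B" using maximal_independent_subset by blast
 define C where "C = complex_vector.extend_basis B"
 have C: "B <= C" "complex_vector.independent C" "cspan C = UNIV"
  using complex_vector.extend_basis_superset[OF B(2)] complex_vector.independent_extend_basis[OF B(2)]
   complex_vector.span_extend_basis[OF B(2)] by (auto simp: C_def)
 obtain f :: "'a => 'a" where f: "clinear f" "!!b. b \<in> C ==> f b = (if b \<in> B then 0 else b)"
  using complex_vector_pair.linear_independent_extend[OF C(2), where f = "%b. if b \<in> B then 0 else b"] by metis
 have 1: "f x = 0" if "x \<in> W" for x by (rule clinear_eq_on_span[OF f(1) clinear_const_0, of B]) (use that B C f in auto)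
 have 2: "x - f x \<in> W" for x by (rule clinear_span_in[OF clinear_minus[OF clinear_id f(1)] assms, of C])
   (use B C f assms subspace_0 in auto)
 show thesis
 proof (rule that[OF f(1)])
  show "f x = 0 \<longleftrightarrow> x \<in> W" for x using 1 2[of x] by (cases "f x = 0") auto
 qed (rule 2)
qed


subsection \<open>Traces\<close>

text \<open>When \<open>T\<close> preserves \<open>cspan B\<close>, this is the trace of the
  restriction, so traces on strings and eigenspaces need no type of their own.\<close>

definition tr :: "'a::complex_vector set => ('a => 'a) => complex" where
 "tr B T = (\<Sum>b\<in>B. coords B (T b) b)"

lemma ctrace_eq_tr: "ctrace T = tr (complex_vector.extend_basis {}) T" by (simp add: ctrace_def tr_def Let_def)

lemma tr_cong: "(!!b. b \<in> B ==> T b = U b) ==> tr B T = tr B U" by (simp add: tr_def)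

lemma tr_zero: "tr B (%x. 0) = 0" by (simp add: tr_def complex_vector.representation_zero)

context
 fixes B :: "'a::complex_vector set"
 assumes ind: "complex_vector.independent B"
begin

lemma tr_add:
 assumes "!!b. b \<in> B ==> T b \<in> cspan B" "!!b. b \<in> B ==> U b \<in> cspan B" shows "tr B (%x. T x + U x) = tr B T + tr B U"
 using assms by (simp add: tr_def complex_vector.representation_add[OF ind] sum.distrib)

lemma tr_scale:
 assumes "!!b. b \<in> B ==> T b \<in> cspan B" shows "tr B (%x. c *\<^sub>C T x) = c * tr B T"
 using assms by (simp add: tr_def representation_scale[OF ind] sum_distrib_left)

lemma tr_diff:
 assumes "!!b. b \<in> B ==> T b \<in> cspan B" "!!b. b \<in> B ==> U b \<in> cspan B" shows "tr B (%x. T x - U x) = tr B T - tr B U"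
 using assms by (simp add: tr_def complex_vector.representation_diff[OF ind] sum_subtractf)

lemma tr_diag:
 assumes "!!b. b \<in> B ==> T b = f b *\<^sub>C b" shows "tr B T = sum f B" using assms by (simp add: tr_def representation_scale[OF ind]
   span_base complex_vector.representation_basis[OF ind])

lemma representation_apply:
 assumes "finite C" "clinear T" "!!b. b \<in> C ==> T b \<in> cspan B"
  "complex_vector.independent C" "v \<in> cspan C" shows "coords B (T v) c =
  (\<Sum>b\<in>C. coords C v b * coords B (T b) c)"
proof -
 have "v = (\<Sum>b\<in>C. coords C v b *\<^sub>C b)" using sum_representation_eq[OF assms(4,5)] assms by simp
 hence "T v = (\<Sum>b\<in>C. coords C v b *\<^sub>C T b)"
  using clinear_sum[OF assms(2)] clinear_scale[OF assms(2)] by (metis (no_types, lifting) sum.cong)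
 thus ?thesis using assms by (simp add: complex_vector.representation_sum[OF ind] span_scale
    representation_scale[OF ind])
qed

lemma tr_commute:
 assumes "finite B" "clinear T" "clinear U"
  "!!b. b \<in> B ==> T b \<in> cspan B" "!!b. b \<in> B ==> U b \<in> cspan B" shows "tr B (%x. T (U x)) = tr B (%x. U (T x))"
proof -
 have "tr B (%x. T (U x)) = (\<Sum>b\<in>B. \<Sum>c\<in>B. coords B (U b) c *
   coords B (T c) b)" unfolding tr_def by (intro sum.cong refl representation_apply) (use assms ind in auto)
 also have "\<dots> = (\<Sum>c\<in>B. \<Sum>b\<in>B. coords B (T c) b *
   coords B (U b) c)" by (subst sum.swap) (simp add: mult.commute)
 also have "\<dots> = tr B (%x. U (T x))" unfolding tr_def by (intro sum.cong refl representation_apply[symmetric]) (use assms ind in auto)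
 finally show ?thesis .
qed

lemma tr_basis_change:
 assumes "finite B" "clinear T" "!!b. b \<in> B ==> T b \<in> cspan B"
  "finite C" "complex_vector.independent C" "cspan C = cspan B" shows "tr B T = tr C T"
proof -
 have T: "T x \<in> cspan B" if "x \<in> cspan B" for x by (rule clinear_span_in[OF assms(2) subspace_span assms(3) that])
 have "tr B T = (\<Sum>b\<in>B. \<Sum>c\<in>C. coords C b c *
   coords B (T c) b)" unfolding tr_def
 proof (intro sum.cong refl representation_apply)
  fix c assume "c \<in> C"
  thus "T c \<in> cspan B" using T span_base assms(6) by metis
 qed (use assms span_base in auto)
 also have "\<dots> = (\<Sum>c\<in>C. \<Sum>b\<in>B. coords B (T c) b *
   coords C b c)" by (subst sum.swap) (simp add: mult.commute)
 also have "\<dots> = (\<Sum>c\<in>C. coords C (T c) c)"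
 proof (intro sum.cong refl)
  fix c assume "c \<in> C"
  hence "T c \<in> cspan B" using T assms span_base by metis
  hence "T c = (\<Sum>b\<in>B. coords B (T c) b *\<^sub>C b)" using sum_representation_eq[OF ind] assms by simp
  hence "coords C (T c) =
   coords C (\<Sum>b\<in>B. coords B (T c) b *\<^sub>C b)" by simp
  also have "\<dots> = (%d. \<Sum>b\<in>B. coords B (T c) b *
   coords C b d)" using assms by (simp add: complex_vector.representation_sum span_scale
    representation_scale span_base)
  finally show "(\<Sum>b\<in>B. coords B (T c) b *
   coords C b c) = coords C (T c) c" by simp
 qed
 finally show ?thesis by (simp add: tr_def)
qed

end


subsection \<open>Generalized eigenspaces\<close>

definition geig :: "('a::complex_vector => 'a) => complex => 'a set" where
 "geig T a = {v. \<exists>k. ((%w. T w - a *\<^sub>C w) ^^ k) v = 0}"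

lemma geig_step: "T v - a *\<^sub>C v \<in> geig T a ==> v \<in> geig T a"
proof -
 assume "T v - a *\<^sub>C v \<in> geig T a"
 then obtain k where "((%w. T w - a *\<^sub>C w) ^^ k) (T v - a *\<^sub>C v) = 0" by (auto simp: geig_def)
 hence "((%w. T w - a *\<^sub>C w) ^^ Suc k) v = 0" by (simp only: funpow_Suc_right o_apply)
 thus ?thesis unfolding geig_def by blast
qed

text \<open>Induction on the exponent that kills \<open>v\<close>, with the exponent hidden: one
  application of \<open>T - a\<close> lowers it. This replaces binomial expansions in what
  follows.\<close>

lemma geig_induct [consumes 1, case_names zero step]:
 assumes "v \<in> geig T a" "P 0" "!!v. T v - a *\<^sub>C v \<in> geig T a ==> P (T v - a *\<^sub>C v) ==> P v" shows "P v"
proof -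
 obtain k where "((%w. T w - a *\<^sub>C w) ^^ k) v = 0" using assms(1) by (auto simp: geig_def)
 hence "v \<in> geig T a \<and> P v"
 proof (induction k arbitrary: v)
  case 0 thus ?case using assms(2) by (auto simp: geig_def intro!: exI[of _ 0])
 next
  case (Suc k)
  have "((%w. T w - a *\<^sub>C w) ^^ k) (T v - a *\<^sub>C v) = 0" using Suc.prems by (simp only: funpow_Suc_right o_apply)
  from Suc.IH[OF this] show ?case using geig_step assms(3) by blast
 qed
 thus ?thesis by simp
qed

context
 fixes T :: "'a::complex_vector => 'a"
 assumes lin: "clinear T"
begin

lemma geig_zero: "0 \<in> geig T a" by (auto simp: geig_def intro!: exI[of _ 0])

lemma geig_down: "v \<in> geig T a ==> T v - a *\<^sub>C v \<in> geig T a"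
proof (induction rule: geig_induct)
 case zero show ?case by (simp add: clin[OF lin] geig_zero)
qed

lemma geig_subspace: "csubspace (geig T a)"
proof -
 let ?S = "%w. T w - a *\<^sub>C w"
 have S: "clinear (?S ^^ k)" for k by (intro clinear_funpow clinear_minus lin clinear_scale_fun clinear_id)
 have S1: "clinear ?S" by (intro clinear_minus lin clinear_scale_fun clinear_id)
 have up: "(?S ^^ k) x = 0 ==> (?S ^^ (k + j)) x = 0" for k j x by (induction j) (simp_all add: clin[OF lin])
 show ?thesis
 proof (intro csubspaceI)
  fix x y assume "x \<in> geig T a" "y \<in> geig T a"
  then obtain k l where kl: "(?S ^^ k) x = 0" "(?S ^^ l) y = 0" by (auto simp: geig_def)
  have "(?S ^^ (k + l)) (x + y) = 0" using up[OF kl(1), of l] up[OF kl(2), of k] by (simp add: clin[OF S] add.commute)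
  thus "x + y \<in> geig T a" by (auto simp: geig_def)
 next
  fix c x assume "x \<in> geig T a"
  thus "c *\<^sub>C x \<in> geig T a" by (auto simp: geig_def clin[OF S])
 qed (rule geig_zero)
qed

lemma geig_eigen: "T v = a *\<^sub>C v ==> v \<in> geig T a" by (rule geig_step) (simp add: geig_zero)

lemma geig_stable: "v \<in> geig T a ==> T v \<in> geig T a" using subspace_add[OF geig_subspace geig_down
   subspace_scale[OF geig_subspace, of v a a], of v] by simp

lemma geig_disjoint: "v \<in> geig T a ==> v \<in> geig T b ==> a ~= b ==> v = 0"
proof (induction rule: geig_induct)
 case (step v)
 have "T v - a *\<^sub>C v \<in> geig T b" using step.prems(1) geig_stable subspace_diff[OF geig_subspace]
   subspace_scale[OF geig_subspace] by blast
 hence "T v = a *\<^sub>C v" using step by simp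
 with step.prems(1) show "v = 0"
 proof (induction rule: geig_induct)
  case (step v)
  have *: "T v - b *\<^sub>C v = (a - b) *\<^sub>C v" using step.prems by (simp add: scale_left_diff_distrib)
  have "T ((a - b) *\<^sub>C v) = a *\<^sub>C (a - b) *\<^sub>C v" using step.prems by (simp add: clin[OF lin] scaleC_scaleC mult.commute)
  hence "(a - b) *\<^sub>C v = 0" using step.IH unfolding * by blast
  thus ?case using \<open>a ~= b\<close> by simp
 qed simp
qed simp

text \<open>Apply \<open>T - b\<close> to the relation. This lowers the exponent of the
  \<open>b\<close>-component, so all components of the new relation vanish by induction; the other
  original components then lie in two different generalized eigenspaces.\<close>

lemma geig_independent:
 assumes "finite A" "!!a. a \<in> A ==> f a \<in> geig T a" "(\<Sum>a\<in>A. f a) = 0" "a0 \<in> A" shows "f a0 = 0"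
proof -
 have "\<forall>f. (\<forall>a\<in>A. f a \<in> geig T a) --> (\<Sum>a\<in>A. f a) = 0 --> (\<forall>a\<in>A. f a = 0)" using assms(1)
 proof (induction A rule: finite_induct)
  case (insert b A)
  have "\<forall>f. f b = v --> (\<forall>a\<in>insert b A. f a \<in> geig T a) --> (\<Sum>a\<in>insert b A. f a) = 0 -->
   (\<forall>a\<in>insert b A. f a = 0)" if "v \<in> geig T b" for v using that
  proof (induction rule: geig_induct)
   case zero
   show ?case using insert by auto
  next
   case (step v)
   show ?case
   proof (intro allI impI)
    fix f assume f: "f b = v" "\<forall>a\<in>insert b A. f a \<in> geig T a" "(\<Sum>a\<in>insert b A. f a) = 0"
    define g where "g a = T (f a) - b *\<^sub>C f a" for a
    have "(\<Sum>a\<in>insert b A. g a) = 0" using arg_cong[OF f(3), of "%x. T x - b *\<^sub>C x"]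
     unfolding g_def sum_subtractf clinear_sum[OF lin, symmetric]
      scale_sum_right[symmetric] by (simp only: clin[OF lin] complex_vector.scale_zero_right diff_self)
    moreover have "\<forall>a\<in>insert b A. g a \<in> geig T a"
    proof
     fix a assume "a \<in> insert b A"
     hence "f a \<in> geig T a" using f(2) by blast
     thus "g a \<in> geig T a" unfolding g_def by (intro subspace_diff[OF geig_subspace] geig_stable
       subspace_scale[OF geig_subspace])
    qed
    moreover have "g b = T v - b *\<^sub>C v" using f by (simp add: g_def)
    ultimately have g: "\<forall>a\<in>insert b A. g a = 0" using step.IH by blast
    have *: "f a = 0" if "a \<in> A" for a
    proof (rule geig_disjoint)
     show "f a \<in> geig T a" using f(2) that by blast
     show "f a \<in> geig T b" using g that by (intro geig_eigen) (auto simp: g_def)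
     show "a ~= b" using that insert.hyps by blast
    qed
    hence "(\<Sum>a\<in>A. f a) = 0" by simp
    hence "f b = 0" using f(3) insert.hyps by simp
    thus "\<forall>a\<in>insert b A. f a = 0" using * by auto
   qed
  qed
  thus ?case by blast
 qed simp
 thus ?thesis using assms by blast
qed

text \<open>On \<open>geig T b\<close> with \<open>b ~= a\<close> the map \<open>T - a\<close> is
  onto. So the part of \<open>(T - a) w\<close> outside \<open>geig T a\<close> equals
  \<open>(T - a) u\<close> for some \<open>u\<close> in the span, and then \<open>w - u\<close> lies
  in \<open>geig T a\<close>.\<close>

lemma geig_span_step:
 assumes W: "csubspace W" "!!w. w \<in> W ==> T w \<in> W" and w: "w \<in> W" "T w - a *\<^sub>C w \<in> cspan (\<Union>b. geig T b \<inter> W)"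
 shows "w \<in> cspan (\<Union>b. geig T b \<inter> W)"
proof -
 let ?G = "cspan (\<Union>b. geig T b \<inter> W)"
 have inv: "\<exists>u\<in>geig T b \<inter> W. T u - a *\<^sub>C u = v" if v: "v \<in> geig T b" "v \<in> W" and "b ~= a" for v b using v
 proof (induction rule: geig_induct)
  case zero
  show ?case using geig_zero subspace_0[OF W(1)] by (auto simp: clin[OF lin] intro!: bexI[of _ 0])
 next
  case (step v)
  have "T v - b *\<^sub>C v \<in> W" using step.prems W subspace_diff[OF W(1)] subspace_scale[OF W(1)] by blast
  then obtain u where u: "u \<in> geig T b" "u \<in> W" "T u - a *\<^sub>C u = T v - b *\<^sub>C v" using step.IH by blast
  \<comment> \<open>Here \<open>(T - a) v = (b - a) v + (T - b) v\<close> and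
    \<open>(T - b) v = (T - a) u\<close>; this is solved for a preimage of \<open>v\<close>.\<close>
  define u' where "u' = (1 / (b - a)) *\<^sub>C (v - u)"
  have vg: "v \<in> geig T b" using geig_step[OF step.hyps] .
  have "u' \<in> geig T b \<inter> W" unfolding u'_def using u vg step.prems W(1) by (auto intro!: subspace_diff subspace_scale geig_subspace)
  moreover have "T u' - a *\<^sub>C u' = (1 / (b - a)) *\<^sub>C ((T v - a *\<^sub>C v) - (T u - a *\<^sub>C u))"
   by (simp add: u'_def clin[OF lin] scale_right_diff_distrib
     complex_vector.scale_left_commute algebra_simps)
  moreover have "(T v - a *\<^sub>C v) - (T u - a *\<^sub>C u) = (b - a) *\<^sub>C v" unfolding u by (simp add: scale_left_diff_distrib)
  ultimately show ?case using \<open>b ~= a\<close> by (intro bexI[of _ u']) (auto simp: scaleC_scaleC)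
 qed
 have "\<exists>u\<in>?G \<inter> W. \<exists>y\<in>geig T a \<inter> W. v = (T u - a *\<^sub>C u) + y" if "v \<in> ?G" for v using that
 proof (induction rule: span_induct_alt)
  case base
  show ?case using geig_zero subspace_0[OF W(1)] span_zero by (auto simp: clin[OF lin] intro!: bexI[of _ 0])
 next
  case (step c x v)
  then obtain u y where uy: "u \<in> ?G" "u \<in> W" "y \<in> geig T a" "y \<in> W" "v = (T u - a *\<^sub>C u) + y" by blast
  obtain b where b: "x \<in> geig T b" "x \<in> W" using step by blast
  show ?case
  proof (cases "b = a")
   case True
   have "c *\<^sub>C x + y \<in> geig T a \<inter> W" using b uy True W(1) by (auto intro!: subspace_add subspace_scale geig_subspace)
   thus ?thesis using uy by (intro bexI[of _ u] bexI[of _ "c *\<^sub>C x + y"]) (auto simp: algebra_simps)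
  next
   case False
   obtain z where z: "z \<in> geig T b" "z \<in> W" "T z - a *\<^sub>C z = x" using inv[OF b False] by blast
   have "z \<in> ?G" using z by (intro span_base) auto
   hence "c *\<^sub>C z + u \<in> ?G \<inter> W" using z uy W(1) by (auto intro!: subspace_add subspace_scale
     span_add span_scale)
   moreover have "c *\<^sub>C x + v = (T (c *\<^sub>C z + u) - a *\<^sub>C (c *\<^sub>C z + u)) + y" unfolding uy(5) z(3)[symmetric]
    by (simp add: clin[OF lin] scale_right_diff_distrib scaleC_add_right
     complex_vector.scale_left_commute algebra_simps)
   ultimately show ?thesis using uy by blast
  qed
 qed
 then obtain u y where uy: "u \<in> ?G" "u \<in> W" "y \<in> geig T a" "T w - a *\<^sub>C w = (T u - a *\<^sub>C u) + y" using w by blast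
 have "T (w - u) - a *\<^sub>C (w - u) = y" using uy(4) by (simp add: clin[OF lin] scale_right_diff_distrib algebra_simps)
 hence "w - u \<in> geig T a" using uy geig_step by metis
 moreover have "w - u \<in> W" using uy w subspace_diff[OF W(1)] by blast
 ultimately have "w - u \<in> ?G" by (intro span_base) auto
 hence "(w - u) + u \<in> ?G" using uy span_add by blast
 thus ?thesis by simp
qed

end

text \<open>A nilpotent map sends \<open>cspan B\<close> onto a proper subspace unless
  \<open>B\<close> is empty. In a basis extending one of the image only image vectors contribute, so
  the trace equals the trace on this smaller space.\<close>

lemma tr_nilpotent:
 assumes "complex_vector.independent B" "finite B" "clinear T"
  "!!b. b \<in> B ==> T b \<in> cspan B" "!!b. b \<in> B ==> \<exists>k. (T ^^ k) b = 0" shows "tr B T = 0" using assms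
proof (induction "card B" arbitrary: B rule: less_induct)
 case less
 note lin = \<open>clinear T\<close>
 let ?W = "cspan B"
 have T: "T x \<in> ?W" if "x \<in> ?W" for x by (rule clinear_span_in[OF lin subspace_span less.prems(4) that])
 have nil: "\<exists>k. (T ^^ k) x = 0" if "x \<in> ?W" for x
  using span_in_subspace[OF geig_subspace[OF lin], of B 0 x] that less.prems(5) by (auto simp: geig_def)
 show ?case
 proof (cases "B = {}")
  case True thus ?thesis by (simp add: tr_def)
 next
  case False
  have sub: "csubspace (T ` ?W)" by (rule complex_vector_pair.linear_subspace_image[OF lin subspace_span])
  have "T ` ?W <= ?W" using T by blast
  moreover have "T ` ?W ~= ?W"
  proof
   assume eq: "T ` ?W = ?W"
   have pow: "(T ^^ k) ` ?W = ?W" for k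
   proof (induction k)
    case (Suc k)
    have "(T ^^ Suc k) ` ?W = T ` ((T ^^ k) ` ?W)" by (simp add: image_comp comp_def)
    thus ?case using Suc eq by simp
   qed simp
   obtain k where k: "!!b. b \<in> B ==> (T ^^ k b) b = 0" using less.prems(5) by metis
   define K where "K = (\<Sum>b\<in>B. k b)"
   have "(T ^^ K) b = 0" if "b \<in> B" for b
   proof -
    have "k b \<le> K" unfolding K_def using that less.prems(2) by (simp add: member_le_sum)
    hence "(T ^^ K) b = (T ^^ (K - k b)) ((T ^^ k b) b)" by (simp flip: funpow_add[THEN fun_cong, unfolded comp_def])
    thus ?thesis using k[OF that] by (simp add: clin[OF clinear_funpow[OF lin]])
   qed
   hence "(T ^^ K) x = 0" if "x \<in> ?W" for x using clinear_eq_on_span[OF clinear_funpow[OF lin] clinear_const_0] that by metis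
   hence "?W <= {0}" using pow[of K] by force
   hence "b = 0" if "b \<in> B" for b using that span_base by blast
   thus False using False less.prems(1) complex_vector.dependent_zero by blast
  qed
  ultimately have pd: "cdim (T ` ?W) < cdim ?W" by (intro fin_dim_psubset_dim fin_dim_span sub less.prems) auto
  obtain C where C: "finite C" "complex_vector.independent C" "C <= T ` ?W" "cspan C = T ` ?W"
   using fin_dim_basis[OF fin_dim_subset[OF fin_dim_span[OF less.prems(2)] \<open>T ` ?W <= ?W\<close>] sub] .
  obtain D where D: "C <= D" "D <= ?W" "complex_vector.independent D" "?W <= cspan D"
   using complex_vector.maximal_independent_subset_extend[of C ?W] C \<open>T ` ?W <= ?W\<close> by blast
  have Dsp: "cspan D = ?W" using D by (simp add: span_minimal antisym)
  have finD: "finite D" using fin_dim_independent[OF fin_dim_span[OF less.prems(2)]] D by blast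
  have TD: "T d \<in> cspan C" if "d \<in> D" for d using that D C by auto
  have "tr B T = tr D T" by (rule tr_basis_change) (use less.prems finD D Dsp in auto)
  also have "\<dots> = (\<Sum>b\<in>D. coords C (T b) b)" unfolding tr_def using complex_vector.representation_extend[OF D(3) TD D(1)] by simp
  also have "\<dots> = tr C T" unfolding tr_def using D(1) finD by (intro sum.mono_neutral_right) (auto dest: complex_vector.representation_ne_zero)
  also have "\<dots> = 0"
  proof (rule less.hyps)
   show "card C < card B" using pd complex_vector.dim_eq_card_independent[OF C(2)] C(4)
     complex_vector.dim_eq_card_independent[OF less.prems(1)] by (metis complex_vector.dim_span)
   show "T b \<in> cspan C" if "b \<in> C" for b using TD that D(1) by blast
   show "\<exists>k. (T ^^ k) b = 0" if "b \<in> C" for b using nil that C(3) T by blast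
  qed (use C lin in auto)
  finally show ?thesis .
 qed
qed

definition poly_op :: "('a::complex_vector => 'a) => complex poly => 'a => 'a" where
 "poly_op T p v = (\<Sum>i\<le>degree p. coeff p i *\<^sub>C (T ^^ i) v)"

lemma poly_op_altdef:
 assumes "degree p \<le> n" shows "poly_op T p v = (\<Sum>i\<le>n. coeff p i *\<^sub>C (T ^^ i) v)" unfolding poly_op_def using assms
 by (intro sum.mono_neutral_left) (auto simp: coeff_eq_0)

lemma poly_op_add: "poly_op T (p + q) v = poly_op T p v + poly_op T q v" by (simp add: poly_op_altdef[of _ "max (degree p) (degree q)"] degree_add_le
   scaleC_add_left sum.distrib)

lemma poly_op_smult: "poly_op T (smult c p) v = c *\<^sub>C poly_op T p v" by (simp add: poly_op_altdef[of _ "degree p"] scale_sum_right scaleC_scaleC)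

lemma poly_op_monom: "poly_op T (monom c n) v = c *\<^sub>C (T ^^ n) v"
proof -
 have "poly_op T (monom c n) v = (\<Sum>i\<le>n. if i = n then c *\<^sub>C (T ^^ i) v else 0)"
  by (simp add: poly_op_altdef[of _ n] degree_monom_le if_distrib[of "%c. c *\<^sub>C _"] cong: if_cong)
 thus ?thesis by simp
qed

lemma poly_op_root:
 assumes "clinear T" shows "poly_op T ([:- a, 1:] * q) v = T (poly_op T q v) - a *\<^sub>C poly_op T q v"
proof -
 let ?n = "degree q"
 have eq: "[:- a, 1:] * q = pCons 0 q + smult (- a) q" by simp
 have "poly_op T (pCons 0 q) v = (\<Sum>i\<le>Suc ?n. coeff (pCons 0 q) i *\<^sub>C (T ^^ i) v)" by (rule poly_op_altdef) (simp add: degree_pCons_le)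
 also have "\<dots> = (\<Sum>i\<le>?n. coeff q i *\<^sub>C T ((T ^^ i) v))" by (subst sum.atMost_Suc_shift) simp
 also have "\<dots> = T (poly_op T q v)" by (simp add: poly_op_def clinear_sum[OF assms] clinear_scale[OF assms])
 finally have "poly_op T (pCons 0 q) v = T (poly_op T q v)" .
 thus ?thesis unfolding eq poly_op_add poly_op_smult by simp
qed

text \<open>The iterates of \<open>v\<close> stay in a finite-dimensional space, hence satisfy a
  linear relation; its coefficients are those of \<open>p\<close>.\<close>

lemma poly_op_annihilator:
 assumes "fin_dim W" "clinear T" "!!k. (T ^^ k) v \<in> W"
 obtains p where "p ~= 0" "poly_op T p v = 0"
proof -
 obtain B where B: "finite B" "W <= cspan B" using assms(1) by (auto simp: fin_dim_def)
 have ex: "\<exists>k. (T ^^ k) v \<in> cspan ((%j. (T ^^ j) v) ` {..<k})"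
 proof (rule ccontr)
  assume *: "\<not> ?thesis"
  have "complex_vector.independent ((%j. (T ^^ j) v) ` {..<k}) \<and> card ((%j. (T ^^ j) v) ` {..<k}) = k" for k
  proof (induction k)
   case (Suc k)
   have "(T ^^ k) v \<notin> cspan ((%j. (T ^^ j) v) ` {..<k})" using * by blast
   moreover from this have "(T ^^ k) v \<notin> (%j. (T ^^ j) v) ` {..<k}" by (rule contrapos_nn) (rule span_base)
   ultimately show ?case using Suc by (simp add: lessThan_Suc complex_vector.independent_insertI)
  qed (simp add: complex_vector.independent_empty)
  moreover have "(%j. (T ^^ j) v) ` {..<k} <= cspan B" for k using assms(3) B by blast
  ultimately have "Suc (card B) \<le> card B" using complex_vector.independent_span_bound[OF B(1), of "(%j. (T ^^ j) v) ` {..<Suc (card B)}"] by simp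
  thus False by simp
 qed
 then obtain k where k: "(T ^^ k) v \<in> cspan ((%j. (T ^^ j) v) ` {..<k})" by blast
 have "\<exists>q. (\<forall>i\<ge>k. coeff q i = 0) \<and> poly_op T q v = (T ^^ k) v" using k
 proof (induction rule: span_induct_alt)
  case base show ?case by (intro exI[of _ 0]) (simp add: poly_op_def)
 next
  case (step c x y)
  then obtain j q where "j < k" "x = (T ^^ j) v" "\<forall>i\<ge>k. coeff q i = 0" "poly_op T q v = y" by auto
  hence "(\<forall>i\<ge>k. coeff (monom c j + q) i = 0) \<and> poly_op T (monom c j + q) v = c *\<^sub>C x + y"
   by (auto simp: poly_op_add poly_op_monom)
  thus ?case by blast
 qed
 then obtain q where q: "\<forall>i\<ge>k. coeff q i = 0" "poly_op T q v = (T ^^ k) v" by blast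
 have "coeff (monom 1 k + smult (- 1) q) k = 1" using q(1) by simp
 hence "monom 1 k + smult (- 1) q ~= 0" by (metis coeff_0 zero_neq_one)
 moreover have "poly_op T (monom 1 k + smult (- 1) q) v = 0" by (simp only: poly_op_add poly_op_smult poly_op_monom q(2)) simp
 ultimately show thesis using that by blast
qed

text \<open>An annihilating polynomial of \<open>w\<close> splits into linear factors, and
  \<open>geig_span_step\<close> strips them one at a time.\<close>

lemma geig_span:
 assumes lin: "clinear T" and W: "fin_dim W" "csubspace W" "!!w. w \<in> W ==> T w \<in> W" and w: "w \<in> W"
 shows "w \<in> cspan (\<Union>b. geig T b \<inter> W)"
proof -
 have pow: "(T ^^ k) w \<in> W" for k using w W(3) by (induction k) auto
 obtain p where p: "p ~= 0" "poly_op T p w = 0" using poly_op_annihilator[OF W(1) lin pow] .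
 have inW: "poly_op T q w \<in> W" for q unfolding poly_op_def using pow by (intro subspace_sum subspace_scale W(2))
 have "poly_op T p w \<in> cspan (\<Union>b. geig T b \<inter> W) ==> ?thesis" using p(1)
 proof (induction "degree p" arbitrary: p)
  case 0
  then obtain c where c: "p = [:c:]" "c ~= 0" by (metis degree_eq_zeroE pCons_0_0)
  hence "c *\<^sub>C w \<in> cspan (\<Union>b. geig T b \<inter> W)" using 0 by (simp add: poly_op_def)
  hence "(1 / c) *\<^sub>C c *\<^sub>C w \<in> cspan (\<Union>b. geig T b \<inter> W)" by (rule span_scale)
  thus ?case using c by (simp add: scaleC_scaleC)
 next
  case (Suc n)
  then obtain a where "poly p a = 0" using fundamental_theorem_of_algebra[of p] by (auto simp: constant_degree)
  then obtain q where q: "p = [:- a, 1:] * q" using poly_eq_0_iff_dvd by (metis dvdE)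
  have "q ~= 0" using Suc.prems q by auto
  hence "degree q = n" using Suc.hyps(2) q degree_mult_eq[of "[:- a, 1:]" q] by auto
  moreover have "poly_op T q w \<in> cspan (\<Union>b. geig T b \<inter> W)"
  proof (rule geig_span_step[OF lin W(2)])
   show "T (poly_op T q w) - a *\<^sub>C poly_op T q w \<in> cspan (\<Union>b. geig T b \<inter> W)"
    using Suc.prems(1) unfolding q poly_op_root[OF lin] .
  qed (use W(3) inW in auto)
  ultimately show ?case using Suc.hyps(1) \<open>q ~= 0\<close> by blast
 qed
 moreover have "poly_op T p w \<in> cspan (\<Union>b. geig T b \<inter> W)" unfolding p(2) by (rule span_zero)
 ultimately show ?thesis by blast
qed

lemma geig_span_UNIV:
 assumes "fin_dim (UNIV :: 'a::complex_vector set)" "clinear (T :: 'a => 'a)" shows "cspan (\<Union>b. geig T b) = UNIV"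
 using geig_span[OF assms(2,1), of _] by (auto simp: complex_vector.subspace_UNIV)

lemma geig_basis:
 assumes fd: "fin_dim (UNIV :: 'a::complex_vector set)" and lin: "clinear (T :: 'a => 'a)"
 obtains B ev where "finite B" "complex_vector.independent B" "cspan B = UNIV"
  "!!b. b \<in> B ==> b \<in> geig T (ev b)" "!!a. geig T a = cspan {b\<in>B. ev b = a}"
proof -
 obtain B where B: "B <= (\<Union>b. geig T b)" "complex_vector.independent B" "(\<Union>b. geig T b) <= cspan B"
  using maximal_independent_subset by blast
 have sp: "cspan B = UNIV" using span_minimal[OF B(3) subspace_span] geig_span_UNIV[OF assms] by auto
 have fin: "finite B" using fin_dim_independent[OF fd B(2)] by simp
 have "\<forall>b\<in>B. \<exists>a. b \<in> geig T a" using B(1) by blast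
 then obtain ev where ev: "!!b. b \<in> B ==> b \<in> geig T (ev b)" by metis
 have "v \<in> cspan {b\<in>B. ev b = a}" if v: "v \<in> geig T a" for v a
 proof -
  let ?r = "coords B v"
  define A where "A = insert a (ev ` B)"
  define g where "g c = (\<Sum>b\<in>{b\<in>B. ev b = c}. ?r b *\<^sub>C b)" for c
  define f where "f c = g c - (if c = a then v else 0)" for c
  have g: "g c \<in> geig T c" for c unfolding g_def by (intro subspace_sum subspace_scale geig_subspace lin)
    (use ev in auto)
  have f: "f c \<in> geig T c" for c unfolding f_def using g v geig_zero[OF lin] subspace_diff[OF geig_subspace[OF lin]] by simp
  have "(\<Sum>c\<in>A. g c) = (\<Sum>b\<in>B. ?r b *\<^sub>C b)" unfolding g_def by (rule sum.group) (auto simp: A_def fin)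
  also have "\<dots> = v" using sum_representation_eq[OF B(2), of v] fin sp by simp
  finally have "(\<Sum>c\<in>A. f c) = 0" unfolding f_def sum_subtractf using fin by (simp add: A_def)
  hence "f a = 0" using geig_independent[OF lin, of A f a] f fin by (simp add: A_def)
  hence "v = g a" by (simp add: f_def)
  moreover have "g a \<in> cspan {b\<in>B. ev b = a}" unfolding g_def by (intro span_sum span_scale span_base) simp
  ultimately show ?thesis by simp
 qed
 moreover have "cspan {b\<in>B. ev b = a} <= geig T a" for a by (rule span_minimal) (use ev geig_subspace[OF lin] in auto)
 ultimately show thesis using that[OF fin B(2) sp ev] by blast
qed

text \<open>\<open>S\<close> is \<open>f\<close> applied to the semisimple part of \<open>T\<close>.
  The identity gives the Jordan decomposition, and \<open>cnj\<close> gives the partner needed for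
  Cartan's criterion.\<close>

lemma spectral_map:
 assumes fd: "fin_dim (UNIV :: 'a::complex_vector set)" and lin: "clinear (T :: 'a => 'a)"
 obtains S where "clinear S" "!!a v. v \<in> geig T a ==> S v = f a *\<^sub>C v"
proof -
 obtain B ev where B: "finite B" "complex_vector.independent B" "cspan B = UNIV"
  "!!b. b \<in> B ==> b \<in> geig T (ev b)" "!!a. geig T a = cspan {b\<in>B. ev b = a}" by (rule geig_basis[OF assms]) blast
 obtain S where S: "clinear S" "!!b. b \<in> B ==> S b = f (ev b) *\<^sub>C b"
  using complex_vector_pair.linear_independent_extend[OF B(2), where f = "%b. f (ev b) *\<^sub>C b"] by metis
 show thesis
 proof (rule that[OF S(1)])
  fix a v assume "v \<in> geig T a"
  thus "S v = f a *\<^sub>C v" using clinear_eq_on_span[OF S(1) clinear_scale_fun[OF clinear_id], of "{b\<in>B. ev b = a}" "f a" v] S(2) B(5) by auto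
 qed
qed

text \<open>The semisimple part of \<open>T\<close> contributes the sum of the squared moduli of the
  eigenvalues to the trace, while the nilpotent part composed with \<open>S\<close> is again
  nilpotent. Hence all eigenvalues are 0.\<close>

lemma geig_trace_zero:
 assumes fd: "fin_dim (UNIV :: 'a::complex_vector set)" and lin: "clinear (T :: 'a => 'a)"
  and B: "complex_vector.independent B" "finite B" "cspan B = UNIV" and S: "clinear S" "!!a v. v \<in> geig T a ==> S v = cnj a *\<^sub>C v"
  and z: "tr B (%x. T (S x)) = 0" shows "geig T 0 = UNIV"
proof -
 obtain C ev where C: "finite C" "complex_vector.independent C" "cspan C = UNIV"
  "!!b. b \<in> C ==> b \<in> geig T (ev b)" "!!a. geig T a = cspan {b\<in>C. ev b = a}" by (rule geig_basis[OF fd lin]) blast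
 obtain R where R: "clinear R" "!!a v. v \<in> geig T a ==> R v = a *\<^sub>C v" using spectral_map[OF fd lin, where f = "%a. a"] by blast
 let ?N = "%x. T x - R x"
 have N: "clinear ?N" by (intro clinear_minus lin R)
 have N_geig: "?N v = T v - a *\<^sub>C v" if "v \<in> geig T a" for a v using R(2)[OF that] by simp
 have NS: "clinear (%x. ?N (S x))" by (rule clinear_compose[OF N S(1)])
 have nil: "\<exists>k. ((%x. ?N (S x)) ^^ k) v = 0" if "v \<in> geig T a" for a v using that
 proof (induction rule: geig_induct)
  case zero show ?case by (intro exI[of _ 0]) simp
 next
  case (step v)
  have v: "v \<in> geig T a" using geig_step[OF step.hyps] .
  obtain k where k: "((%x. ?N (S x)) ^^ k) (T v - a *\<^sub>C v) = 0" using step.IH by blast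
  have "?N (S v) = cnj a *\<^sub>C (T v - a *\<^sub>C v)" using N_geig[OF v] by (simp only: S(2)[OF v] clinear_scale[OF N])
  hence "((%x. ?N (S x)) ^^ Suc k) v = 0" using k by (simp only: funpow_Suc_right o_apply clinear_scale[OF clinear_funpow[OF NS]]) simp
  thus ?case by blast
 qed
 have "tr B (%x. T (S x)) = tr C (%x. T (S x))" by (rule tr_basis_change) (use B C clinear_compose[OF lin S(1)] in auto)
 also have "\<dots> = tr C (%x. R (S x) + ?N (S x))" by simp
 also have "\<dots> = tr C (%x. R (S x)) + tr C (%x. ?N (S x))" by (rule tr_add) (use C in auto)
 also have "tr C (%x. ?N (S x)) = 0" by (rule tr_nilpotent[OF C(2,1) NS]) (use C(3) nil[OF C(4)] in auto)
 also have "tr C (%x. R (S x)) = (\<Sum>b\<in>C. cnj (ev b) * ev b)"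
  by (rule tr_diag[OF C(2)]) (use S(2)[OF C(4)] R(2)[OF C(4)] clinear_scale[OF R(1)] in
   \<open>simp add: scaleC_scaleC\<close>)
 also have "\<dots> = of_real (\<Sum>b\<in>C. (cmod (ev b))\<^sup>2)" by (simp only: of_real_sum complex_norm_square mult.commute[of "cnj _"])
 finally have "(\<Sum>b\<in>C. (cmod (ev b))\<^sup>2) = 0" using z by (metis add.right_neutral of_real_eq_0_iff)
 hence "ev b = 0" if "b \<in> C" for b using that C(1) by (simp add: sum_nonneg_eq_0_iff)
 hence "{b\<in>C. ev b = 0} = C" by blast
 thus ?thesis using C(3,5) by metis
qed

section \<open>Lie algebras and the Killing form\<close>

lemma clinear_brk: "clinear (brk x)" by (intro clinearI) (simp_all add: brk_add_right brk_scaleC_right)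

lemma clinear_brk_left: "clinear (%x. brk x y)" by (intro clinearI) (simp_all add: brk_add_left brk_scaleC_left)

lemmas brk_simps =
 brk_add_left brk_add_right brk_scaleC_left brk_scaleC_right
 clinear_diff[OF clinear_brk] clinear_diff[OF clinear_brk_left]
 clinear_zero[OF clinear_brk] clinear_zero[OF clinear_brk_left]
 clinear_neg[OF clinear_brk] clinear_neg[OF clinear_brk_left] brk_self

lemma brk_anti: "brk x y = - brk y x"
proof -
 have "brk x y + brk y x = brk (x + y) (x + y) - brk x x - brk y y" by (simp only: brk_add_left brk_add_right) simp
 hence "brk x y + brk y x = 0" by (simp only: brk_self) simp
 thus ?thesis by (simp add: eq_neg_iff_add_eq_0)
qed

lemma brk_deriv: "brk x (brk y z) = brk (brk x y) z + brk y (brk x z)"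
proof -
 have "brk x (brk y z) + brk y (brk z x) + brk z (brk x y) = 0" by (rule brk_jacobi)
 moreover have "brk y (brk z x) = - brk y (brk x z)" by (subst brk_anti[of z]) (simp add: brk_simps)
 moreover have "brk z (brk x y) = - brk (brk x y) z" by (rule brk_anti)
 ultimately show ?thesis by (simp add: algebra_simps add_eq_0_iff)
qed

lemma brk_brk: "brk (brk x y) z = brk x (brk y z) - brk y (brk x z)" by (simp add: brk_deriv[of x])

section \<open>Engel's theorem and solvability of ad-nilpotent subalgebras\<close>

lemma max_dim_exists:
 assumes "P X" "!!X. P X ==> cdim X \<le> n" shows "\<exists>X. P X \<and> (\<forall>Y. P Y --> cdim Y \<le> cdim X)"
 by (rule ex_has_greatest_nat[of P X _ "Suc n"]) (use assms in \<open>auto simp: less_Suc_eq_le\<close>)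

lemma brk_in_ideal:
 assumes "csubspace I" "!!x y. x \<in> A ==> y \<in> B ==> brk x y \<in> I" "x \<in> cspan A" "y \<in> cspan B" shows "brk x y \<in> I"
proof -
 have "brk x b \<in> I" if "b \<in> B" for b by (rule clinear_span_in[OF clinear_brk_left assms(1) _ assms(3)]) (use assms(2) that in blast)
 thus ?thesis by (intro clinear_span_in[OF clinear_brk assms(1) _ assms(4)]) blast
qed

text \<open>Leibniz rule: \<open>ad x - (a + b)\<close> sends \<open>[u, v]\<close> to
  \<open>[(ad x - a) u, v] + [u, (ad x - b) v]\<close>, which drives a double induction on the
  exponents.\<close>

lemma geig_brk:
 assumes "u \<in> geig (brk x) a" "v \<in> geig (brk x) b" shows "brk u v \<in> geig (brk x) (a + b)" using assms
proof (induction arbitrary: v rule: geig_induct)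
 case zero
 thus ?case by (simp add: brk_simps geig_zero[OF clinear_brk])
next
 case (step u)
 note IH1 = step.IH
 show ?case using step.prems
 proof (induction rule: geig_induct)
  case zero
  thus ?case by (simp add: brk_simps geig_zero[OF clinear_brk])
 next
  case (step v)
  have "brk x (brk u v) - (a + b) *\<^sub>C brk u v = brk (brk x u - a *\<^sub>C u) v + brk u (brk x v - b *\<^sub>C v)"
   by (simp add: brk_deriv[of x u v] brk_simps scaleC_add_left algebra_simps)
  moreover have "brk (brk x u - a *\<^sub>C u) v \<in> geig (brk x) (a + b)" by (rule IH1) (rule geig_step[OF step.hyps])
  ultimately have "brk x (brk u v) - (a + b) *\<^sub>C brk u v \<in> geig (brk x) (a + b)"
   using step.IH subspace_add[OF geig_subspace[OF clinear_brk]] by metis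
  thus ?case by (rule geig_step)
 qed
qed

lemma geig_zero_iff: "v \<in> geig T 0 \<longleftrightarrow> (\<exists>k. (T ^^ k) v = 0)" by (simp add: geig_def)

text \<open>Take a proper subalgebra \<open>K\<close> of maximal dimension. Together with an outside
  vector that normalizes it, \<open>K\<close> generates a larger subalgebra, which must be
  \<open>L\<close>.\<close>

lemma maximal_subalgebra:
 assumes L: "fin_dim L" "lie_subalgebra L" "L ~= {0}"
  and norm: "!!K. lie_subalgebra K ==> K \<subset> L ==> \<exists>y. y \<in> L \<and> y \<notin> K \<and> (\<forall>x\<in>K. brk x y \<in> K)"
 obtains K y where "lie_subalgebra K" "K \<subset> L" "y \<in> L" "!!x. x \<in> K ==> brk x y \<in> K" "L = cspan (insert y K)"
proof -
 have Lsub: "csubspace L" and Lbrk: "!!x y. x \<in> L ==> y \<in> L ==> brk x y \<in> L" using L(2) by (auto simp: lie_subalgebra_def)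
 define KK where "KK K \<longleftrightarrow> lie_subalgebra K \<and> K \<subset> L" for K
 have "KK {0}" using L(3) subspace_0[OF Lsub] by (auto simp: KK_def lie_subalgebra_def brk_simps)
 moreover have "cdim K \<le> cdim L" if "KK K" for K using fin_dim_dim_mono[OF L(1) Lsub] that by (auto simp: KK_def)
 ultimately have "\<exists>K. KK K \<and> (\<forall>K'. KK K' --> cdim K' \<le> cdim K)" by (rule max_dim_exists[of KK "{0}"])
 then obtain K where K: "KK K" "!!K'. KK K' ==> cdim K' \<le> cdim K" by blast
 have Kalg: "lie_subalgebra K" and KL: "K \<subset> L" using K(1) by (auto simp: KK_def)
 have Ksub: "csubspace K" and Kbrk: "!!x y. x \<in> K ==> y \<in> K ==> brk x y \<in> K" using Kalg by (auto simp: lie_subalgebra_def)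
 obtain y where y: "y \<in> L" "y \<notin> K" "!!x. x \<in> K ==> brk x y \<in> K" using norm[OF Kalg KL] by blast
 define M where "M = cspan (insert y K)"
 have Msub: "csubspace M" by (simp add: M_def)
 have KM: "K <= M" and yM: "y \<in> M" unfolding M_def using span_superset[of "insert y K"] by auto
 have "brk x z \<in> M" if "x \<in> M" "z \<in> M" for x z
 proof (rule brk_in_ideal[OF Msub _ that[unfolded M_def]])
  fix a b assume "a \<in> insert y K" "b \<in> insert y K"
  then consider "a = y" "b = y" | "a = y" "b \<in> K" | "a \<in> K" "b = y" | "a \<in> K" "b \<in> K" by blast
  thus "brk a b \<in> M"
  proof cases
   case 1 thus ?thesis using subspace_0[OF Msub] by (simp add: brk_simps)
  next
   case 2
   hence "brk b a \<in> M" using y(3) KM by blast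
   thus ?thesis using brk_anti[of a b] subspace_neg[OF Msub] by metis
  next
   case 3 thus ?thesis using y(3) KM by blast
  next
   case 4 thus ?thesis using Kbrk KM by blast
  qed
 qed
 hence Malg: "lie_subalgebra M" using Msub by (auto simp: lie_subalgebra_def)
 have MsL: "M <= L" unfolding M_def using y KL Lsub by (intro span_minimal) auto
 have LM: "L = M"
 proof (rule ccontr)
  assume "L ~= M"
  hence "KK M" using Malg MsL by (auto simp: KK_def)
  moreover have "cdim K < cdim M" by (rule fin_dim_psubset_dim) (use Msub Ksub KM yM y L(1) MsL fin_dim_subset in auto)
  ultimately show False using K(2) by (meson not_less)
 qed
 thus ?thesis using that[OF Kalg KL y(1,3)] M_def by blast
qed

text \<open>A relative form in which \<open>W'\<close> takes the place of 0, so that no quotient is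
  formed. With \<open>W = L\<close> and \<open>W' = K\<close> it yields an element outside
  \<open>K\<close> that normalizes \<open>K\<close>, and this instance feeds the induction
  itself.\<close>

lemma engel:
 assumes "fin_dim L" "lie_subalgebra L" "!!x y. x \<in> L ==> y \<in> L ==> y \<in> geig (brk x) 0" and "csubspace W" "csubspace W'" "W' \<subset> W"
  and "!!x w. x \<in> L ==> w \<in> W ==> brk x w \<in> W" "!!x w. x \<in> L ==> w \<in> W' ==> brk x w \<in> W'"
  and "!!x w. x \<in> L ==> w \<in> W ==> \<exists>k. (brk x ^^ k) w \<in> W'"
 shows "\<exists>w. w \<in> W \<and> w \<notin> W' \<and> (\<forall>x\<in>L. brk x w \<in> W')" using assms
proof (induction "cdim L" arbitrary: L W W' rule: less_induct)
 case less
 note L = \<open>lie_subalgebra L\<close>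
 have Lsub: "csubspace L" and Lbrk: "!!x y. x \<in> L ==> y \<in> L ==> brk x y \<in> L" using L by (auto simp: lie_subalgebra_def)
 show ?case
 proof (cases "L = {0}")
  case True
  thus ?thesis using less.prems(5,6) subspace_0[of W'] by (auto simp: brk_simps)
 next
  case False
  have norm: "\<exists>y. y \<in> L \<and> y \<notin> K \<and> (\<forall>x\<in>K. brk x y \<in> K)" if K: "lie_subalgebra K" "K \<subset> L" for K
  proof -
   have Ksub: "csubspace K" and Kbrk: "!!x y. x \<in> K ==> y \<in> K ==> brk x y \<in> K" using K(1) by (auto simp: lie_subalgebra_def)
   show ?thesis
   proof (rule less.hyps[OF _ _ K(1) _ Lsub Ksub K(2)])
    show "cdim K < cdim L" by (rule fin_dim_psubset_dim[OF less.prems(1) Lsub Ksub K(2)])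
    fix x w assume "x \<in> K" "w \<in> L"
    thus "\<exists>k. (brk x ^^ k) w \<in> K" using K(2) less.prems(3) subspace_0[OF Ksub] by (metis geig_zero_iff psubsetD)
   qed (use psubset_imp_subset[OF K(2)] subsetD[OF psubset_imp_subset[OF K(2)]] Lbrk Kbrk less.prems(3) fin_dim_subset[OF less.prems(1)] in auto)
  qed
  obtain K y where Kalg: "lie_subalgebra K" and KL: "K \<subset> L" and y: "y \<in> L" "!!x. x \<in> K ==> brk x y \<in> K" and LM: "L = cspan (insert y K)"
   by (rule maximal_subalgebra[OF less.prems(1) L False norm]) (assumption | blast)+
  have dimK: "cdim K < cdim L" using fin_dim_psubset_dim[OF less.prems(1) Lsub _ KL] Kalg by (simp add: lie_subalgebra_def)
  \<comment> \<open>\<open>K\<close> annihilates \<open>W1\<close> modulo \<open>W'\<close>, and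
    \<open>y\<close> preserves \<open>W1\<close> because it normalizes \<open>K\<close>. The last
    power of \<open>y\<close> that keeps \<open>w1\<close> outside \<open>W'\<close> gives the
    vector.\<close>
  define W1 where "W1 = {w\<in>W. \<forall>x\<in>K. brk x w \<in> W'}"
  have "\<exists>w. w \<in> W \<and> w \<notin> W' \<and> (\<forall>x\<in>K. brk x w \<in> W')"
   by (rule less.hyps[OF dimK _ Kalg _ less.prems(4-6)]) (use less.prems(3,7-9) psubset_imp_subset[OF KL] subsetD[OF psubset_imp_subset[OF KL]] fin_dim_subset[OF less.prems(1)] in auto)
  then obtain w1 where w1: "w1 \<in> W1" "w1 \<notin> W'" by (auto simp: W1_def)
  have W1y: "brk y w \<in> W1" if w: "w \<in> W1" for w
  proof -
   have "brk x (brk y w) \<in> W'" if "x \<in> K" for x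
   proof -
    have "brk (brk x y) w \<in> W'" using w y(2)[OF that] by (auto simp: W1_def)
    moreover have "brk y (brk x w) \<in> W'" using w that less.prems(8) y(1) by (auto simp: W1_def)
    ultimately show ?thesis unfolding brk_deriv[of x y] by (rule subspace_add[OF less.prems(5)])
   qed
   thus ?thesis using w less.prems(7) y(1) by (auto simp: W1_def)
  qed
  have pow: "(brk y ^^ k) w1 \<in> W1" for k using w1 W1y by (induction k) auto
  define k where "k = (LEAST k. (brk y ^^ k) w1 \<in> W')"
  have ex: "\<exists>k. (brk y ^^ k) w1 \<in> W'" using less.prems(9)[OF y(1)] w1 by (auto simp: W1_def)
  have k: "(brk y ^^ k) w1 \<in> W'" unfolding k_def by (rule LeastI_ex[OF ex])
  have "k ~= 0" using k w1 by (intro notI) simp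
  then obtain j where j: "k = Suc j" using not0_implies_Suc by blast
  define w where "w = (brk y ^^ j) w1"
  have "w \<notin> W'" unfolding w_def using j not_less_Least[of j "%k. (brk y ^^ k) w1 \<in> W'"] by (simp add: k_def)
  moreover have "w \<in> W1" unfolding w_def by (rule pow)
  moreover have "brk y w \<in> W'" using k unfolding j w_def by simp
  moreover have "brk x w \<in> W'" if "x \<in> L" for x by (rule clinear_span_in[OF clinear_brk_left less.prems(5), of "insert y K"])
    (use that LM \<open>brk y w \<in> W'\<close> \<open>w \<in> W1\<close> in \<open>auto simp: W1_def\<close>)
  ultimately show ?thesis by (auto simp: W1_def)
 qed
qed

lemma brk_span_subspace: "csubspace (brk_span A B)" by (simp add: brk_span_def)

lemma brk_span_mono: "A <= A' ==> B <= B' ==> brk_span A B <= brk_span A' B'" unfolding brk_span_def by (rule span_mono) blast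

lemma brk_span_base: "x \<in> A ==> y \<in> B ==> brk x y \<in> brk_span A B" unfolding brk_span_def by (rule span_base) blast

lemma brk_span_subset: "csubspace S ==> (!!x y. x \<in> A ==> y \<in> B ==> brk x y \<in> S) ==> brk_span A B <= S"
 unfolding brk_span_def by (rule span_minimal) auto

lemma derived_series_mono: "A <= B ==> derived_series A n <= derived_series B n" by (induction n) (simp_all add: brk_span_mono)

lemma zero_in_derived_series: "csubspace L ==> 0 \<in> derived_series L n" by (cases n) (simp_all add: subspace_0 brk_span_subspace)

lemma derived_series_Suc: "derived_series L (Suc n) = derived_series (brk_span L L) n" by (induction n) simp_all

lemma solvable_extension:
 assumes "solvable K" "csubspace L" "brk_span L L <= K" shows "solvable L"
proof -
 obtain n where "derived_series K n = {0}" using assms(1) by (auto simp: solvable_def)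
 hence "derived_series L (Suc n) <= {0}" using derived_series_mono[OF assms(3), of n] by (simp only: derived_series_Suc)
 thus ?thesis unfolding solvable_def using zero_in_derived_series[OF assms(2)] by blast
qed

text \<open>By Engel's theorem a maximal proper subalgebra \<open>K\<close> is an ideal with
  one-dimensional quotient, so all commutators of \<open>L\<close> lie in \<open>K\<close>.\<close>

lemma ad_nilpotent_solvable:
 assumes "fin_dim L" "lie_subalgebra L" "!!x y. x \<in> L ==> y \<in> L ==> y \<in> geig (brk x) 0" shows "solvable L" using assms
proof (induction "cdim L" arbitrary: L rule: less_induct)
 case less
 have Lsub: "csubspace L" and Lbrk: "!!x y. x \<in> L ==> y \<in> L ==> brk x y \<in> L" using less.prems(2) by (auto simp: lie_subalgebra_def)
 show ?case
 proof (cases "L = {0}")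
  case True
  hence "derived_series L 0 = {0}" by simp
  thus ?thesis unfolding solvable_def by blast
 next
  case False
  have norm: "\<exists>y. y \<in> L \<and> y \<notin> K \<and> (\<forall>x\<in>K. brk x y \<in> K)" if K: "lie_subalgebra K" "K \<subset> L" for K
  proof (rule engel[OF _ K(1) _ Lsub _ K(2)])
   show "\<exists>k. (brk x ^^ k) w \<in> K" if "x \<in> K" "w \<in> L" for x w
    using that K less.prems(3) subspace_0[of K] by (metis geig_zero_iff lie_subalgebra_def psubsetD)
  qed (use K(1) psubset_imp_subset[OF K(2)] subsetD[OF psubset_imp_subset[OF K(2)]] K(2) less.prems(3) Lbrk fin_dim_subset[OF less.prems(1)] in \<open>auto simp: lie_subalgebra_def\<close>)
  obtain K y where K: "lie_subalgebra K" "K \<subset> L" and y: "!!x. x \<in> K ==> brk x y \<in> K" and LM: "L = cspan (insert y K)"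
   by (rule maximal_subalgebra[OF less.prems(1,2) False norm]) (assumption | blast)+
  have Ks: "csubspace K" and Kb: "!!x y. x \<in> K ==> y \<in> K ==> brk x y \<in> K" using K(1) by (auto simp: lie_subalgebra_def)
  have "solvable K"
   by (rule less.hyps[OF fin_dim_psubset_dim[OF less.prems(1) Lsub Ks K(2)] _ K(1)]) (use psubset_imp_subset[OF K(2)] subsetD[OF psubset_imp_subset[OF K(2)]] less.prems(3) fin_dim_subset[OF less.prems(1)] in auto)
  moreover have "brk u v \<in> K" if "u \<in> L" "v \<in> L" for u v
  proof (rule brk_in_ideal[OF Ks _ that[unfolded LM]])
   fix a b assume "a \<in> insert y K" "b \<in> insert y K"
   thus "brk a b \<in> K" using y Kb brk_anti[of y b] subspace_neg[OF Ks] subspace_0[OF Ks] by (auto simp: brk_self)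
  qed
  ultimately show ?thesis using solvable_extension[OF _ Lsub] brk_span_subset[OF Ks] by blast
 qed
qed


subsection \<open>The Killing form\<close>

text \<open>The basis that \<open>ctrace\<close> selects, so that \<open>killing\<close> unfolds to
  a \<open>tr\<close> without a change of basis.\<close>

definition kbasis :: "'g::complex_vector set" where "kbasis = complex_vector.extend_basis {}"

definition krad :: "'g::lie_algebra set" where "krad = {x. \<forall>y. killing x y = 0}"

context
 assumes fd: "fin_dim (UNIV :: 'g::lie_algebra set)"
begin

lemma kbasis: "complex_vector.independent (kbasis :: 'g set)" "cspan kbasis = (UNIV :: 'g set)"
 "finite (kbasis :: 'g set)"
proof -
 show 1: "complex_vector.independent (kbasis :: 'g set)" "cspan kbasis = (UNIV :: 'g set)"
  unfolding kbasis_def using complex_vector.independent_extend_basis[OF complex_vector.independent_empty]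
   complex_vector.span_extend_basis[OF complex_vector.independent_empty] by auto
 show "finite (kbasis :: 'g set)" using fin_dim_independent[OF fd 1(1)] by simp
qed

lemma killing_tr: "killing (x::'g) y = tr kbasis (%z. brk x (brk y z))" by (simp add: killing_def ctrace_eq_tr kbasis_def)

lemma clinear_killing_left: "clinear (%x. killing (x::'g) y)"
 by (intro clinearI) (simp_all add: killing_tr brk_simps tr_add[OF kbasis(1)] tr_scale[OF kbasis(1)] kbasis
   scaleC_complex)

lemma killing_sym: "killing x y = killing y (x::'g)" unfolding killing_tr by (rule tr_commute[OF kbasis(1,3)]) (auto simp: clinear_brk kbasis)

lemma clinear_killing: "clinear (%x. killing (y::'g) x)" by (subst killing_sym) (rule clinear_killing_left)

lemma killing_invariant: "killing (brk x y) z = killing x (brk y (z::'g))"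
proof -
 have "killing (brk x y) z = tr kbasis (%v. brk x (brk y (brk z v))) - tr kbasis (%v. brk y (brk x (brk z v)))"
  unfolding killing_tr brk_brk by (rule tr_diff[OF kbasis(1)]) (auto simp: kbasis)
 moreover have "tr kbasis (%v. brk y (brk x (brk z v))) = tr kbasis (%v. brk x (brk z (brk y v)))"
  by (rule tr_commute[OF kbasis(1,3) clinear_brk clinear_compose[OF clinear_brk clinear_brk]]) (auto simp: kbasis)
 moreover have "killing x (brk y z) = tr kbasis (%v. brk x (brk y (brk z v))) - tr kbasis (%v. brk x (brk z (brk y v)))"
  unfolding killing_tr brk_brk brk_simps by (rule tr_diff[OF kbasis(1)]) (auto simp: kbasis)
 ultimately show ?thesis by simp
qed

lemma killing_geig:
 assumes "u \<in> geig (brk x) a" "v \<in> geig (brk x) b" "a + b ~= 0" shows "killing u (v::'g) = 0" using assms(1,2)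
proof (induction arbitrary: v rule: geig_induct)
 case zero
 thus ?case by (simp add: clinear_zero[OF clinear_killing_left])
next
 case (step u)
 note IH1 = step.IH
 show ?case using step.prems
 proof (induction rule: geig_induct)
  case zero
  thus ?case by (simp add: clinear_zero[OF clinear_killing])
 next
  case (step v)
  have "killing (brk x u - a *\<^sub>C u) v = 0" by (rule IH1) (rule geig_step[OF step.hyps])
  moreover have "killing u (brk x v - b *\<^sub>C v) = 0" by (rule step.IH)
  moreover have "killing (brk x u) v = - killing u (brk x v)"
   using killing_invariant[of u x v] brk_anti[of x u] clinear_neg[OF clinear_killing_left] by simp
  ultimately have "(a + b) * killing u v = 0" by (simp add: clinC[OF clinear_killing] clinC[OF clinear_killing_left] distrib_right)
    (metis add.inverse_inverse add_eq_0_iff)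
  thus ?case using assms(3) by simp
 qed
qed

text \<open>The bracket of the generalized eigenspaces for \<open>a\<close> and \<open>b\<close>
  lands in the one for \<open>a + b\<close>, so additivity of \<open>f\<close> is the Leibniz
  rule.\<close>

lemma spectral_derivation:
 assumes S: "clinear S" "!!a v. v \<in> geig (brk (x::'g)) a ==> S v = f a *\<^sub>C v" and f: "!!a b. f (a + b) = f a + f b"
 shows "S (brk u v) = brk (S u) v + brk u (S v)"
proof -
 let ?G = "\<Union>b. geig (brk x) b"
 note sp = geig_span_UNIV[OF fd clinear_brk, of x]
 have 1: "S (brk u v) = brk (S u) v + brk u (S v)" if uv: "u \<in> ?G" "v \<in> ?G" for u v
 proof -
  obtain a b where ab: "u \<in> geig (brk x) a" "v \<in> geig (brk x) b" using uv by blast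
  show ?thesis using S(2)[OF geig_brk[OF ab]] S(2)[OF ab(1)] S(2)[OF ab(2)] by (simp add: f brk_simps scaleC_add_left)
 qed
 have 2: "S (brk u v) = brk (S u) v + brk u (S v)" if u: "u \<in> ?G" for u v by (rule clinear_eq_on_span[OF clinear_compose[OF S(1) clinear_brk]
    clinear_plus[OF clinear_brk clinear_compose[OF clinear_brk S(1)]], of ?G]) (use 1 u sp in auto)
 show ?thesis by (rule clinear_eq_on_span[OF clinear_compose[OF S(1) clinear_brk_left]
    clinear_plus[OF clinear_compose[OF clinear_brk_left S(1)] clinear_brk_left], of ?G]) (use 2 sp in auto)
qed

lemma krad_subspace: "csubspace (krad :: 'g set)" unfolding krad_def by (intro csubspaceI) (auto simp: clinC[OF clinear_killing_left])

lemma krad_brk: "y \<in> krad ==> brk x y \<in> krad" "y \<in> krad ==> brk y x \<in> krad" for x y :: 'g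
proof -
 show 1: "brk y x \<in> krad" if "y \<in> krad" for x y :: 'g using that by (auto simp: krad_def killing_invariant)
 show "y \<in> krad ==> brk x y \<in> krad" using 1[of y x] brk_anti[of x y] subspace_neg[OF krad_subspace] by metis
qed

text \<open>Cartan's criterion. Let \<open>S\<close> be the conjugate of the semisimple part of
  \<open>ad x\<close>; it is a derivation. Then tr (ad [y, z] S) = - killing y (S z), which is 0 for
  \<open>y\<close> in the radical, so tr (ad x S) = 0 and \<open>geig_trace_zero\<close>
  applies.\<close>

lemma krad_brk_span_nilpotent:
 assumes "(x::'g) \<in> brk_span krad krad" shows "geig (brk x) 0 = UNIV"
proof -
 obtain S where S: "clinear S" "!!a v. v \<in> geig (brk x) a ==> S v = cnj a *\<^sub>C v"
  using spectral_map[OF fd clinear_brk, where f = cnj] by blast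
 have der: "S (brk u v) = brk (S u) v + brk u (S v)" for u v by (rule spectral_derivation[OF S complex_cnj_add])
 have "tr kbasis (%v. brk x' (S v)) = 0" if "x' \<in> brk_span krad krad" for x' using that unfolding brk_span_def
 proof (induction rule: span_induct_alt)
  case base show ?case by (simp add: brk_simps tr_zero)
 next
  case (step c w x')
  then obtain y z where yz: "y \<in> krad" "z \<in> krad" "w = brk y z" by blast
  have "tr kbasis (%v. brk w (S v)) =
   tr kbasis (%v. brk y (brk z (S v))) - tr kbasis (%v. brk z (brk y (S v)))" unfolding yz brk_brk by (rule tr_diff[OF kbasis(1)]) (auto simp: kbasis)
  also have "tr kbasis (%v. brk z (brk y (S v))) = tr kbasis (%v. brk y (S (brk z v)))"
   by (rule tr_commute[OF kbasis(1,3) clinear_brk clinear_compose[OF clinear_brk S(1)]]) (auto simp: kbasis)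
  also have "tr kbasis (%v. brk y (brk z (S v))) - tr kbasis (%v. brk y (S (brk z v))) =
   tr kbasis (%v. brk y (brk z (S v)) - brk y (S (brk z v)))" by (rule tr_diff[OF kbasis(1), symmetric]) (auto simp: kbasis)
  also have "\<dots> = tr kbasis (%v. (-1) *\<^sub>C brk y (brk (S z) v))" by (simp add: der brk_simps)
  also have "\<dots> = - killing y (S z)" by (subst tr_scale[OF kbasis(1)]) (auto simp: kbasis killing_tr)
  also have "\<dots> = 0" using yz by (simp add: krad_def)
  finally have w: "tr kbasis (%v. brk w (S v)) = 0" .
  have "tr kbasis (%v. brk (c *\<^sub>C w + x') (S v)) =
   tr kbasis (%v. c *\<^sub>C brk w (S v) + brk x' (S v))" by (simp add: brk_simps)
  also have "\<dots> = c * tr kbasis (%v. brk w (S v)) + tr kbasis (%v. brk x' (S v))"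
   by (simp add: tr_add[OF kbasis(1)] tr_scale[OF kbasis(1)] kbasis)
  finally show ?case using w step by simp
 qed
 from this[OF assms] show ?thesis by (intro geig_trace_zero[OF fd clinear_brk kbasis(1,3,2) S])
qed

text \<open>Commutators of \<open>krad\<close> are ad-nilpotent, so \<open>krad\<close> is a
  solvable ideal and lies in the radical, which reductivity identifies with the center.\<close>

lemma krad_eq_center:
 assumes "reductive (UNIV :: 'g set)" shows "krad = {x::'g. \<forall>y. brk x y = 0}"
proof
 let ?D = "brk_span krad krad :: 'g set"
 have Dk: "?D <= krad" by (intro brk_span_subset krad_subspace krad_brk)
 have "lie_subalgebra ?D" unfolding lie_subalgebra_def using Dk brk_span_subspace brk_span_base by blast
 hence "solvable ?D" using krad_brk_span_nilpotent by (intro ad_nilpotent_solvable fin_dim_subset[OF fd]) auto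
 hence "solvable (krad :: 'g set)" unfolding solvable_def using derived_series_Suc by metis
 hence "(krad :: 'g set) <= radical UNIV" unfolding radical_def lie_ideal_def using krad_subspace krad_brk by blast
 thus "krad <= {x::'g. \<forall>y. brk x y = 0}" using assms by (auto simp: reductive_def lie_center_def)
 show "{x::'g. \<forall>y. brk x y = 0} <= krad" by (auto simp: krad_def killing_tr tr_zero)
qed

end

section \<open>Functionals and independence of weight vectors\<close>

lemma functional_in_span:
 fixes \<phi> :: "'a::complex_vector => complex"
 assumes "finite S" "!!f. f \<in> S ==> clinear f" "clinear \<phi>"
  "!!x. (!!f. f \<in> S ==> f x = 0) ==> \<phi> x = 0" shows "\<phi> \<in> cspan S" using assms
proof (induction S arbitrary: \<phi> rule: finite_induct)
 case empty
 hence 0: "\<phi> = 0" by (auto simp: fun_eq_iff)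
 show ?case unfolding 0 by (rule span_zero)
next
 case (insert f S)
 show ?case
 proof (cases "\<forall>x. (\<forall>g\<in>S. g x = 0) --> f x = 0")
  case True
  hence "\<phi> \<in> cspan S" by (intro insert.IH insert.prems) (use insert.prems in auto)
  thus ?thesis using span_mono[of S "insert f S"] by blast
 next
  case False
  then obtain y where y: "!!g. g \<in> S ==> g y = 0" "f y ~= 0" by blast
  have f: "clinear f" using insert.prems by blast
  define \<psi> where "\<psi> = (%x. \<phi> x - (\<phi> y / f y) *\<^sub>C f x)"
  have psi: "clinear \<psi>" unfolding \<psi>_def by (rule clinear_minus[OF insert.prems(2) clinear_scale_fun[OF f]])
  have "\<psi> \<in> cspan S"
  proof (rule insert.IH[OF _ psi])
   fix x assume x: "!!g. g \<in> S ==> g x = 0"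
   define x' where "x' = x - (f x / f y) *\<^sub>C y"
   have "\<phi> x' = 0"
   proof (rule insert.prems(3))
    fix g assume "g \<in> insert f S"
    thus "g x' = 0" using x[of g] y(1)[of g] y(2) insert.prems(1)[of g] by (auto simp: x'_def clinC)
   qed
   thus "\<psi> x = 0" by (simp add: \<psi>_def x'_def clinC[OF insert.prems(2)] scaleC_complex)
  qed (use insert.prems in auto)
  hence "\<psi> \<in> cspan (insert f S)" using span_mono[of S "insert f S"] by blast
  moreover have "(\<phi> y / f y) *\<^sub>C f \<in> cspan (insert f S)" by (intro span_scale span_base) simp
  ultimately have "\<psi> + (\<phi> y / f y) *\<^sub>C f \<in> cspan (insert f S)" by (rule span_add)
  moreover have "\<psi> + (\<phi> y / f y) *\<^sub>C f = \<phi>" by (simp add: \<psi>_def fun_eq_iff scaleC_fun_apply)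
  ultimately show ?thesis by simp
 qed
qed

lemma commuting_funpow:
 assumes "!!v. N (C v) = C (N v)" shows "((%x. N (C x)) ^^ k) v = (C ^^ k) ((N ^^ k) v)"
proof (induction k arbitrary: v)
 case (Suc k)
 have comm: "(N ^^ k) (C v) = C ((N ^^ k) v)" for v by (induction k) (simp_all add: assms)
 have "((%x. N (C x)) ^^ Suc k) v = ((%x. N (C x)) ^^ k) (N (C v))" by (simp only: funpow_Suc_right o_apply)
 also have "\<dots> = (C ^^ k) ((N ^^ k) (C (N v)))" by (simp only: Suc.IH assms[of v])
 also have "\<dots> = (C ^^ Suc k) ((N ^^ Suc k) v)" by (simp only: comm funpow_Suc_right o_apply)
 finally show ?case .
qed simp

lemma weight_independent:
 assumes "finite A" "!!h. h \<in> H ==> clinear (a h)"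
  "!!\<beta> h. \<beta> \<in> A ==> h \<in> H ==> a h (f \<beta>) = \<beta> h *\<^sub>C f \<beta>"
  "!!\<beta> \<gamma>. \<beta> \<in> A ==> \<gamma> \<in> A ==> \<beta> ~= \<gamma> ==> \<exists>h\<in>H. \<beta> h ~= \<gamma> h"
  "(\<Sum>\<beta>\<in>A. f \<beta>) = 0" "\<beta> \<in> A" shows "f \<beta> = 0" using assms(1,3-6)
proof (induction A arbitrary: f \<beta> rule: finite_induct)
 case (insert \<gamma> A)
 have 0: "f \<beta> = 0" if b: "\<beta> \<in> A" for \<beta>
 proof -
  have "\<beta> ~= \<gamma>" using b insert.hyps by blast
  then obtain h where h: "h \<in> H" "\<beta> h ~= \<gamma> h" using insert.prems(2)[of \<beta> \<gamma>] b by blast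
  define g where "g \<delta> = (\<delta> h - \<gamma> h) *\<^sub>C f \<delta>" for \<delta>
  have "g \<beta> = 0"
  proof (rule insert.IH[OF _ _ _ b])
   fix \<delta> h' assume "\<delta> \<in> A" "h' \<in> H"
   thus "a h' (g \<delta>) = \<delta> h' *\<^sub>C g \<delta>"
    using insert.prems(1)[of \<delta> h'] by (simp add: g_def clin[OF assms(2)] scaleC_scaleC mult.commute)
  next
   have "(\<Sum>\<delta>\<in>insert \<gamma> A. g \<delta>) = (\<Sum>\<delta>\<in>insert \<gamma> A. a h (f \<delta>)) - (\<Sum>\<delta>\<in>insert \<gamma> A. \<gamma> h *\<^sub>C f \<delta>)"
    unfolding g_def sum_subtractf[symmetric] by (intro sum.cong refl) (use insert.prems(1) h in \<open>simp add: scale_left_diff_distrib\<close>)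
   also have "\<dots> = a h (\<Sum>\<delta>\<in>insert \<gamma> A. f \<delta>) - \<gamma> h *\<^sub>C (\<Sum>\<delta>\<in>insert \<gamma> A. f \<delta>)"
    by (simp only: clinear_sum[OF assms(2)[OF h(1)]] scale_sum_right)
   also have "\<dots> = 0" unfolding insert.prems(3) by (simp add: clin[OF assms(2)[OF h(1)]])
   finally show "(\<Sum>\<delta>\<in>A. g \<delta>) = 0" using insert.hyps by (simp add: g_def)
  qed (use insert.prems(2) in blast)
  thus ?thesis using h by (simp add: g_def)
 qed
 moreover have "f \<gamma> = 0" using insert.prems(3) insert.hyps 0 by simp
 ultimately show ?case using insert.prems(4) by blast
qed simp

text \<open>Eigenvectors for distinct weights are independent, so the dimension bounds the number of
  weights.\<close>

lemma finite_weights: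
 assumes fd: "fin_dim W" and lin: "!!h. h \<in> H ==> clinear (a h)"
  and wt: "!!\<beta>. \<beta> \<in> A ==> \<exists>v\<in>W. v ~= 0 \<and> (\<forall>h\<in>H. a h v = \<beta> h *\<^sub>C v)"
  and dist: "!!\<beta> \<gamma>. \<beta> \<in> A ==> \<gamma> \<in> A ==> \<beta> ~= \<gamma> ==> \<exists>h\<in>H. \<beta> h ~= \<gamma> h"
 shows "finite A"
proof -
 obtain f where f: "!!\<beta>. \<beta> \<in> A ==> f \<beta> \<in> W \<and> f \<beta> ~= 0 \<and> (\<forall>h\<in>H. a h (f \<beta>) = \<beta> h *\<^sub>C f \<beta>)"
  using wt by metis
 obtain B where B: "finite B" "W <= cspan B" using fd by (auto simp: fin_dim_def)
 have inj: "inj_on f A"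
 proof (rule inj_onI, rule ccontr)
  fix \<beta> \<gamma> assume *: "\<beta> \<in> A" "\<gamma> \<in> A" "f \<beta> = f \<gamma>" "\<beta> ~= \<gamma>"
  then obtain h where "h \<in> H" "\<beta> h ~= \<gamma> h" using dist by blast
  hence "\<beta> h *\<^sub>C f \<beta> = \<gamma> h *\<^sub>C f \<beta>" using f * by metis
  thus False using f[OF *(1)] \<open>\<beta> h ~= \<gamma> h\<close> by simp
 qed
 have "card F \<le> card B" if F: "F <= A" "finite F" for F
 proof -
  have "complex_vector.independent (f ` F)"
  proof (rule complex_vector.independent_if_scalars_zero)
   fix c x assume s: "(\<Sum>x\<in>f ` F. c x *\<^sub>C x) = 0" and x: "x \<in> f ` F"
   then obtain \<beta> where b: "\<beta> \<in> F" "x = f \<beta>" by blast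
   have s': "(\<Sum>\<beta>\<in>F. c (f \<beta>) *\<^sub>C f \<beta>) = 0" using s F inj by (subst (asm) sum.reindex) (auto intro: inj_on_subset)
   have "c (f \<beta>) *\<^sub>C f \<beta> = 0" by (rule weight_independent[OF F(2) lin _ _ s' b(1)])
     (use f F dist in \<open>auto simp: clin[OF lin] scaleC_scaleC mult.commute subset_iff\<close>)
   thus "c x = 0" using f b F by auto
  qed (use F in auto)
  hence "card (f ` F) \<le> card B" using complex_vector.independent_span_bound[OF B(1)] f F B by blast
  thus ?thesis using F inj card_image inj_on_subset by metis
 qed
 thus ?thesis using finite_if_finite_subsets_card_bdd[of A "card B"] by blast
qed


subsection \<open>Reductive Lie algebras\<close>

locale reductive_lie =
 fixes ty :: "'g::lie_algebra itself"
 assumes fd: "fin_dim (UNIV :: 'g set)" and red: "reductive (UNIV :: 'g set)"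
begin

lemmas kb = kbasis[OF fd]
lemmas killing_tr = killing_tr[of "_ :: 'g"]
lemmas killing_lin = clinear_killing_left[OF fd] clinear_killing[OF fd]
lemmas killing_simps = clinC[OF clinear_killing_left[OF fd]] clinC[OF clinear_killing[OF fd]]
lemmas kinv = killing_invariant[OF fd]
lemmas ksym = killing_sym[OF fd]

lemma krad_iff: "x \<in> krad \<longleftrightarrow> (\<forall>y. brk x y = 0)" for x :: 'g using krad_eq_center[OF fd red] by auto

lemma krad_iff': "x \<in> krad \<longleftrightarrow> (\<forall>y. killing x y = 0)" for x :: 'g by (simp add: krad_def)

lemma krad_brk0: "x \<in> krad ==> brk x y = 0" "x \<in> krad ==> brk y x = 0" for x y :: 'g using krad_iff[of x] brk_anti[of y x] by auto

lemma krad_killing0: "x \<in> krad ==> killing x y = 0" "x \<in> krad ==> killing y x = 0" for x y :: 'g using krad_iff'[of x] ksym[of y x] by auto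

lemma riesz:
 assumes "clinear (\<phi> :: 'g => complex)" "!!x. x \<in> krad ==> \<phi> x = 0"
 obtains d where "!!x. killing d x = \<phi> x"
proof -
 have "\<phi> \<in> cspan (killing ` kbasis)"
 proof (rule functional_in_span)
  fix x :: 'g assume *: "!!f. f \<in> killing ` kbasis ==> f x = 0"
  have "killing y x = 0" for y by (rule clinear_eq_on_span[OF killing_lin(1) clinear_const_0, of kbasis]) (use * kb in auto)
  hence "x \<in> krad" using ksym by (auto simp: krad_iff')
  thus "\<phi> x = 0" by (rule assms)
 qed (use assms kb killing_lin in auto)
 hence "\<exists>d. \<phi> = killing d"
 proof (induction rule: span_induct_alt)
  case base
  show ?case by (intro exI[of _ 0]) (simp add: fun_eq_iff killing_simps)
 next
  case (step c x y)
  then obtain b d where "x = killing b" "y = killing d" by blast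
  thus ?case by (intro exI[of _ "c *\<^sub>C b + d"]) (simp add: fun_eq_iff killing_simps scaleC_fun_apply scaleC_complex)
 qed
 thus thesis using that by blast
qed

text \<open>The classical argument for semisimple algebras, run modulo the center. The element
  \<open>d\<close> represents the functional tr (D ad x) of \<open>x\<close>; then
  \<open>E = D - ad d\<close> satisfies tr (E ad x) = 0 for all \<open>x\<close>, and this forces
  \<open>killing (E x) y = 0\<close>.\<close>

lemma derivation_inner:
 assumes D: "clinear (D :: 'g => 'g)" "!!x y. D (brk x y) - brk (D x) y - brk x (D y) \<in> krad"
  "!!x. x \<in> krad ==> D x \<in> krad"
 obtains d where "!!x. D x - brk d x \<in> krad"
proof -
 have trin: "!!b. b \<in> kbasis ==> T b \<in> cspan kbasis" for T :: "'g => 'g" by (simp add: kb)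
 have l: "clinear (%x. tr kbasis (%v. D (brk x v)))" by (intro clinearI)
   (simp_all add: brk_simps clin[OF D(1)] tr_add[OF kb(1)] tr_scale[OF kb(1)] trin kb scaleC_complex)
 have z: "tr kbasis (%v. D (brk x v)) = 0" if "x \<in> krad" for x using that by (simp add: krad_brk0 clin[OF D(1)] tr_zero)
 obtain d where d: "!!x. killing d x = tr kbasis (%v. D (brk x v))" using riesz[OF l z] by metis
 define E where "E x = D x - brk d x" for x
 have E: "clinear E" unfolding E_def by (rule clinear_minus[OF D(1) clinear_brk])
 have Eder: "E (brk x y) - brk (E x) y - brk x (E y) \<in> krad" for x y
  using D(2)[of x y] by (simp add: E_def brk_simps brk_deriv[of d x y] algebra_simps)
 have Etr: "tr kbasis (%v. E (brk x v)) = 0" for x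
 proof -
  have "tr kbasis (%v. E (brk x v)) = tr kbasis (%v. D (brk x v)) - tr kbasis (%v. brk d (brk x v))"
   unfolding E_def by (rule tr_diff[OF kb(1) trin trin])
  thus ?thesis using d[of x] by (simp add: Defs.killing_def ctrace_eq_tr kbasis_def)
 qed
 have "killing (E x) y = 0" for x y
 proof -
  \<comment> \<open>\<open>N v\<close> is the failure of the Leibniz rule for \<open>E\<close> at
    \<open>x\<close> and \<open>[y, v]\<close>. It is central, so \<open>N\<close> squares to 0 and
    drops out of the trace.\<close>
  define N where "N v = E (brk x (brk y v)) - brk (E x) (brk y v) - brk x (E (brk y v))" for v
  have N: "clinear N" unfolding N_def by (intro clinear_minus clinear_compose[OF E clinear_compose[OF clinear_brk clinear_brk]]
    clinear_compose[OF clinear_brk clinear_brk] clinear_compose[OF clinear_brk clinear_compose[OF E clinear_brk]])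
  have "N (N v) = 0" for v
  proof -
   have "N v \<in> krad" unfolding N_def by (rule Eder)
   hence "brk y (N v) = 0" by (rule krad_brk0)
   thus ?thesis by (subst N_def) (simp add: brk_simps clin[OF E])
  qed
  hence "(N ^^ 2) v = 0" for v by (simp add: numeral_2_eq_2)
  hence "tr kbasis N = 0" by (intro tr_nilpotent[OF kb(1,3) N]) (auto simp: kb)
  have "killing (E x) y = tr kbasis (%v. (E (brk x (brk y v)) - brk x (E (brk y v))) - N v)"
   unfolding Defs.killing_def ctrace_eq_tr kbasis_def[symmetric] by (intro tr_cong) (simp add: N_def)
  also have "\<dots> = tr kbasis (%v. E (brk x (brk y v)) - brk x (E (brk y v))) - tr kbasis N" by (rule tr_diff[OF kb(1) trin trin])
  also have "\<dots> = tr kbasis (%v. E (brk x (brk y v))) - tr kbasis (%v. brk x (E (brk y v)))"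
   using \<open>tr kbasis N = 0\<close> tr_diff[OF kb(1) trin trin] by simp
  also have "tr kbasis (%v. brk x (E (brk y v))) = tr kbasis (%v. E (brk y (brk x v)))"
   by (rule tr_commute[OF kb(1,3) clinear_brk clinear_compose[OF E clinear_brk]]) (simp_all add: kb)
  also have "tr kbasis (%v. E (brk x (brk y v))) - tr kbasis (%v. E (brk y (brk x v))) =
   tr kbasis (%v. E (brk (brk x y) v))" unfolding brk_brk clinear_diff[OF E] by (rule tr_diff[OF kb(1) trin trin, symmetric])
  finally show ?thesis by (simp add: Etr)
 qed
 thus thesis using that[of d] by (simp add: E_def krad_iff')
qed

text \<open>Killing duality turns a functional \<theta> with \<open>\<theta> c = 1\<close> into a
  map \<open>D\<close> with \<open>killing (D x) y = \<theta> (brk x y)\<close>, a derivation modulo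
  the center. As \<open>D\<close> is inner modulo the center, \<theta> agrees with some
  \<open>killing d\<close> on all commutators, yet \<open>killing d c = 0\<close>.\<close>

lemma krad_inter_derived:
 assumes "c \<in> krad" "c \<in> brk_span UNIV UNIV" shows "(c::'g) = 0"
proof (rule ccontr)
 assume "c ~= 0"
 then obtain \<theta> :: "'g => complex" where th: "clinear \<theta>" "\<theta> c = 1"
  using clinear_zero_outside[of "{0}" c] complex_vector.subspace_single_0 by (metis singletonD)
 have "\<exists>d. \<forall>y. killing d y = \<theta> (brk x y)" for x by (rule riesz[OF clinear_compose[OF th(1) clinear_brk[of x]]])
   (auto simp: krad_brk0 clinC[OF th(1)])
 then obtain D0 where D0: "!!x y. killing (D0 x) y = \<theta> (brk x y)" by metis
 obtain D where D: "clinear D" "!!b. b \<in> kbasis ==> D b = D0 b"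
  using complex_vector_pair.linear_independent_extend[OF kb(1), where f = D0] by metis
 have kD: "killing (D x) y = \<theta> (brk x y)" for x y by (rule clinear_eq_on_span[OF clinear_compose[OF killing_lin(1) D(1)]
    clinear_compose[OF th(1) clinear_brk_left], of kbasis]) (auto simp: D D0 kb)
 obtain d where d: "!!x. D x - brk d x \<in> krad"
 proof (rule derivation_inner[OF D(1)])
  show "D (brk x y) - brk (D x) y - brk x (D y) \<in> krad" for x y
  proof -
   have "killing (D (brk x y) - brk (D x) y - brk x (D y)) z = 0" for z
   proof -
    have "killing (brk x (D y)) z = - \<theta> (brk y (brk x z))" using brk_anti[of x "D y"] by (simp add: killing_simps kinv kD)
    thus ?thesis by (simp add: killing_simps kinv kD brk_brk[of x y z] clinC[OF th(1)])
   qed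
   thus ?thesis by (simp add: krad_iff')
  qed
  show "D x \<in> krad" if "x \<in> krad" for x using that by (simp add: krad_iff' kD krad_brk0 clinC[OF th(1)])
 qed blast
 have "\<theta> (brk x y) = killing d (brk x y)" for x y
 proof -
  have "killing (D x - brk d x) y = 0" using d krad_killing0 by blast
  thus ?thesis by (simp add: killing_simps kinv kD)
 qed
 hence "\<theta> c = killing d c" by (intro clinear_eq_on_span[OF th(1) killing_lin(2) _ assms(2)[unfolded brk_span_def]]) auto
 thus False using th krad_killing0 assms by simp
qed

end

section \<open>Cartan subalgebras are abelian and act diagonalizably\<close>

locale cartan_lie = reductive_lie ty for ty :: "'g::lie_algebra itself" +
 fixes H :: "'g set"
 assumes cartan: "cartan_subalgebra H"
begin

lemma H_alg: "lie_subalgebra H" and H_nilp: "nilpotent H" using cartan unfolding cartan_subalgebra_def by blast+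

lemma H_sub: "csubspace H" and H_brk: "x \<in> H ==> y \<in> H ==> brk x y \<in> H" using H_alg unfolding lie_subalgebra_def by blast+

lemma H_norm: "(!!y. y \<in> H ==> brk x y \<in> H) ==> x \<in> H" using cartan unfolding cartan_subalgebra_def by blast

lemma krad_H: "krad <= H"
proof
 fix x :: 'g assume "x \<in> krad"
 thus "x \<in> H" by - (rule H_norm, simp add: krad_brk0 subspace_0[OF H_sub])
qed

lemma H_geig: assumes "x \<in> H" "y \<in> H" shows "y \<in> geig (brk x) 0"
proof -
 have "(brk x ^^ n) y \<in> lower_central_series H n" for n using assms by (induction n) (auto intro: brk_span_base)
 thus ?thesis using H_nilp unfolding nilpotent_def geig_zero_iff by blast
qed

lemma geig_H_stable: "x \<in> H ==> u \<in> H ==> v \<in> geig (brk x) a ==> brk u v \<in> geig (brk x) a"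
 using geig_brk[OF H_geig, of x u v a] by simp

text \<open>If the common generalized 0-space of \<open>H\<close> were larger than \<open>H\<close>,
  Engel's theorem would give a vector outside \<open>H\<close> that normalizes
  \<open>H\<close>.\<close>

lemma geig_all_H:
 assumes "!!x. x \<in> H ==> y \<in> geig (brk x) 0" shows "y \<in> H"
proof (rule ccontr)
 assume y: "y \<notin> H"
 define G where "G = {y. \<forall>x\<in>H. y \<in> geig (brk x) 0}"
 have "\<exists>w. w \<in> G \<and> w \<notin> H \<and> (\<forall>x\<in>H. brk x w \<in> H)"
 proof (rule engel[OF _ H_alg H_geig])
  show "csubspace G" unfolding G_def by (intro csubspaceI) (auto simp: subspace_0 subspace_add
    subspace_scale geig_subspace[OF clinear_brk])
  show "H \<subset> G" using y assms H_geig unfolding G_def by blast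
  show "\<exists>k. (brk x ^^ k) w \<in> H" if "x \<in> H" "w \<in> G" for x w
  proof -
   have "w \<in> geig (brk x) 0" using that by (auto simp: G_def)
   then obtain k where "(brk x ^^ k) w = 0" by (auto simp: geig_zero_iff)
   thus ?thesis using subspace_0[OF H_sub] by metis
  qed
 qed (use fin_dim_subset[OF fd] H_sub H_brk geig_H_stable in \<open>auto simp: G_def\<close>)
 then obtain w where w: "w \<notin> H" "!!x. x \<in> H ==> brk x w \<in> H" by blast
 hence "brk w x \<in> H" if "x \<in> H" for x using brk_anti[of w x] subspace_neg[OF H_sub] that by metis
 thus False using H_norm w by blast
qed

text \<open>Split \<open>W\<close> by an element of \<open>H\<close> that is not nilpotent on it and
  recurse on its generalized 0-space; what remains at the end lies in \<open>H\<close>.\<close>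

lemma fitting:
 assumes "csubspace W" "!!x w. x \<in> H ==> w \<in> W ==> brk x w \<in> W"
 shows "W <= cspan (H \<union> {v. \<exists>x\<in>H. \<exists>a. a ~= 0 \<and> v \<in> geig (brk x) a})" (is "_ <= ?S") using assms
proof (induction "cdim W" arbitrary: W rule: less_induct)
 case less
 show ?case
 proof (cases "\<forall>x\<in>H. W <= geig (brk x) 0")
  case True
  hence "W <= H" using geig_all_H by blast
  thus ?thesis using span_superset[of "H \<union> _"] by blast
 next
  case False
  then obtain x where x: "x \<in> H" "\<not> W <= geig (brk x) 0" by blast
  define W0 where "W0 = geig (brk x) 0 \<inter> W"
  have W0: "csubspace W0" unfolding W0_def by (intro complex_vector.subspace_inter geig_subspace clinear_brk less.prems)
  have "cdim W0 < cdim W" by (rule fin_dim_psubset_dim) (use fin_dim_subset[OF fd] less.prems W0 x in \<open>auto simp: W0_def\<close>)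
  moreover have "brk u w \<in> W0" if "u \<in> H" "w \<in> W0" for u w using that x geig_H_stable less.prems(2) by (auto simp: W0_def)
  ultimately have W0S: "geig (brk x) 0 \<inter> W <= ?S" using less.hyps W0 unfolding W0_def by blast
  have WbS: "geig (brk x) b \<inter> W <= ?S" if "b ~= 0" for b
  proof
   fix v assume "v \<in> geig (brk x) b \<inter> W"
   thus "v \<in> ?S" using that x by (intro span_base) blast
  qed
  have "(\<Union>b. geig (brk x) b \<inter> W) <= ?S"
  proof (rule UN_least)
   show "geig (brk x) b \<inter> W <= ?S" for b using W0S WbS by (cases "b = 0") simp_all
  qed
  hence "cspan (\<Union>b. geig (brk x) b \<inter> W) <= ?S" by (rule span_minimal[OF _ subspace_span])
  moreover have "w \<in> cspan (\<Union>b. geig (brk x) b \<inter> W)" if "w \<in> W" for w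
   by (rule geig_span[OF clinear_brk fin_dim_subset[OF fd] less.prems(1)]) (use that less.prems x in auto)
  ultimately show ?thesis by blast
 qed
qed

text \<open>\<open>H\<close> is orthogonal to the generalized eigenspaces of its elements for
  nonzero eigenvalues, and together with these it spans the algebra.\<close>

lemma killing_H_nondeg:
 assumes "c \<in> H" "!!y. y \<in> H ==> killing c y = 0" shows "c \<in> krad"
proof -
 have "killing c y = 0" for y
 proof (rule clinear_eq_on_span[OF killing_lin(2) clinear_const_0])
  show "y \<in> cspan (H \<union> {v. \<exists>x\<in>H. \<exists>a. a ~= 0 \<and> v \<in> geig (brk x) a})"
   using fitting[of UNIV] by (auto simp: complex_vector.subspace_UNIV)
  fix v assume "v \<in> H \<union> {v. \<exists>x\<in>H. \<exists>a. a ~= 0 \<and> v \<in> geig (brk x) a}"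
  thus "killing c v = 0"
  proof
   assume "v \<in> {v. \<exists>x\<in>H. \<exists>a. a ~= 0 \<and> v \<in> geig (brk x) a}"
   then obtain x a where "x \<in> H" "a ~= 0" "v \<in> geig (brk x) a" by blast
   thus ?thesis using killing_geig[OF fd H_geig[of x c], of v a] assms(1) by simp
  qed (use assms in blast)
 qed
 thus ?thesis by (simp add: krad_iff')
qed

text \<open>\<open>ad n\<close> commutes with \<open>ad y\<close>, so their product is nilpotent and
  has trace 0.\<close>

lemma killing_comm_nilpotent:
 assumes "!!v. \<exists>k. (brk n ^^ k) v = 0" "brk n y \<in> krad" shows "killing n (y::'g) = 0" unfolding killing_tr[OF fd]
proof (rule tr_nilpotent[OF kb(1,3) clinear_compose[OF clinear_brk clinear_brk]])
 fix b
 obtain k where k: "(brk n ^^ k) b = 0" using assms(1)[of b] by auto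
 have "brk n (brk y v) = brk y (brk n v)" for v using krad_brk0(1)[OF assms(2)] by (simp add: brk_deriv[of n y v])
 from commuting_funpow[of "brk n" "brk y", OF this, of k b] k
 show "\<exists>k. ((%x. brk n (brk y x)) ^^ k) b = 0" by (auto simp: clin[OF clinear_funpow[OF clinear_brk]])
qed (simp add: kb)

text \<open>Each generalized eigenspace of \<open>ad c\<close> is stable under \<open>H\<close>. As
  a sum of commutators \<open>c\<close> has trace 0 on it, but this trace is the eigenvalue times
  the dimension.\<close>

lemma derived_nilpotent:
 assumes c: "c \<in> brk_span H H" shows "\<exists>k. (brk c ^^ k) v = 0"
proof -
 have cH: "c \<in> H" using c brk_span_subset[OF H_sub H_brk] by blast
 have "geig (brk c) a <= geig (brk c) 0" for a
 proof -
  obtain B where B: "finite B" "complex_vector.independent B" "B <= geig (brk c) a" "cspan B = geig (brk c) a"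
   using fin_dim_basis[OF fin_dim_subset[OF fd] geig_subspace[OF clinear_brk]] by blast
  have st: "brk u b \<in> cspan B" if "u \<in> H" "b \<in> cspan B" for u b using geig_H_stable[OF cH that(1)] that(2) B(4) by blast
  note st' = st[OF _ span_base]
  have d: "brk c b - a *\<^sub>C b \<in> cspan B" if "b \<in> B" for b by (intro complex_vector.span_diff span_scale span_base st'[OF cH] that)
  have "tr B (brk c) = 0 \<and> c \<in> H" using c unfolding brk_span_def
  proof (induction rule: span_induct_alt)
   case base
   show ?case using tr_zero subspace_0[OF H_sub] by (simp add: brk_simps)
  next
   case (step r x z)
   then obtain u v where uv: "u \<in> H" "v \<in> H" "x = brk u v" by blast
   have xH: "x \<in> H" using uv H_brk by blast
   have "tr B (brk x) = tr B (%w. brk u (brk v w)) - tr B (%w. brk v (brk u w))"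
    unfolding uv brk_brk by (rule tr_diff[OF B(2)]) (use st st' uv in blast)+
   hence "tr B (brk x) = 0" using tr_commute[OF B(2,1) clinear_brk clinear_brk, of u v] st' uv by simp
   moreover have "tr B (%w. r *\<^sub>C brk x w + brk z w) = tr B (%w. r *\<^sub>C brk x w) + tr B (brk z)"
    by (rule tr_add[OF B(2)]) (use step st' xH span_scale in blast)+
   moreover have "tr B (%w. r *\<^sub>C brk x w) = r * tr B (brk x)" by (rule tr_scale[OF B(2)]) (use st' xH in blast)
   moreover have "tr B (brk (r *\<^sub>C x + z)) = tr B (%w. r *\<^sub>C brk x w + brk z w)" by (intro tr_cong) (simp add: brk_simps)
   ultimately show ?case using step subspace_add[OF H_sub] subspace_scale[OF H_sub xH] by simp
  qed
  hence "0 = tr B (%w. a *\<^sub>C w + (brk c w - a *\<^sub>C w))" by simp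
  also have "\<dots> = tr B (%w. a *\<^sub>C w) + tr B (%w. brk c w - a *\<^sub>C w)" by (rule tr_add[OF B(2)]) (use d span_scale span_base in blast)+
  also have "tr B (%w. a *\<^sub>C w) = (\<Sum>b\<in>B. a)" by (rule tr_diag[OF B(2)]) simp
  also have "tr B (%w. brk c w - a *\<^sub>C w) = 0" by (rule tr_nilpotent[OF B(2,1) clinear_minus[OF clinear_brk clinear_scale_fun[OF clinear_id]]])
    (use B(3) d in \<open>auto simp: geig_def\<close>)
  finally have "of_nat (card B) * a = 0" by simp
  hence "a = 0 \<or> B = {}" using B(1) by auto
  thus ?thesis
  proof
   assume "B = {}"
   thus ?thesis unfolding B(4)[symmetric] using geig_zero[OF clinear_brk] by simp
  qed simp
 qed
 hence "v \<in> geig (brk c) 0"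
  using span_in_subspace[OF geig_subspace[OF clinear_brk], of "\<Union>a. geig (brk c) a"] geig_span_UNIV[OF fd clinear_brk] by blast
 thus ?thesis by (simp add: geig_zero_iff)
qed

text \<open>Otherwise consider the last term of the lower central series that is not central. Its
  elements are ad-nilpotent and commute with \<open>H\<close> modulo the center, so they are
  orthogonal to \<open>H\<close> and hence central, a contradiction. So commutators of
  \<open>H\<close> are central, and a central commutator is 0.\<close>

lemma H_abelian: assumes "x \<in> H" "y \<in> H" shows "brk x y = 0"
proof -
 have "lower_central_series H 1 <= krad"
 proof (rule ccontr)
  assume n1: "\<not> lower_central_series H 1 <= krad"
  obtain N where "lower_central_series H N = {0}" using H_nilp by (auto simp: nilpotent_def)
  hence ex: "\<exists>n. lower_central_series H n <= krad" using subspace_0[OF krad_subspace[OF fd]] by (intro exI[of _ N]) auto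
  define n where "n = (LEAST n. lower_central_series H n <= krad)"
  have n: "lower_central_series H n <= krad" unfolding n_def by (rule LeastI_ex[OF ex])
  have dec: "lower_central_series H (Suc m) <= lower_central_series H m" for m
  proof (induction m)
   case 0
   show ?case using brk_span_subset[OF H_sub H_brk] by simp
  next
   case (Suc m)
   thus ?case using brk_span_mono[of H H] by simp
  qed
  have "n ~= 0" using n n1 dec[of 0] by (intro notI) auto
  moreover have "n ~= 1" using n n1 by (intro notI) simp
  ultimately obtain k where k: "n = Suc (Suc k)" by (metis One_nat_def not0_implies_Suc)
  have "\<not> lower_central_series H (Suc k) <= krad" using not_less_Least[of "Suc k" "%n. lower_central_series H n <= krad"] k by (simp add: n_def)
  then obtain c where c: "c \<in> lower_central_series H (Suc k)" "c \<notin> krad" by blast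
  have "lower_central_series H (Suc k) <= brk_span H H"
  proof (induction k)
   case (Suc k)
   thus ?case using dec[of "Suc k"] by (metis order_trans)
  qed simp
  hence cD: "c \<in> brk_span H H" using c by blast
  hence cH: "c \<in> H" using brk_span_subset[OF H_sub H_brk] by blast
  have "killing c y = 0" if "y \<in> H" for y
  proof -
   have "brk y c \<in> lower_central_series H n" unfolding k using c that by (simp add: brk_span_base)
   hence "brk c y \<in> krad" using n brk_anti[of c y] subspace_neg[OF krad_subspace[OF fd]] by auto
   thus ?thesis by (rule killing_comm_nilpotent[OF derived_nilpotent[OF cD]])
  qed
  thus False using killing_H_nondeg[OF cH] c by blast
 qed
 hence "brk x y \<in> krad" using assms by (auto intro: brk_span_base)
 moreover have "brk x y \<in> brk_span UNIV UNIV" by (intro brk_span_base) auto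
 ultimately show ?thesis by (rule krad_inter_derived)
qed

text \<open>The semisimple part of \<open>ad x\<close> is a derivation, hence \<open>ad s\<close>
  modulo the center for some \<open>s\<close> in \<open>H\<close>. Then \<open>x - s\<close> is
  ad-nilpotent and commutes with \<open>H\<close>, so it is orthogonal to \<open>H\<close> and
  central.\<close>

lemma H_diag: assumes x: "x \<in> H" and v: "v \<in> geig (brk x) a" shows "brk x v = a *\<^sub>C v"
proof -
 obtain S where S: "clinear S" "!!a v. v \<in> geig (brk x) a ==> S v = a *\<^sub>C v"
  using spectral_map[OF fd clinear_brk[of x], where f = "%a. a"] by blast
 have kr0: "z \<in> geig (brk x) 0" if "z \<in> krad" for z using that by (intro geig_eigen[OF clinear_brk]) (simp add: krad_brk0)
 have der: "S (brk u v) = brk (S u) v + brk u (S v)" for u v by (rule spectral_derivation[OF fd S]) simp_all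
 obtain s where s: "!!v. S v - brk s v \<in> krad"
 proof (rule derivation_inner[OF S(1)])
  show "S (brk x y) - brk (S x) y - brk x (S y) \<in> krad" for x y using subspace_0[OF krad_subspace[OF fd]] by (simp add: der)
  show "S z \<in> krad" if "z \<in> krad" for z using S(2)[OF kr0[OF that]] subspace_0[OF krad_subspace[OF fd]] by simp
 qed blast
 have sH: "s \<in> H"
 proof (rule H_norm)
  fix y assume "y \<in> H"
  hence "S y = 0" using S(2)[OF H_geig[OF x]] by simp
  hence "- brk s y \<in> krad" using s[of y] by simp
  thus "brk s y \<in> H" using subspace_neg[OF krad_subspace[OF fd]] krad_H by fastforce
 qed
 define n where "n = x - s"
 have nH: "n \<in> H" unfolding n_def using x sH subspace_diff[OF H_sub] by blast
 have nil0: "\<exists>k. (brk n ^^ k) v = 0" if "v \<in> geig (brk x) a" for v a using that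
 proof (induction rule: geig_induct)
  case zero show ?case by (intro exI[of _ 0]) simp
 next
  case (step v)
  obtain k where k: "(brk n ^^ k) (brk x v - a *\<^sub>C v) = 0" using step.IH by auto
  define z where "z = S v - brk s v"
  have z: "brk n z = 0" using s krad_brk0 by (simp add: z_def)
  have 1: "brk n v = (brk x v - a *\<^sub>C v) + z" using S(2)[OF geig_step[OF step.hyps]] by (simp add: n_def z_def brk_simps)
  have "(brk n ^^ Suc k) z = (brk n ^^ k) 0" using z by (simp only: funpow_Suc_right o_apply)
  hence "(brk n ^^ Suc k) z = 0" by (simp only: clin[OF clinear_funpow[OF clinear_brk]])
  moreover have "(brk n ^^ Suc k) (brk x v - a *\<^sub>C v) = 0" using k by (simp add: brk_simps)
  ultimately have "(brk n ^^ Suc k) (brk n v) = 0" unfolding 1 clinear_add[OF clinear_funpow[OF clinear_brk]] by simp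
  hence "(brk n ^^ Suc (Suc k)) v = 0" by (simp only: funpow_Suc_right[of "Suc k"] o_apply)
  thus ?case by (rule exI)
 qed
 have nil: "\<exists>k. (brk n ^^ k) v = 0" for v
 proof -
  have "v \<in> geig (brk n) 0" by (rule span_in_subspace[OF geig_subspace[OF clinear_brk], of "\<Union>b. geig (brk x) b"])
    (use nil0 geig_span_UNIV[OF fd clinear_brk] in \<open>auto simp: geig_zero_iff\<close>)
  thus ?thesis by (simp add: geig_zero_iff)
 qed
 have "n \<in> krad"
 proof (rule killing_H_nondeg[OF nH])
  fix y assume "y \<in> H"
  thus "killing n y = 0" using H_abelian[OF nH] subspace_0[OF krad_subspace[OF fd]] by (intro killing_comm_nilpotent nil) simp
 qed
 hence "brk n v = 0" by (rule krad_brk0)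
 hence xs: "brk x v = brk s v" by (simp add: n_def brk_simps)
 have d: "brk x v - a *\<^sub>C v \<in> krad" using s[of v] S(2)[OF v] xs subspace_neg[OF krad_subspace[OF fd], of "S v - brk s v"] by simp
 \<comment> \<open>The central error remains to be removed: for \<open>a = 0\<close> it is a
   commutator, for \<open>a ~= 0\<close> it lies in two different generalized eigenspaces.\<close>
 show ?thesis
 proof (cases "a = 0")
  case True
  hence "brk x v \<in> krad" using d by simp
  moreover have "brk x v \<in> brk_span UNIV UNIV" by (intro brk_span_base) auto
  ultimately have "brk x v = 0" by (rule krad_inter_derived)
  thus ?thesis using True by simp
 next
  case False
  have "brk x v - a *\<^sub>C v \<in> geig (brk x) a" by (rule geig_down[OF clinear_brk v])
  hence "brk x v - a *\<^sub>C v = 0" using geig_disjoint[OF clinear_brk _ kr0[OF d]] False by blast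
  thus ?thesis by simp
 qed
qed

lemma dualI:
 assumes "!!x y. x \<in> H ==> y \<in> H ==> f (x + y) = f x + f y"
  "!!c x. x \<in> H ==> f (c *\<^sub>C x) = c * f x" "!!x. x \<notin> H ==> f x = 0" shows "f \<in> dual H"
 unfolding dual_def mem_Collect_eq by (intro conjI ballI allI impI assms)

lemma H_dual_linear: "\<beta> \<in> dual H ==> x \<in> H ==> y \<in> H ==> \<beta> (x + y) = \<beta> x + \<beta> y"
 "\<beta> \<in> dual H ==> x \<in> H ==> \<beta> (c *\<^sub>C x) = c * \<beta> x"
 "\<beta> \<in> dual H ==> x \<notin> H ==> \<beta> x = 0"
proof -
 assume "\<beta> \<in> dual H"
 hence *: "\<forall>x\<in>H. \<forall>y\<in>H. \<beta> (x + y) = \<beta> x + \<beta> y" "\<forall>c. \<forall>x\<in>H. \<beta> (c *\<^sub>C x) = c * \<beta> x"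
  "\<forall>x. x \<notin> H --> \<beta> x = 0" unfolding dual_def mem_Collect_eq by - (elim conjE, assumption)+
 show "x \<in> H ==> y \<in> H ==> \<beta> (x + y) = \<beta> x + \<beta> y" "x \<in> H ==> \<beta> (c *\<^sub>C x) = c * \<beta> x"
  "x \<notin> H ==> \<beta> x = 0" using *(1)[rule_format, of x y] *(2)[rule_format, of x c] *(3)[rule_format, of x] by simp_all
qed

lemma dual_eqI: "\<beta> \<in> dual H ==> \<gamma> \<in> dual H ==> (!!x. x \<in> H ==> \<beta> x = \<gamma> x) ==> \<beta> = \<gamma>"
 unfolding fun_eq_iff using H_dual_linear(3) by metis

lemma dual_closed:
 "0 \<in> dual H" "\<beta> \<in> dual H ==> \<gamma> \<in> dual H ==> \<beta> + \<gamma> \<in> dual H"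
 "\<beta> \<in> dual H ==> \<gamma> \<in> dual H ==> \<beta> - \<gamma> \<in> dual H" "\<beta> \<in> dual H ==> - \<beta> \<in> dual H"
 "\<beta> \<in> dual H ==> (%x. c * \<beta> x) \<in> dual H"
 by (rule dualI; simp add: H_dual_linear(1,2) H_dual_linear(3)[of \<beta>] H_dual_linear(3)[of \<gamma>] algebra_simps)+

lemma root_space_subspace: "csubspace (root_space H \<beta>)"
 by (intro csubspaceI) (auto simp: root_space_def brk_simps scaleC_add_right scaleC_scaleC mult.commute)

lemma root_space_brk: "x \<in> root_space H \<beta> ==> y \<in> root_space H \<gamma> ==> brk x y \<in> root_space H (\<beta> + \<gamma>)"
 by (auto simp: root_space_def brk_deriv[of _ x y] brk_simps scaleC_add_left)

lemma root_space_0: "root_space H 0 = H"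
proof
 show "H <= root_space H 0" using H_abelian by (auto simp: root_space_def)
 show "root_space H 0 <= H"
 proof
  fix x assume "x \<in> root_space H 0"
  hence "brk x y = 0" if "y \<in> H" for y using that brk_anti[of x y] by (auto simp: root_space_def)
  thus "x \<in> H" using subspace_0[OF H_sub] by - (rule H_norm, simp)
 qed
qed

text \<open>Either every element of \<open>H\<close> acts on \<open>W\<close> by a scalar, and these
  scalars form a weight, or some element splits \<open>W\<close> into smaller stable pieces.\<close>

lemma weight_decomposition:
 assumes "csubspace W" "!!x w. x \<in> H ==> w \<in> W ==> brk x w \<in> W"
 shows "W <= cspan (\<Union>\<beta>\<in>dual H. root_space H \<beta> \<inter> W)" using assms
proof (induction "cdim W" arbitrary: W rule: less_induct)
 case less
 show ?case
 proof (cases "\<forall>x\<in>H. \<exists>a. W <= geig (brk x) a")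
  case True
  then obtain a where a: "!!x w. x \<in> H ==> w \<in> W ==> brk x w = a x *\<^sub>C w" using H_diag by (metis subset_iff)
  show ?thesis
  proof (cases "W = {0}")
   case True
   thus ?thesis using span_zero by blast
  next
   case False
   then obtain w where w: "w \<in> W" "w ~= 0" using subspace_0[OF less.prems(1)] by blast
   define \<beta> where "\<beta> x = (if x \<in> H then a x else 0)" for x
   have "\<beta> \<in> dual H"
   proof (rule dualI)
    fix x y assume xy: "x \<in> H" "y \<in> H"
    have "(a (x + y) - (a x + a y)) *\<^sub>C w = 0" using a[OF subspace_add[OF H_sub xy] w(1)] a[OF xy(1) w(1)] a[OF xy(2) w(1)]
     by (simp add: brk_simps scale_left_diff_distrib scaleC_add_left)
    thus "\<beta> (x + y) = \<beta> x + \<beta> y" using w(2) xy subspace_add[OF H_sub xy] by (simp add: \<beta>_def)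
   next
    fix c x assume xy: "x \<in> H"
    have "a (c *\<^sub>C x) *\<^sub>C w = c *\<^sub>C a x *\<^sub>C w" using a[OF subspace_scale[OF H_sub xy] w(1), of c] a[OF xy w(1)]
     by (simp only: brk_simps)
    hence "(a (c *\<^sub>C x) - c * a x) *\<^sub>C w = 0" by (simp only: scale_left_diff_distrib scaleC_scaleC diff_self)
    thus "\<beta> (c *\<^sub>C x) = c * \<beta> x" using w(2) xy subspace_scale[OF H_sub xy, of c] by (simp add: \<beta>_def)
   qed (simp add: \<beta>_def)
   moreover have "W <= root_space H \<beta>" using a by (auto simp: root_space_def \<beta>_def)
   ultimately show ?thesis by (intro subsetI span_base) blast
  qed
 next
  case False
  then obtain x where x: "x \<in> H" "!!a. \<not> W <= geig (brk x) a" by blast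
  have "geig (brk x) a \<inter> W <= cspan (\<Union>\<beta>\<in>dual H. root_space H \<beta> \<inter> W)" for a
  proof -
   have sub: "csubspace (geig (brk x) a \<inter> W)" by (intro complex_vector.subspace_inter geig_subspace clinear_brk less.prems)
   have "cdim (geig (brk x) a \<inter> W) < cdim W" by (rule fin_dim_psubset_dim) (use fin_dim_subset[OF fd] less.prems sub x(2)[of a] in blast)+
   hence "geig (brk x) a \<inter> W <= cspan (\<Union>\<beta>\<in>dual H. root_space H \<beta> \<inter> (geig (brk x) a \<inter> W))"
    by (rule less.hyps[OF _ sub]) (use geig_H_stable x less.prems in blast)
   also have "\<dots> <= cspan (\<Union>\<beta>\<in>dual H. root_space H \<beta> \<inter> W)" by (rule span_mono) blast
   finally show ?thesis .
  qed
  hence "(\<Union>a. geig (brk x) a \<inter> W) <= cspan (\<Union>\<beta>\<in>dual H. root_space H \<beta> \<inter> W)" by (rule UN_least)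
  hence "cspan (\<Union>a. geig (brk x) a \<inter> W) <= cspan (\<Union>\<beta>\<in>dual H. root_space H \<beta> \<inter> W)"
   by (rule span_minimal[OF _ subspace_span])
  moreover have "w \<in> cspan (\<Union>b. geig (brk x) b \<inter> W)" if "w \<in> W" for w
   by (rule geig_span[OF clinear_brk fin_dim_subset[OF fd] less.prems(1)]) (use that less.prems x in auto)
  ultimately show ?thesis by blast
 qed
qed

lemma dual_distinct: "\<beta> \<in> dual H ==> \<gamma> \<in> dual H ==> \<beta> ~= \<gamma> ==> \<exists>h\<in>H. \<beta> h ~= \<gamma> h"
 using dual_eqI by blast

lemma finite_roots: "finite (roots H)"
proof (rule finite_weights[OF fd, of H brk])
 fix \<beta> assume "\<beta> \<in> roots H"
 hence "root_space H \<beta> ~= {0}" by (simp add: roots_def)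
 then obtain v where "v \<in> root_space H \<beta>" "v ~= 0" using subspace_0[OF root_space_subspace] by blast
 thus "\<exists>v\<in>UNIV. v ~= 0 \<and> (\<forall>h\<in>H. brk h v = \<beta> h *\<^sub>C v)" by (auto simp: root_space_def)
qed (use dual_distinct in \<open>auto simp: clinear_brk roots_def\<close>)

lemma root_space_decomposition:
 assumes "csubspace W" "!!x w. x \<in> H ==> w \<in> W ==> brk x w \<in> W"
 shows "W = cspan ((H \<inter> W) \<union> (\<Union>\<beta>\<in>roots H. root_space H \<beta> \<inter> W))"
proof
 have "root_space H \<beta> \<inter> W <= cspan ((H \<inter> W) \<union> (\<Union>\<beta>\<in>roots H. root_space H \<beta> \<inter> W))" if "\<beta> \<in> dual H" for \<beta>
 proof (cases "\<beta> \<in> roots H")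
  case True
  thus ?thesis by (intro subsetI span_base) blast
 next
  case False
  hence "\<beta> = 0 \<or> root_space H \<beta> = {0}" using that by (auto simp: roots_def)
  thus ?thesis
  proof
   assume "\<beta> = 0"
   thus ?thesis using root_space_0 by (intro subsetI span_base) blast
  next
   assume "root_space H \<beta> = {0}"
   thus ?thesis by (auto simp: span_zero)
  qed
 qed
 hence "(\<Union>\<beta>\<in>dual H. root_space H \<beta> \<inter> W) <= cspan ((H \<inter> W) \<union> (\<Union>\<beta>\<in>roots H. root_space H \<beta> \<inter> W))"
  by (rule UN_least)
 hence "cspan (\<Union>\<beta>\<in>dual H. root_space H \<beta> \<inter> W) <= cspan ((H \<inter> W) \<union> (\<Union>\<beta>\<in>roots H. root_space H \<beta> \<inter> W))"
  by (rule span_minimal[OF _ subspace_span])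
 thus "W <= cspan ((H \<inter> W) \<union> (\<Union>\<beta>\<in>roots H. root_space H \<beta> \<inter> W))"
  using weight_decomposition[OF assms] by blast
 show "cspan ((H \<inter> W) \<union> (\<Union>\<beta>\<in>roots H. root_space H \<beta> \<inter> W)) <= W" by (rule span_minimal[OF _ assms(1)]) blast
qed

lemma root_space_decomposition_UNIV: "cspan (H \<union> (\<Union>\<beta>\<in>roots H. root_space H \<beta>)) = UNIV"
 using root_space_decomposition[of UNIV] by (simp add: complex_vector.subspace_UNIV)

end

lemma span_Union_subspaces:
 assumes sub: "!!\<beta>. \<beta> \<in> A ==> csubspace (W \<beta>)" and v: "v \<in> cspan (\<Union>\<beta>\<in>A. W \<beta>)"
 shows "\<exists>F f. finite F \<and> F <= A \<and> (\<forall>\<beta>\<in>F. f \<beta> \<in> W \<beta>) \<and> v = (\<Sum>\<beta>\<in>F. f \<beta>)"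
 using v
proof (induction rule: span_induct_alt)
 case base
 show ?case by (intro exI[of _ "{}"]) simp
next
 case (step c x y)
 then obtain \<beta> F f where b: "\<beta> \<in> A" "x \<in> W \<beta>"
  and F: "finite F" "F <= A" "\<forall>\<beta>\<in>F. f \<beta> \<in> W \<beta>" "y = (\<Sum>\<beta>\<in>F. f \<beta>)" by blast
 have cx: "c *\<^sub>C x \<in> W \<beta>" using b sub subspace_scale by blast
 define f' where "f' = f(\<beta> := (if \<beta> \<in> F then f \<beta> else 0) + c *\<^sub>C x)"
 have "(\<Sum>\<gamma>\<in>insert \<beta> F. f' \<gamma>) = c *\<^sub>C x + y"
 proof (cases "\<beta> \<in> F")
  case True
  hence "insert \<beta> F = F" by blast
  moreover have "(\<Sum>\<gamma>\<in>F. f' \<gamma>) = f' \<beta> + (\<Sum>\<gamma>\<in>F - {\<beta>}. f \<gamma>)"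
   using F True by (subst sum.remove[of F \<beta>]) (auto simp: f'_def)
  ultimately show ?thesis using F True sum.remove[of F \<beta> f] by (simp add: f'_def algebra_simps)
 next
  case False
  hence "(\<Sum>\<gamma>\<in>F. f' \<gamma>) = (\<Sum>\<gamma>\<in>F. f \<gamma>)" by (intro sum.cong) (auto simp: f'_def)
  thus ?thesis using F False by (simp add: f'_def)
 qed
 moreover have "\<forall>\<gamma>\<in>insert \<beta> F. f' \<gamma> \<in> W \<gamma>"
  using F b cx subspace_add[OF sub[OF b(1)]] subspace_0[OF sub[OF b(1)]] by (auto simp: f'_def)
 ultimately show ?case using F b by (intro exI[of _ "insert \<beta> F"] exI[of _ f']) auto
qed

definition wtsp :: "'g set => ('g => 'm => 'm) => ('g => complex) => 'm::complex_vector set" where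
 "wtsp H a \<beta> = {v. \<forall>h\<in>H. a h v = \<beta> h *\<^sub>C v}"

lemma root_space_wtsp: "root_space H \<beta> = wtsp H brk \<beta>" by (simp add: root_space_def wtsp_def)

lemma wtsp_subspace: "(!!h. h \<in> H ==> clinear (a h)) ==> csubspace (wtsp H a \<beta>)"
 by (intro csubspaceI) (auto simp: wtsp_def clin scaleC_add_right scaleC_scaleC mult.commute)

lemma wtsp_disjoint:
 assumes lin: "!!h. h \<in> H ==> clinear (a h)"
  and dist: "!!\<beta> \<delta>. \<beta> \<in> insert \<gamma> A ==> \<delta> \<in> insert \<gamma> A ==> \<beta> ~= \<delta> ==> \<exists>h\<in>H. \<beta> h ~= \<delta> h"
  and "\<gamma> \<notin> A" "v \<in> wtsp H a \<gamma>" "v \<in> cspan (\<Union>\<beta>\<in>A. wtsp H a \<beta>)" shows "v = 0"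
proof -
 obtain F f where F: "finite F" "F <= A" "!!\<beta>. \<beta> \<in> F ==> f \<beta> \<in> wtsp H a \<beta>" "v = (\<Sum>\<beta>\<in>F. f \<beta>)"
  using span_Union_subspaces[of A "wtsp H a", OF wtsp_subspace[OF lin] assms(5)] by blast
 hence g: "\<gamma> \<notin> F" using assms(3) by blast
 let ?f = "%\<beta>. if \<beta> = \<gamma> then - v else f \<beta>"
 have "(\<Sum>\<beta>\<in>F. ?f \<beta>) = v" unfolding F(4) using g by (intro sum.cong) auto
 hence s: "(\<Sum>\<beta>\<in>insert \<gamma> F. ?f \<beta>) = 0" using F(1) g by simp
 have "?f \<gamma> = 0" by (rule weight_independent[where a = a and H = H and f = ?f, OF _ lin _ dist s])
   (use F assms(4) in \<open>auto simp: wtsp_def clin[OF lin]\<close>)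
 thus ?thesis by simp
qed

subsection \<open>Roots and \<open>sl\<^sub>2\<close>-triples\<close>

definition lie_rep :: "('g::lie_algebra => 'n::complex_vector => 'n) => bool" where
 "lie_rep a \<longleftrightarrow> (\<forall>x. clinear (a x)) \<and> (\<forall>p. clinear (%x. a x p)) \<and>
   (\<forall>x y p. a (brk x y) p = a x (a y p) - a y (a x p))"

lemma rep_simps:
 assumes "lie_rep a" shows "a x (p + q) = a x p + a x q" "a x (p - q) = a x p - a x q" "a x (c *\<^sub>C p) = c *\<^sub>C a x p" "a x 0 = 0"
  "a (x + y) p = a x p + a y p" "a (x - y) p = a x p - a y p" "a (c *\<^sub>C x) p = c *\<^sub>C a x p" "a 0 p = 0"
  "a (- x) p = - a x p" "a x (- p) = - a x p" "a (brk x y) p = a x (a y p) - a y (a x p)"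
 using assms clin[of "a x"] clin[of "%x. a x p"] unfolding lie_rep_def by auto

context
 fixes a :: "'g::lie_algebra => 'n::complex_vector => 'n" and e f h :: 'g
 assumes a: "lie_rep a" and ef: "brk e f = h" "brk h f = - 2 *\<^sub>C f"
begin

lemma sl2_string:
 assumes w: "a e w = 0" "a h w = c *\<^sub>C w" shows "a h ((a f ^^ k) w) = (c - 2 * of_nat k) *\<^sub>C (a f ^^ k) w"
  "a e ((a f ^^ Suc k) w) = (of_nat (Suc k) * (c - of_nat k)) *\<^sub>C (a f ^^ k) w"
proof -
 show h: "a h ((a f ^^ k) w) = (c - 2 * of_nat k) *\<^sub>C (a f ^^ k) w" for k
 proof (induction k)
  case (Suc k)
  have "a h (a f ((a f ^^ k) w)) = a (brk h f) ((a f ^^ k) w) + a f (a h ((a f ^^ k) w))" by (simp add: rep_simps[OF a])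
  also have "\<dots> = (c - 2 * of_nat (Suc k)) *\<^sub>C a f ((a f ^^ k) w)"
   by (simp add: ef(2) Suc rep_simps[OF a] flip: scaleC_add_left) (simp add: algebra_simps)
  finally show ?case by simp
 qed (simp add: w)
 show "a e ((a f ^^ Suc k) w) = (of_nat (Suc k) * (c - of_nat k)) *\<^sub>C (a f ^^ k) w"
 proof (induction k)
  case 0
  have "a e (a f w) = a h w + a f (a e w)" by (simp add: rep_simps[OF a] flip: ef(1))
  thus ?case using w by (simp add: rep_simps[OF a])
 next
  case (Suc k)
  let ?v = "(a f ^^ Suc k) w"
  have "a e (a f ?v) = a h ?v + a f (a e ?v)" by (simp add: rep_simps[OF a] flip: ef(1))
  also have "\<dots> = (c - 2 * of_nat (Suc k)) *\<^sub>C ?v + (of_nat (Suc k) * (c - of_nat k)) *\<^sub>C ?v"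
   unfolding h Suc by (simp add: rep_simps[OF a])
  finally show ?case by (simp flip: scaleC_add_left) (simp add: algebra_simps)
 qed
qed

lemma sl2_string_nonzero:
 assumes w: "w ~= 0" "a e w = 0" "a h w = c *\<^sub>C w" and c: "!!j. j < k ==> c ~= of_nat j" shows "(a f ^^ k) w ~= 0" using c
proof (induction k)
 case (Suc k)
 have "a e ((a f ^^ Suc k) w) ~= 0" unfolding sl2_string(2)[OF w(2,3)] using Suc by (simp del: of_nat_Suc)
 thus ?case by (auto simp: rep_simps[OF a])
qed (simp add: w)

lemma sl2_top:
 assumes eh: "brk h e = 2 *\<^sub>C e" and v: "v ~= 0" "a h v = c *\<^sub>C v" "(a e ^^ m) v = 0"
 obtains k where "(a e ^^ k) v ~= 0" "(a e ^^ Suc k) v = 0" "a h ((a e ^^ k) v) = (c + 2 * of_nat k) *\<^sub>C (a e ^^ k) v"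
proof -
 have "a h ((a e ^^ j) v) = (c + 2 * of_nat j) *\<^sub>C (a e ^^ j) v" for j
 proof (induction j)
  case (Suc j)
  have "a h (a e ((a e ^^ j) v)) = a (brk h e) ((a e ^^ j) v) + a e (a h ((a e ^^ j) v))" by (simp add: rep_simps[OF a])
  hence "a h (a e ((a e ^^ j) v)) = 2 *\<^sub>C a e ((a e ^^ j) v) + (c + 2 * of_nat j) *\<^sub>C a e ((a e ^^ j) v)"
   unfolding Suc eh by (simp add: rep_simps[OF a])
  thus ?case by (simp flip: scaleC_add_left)
 qed (use v in simp)
 moreover obtain k where "(a e ^^ k) v ~= 0" "(a e ^^ Suc k) v = 0" using v(1,3) inc_induct[of 0 m "%k. (a e ^^ k) v = 0"] by auto
 ultimately show ?thesis using that by blast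
qed

end

context cartan_lie
begin

abbreviation "\<Phi> \<equiv> roots H"
abbreviation "gsp \<equiv> root_space H"

lemma Phi_dual: "\<beta> \<in> \<Phi> ==> \<beta> \<in> dual H" and Phi_nz: "\<beta> \<in> \<Phi> ==> \<beta> ~= 0" by (auto simp: roots_def)

lemma dual_scaleC: "\<beta> \<in> dual H ==> c *\<^sub>C \<beta> \<in> dual H"
 using dual_closed(5)[of \<beta> c] by (simp add: scaleC_fun_def scaleC_complex)

lemma gsp_zero: "\<beta> \<in> dual H ==> \<beta> ~= 0 ==> \<beta> \<notin> \<Phi> ==> gsp \<beta> = {0}" by (auto simp: roots_def)

lemma gsp_disjoint:
 assumes "\<gamma> \<in> dual H" "A <= dual H" "\<gamma> \<notin> A" "v \<in> gsp \<gamma>" "v \<in> cspan (\<Union>\<beta>\<in>A. gsp \<beta>)"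
 shows "v = 0"
proof -
 have d: "\<exists>h\<in>H. \<beta> h ~= \<delta> h" if "\<beta> \<in> insert \<gamma> A" "\<delta> \<in> insert \<gamma> A" "\<beta> ~= \<delta>" for \<beta> \<delta>
  using that assms by (intro dual_distinct) auto
 show ?thesis by (rule wtsp_disjoint[of H brk \<gamma> A]) (use d assms in \<open>auto simp: clinear_brk root_space_wtsp\<close>)
qed

lemma killing_gsp:
 assumes "x \<in> gsp \<beta>" "y \<in> gsp \<gamma>" "\<beta> \<in> dual H" "\<gamma> \<in> dual H" "\<beta> + \<gamma> ~= 0" shows "killing x y = 0"
proof -
 obtain h where h: "h \<in> H" "\<beta> h + \<gamma> h ~= 0" using dual_distinct[OF dual_closed(2)[OF assms(3,4)] dual_closed(1) assms(5)] by auto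
 show ?thesis by (rule killing_geig[OF fd _ _ h(2), where x = h])
   (use assms h in \<open>auto simp: root_space_def intro!: geig_eigen clinear_brk\<close>)
qed

lemma gsp_nonzero: "\<beta> \<in> \<Phi> ==> \<exists>e\<in>gsp \<beta>. e ~= 0" using subspace_0[OF root_space_subspace] by (auto simp: roots_def)

text \<open>A root vector is not central, and it is orthogonal to all weight spaces except the one
  for - \<beta>, so it must pair nontrivially there.\<close>

lemma gsp_pairing:
 assumes b: "\<beta> \<in> \<Phi>" and e: "e \<in> gsp \<beta>" "e ~= 0" shows "\<exists>f\<in>gsp (- \<beta>). killing e f = c"
proof -
 have "e \<notin> krad"
 proof
  assume k: "e \<in> krad"
  have "\<beta> h = 0" if "h \<in> H" for h using e that krad_brk0(2)[OF k, of h] by (auto simp: root_space_def)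
  hence "\<beta> = 0" using dual_eqI[OF Phi_dual[OF b] dual_closed(1)] by simp
  thus False using Phi_nz[OF b] by blast
 qed
 have "\<exists>f\<in>gsp (- \<beta>). killing e f ~= 0"
 proof (rule ccontr)
  assume no: "\<not> ?thesis"
  have "killing e y = 0" for y
  proof (rule clinear_eq_on_span[OF killing_lin(2) clinear_const_0])
   show "y \<in> cspan (H \<union> (\<Union>\<beta>\<in>\<Phi>. gsp \<beta>))" using root_space_decomposition_UNIV by blast
   fix x assume "x \<in> H \<union> (\<Union>\<beta>\<in>\<Phi>. gsp \<beta>)"
   then obtain \<gamma> where g: "x \<in> gsp \<gamma>" "\<gamma> \<in> dual H" using root_space_0 dual_closed(1) Phi_dual by blast
   show "killing e x = 0"
   proof (cases "\<beta> + \<gamma> = 0")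
    case True
    hence "\<gamma> = - \<beta>" by (simp add: eq_neg_iff_add_eq_0 add.commute)
    thus ?thesis using no g by blast
   next
    case False
    thus ?thesis using killing_gsp[OF e(1) g(1) Phi_dual[OF b] g(2)] by blast
   qed
  qed
  thus False using \<open>e \<notin> krad\<close> by (simp add: krad_iff')
 qed
 then obtain f where f: "f \<in> gsp (- \<beta>)" "killing e f ~= 0" by blast
 show ?thesis
 proof (rule bexI)
  show "(c / killing e f) *\<^sub>C f \<in> gsp (- \<beta>)" using f subspace_scale[OF root_space_subspace] by blast
  show "killing e ((c / killing e f) *\<^sub>C f) = c" using f by (simp add: killing_simps)
 qed
qed

lemma Phi_uminus: "\<beta> \<in> \<Phi> ==> - \<beta> \<in> \<Phi>"
proof -
 assume b: "\<beta> \<in> \<Phi>"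
 obtain e where e: "e \<in> gsp \<beta>" "e ~= 0" using gsp_nonzero[OF b] by blast
 obtain f where f: "f \<in> gsp (- \<beta>)" "killing e f = 1" using gsp_pairing[OF b e] by blast
 have "f ~= 0" using f by (auto simp: killing_simps)
 thus ?thesis using f b dual_closed(4)[OF Phi_dual[OF b]] by (auto simp: roots_def)
qed

lemma brk_ef_H: "e \<in> gsp \<beta> ==> f \<in> gsp (- \<beta>) ==> brk e f \<in> H"
 using root_space_brk[of e \<beta> f "- \<beta>"] root_space_0 by simp

lemma killing_brk_ef: "f \<in> gsp (- \<beta>) ==> x \<in> H ==> killing (brk e f) x = \<beta> x * killing e f"
 using brk_anti[of f x] by (auto simp: kinv root_space_def killing_simps brk_simps)

abbreviation "derived \<equiv> brk_span (UNIV :: 'g set) UNIV"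

lemma H_derived_unique:
 assumes "t \<in> H" "t \<in> derived" "t' \<in> H" "t' \<in> derived" "!!x. x \<in> H ==> killing t x = killing t' x" shows "t = t'"
proof -
 have "t - t' \<in> krad" using assms subspace_diff[OF H_sub] by (intro killing_H_nondeg) (auto simp: killing_simps)
 moreover have "t - t' \<in> derived" using assms subspace_diff[OF brk_span_subspace] by blast
 ultimately show ?thesis using krad_inter_derived by fastforce
qed

text \<open>\<open>root_vec\<close> is a definite description, and its linearity is provable only
  for weights that have a representing vector; this is the set of such weights.\<close>

definition repr :: "('g => complex) set" where
 "repr = {\<beta> \<in> dual H. \<exists>t. t \<in> H \<and> t \<in> derived \<and> (\<forall>x\<in>H. killing t x = \<beta> x)}"

abbreviation "tv \<equiv> root_vec H"

lemma tv_eqI: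
 assumes "t \<in> H" "t \<in> derived" "!!x. x \<in> H ==> killing t x = \<beta> x" shows "tv \<beta> = t" unfolding root_vec_def
proof (rule the_equality)
 show "t \<in> H \<inter> derived \<and> (\<forall>x\<in>H. killing t x = \<beta> x)" using assms by blast
 fix t' assume t': "t' \<in> H \<inter> derived \<and> (\<forall>x\<in>H. killing t' x = \<beta> x)"
 show "t' = t" by (rule H_derived_unique) (use t' assms in auto)
qed

lemma tv:
 assumes "\<beta> \<in> repr" shows "tv \<beta> \<in> H" "tv \<beta> \<in> derived" "!!x. x \<in> H ==> killing (tv \<beta>) x = \<beta> x"
proof -
 obtain t where t: "t \<in> H" "t \<in> derived" "!!x. x \<in> H ==> killing t x = \<beta> x" using assms unfolding repr_def by blast
 thus "tv \<beta> \<in> H" "tv \<beta> \<in> derived" "!!x. x \<in> H ==> killing (tv \<beta>) x = \<beta> x" using tv_eqI[OF t] by auto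
qed

lemma reprI: "\<beta> \<in> dual H ==> t \<in> H ==> t \<in> derived ==> (!!x. x \<in> H ==> killing t x = \<beta> x) ==> \<beta> \<in> repr"
 unfolding repr_def by blast

lemma repr_dual: "\<beta> \<in> repr ==> \<beta> \<in> dual H" by (simp add: repr_def)

lemma tv_add: "\<beta> \<in> repr ==> \<gamma> \<in> repr ==> \<beta> + \<gamma> \<in> repr \<and> tv (\<beta> + \<gamma>) = tv \<beta> + tv \<gamma>"
proof -
 assume a: "\<beta> \<in> repr" "\<gamma> \<in> repr"
 have 1: "tv \<beta> + tv \<gamma> \<in> H" "tv \<beta> + tv \<gamma> \<in> derived"
  using tv[OF a(1)] tv[OF a(2)] H_sub subspace_add brk_span_subspace by blast+
 have 2: "killing (tv \<beta> + tv \<gamma>) x = (\<beta> + \<gamma>) x" if "x \<in> H" for x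
  using tv(3)[OF a(1) that] tv(3)[OF a(2) that] by (simp add: killing_simps)
 show ?thesis using reprI[OF dual_closed(2)[OF repr_dual[OF a(1)] repr_dual[OF a(2)]] 1 2] tv_eqI[OF 1 2] by blast
qed

lemma tv_scale: "\<beta> \<in> repr ==> c *\<^sub>C \<beta> \<in> repr \<and> tv (c *\<^sub>C \<beta>) = c *\<^sub>C tv \<beta>"
proof -
 assume a: "\<beta> \<in> repr"
 have 1: "c *\<^sub>C tv \<beta> \<in> H" "c *\<^sub>C tv \<beta> \<in> derived" using tv[OF a] H_sub subspace_scale brk_span_subspace by blast+
 have 2: "killing (c *\<^sub>C tv \<beta>) x = (c *\<^sub>C \<beta>) x" if "x \<in> H" for x
  using tv(3)[OF a that] by (simp add: killing_simps scaleC_fun_apply scaleC_complex)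
 show ?thesis using reprI[OF dual_scaleC[OF repr_dual[OF a]] 1 2] tv_eqI[OF 1 2] by blast
qed

lemma tv_zero: "0 \<in> repr \<and> tv 0 = 0"
proof -
 have 1: "0 \<in> H" "0 \<in> derived" using subspace_0 H_sub brk_span_subspace by blast+
 have 2: "killing 0 x = 0 x" for x :: 'g by (simp add: killing_simps)
 show ?thesis using reprI[OF dual_closed(1) 1 2] tv_eqI[OF 1 2] by blast
qed

lemma tv_minus: "\<beta> \<in> repr ==> - \<beta> \<in> repr \<and> tv (- \<beta>) = - tv \<beta>" using tv_scale[of \<beta> "-1"] by simp

lemma tv_symmetric: "\<beta> \<in> repr ==> \<gamma> \<in> repr ==> \<beta> (tv \<gamma>) = \<gamma> (tv \<beta>)"
 using tv(3)[of \<beta> "tv \<gamma>"] tv(3)[of \<gamma> "tv \<beta>"] tv(1) ksym by metis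

lemma Phi_repr: assumes b: "\<beta> \<in> \<Phi>" shows "\<beta> \<in> repr"
proof -
 obtain e where e: "e \<in> gsp \<beta>" "e ~= 0" using gsp_nonzero[OF b] by blast
 obtain f where f: "f \<in> gsp (- \<beta>)" "killing e f = 1" using gsp_pairing[OF b e] by blast
 show ?thesis by (rule reprI[OF Phi_dual[OF b] brk_ef_H[OF e(1) f(1)]])
   (use f killing_brk_ef[OF f(1)] in \<open>auto intro: brk_span_base\<close>)
qed

lemma brk_ef: assumes b: "\<beta> \<in> \<Phi>" and "e \<in> gsp \<beta>" "f \<in> gsp (- \<beta>)" shows "brk e f = killing e f *\<^sub>C tv \<beta>"
proof (rule H_derived_unique)
 show "brk e f \<in> H" using brk_ef_H assms by blast
 show "brk e f \<in> derived" by (intro brk_span_base) auto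
 show "killing e f *\<^sub>C tv \<beta> \<in> H" "killing e f *\<^sub>C tv \<beta> \<in> derived"
  using tv[OF Phi_repr[OF b]] H_sub subspace_scale brk_span_subspace by blast+
 show "killing (brk e f) x = killing (killing e f *\<^sub>C tv \<beta>) x" if "x \<in> H" for x
  using killing_brk_ef[OF assms(3) that] tv(3)[OF Phi_repr[OF b] that] by (simp add: killing_simps)
qed

lemma trace_brk_zero:
 assumes "complex_vector.independent B" "finite B"
  "!!b. b \<in> B ==> brk e b \<in> cspan B" "!!b. b \<in> B ==> brk f b \<in> cspan B"
  "!!b. b \<in> B ==> brk (brk e f) b = \<phi> b *\<^sub>C (b::'g)" shows "sum \<phi> B = 0"
proof -
 have st: "brk x v \<in> cspan B" if "!!b. b \<in> B ==> brk x b \<in> cspan B" "v \<in> cspan B" for x v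
  by (rule clinear_span_in[OF clinear_brk subspace_span that])
 have "sum \<phi> B = tr B (brk (brk e f))" by (rule tr_diag[OF assms(1,5), symmetric])
 also have "\<dots> = tr B (%v. brk e (brk f v)) - tr B (%v. brk f (brk e v))"
  unfolding brk_brk by (rule tr_diff[OF assms(1)]) (use st assms(3,4) in blast)+
 also have "\<dots> = 0" using tr_commute[OF assms(1,2) clinear_brk[of e] clinear_brk[of f]] assms(3,4) by simp
 finally show ?thesis .
qed

lemma krad_if_roots_vanish:
 assumes "t \<in> H" "!!\<beta>. \<beta> \<in> \<Phi> ==> \<beta> t = 0" shows "t \<in> krad"
proof -
 have "brk t y = 0" for y
 proof (rule clinear_eq_on_span[OF clinear_brk clinear_const_0])
  show "y \<in> cspan (H \<union> (\<Union>\<beta>\<in>\<Phi>. gsp \<beta>))" using root_space_decomposition_UNIV by blast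
  show "brk t x = 0" if "x \<in> H \<union> (\<Union>\<beta>\<in>\<Phi>. gsp \<beta>)" for x using that assms H_abelian by (auto simp: root_space_def)
 qed
 thus ?thesis by (simp add: krad_iff)
qed

text \<open>If the value were 0, then \<open>tv \<beta>\<close> would act on the whole
  \<beta>-string through a root \<gamma> by the scalar \<open>\<gamma> (tv \<beta>)\<close>. As a
  commutator \<open>[e, f]\<close> it has trace 0 there, so every root vanishes at
  \<open>tv \<beta>\<close>, which is then central and derived, hence 0.\<close>

lemma root_tv_nonzero: assumes b: "\<beta> \<in> \<Phi>" shows "\<beta> (tv \<beta>) ~= 0"
proof
 assume 0: "\<beta> (tv \<beta>) = 0"
 obtain e where e: "e \<in> gsp \<beta>" "e ~= 0" using gsp_nonzero[OF b] by blast
 obtain f where f: "f \<in> gsp (- \<beta>)" "killing e f = 1" using gsp_pairing[OF b e] by blast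
 have ef: "brk e f = tv \<beta>" using brk_ef[OF b e(1) f(1)] f by simp
 note tb = tv[OF Phi_repr[OF b]]
 have "\<gamma> (tv \<beta>) = 0" if g: "\<gamma> \<in> \<Phi>" for \<gamma>
 proof -
  define G where "G = (\<Union>k::int. gsp (\<gamma> + of_int k *\<^sub>C \<beta>))"
  obtain B where B: "B <= G" "complex_vector.independent B" "G <= cspan B" using maximal_independent_subset by blast
  have finB: "finite B" using fin_dim_independent[OF fd B(2)] by simp
  have eG: "brk e v \<in> G" and fG: "brk f v \<in> G" if v: "v \<in> G" for v
  proof -
   obtain k where k: "v \<in> gsp (\<gamma> + of_int k *\<^sub>C \<beta>)" using v by (auto simp: G_def)
   have eq: "\<beta> + (\<gamma> + of_int k *\<^sub>C \<beta>) = \<gamma> + of_int (k + 1) *\<^sub>C \<beta>"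
    "- \<beta> + (\<gamma> + of_int k *\<^sub>C \<beta>) = \<gamma> + of_int (k - 1) *\<^sub>C \<beta>"
    by (simp_all add: scaleC_add_left scale_left_diff_distrib)
   hence "brk e v \<in> gsp (\<gamma> + of_int (k + 1) *\<^sub>C \<beta>)" "brk f v \<in> gsp (\<gamma> + of_int (k - 1) *\<^sub>C \<beta>)"
    using root_space_brk[OF e(1) k] root_space_brk[OF f(1) k] unfolding eq by blast+
   thus "brk e v \<in> G" "brk f v \<in> G" unfolding G_def by - (rule UN_I[OF UNIV_I], assumption)+
  qed
  have "(\<Sum>b\<in>B. \<gamma> (tv \<beta>)) = 0"
  proof (rule trace_brk_zero[OF B(2) finB, of e f])
   fix v assume "v \<in> B"
   hence vG: "v \<in> G" using B(1) by blast
   show "brk e v \<in> cspan B" "brk f v \<in> cspan B" using eG[OF vG] fG[OF vG] B(3) by blast+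
   obtain k where "v \<in> gsp (\<gamma> + of_int k *\<^sub>C \<beta>)" using vG by (auto simp: G_def)
   hence "brk (tv \<beta>) v = (\<gamma> + of_int k *\<^sub>C \<beta>) (tv \<beta>) *\<^sub>C v" using tb(1) by (simp add: root_space_def)
   thus "brk (brk e f) v = \<gamma> (tv \<beta>) *\<^sub>C v" unfolding ef by (simp add: 0 scaleC_fun_apply scaleC_complex)
  qed
  moreover have "B ~= {}"
  proof
   assume "B = {}"
   hence "G <= {0}" using B(3) by simp
   moreover have "gsp \<gamma> <= G" unfolding G_def using UN_upper[of "0::int" UNIV "%k. gsp (\<gamma> + of_int k *\<^sub>C \<beta>)"] by simp
   ultimately show False using gsp_nonzero[OF g] by blast
  qed
  ultimately show ?thesis using finB by simp
 qed
 hence "tv \<beta> \<in> krad" by (rule krad_if_roots_vanish[OF tb(1)])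
 hence "tv \<beta> = 0" using krad_inter_derived tb(2) by blast
 hence "\<beta> x = 0" if "x \<in> H" for x using tb(3)[OF that] by (simp add: killing_simps)
 hence "\<beta> = 0" using dual_eqI[OF Phi_dual[OF b] dual_closed(1)] by simp
 thus False using Phi_nz[OF b] by blast
qed

definition coroot :: "('g => complex) => 'g" where
 "coroot \<beta> = (2 / \<beta> (tv \<beta>)) *\<^sub>C tv \<beta>"

lemma coroot_H: "\<beta> \<in> \<Phi> ==> coroot \<beta> \<in> H" and coroot_derived: "\<beta> \<in> \<Phi> ==> coroot \<beta> \<in> derived"
 unfolding coroot_def using tv[OF Phi_repr] H_sub subspace_scale brk_span_subspace by blast+

lemma dual_coroot: "lam \<in> dual H ==> \<beta> \<in> \<Phi> ==> lam (coroot \<beta>) = 2 * lam (tv \<beta>) / \<beta> (tv \<beta>)"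
 unfolding coroot_def using tv(1)[OF Phi_repr] by (simp add: H_dual_linear(2))

lemma root_coroot: "\<beta> \<in> \<Phi> ==> \<beta> (coroot \<beta>) = 2"
 using dual_coroot[of \<beta> \<beta>] Phi_dual[of \<beta>] root_tv_nonzero[of \<beta>] by simp

lemma sl2_triple:
 assumes "\<beta> \<in> \<Phi>" "e \<in> gsp \<beta>" "e ~= 0" shows "\<exists>f\<in>gsp (- \<beta>). brk e f = coroot \<beta>"
proof -
 obtain f where "f \<in> gsp (- \<beta>)" "killing e f = 2 / \<beta> (tv \<beta>)" using gsp_pairing[OF assms] by blast
 thus ?thesis using brk_ef[OF assms(1,2), of f] by (auto simp: coroot_def)
qed

lemma reflection_eq:
 assumes "lam \<in> dual H" "\<beta> \<in> \<Phi>" shows "reflection H \<beta> lam = lam - lam (coroot \<beta>) *\<^sub>C \<beta>"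
 by (simp add: reflection_def pairing_def dual_coroot[OF assms] scaleC_fun_def scaleC_complex)

text \<open>\<open>u\<close> is the top of the string through \<open>v\<close>, reached after
  \<open>k\<close> steps, and \<open>M\<close> is its eigenvalue under the coroot. \<open>M\<close>
  is a natural number because there are finitely many roots, so some power of \<open>f\<close> kills
  \<open>u\<close>.\<close>

lemma ad_string:
 assumes b: "\<beta> \<in> \<Phi>" and g: "\<gamma> \<in> dual H" "v \<in> gsp \<gamma>" "v ~= 0"
  and e: "e \<in> gsp \<beta>" and f: "f \<in> gsp (- \<beta>)" "brk e f = coroot \<beta>"
 obtains k M u where "u = (brk e ^^ k) v" "brk e u = 0" "\<gamma> (coroot \<beta>) + 2 * of_nat k = of_nat M"
  "!!j. j \<le> M ==> (brk f ^^ j) u ~= 0" "!!j. (brk f ^^ j) u \<in> gsp (\<gamma> + (of_nat k - of_nat j) *\<^sub>C \<beta>)"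
  "!!j. brk e ((brk f ^^ Suc j) u) = (of_nat (Suc j) * (of_nat M - of_nat j)) *\<^sub>C (brk f ^^ j) u"
proof -
 have a: "lie_rep brk" unfolding lie_rep_def using clinear_brk clinear_brk_left brk_deriv by (metis add_diff_cancel_right')
 have pow: "(brk x ^^ j) w \<in> gsp (\<eta> + of_nat j *\<^sub>C \<delta>)" if "w \<in> gsp \<eta>" "x \<in> gsp \<delta>" for x w \<eta> \<delta> j
 proof (induction j)
  case (Suc j)
  have "\<delta> + (\<eta> + of_nat j *\<^sub>C \<delta>) = \<eta> + of_nat (Suc j) *\<^sub>C \<delta>"
   by (simp add: fun_eq_iff plus_fun_apply scaleC_fun_apply scaleC_add_left)
  thus ?case using root_space_brk[OF that(2) Suc] by (simp only: funpow.simps o_apply)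
 qed (use that in simp)
 have nil: "\<exists>j. (brk x ^^ j) w = 0" if "w \<in> gsp \<eta>" "x \<in> gsp \<delta>" "\<eta> \<in> dual H" "\<delta> \<in> \<Phi>" for x w \<eta> \<delta>
 proof (rule ccontr)
  let ?r = "%j::nat. \<eta> + of_nat j *\<^sub>C \<delta>"
  assume "\<not> ?thesis"
  hence "gsp (?r j) ~= {0}" for j using pow[OF that(1,2), of j] by auto
  hence "range ?r <= insert 0 \<Phi>" using gsp_zero[OF dual_closed(2)[OF that(3) dual_scaleC[OF Phi_dual[OF that(4)]]]] by blast
  moreover have "inj ?r" using Phi_nz[OF that(4)] by (auto simp: inj_def scale_cancel_right)
  ultimately show False using range_inj_infinite finite_roots finite_subset by blast
 qed
 have hb: "brk (coroot \<beta>) w = \<eta> (coroot \<beta>) *\<^sub>C w" if "w \<in> gsp \<eta>" for w \<eta>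
  using that coroot_H[OF b] by (simp add: root_space_def)
 have fh: "brk (coroot \<beta>) f = - 2 *\<^sub>C f" using hb[OF f(1)] root_coroot[OF b] by simp
 obtain m where "(brk e ^^ m) v = 0" using nil[OF g(2) e g(1) b] by blast
 then obtain k where k: "(brk e ^^ k) v ~= 0" "(brk e ^^ Suc k) v = 0"
  "brk (coroot \<beta>) ((brk e ^^ k) v) = (\<gamma> (coroot \<beta>) + 2 * of_nat k) *\<^sub>C (brk e ^^ k) v"
  using sl2_top[OF a f(2) fh _ g(3) hb[OF g(2)]] hb[OF e] root_coroot[OF b] by metis
 define u where "u = (brk e ^^ k) v"
 have u: "brk e u = 0" "u \<in> gsp (\<gamma> + of_nat k *\<^sub>C \<beta>)" using k(2) pow[OF g(2) e] by (simp_all add: u_def)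
 note str = sl2_string_nonzero[OF a f(2) fh k(1,2)[unfolded funpow.simps o_apply] k(3), folded u_def]
 have "\<gamma> + of_nat k *\<^sub>C \<beta> \<in> dual H" by (intro dual_closed(2) dual_scaleC g Phi_dual b)
 then obtain N where "(brk f ^^ N) u = 0" using nil[OF u(2) f(1) _ Phi_uminus[OF b]] by blast
 then obtain M where M: "\<gamma> (coroot \<beta>) + 2 * of_nat k = of_nat M" using str by blast
 show ?thesis
 proof (rule that[OF u_def u(1) M])
  show "(brk f ^^ j) u ~= 0" if "j \<le> M" for j by (rule str) (use that M in auto)
  show "(brk f ^^ j) u \<in> gsp (\<gamma> + (of_nat k - of_nat j) *\<^sub>C \<beta>)" for j
   using pow[OF u(2) f(1), of j] by (simp only: scaleC_add_left diff_conv_add_uminus add.assoc complex_vector.scale_minus_right complex_vector.scale_minus_left)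
  show "brk e ((brk f ^^ Suc j) u) = (of_nat (Suc j) * (of_nat M - of_nat j)) *\<^sub>C (brk f ^^ j) u" for j
   using sl2_string(2)[OF a f(2) fh u(1), of "of_nat M"] k(3) M by (simp add: u_def)
 qed
qed

lemma coroot_minus: assumes "\<beta> \<in> \<Phi>" shows "coroot (- \<beta>) = - coroot \<beta>"
proof -
 have "\<beta> (- tv \<beta>) = - \<beta> (tv \<beta>)" using H_dual_linear(2)[OF Phi_dual[OF assms] tv(1)[OF Phi_repr[OF assms]], of "-1"] by simp
 thus ?thesis using tv_minus[OF Phi_repr[OF assms]] by (simp add: coroot_def)
qed

lemma dual_coroot_minus: "\<gamma> \<in> dual H ==> \<beta> \<in> \<Phi> ==> \<gamma> (coroot (- \<beta>)) = - \<gamma> (coroot \<beta>)"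
 using H_dual_linear(2)[of \<gamma> "coroot \<beta>" "-1"] coroot_H by (simp add: coroot_minus)

text \<open>A second independent vector can be corrected by a multiple of \<open>e\<close> so that
  \<open>f\<close> kills it. For the triple of - \<beta>, where \<open>f\<close> raises, it is then
  a highest weight vector of eigenvalue - 2, which is not a natural number.\<close>

lemma gsp_dim_one:
 assumes b: "\<beta> \<in> \<Phi>" and e: "e \<in> gsp \<beta>" "e ~= 0" and v: "v \<in> gsp \<beta>" shows "\<exists>c. v = c *\<^sub>C e"
proof (rule ccontr)
 assume no: "\<not> ?thesis"
 obtain f where f: "f \<in> gsp (- \<beta>)" "brk e f = coroot \<beta>" using sl2_triple[OF b e] by blast
 obtain g where g: "g \<in> gsp \<beta>" "brk f g = coroot (- \<beta>)"
 proof -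
  have "f ~= 0" using f(2) root_coroot[OF b] H_dual_linear(2)[OF Phi_dual[OF b], of 0 0] subspace_0[OF H_sub] by (auto simp: brk_simps)
  thus ?thesis using sl2_triple[OF Phi_uminus[OF b] f(1)] that by auto
 qed
 \<comment> \<open>The coefficient is chosen so that \<open>brk x f = 0\<close>:
   \<open>brk v f\<close> is \<open>killing v f\<close> times \<open>tv \<beta>\<close>, and
   \<open>brk e f\<close> is \<open>2 / \<beta> (tv \<beta>)\<close> times
   \<open>tv \<beta>\<close>.\<close>
 define x where "x = v - (killing v f * \<beta> (tv \<beta>) / 2) *\<^sub>C e"
 have x: "x \<in> gsp \<beta>" "x ~= 0" using no by (auto simp: x_def intro!: subspace_diff subspace_scale root_space_subspace v e)
 have "brk x f = 0" using brk_ef[OF b v f(1)] f(2) root_tv_nonzero[OF b] by (simp add: x_def brk_simps coroot_def scaleC_scaleC)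
 hence "(brk f ^^ Suc k) x = 0" for k by (induction k) (use brk_anti[of f x] in \<open>simp_all add: brk_simps\<close>)
 moreover obtain k M u where u: "u = (brk f ^^ k) x" "\<beta> (coroot (- \<beta>)) + 2 * of_nat k = of_nat M" "(brk g ^^ 0) u ~= 0"
  using ad_string[OF Phi_uminus[OF b] Phi_dual[OF b] x f(1), of g] g by (metis le0 minus_minus)
 ultimately have "k = 0" by (cases k) auto
 hence "of_nat M = (- 2 :: complex)" using u(2) dual_coroot_minus[OF Phi_dual[OF b] b] root_coroot[OF b] by simp
 hence "(of_nat (M + 2) :: complex) = 0" by simp
 thus False by (simp only: of_nat_eq_0_iff)
qed

text \<open>From the top weight (n + 2 + k) \<beta> of the string, n + k + 1 steps lead down to
  \<beta>. The vector reached is a multiple of \<open>e\<close>, so \<open>e\<close> kills it,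
  contrary to the nonzero coefficient in the string formula.\<close>

lemma no_multiple: assumes b: "\<beta> \<in> \<Phi>" shows "of_nat (Suc (Suc n)) *\<^sub>C \<beta> \<notin> \<Phi>"
proof
 let ?m = "of_nat (Suc (Suc n)) *\<^sub>C \<beta>"
 assume m: "?m \<in> \<Phi>"
 obtain e where e: "e \<in> gsp \<beta>" "e ~= 0" using gsp_nonzero[OF b] by blast
 obtain f where f: "f \<in> gsp (- \<beta>)" "brk e f = coroot \<beta>" using sl2_triple[OF b e] by blast
 obtain v where v: "v \<in> gsp ?m" "v ~= 0" using gsp_nonzero[OF m] by blast
 obtain k M u where u: "?m (coroot \<beta>) + 2 * of_nat k = of_nat M" "!!j. j \<le> M ==> (brk f ^^ j) u ~= 0"
  "!!j. (brk f ^^ j) u \<in> gsp (?m + (of_nat k - of_nat j) *\<^sub>C \<beta>)"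
  "!!j. brk e ((brk f ^^ Suc j) u) = (of_nat (Suc j) * (of_nat M - of_nat j)) *\<^sub>C (brk f ^^ j) u"
  using ad_string[OF b Phi_dual[OF m] v e(1) f] by metis
 have "of_nat M = (of_nat (2 * (n + k + 2)) :: complex)" using u(1) root_coroot[OF b] by (simp add: scaleC_fun_apply scaleC_complex algebra_simps)
 hence M: "M = 2 * (n + k + 2)" by (simp only: of_nat_eq_iff)
 have "(brk f ^^ Suc (n + k)) u \<in> gsp \<beta>" using u(3)[of "Suc (n + k)"] by (simp flip: scaleC_add_left)
 then obtain c where "(brk f ^^ Suc (n + k)) u = c *\<^sub>C e" using gsp_dim_one[OF b e] by blast
 hence "(of_nat (Suc (n + k)) * (of_nat M - of_nat (n + k))) *\<^sub>C (brk f ^^ (n + k)) u = 0"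
  unfolding u(4)[symmetric] by (simp add: brk_simps del: funpow.simps)
 moreover have "(of_nat M :: complex) ~= of_nat (n + k)" unfolding of_nat_eq_iff M by simp
 ultimately show False using u(2)[of "n + k"] by (simp add: M del: of_nat_Suc of_nat_add)
qed

lemma multiple_pm1:
 assumes "\<beta> \<in> \<Phi>" "\<gamma> \<in> \<Phi>" "\<gamma> = of_int k *\<^sub>C \<beta>" shows "\<gamma> = \<beta> \<or> \<gamma> = - \<beta>"
proof -
 consider "k = 0" | "k = 1" | "k = -1" | "k \<ge> 2" | "k \<le> -2" by linarith
 thus ?thesis
 proof cases
  case 1 thus ?thesis using assms Phi_nz by auto
 next
  case 4
  hence "k = int (Suc (Suc (nat (k - 2))))" by simp
  hence "of_int k = (of_nat (Suc (Suc (nat (k - 2)))) :: complex)" by (metis of_int_of_nat_eq)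
  thus ?thesis using no_multiple[OF assms(1)] assms by metis
 next
  case 5
  hence "- k = int (Suc (Suc (nat (- k - 2))))" by simp
  hence "of_int (- k) = (of_nat (Suc (Suc (nat (- k - 2)))) :: complex)" by (metis of_int_of_nat_eq)
  moreover have "of_int (- k) *\<^sub>C - \<beta> = \<gamma>" using assms(3) by simp
  ultimately show ?thesis using no_multiple[OF Phi_uminus[OF assms(1)]] assms by metis
 qed (use assms in auto)
qed

lemma root_plus_multiple_nonzero:
 assumes "\<beta> \<in> \<Phi>" "\<gamma> \<in> \<Phi>" "\<gamma> ~= \<beta>" "\<gamma> ~= - \<beta>"
 shows "\<gamma> + of_int k *\<^sub>C \<beta> ~= 0"
proof
 assume "\<gamma> + of_int k *\<^sub>C \<beta> = 0"
 hence "\<gamma> = - (of_int k *\<^sub>C \<beta>)" by (simp add: eq_neg_iff_add_eq_0)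
 hence "\<gamma> = of_int (- k) *\<^sub>C \<beta>" by simp
 thus False using multiple_pm1 assms by blast
qed

lemma root_string:
 assumes b: "\<beta> \<in> \<Phi>" and g: "\<gamma> \<in> \<Phi>"
 shows "\<exists>k M. \<gamma> (coroot \<beta>) + 2 * of_nat k = of_nat M \<and> (\<forall>j\<le>M. gsp (\<gamma> + (of_nat k - of_nat j) *\<^sub>C \<beta>) ~= {0})"
proof -
 obtain e v where e: "e \<in> gsp \<beta>" "e ~= 0" and v: "v \<in> gsp \<gamma>" "v ~= 0" using gsp_nonzero b g by metis
 obtain f where f: "f \<in> gsp (- \<beta>)" "brk e f = coroot \<beta>" using sl2_triple[OF b e] by blast
 show ?thesis by (rule ad_string[OF b Phi_dual[OF g] v e(1) f]) blast
qed

lemma cartan_integer: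
 assumes "\<beta> \<in> \<Phi>" "\<gamma> \<in> \<Phi>" shows "\<exists>n. \<gamma> (coroot \<beta>) = of_int n"
proof -
 obtain k M :: nat where "\<gamma> (coroot \<beta>) + 2 * of_nat k = of_nat M" using root_string[OF assms] by blast
 thus ?thesis by (intro exI[of _ "int M - 2 * int k"]) (simp add: eq_diff_eq)
qed

text \<open>The string through \<gamma> reaches at least to the reflected weight. A negative Cartan
  integer is reduced to a positive one by passing to - \<beta>.\<close>

lemma root_minus_multiple:
 assumes b: "\<beta> \<in> \<Phi>" and g: "\<gamma> \<in> \<Phi>" "\<gamma> ~= \<beta>" "\<gamma> ~= - \<beta>" and n: "\<gamma> (coroot \<beta>) = of_int n"
  and j: "0 \<le> j \<and> j \<le> n \<or> n \<le> j \<and> j \<le> 0" shows "\<gamma> - of_int j *\<^sub>C \<beta> \<in> \<Phi>"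
proof -
 have *: "\<gamma> - of_nat j *\<^sub>C \<beta> \<in> \<Phi>"
  if as: "\<beta> \<in> \<Phi>" "\<gamma> ~= \<beta>" "\<gamma> ~= - \<beta>" "\<gamma> (coroot \<beta>) = of_int n" "int j \<le> n" for \<beta> n j
 proof -
  obtain k M where k: "\<gamma> (coroot \<beta>) + 2 * of_nat k = of_nat M"
   "!!j. j \<le> M ==> gsp (\<gamma> + (of_nat k - of_nat j) *\<^sub>C \<beta>) ~= {0}" using root_string[OF as(1) g(1)] by blast
  have "(of_int (n + 2 * int k) :: complex) = of_int (int M)" using k(1) as(4) by simp
  hence "k + j \<le> M" using as(5) unfolding of_int_eq_iff by linarith
  from k(2)[OF this] have "gsp (\<gamma> - of_nat j *\<^sub>C \<beta>) ~= {0}" by simp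
  moreover have "\<gamma> - of_nat j *\<^sub>C \<beta> \<in> dual H" by (intro dual_closed(3) dual_scaleC Phi_dual g as)
  moreover have "\<gamma> - of_nat j *\<^sub>C \<beta> ~= 0" using root_plus_multiple_nonzero[OF as(1) g(1) as(2,3), of "- int j"] by simp
  ultimately show ?thesis using gsp_zero by blast
 qed
 show ?thesis
 proof (cases "0 \<le> j \<and> j \<le> n")
  case True
  thus ?thesis using *[of \<beta> n "nat j"] assms by simp
 next
  case False
  thus ?thesis using *[of "- \<beta>" "- n" "nat (- j)"] Phi_uminus[OF b] dual_coroot_minus[OF Phi_dual[OF g(1)] b] g n j by auto
 qed
qed

lemma reflect_root:
 assumes b: "\<beta> \<in> \<Phi>" and g: "\<gamma> \<in> \<Phi>" shows "\<gamma> - \<gamma> (coroot \<beta>) *\<^sub>C \<beta> \<in> \<Phi>"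
proof -
 consider "\<gamma> = \<beta>" | "\<gamma> = - \<beta>" | "\<gamma> ~= \<beta>" "\<gamma> ~= - \<beta>" by blast
 thus ?thesis
 proof cases
  case 1
  hence "\<gamma> - \<gamma> (coroot \<beta>) *\<^sub>C \<beta> = - \<beta>" using root_coroot[OF b] scaleC_add_left[of 1 1 \<beta>] by simp
  thus ?thesis using Phi_uminus[OF b] by simp
 next
  case 2
  hence "\<gamma> - \<gamma> (coroot \<beta>) *\<^sub>C \<beta> = \<beta>" using root_coroot[OF b] scaleC_add_left[of 1 1 \<beta>] by simp
  thus ?thesis using b by simp
 next
  case 3
  obtain n where "\<gamma> (coroot \<beta>) = of_int n" using cartan_integer[OF b g] by blast
  thus ?thesis using root_minus_multiple[OF b g 3, of n n] by (cases "n \<ge> 0") auto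
 qed
qed

lemma root_add:
 assumes b: "\<beta> \<in> \<Phi>" and g: "\<gamma> \<in> \<Phi>" "\<gamma> ~= - \<beta>" and n: "\<gamma> (coroot \<beta>) = of_int n" "n < 0"
 shows "\<gamma> + \<beta> \<in> \<Phi>"
proof -
 have "\<gamma> ~= \<beta>"
 proof
  assume "\<gamma> = \<beta>"
  hence "(of_int n :: complex) = of_int 2" using n root_coroot[OF b] by simp
  thus False using n(2) unfolding of_int_eq_iff by simp
 qed
 thus ?thesis using root_minus_multiple[OF b g(1) _ g(2) n(1), of "-1"] n(2) by simp
qed

text \<open>If \<open>e\<close> killed \<open>v\<close>, then \<open>v\<close> would be the top of
  its string, so its eigenvalue \<open>m\<close> would be a natural number. The string through
  \<beta> + \<gamma> descends to a multiple of \<open>v\<close> on which \<open>e\<close> acts by a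
  nonzero coefficient, a contradiction.\<close>

lemma brk_gsp_nonzero:
 assumes b: "\<beta> \<in> \<Phi>" and g: "\<gamma> \<in> \<Phi>" and bg: "\<beta> + \<gamma> \<in> \<Phi>"
  and e: "e \<in> gsp \<beta>" "e ~= 0" and v: "v \<in> gsp \<gamma>" "v ~= 0" shows "brk e v ~= 0"
proof
 assume 0: "brk e v = 0"
 obtain f where f: "f \<in> gsp (- \<beta>)" "brk e f = coroot \<beta>" using sl2_triple[OF b e] by blast
 obtain m where m: "\<gamma> (coroot \<beta>) = of_nat m"
 proof (rule ad_string[OF b Phi_dual[OF g] v e(1) f])
  fix k M u assume u: "u = (brk e ^^ k) v" "\<gamma> (coroot \<beta>) + 2 * of_nat k = of_nat M" "!!j. j \<le> M ==> (brk f ^^ j) u ~= 0"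
  have "(brk e ^^ Suc j) v = 0" for j by (induction j) (simp_all add: 0 brk_simps)
  hence "k = 0" using u(1) u(3)[of 0] by (cases k) auto
  thus thesis using u(2) that by simp
 qed
 obtain w where w: "w \<in> gsp (\<beta> + \<gamma>)" "w ~= 0" using gsp_nonzero[OF bg] by blast
 obtain k M u where u: "(\<beta> + \<gamma>) (coroot \<beta>) + 2 * of_nat k = of_nat M" "!!j. j \<le> M ==> (brk f ^^ j) u ~= 0"
  "!!j. (brk f ^^ j) u \<in> gsp (\<beta> + \<gamma> + (of_nat k - of_nat j) *\<^sub>C \<beta>)"
  "!!j. brk e ((brk f ^^ Suc j) u) = (of_nat (Suc j) * (of_nat M - of_nat j)) *\<^sub>C (brk f ^^ j) u"
  using ad_string[OF b Phi_dual[OF bg] w e(1) f] by metis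
 have "(of_nat M :: complex) = of_nat (m + 2 * k + 2)" using u(1) m root_coroot[OF b] by (simp add: plus_fun_apply algebra_simps)
 hence M: "M = m + 2 * k + 2" by (simp only: of_nat_eq_iff)
 have "(brk f ^^ Suc k) u \<in> gsp \<gamma>" using u(3)[of "Suc k"] by (simp add: scaleC_add_left)
 then obtain c where "(brk f ^^ Suc k) u = c *\<^sub>C v" using gsp_dim_one[OF g v] by blast
 hence "(of_nat (Suc k) * (of_nat M - of_nat k)) *\<^sub>C (brk f ^^ k) u = 0" unfolding u(4)[symmetric] by (simp add: brk_simps 0 del: funpow.simps)
 moreover have "(of_nat M :: complex) ~= of_nat k" unfolding of_nat_eq_iff M by simp
 ultimately show False using u(2)[of k] by (simp add: M del: of_nat_Suc of_nat_add of_nat_mult)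
qed

end

subsection \<open>Borel subalgebras and positive roots\<close>

context cartan_lie
begin

text \<open>A set of roots without nonempty zero sums spans a pointed cone; this replaces the choice of
 a linear functional that is positive on it.\<close>

definition pointed :: "('g => complex) set => bool" where
 "pointed X \<longleftrightarrow> (\<forall>bs. set bs <= X --> sum_list bs = 0 --> bs = [])"

definition root_alg :: "('g => complex) set => 'g set" where
 "root_alg X = cspan (H \<union> (\<Union>\<beta>\<in>X. gsp \<beta>))"

lemma gsp_inter_subspace:
 assumes "csubspace W" "\<beta> \<in> \<Phi>" "v \<in> gsp \<beta>" "v \<in> W" "v ~= 0" shows "gsp \<beta> <= W"
proof
 fix w assume "w \<in> gsp \<beta>"
 then obtain c where "w = c *\<^sub>C v" using gsp_dim_one[OF assms(2,3,5)] by blast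
 thus "w \<in> W" using subspace_scale[OF assms(1,4)] by simp
qed

lemma H_stable_root_alg:
 assumes W: "csubspace W" "H <= W" "!!x w. x \<in> H ==> w \<in> W ==> brk x w \<in> W" shows "W = root_alg {\<beta>\<in>\<Phi>. gsp \<beta> <= W}"
proof
 have "gsp \<beta> \<inter> W <= root_alg {\<beta>\<in>\<Phi>. gsp \<beta> <= W}" if b: "\<beta> \<in> \<Phi>" for \<beta>
 proof
  fix v assume v: "v \<in> gsp \<beta> \<inter> W"
  show "v \<in> root_alg {\<beta>\<in>\<Phi>. gsp \<beta> <= W}"
  proof (cases "v = 0")
   case False
   hence "gsp \<beta> <= W" using gsp_inter_subspace[OF W(1) b] v by blast
   thus ?thesis unfolding root_alg_def using v b by (intro span_base) blast
  qed (simp add: root_alg_def span_zero)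
 qed
 moreover have "H <= root_alg {\<beta>\<in>\<Phi>. gsp \<beta> <= W}" unfolding root_alg_def by (intro subsetI span_base) blast
 ultimately have "(H \<inter> W) \<union> (\<Union>\<beta>\<in>\<Phi>. gsp \<beta> \<inter> W) <= root_alg {\<beta>\<in>\<Phi>. gsp \<beta> <= W}"
  by (intro Un_least UN_least) auto
 hence "cspan ((H \<inter> W) \<union> (\<Union>\<beta>\<in>\<Phi>. gsp \<beta> \<inter> W)) <= root_alg {\<beta>\<in>\<Phi>. gsp \<beta> <= W}"
  unfolding root_alg_def by (rule span_minimal[OF _ subspace_span])
 thus "W <= root_alg {\<beta>\<in>\<Phi>. gsp \<beta> <= W}" using root_space_decomposition[OF W(1,3)] by simp
 show "root_alg {\<beta>\<in>\<Phi>. gsp \<beta> <= W} <= W" unfolding root_alg_def by (rule span_minimal[OF _ W(1)]) (use W(2) in blast)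
qed

lemma brk_closed_roots:
 assumes W: "csubspace W" "!!x y. x \<in> W ==> y \<in> W ==> brk x y \<in> W"
  and "\<beta> \<in> \<Phi>" "\<gamma> \<in> \<Phi>" "\<beta> + \<gamma> \<in> \<Phi>" "gsp \<beta> <= W" "gsp \<gamma> <= W"
 shows "gsp (\<beta> + \<gamma>) <= W"
proof -
 obtain x where x: "x \<in> gsp \<beta>" "x ~= 0" using gsp_nonzero[OF assms(3)] by blast
 obtain y where y: "y \<in> gsp \<gamma>" "y ~= 0" using gsp_nonzero[OF assms(4)] by blast
 show ?thesis
 proof (rule gsp_inter_subspace[OF W(1) assms(5)])
  show "brk x y \<in> gsp (\<beta> + \<gamma>)" by (rule root_space_brk[OF x(1) y(1)])
  show "brk x y ~= 0" by (rule brk_gsp_nonzero[OF assms(3-5) x y])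
  show "brk x y \<in> W" using W(2) assms(6,7) x y by blast
 qed
qed

text \<open>The triple \<open>e\<close>, \<open>f\<close>, \<open>coroot \<beta>\<close> reproduces
  itself in every term of the derived series.\<close>

lemma solvable_no_opposite:
 assumes W: "lie_subalgebra W" "solvable W" and b: "\<beta> \<in> \<Phi>" "gsp \<beta> <= W" "gsp (- \<beta>) <= W" shows False
proof -
 obtain e where e: "e \<in> gsp \<beta>" "e ~= 0" using gsp_nonzero[OF b(1)] by blast
 obtain f where f: "f \<in> gsp (- \<beta>)" "brk e f = coroot \<beta>" using sl2_triple[OF b(1) e] by blast
 let ?h = "coroot \<beta>"
 have he: "brk ?h e = 2 *\<^sub>C e" "brk ?h f = (-2) *\<^sub>C f" using e f coroot_H[OF b(1)] root_coroot[OF b(1)] by (auto simp: root_space_def)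
 have "?h \<in> W" using W(1) b e f unfolding lie_subalgebra_def by (metis subsetD)
 hence "e \<in> derived_series W n \<and> f \<in> derived_series W n \<and> ?h \<in> derived_series W n" for n
 proof (induction n)
  case (Suc n)
  have "brk ?h e \<in> derived_series W (Suc n)" "brk ?h f \<in> derived_series W (Suc n)"
   "brk e f \<in> derived_series W (Suc n)" using Suc by (auto intro: brk_span_base)
  moreover have s: "c *\<^sub>C x \<in> derived_series W (Suc n)" if "x \<in> derived_series W (Suc n)" for c x
   using that subspace_scale[OF brk_span_subspace] by simp
  ultimately show ?case using s[of "brk ?h e" "1/2"] s[of "brk ?h f" "-1/2"] unfolding he f(2) scaleC_scaleC by simp
 qed (use b e f in auto)
 thus False using W(2) e(2) unfolding solvable_def by blast
qed

text \<open>\<open>rk\<close> replaces a height: it counts the elements of \<open>X\<close> that can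
  be split off from \<gamma> so that a sum from \<open>X\<close> is left. Pointedness makes it grow
  strictly when an element of \<open>X\<close> is added, so brackets move through the finite
  filtration \<open>N\<close>.\<close>

lemma pointed_solvable:
 assumes X: "X <= \<Phi>" "pointed X" and cl: "!!\<beta> \<gamma>. \<beta> \<in> X ==> \<gamma> \<in> X ==> \<beta> + \<gamma> \<in> \<Phi> ==> \<beta> + \<gamma> \<in> X"
 shows "lie_subalgebra (root_alg X)" "solvable (root_alg X)"
proof -
 have finX: "finite X" using X(1) finite_roots finite_subset by blast
 define U where "U \<gamma> = {\<delta>\<in>X. \<exists>bs. set bs <= X \<and> \<gamma> = \<delta> + sum_list bs}" for \<gamma>
 define rk where "rk \<gamma> = card (U \<gamma>)" for \<gamma>
 have finU: "finite (U \<gamma>)" for \<gamma> unfolding U_def using finX by simp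
 have rk_less: "rk \<gamma> < rk (\<beta> + \<gamma>)" if bg: "\<beta> \<in> X" "\<gamma> \<in> X" "\<beta> + \<gamma> \<in> X" for \<beta> \<gamma>
 proof -
  have "\<delta> \<in> U (\<beta> + \<gamma>)" if d: "\<delta> \<in> U \<gamma>" for \<delta>
  proof -
   obtain bs where "\<delta> \<in> X" "set bs <= X" "\<gamma> = \<delta> + sum_list bs" using d unfolding U_def by blast
   hence "set (\<beta> # bs) <= X" "\<beta> + \<gamma> = \<delta> + sum_list (\<beta> # bs)" using bg(1) by (simp_all add: algebra_simps)
   thus ?thesis using \<open>\<delta> \<in> X\<close> unfolding U_def by blast
  qed
  moreover have "\<beta> + \<gamma> \<notin> U \<gamma>"
  proof
   assume "\<beta> + \<gamma> \<in> U \<gamma>"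
   then obtain bs where "set bs <= X" "\<gamma> = \<beta> + \<gamma> + sum_list bs" unfolding U_def by blast
   hence "set (\<beta> # bs) <= X" "sum_list (\<beta> # bs) = 0" using bg(1) by (simp_all add: algebra_simps)
   thus False using X(2) unfolding pointed_def by blast
  qed
  moreover have "\<beta> + \<gamma> \<in> U (\<beta> + \<gamma>)" unfolding U_def using bg(3) by (auto intro!: exI[of _ "[]"])
  ultimately show ?thesis unfolding rk_def by (intro psubset_card_mono finU) blast
 qed
 define N where "N k = cspan (\<Union>\<beta>\<in>{\<beta>\<in>X. k \<le> rk \<beta>}. gsp \<beta>)" for k
 have Nsub: "csubspace (N k)" for k by (simp add: N_def)
 have N_in: "x \<in> N k" if "x \<in> gsp \<beta>" "\<beta> \<in> X" "k \<le> rk \<beta>" for x \<beta> k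
  unfolding N_def using that by (intro span_base) blast
 have bXX: "brk x y \<in> N (Suc k)" if xy: "x \<in> gsp \<beta>" "y \<in> gsp \<gamma>" "\<beta> \<in> X" "\<gamma> \<in> X" "k \<le> rk \<gamma>" for x y \<beta> \<gamma> k
 proof (cases "\<beta> + \<gamma> \<in> \<Phi>")
  case True
  hence "\<beta> + \<gamma> \<in> X" using cl xy by blast
  thus ?thesis using N_in[OF root_space_brk[OF xy(1,2)]] rk_less[OF xy(3,4)] xy(5) by simp
 next
  case False
  have "\<beta> + \<gamma> ~= 0"
  proof
   assume "\<beta> + \<gamma> = 0"
   hence "sum_list [\<beta>, \<gamma>] = 0" by simp
   thus False using X(2) xy unfolding pointed_def by (metis empty_set insert_subset list.simps(15) empty_subsetI list.distinct(1))
  qed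
  hence "gsp (\<beta> + \<gamma>) = {0}" using False xy(3,4) X(1) by (intro gsp_zero dual_closed Phi_dual) auto
  hence "brk x y = 0" using root_space_brk[OF xy(1,2)] by simp
  thus ?thesis using subspace_0[OF Nsub] by simp
 qed
 have b0k: "brk x y \<in> N (Suc k)" if "x \<in> N 0" "y \<in> N k" for x y k by (rule brk_in_ideal[OF Nsub _ that[unfolded N_def]]) (use bXX in blast)
 let ?L = "root_alg X"
 have Lsub: "csubspace ?L" by (simp add: root_alg_def)
 have N0L: "N 0 <= ?L" unfolding N_def root_alg_def by (rule span_mono) blast
 have NN: "N (Suc k) <= N k" for k unfolding N_def by (rule span_mono) auto
 have LL: "brk x y \<in> N 0" if xy: "x \<in> ?L" "y \<in> ?L" for x y
 proof (rule brk_in_ideal[OF Nsub _ xy[unfolded root_alg_def]])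
  fix x y assume xy: "x \<in> H \<union> (\<Union>\<beta>\<in>X. gsp \<beta>)" "y \<in> H \<union> (\<Union>\<beta>\<in>X. gsp \<beta>)"
  have one: "brk h z \<in> N 0" if "h \<in> H" "z \<in> gsp \<beta>" "\<beta> \<in> X" for h z \<beta>
   using that subspace_scale[OF Nsub N_in[of z \<beta> 0]] by (auto simp: root_space_def)
  consider "x \<in> H" "y \<in> H" | \<beta> where "x \<in> H" "y \<in> gsp \<beta>" "\<beta> \<in> X" |
   \<beta> where "y \<in> H" "x \<in> gsp \<beta>" "\<beta> \<in> X" | \<beta> \<gamma> where "x \<in> gsp \<beta>" "\<beta> \<in> X" "y \<in> gsp \<gamma>" "\<gamma> \<in> X"
   using xy by blast
  thus "brk x y \<in> N 0"
  proof cases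
   case 1 thus ?thesis using H_abelian subspace_0[OF Nsub] by simp
  next
   case 2 thus ?thesis using one by blast
  next
   case 3
   hence "brk y x \<in> N 0" using one by blast
   thus ?thesis using subspace_neg[OF Nsub] brk_anti[of x y] by metis
  next
   case 4 thus ?thesis using bXX[of x \<beta> y \<gamma> 0] NN by auto
  qed
 qed
 show alg: "lie_subalgebra ?L" unfolding lie_subalgebra_def using Lsub LL N0L by blast
 have N0: "lie_subalgebra (N 0)" unfolding lie_subalgebra_def using Nsub b0k NN by blast
 have rkle: "rk \<beta> \<le> card X" for \<beta> unfolding rk_def U_def by (rule card_mono) (use finX in auto)
 hence emp: "{\<beta>\<in>X. Suc (card X) \<le> rk \<beta>} = {}" using not_less_eq_eq by blast
 have "solvable (N 0)"
 proof (rule ad_nilpotent_solvable[OF fin_dim_subset[OF fd] N0])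
  fix x y assume xy: "x \<in> N 0" "y \<in> N 0"
  have "(brk x ^^ k) y \<in> N k" for k by (induction k) (use xy b0k in auto)
  thus "y \<in> geig (brk x) 0" using emp unfolding N_def geig_zero_iff by (metis UN_empty complex_vector.span_empty singletonD)
 qed simp
 thus "solvable ?L" by (rule solvable_extension[OF _ Lsub brk_span_subset[OF Nsub LL]])
qed

end

locale borel_lie = cartan_lie ty H for ty :: "'g::lie_algebra itself" and H :: "'g set" +
 fixes B :: "'g set"
 assumes borel: "borel_subalgebra B" and HB: "H <= B"
begin

abbreviation "\<Psi> \<equiv> pos_roots H B"

lemma B_alg: "lie_subalgebra B" and B_solv: "solvable B" using borel by (simp_all add: borel_subalgebra_def)

lemma B_max: "lie_subalgebra C ==> solvable C ==> B <= C ==> C = B" using borel by (simp add: borel_subalgebra_def)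

lemma B_sub: "csubspace B" and B_brk: "x \<in> B ==> y \<in> B ==> brk x y \<in> B" using B_alg unfolding lie_subalgebra_def by blast+

lemma Psi_Phi: "\<beta> \<in> \<Psi> ==> \<beta> \<in> \<Phi>" and Psi_B: "\<beta> \<in> \<Psi> ==> gsp \<beta> <= B" by (auto simp: pos_roots_def)

lemma finite_Psi: "finite \<Psi>" using finite_roots by (simp add: pos_roots_def)

lemma B_eq: "B = root_alg \<Psi>" unfolding pos_roots_def by (rule H_stable_root_alg[OF B_sub HB]) (use B_brk HB in blast)

lemma Psi_opposite: "\<beta> \<in> \<Psi> ==> - \<beta> \<notin> \<Psi>"
proof
 assume "\<beta> \<in> \<Psi>" "- \<beta> \<in> \<Psi>"
 thus False using solvable_no_opposite[OF B_alg B_solv Psi_Phi Psi_B Psi_B] by blast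
qed

lemma Psi_closed: "\<beta> \<in> \<Psi> ==> \<gamma> \<in> \<Psi> ==> \<beta> + \<gamma> \<in> \<Phi> ==> \<beta> + \<gamma> \<in> \<Psi>"
proof -
 assume a: "\<beta> \<in> \<Psi>" "\<gamma> \<in> \<Psi>" "\<beta> + \<gamma> \<in> \<Phi>"
 have "gsp (\<beta> + \<gamma>) <= B" by (rule brk_closed_roots[OF B_sub B_brk]) (use a Psi_Phi Psi_B in auto)
 thus ?thesis using a(3) by (simp add: pos_roots_def)
qed

lemma sum_list_apply: "sum_list bs x = sum_list (map (%b. b x) bs)" for bs :: "('g => complex) list" by (induction bs) auto

text \<open>Evaluating a zero sum at the coroot of its first element \<alpha> gives 2 plus the other
  values, so some other summand has a negative Cartan integer with \<alpha>. Replacing these two by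
  their sum, again a positive root, yields a shorter zero sum.\<close>

lemma Psi_pointed: "pointed \<Psi>" unfolding pointed_def
proof (intro allI impI)
 fix bs assume "set bs <= \<Psi>" "sum_list bs = 0"
 thus "bs = []"
 proof (induction "length bs" arbitrary: bs rule: less_induct)
  case less
  show ?case
  proof (cases bs)
   case (Cons \<alpha> rest)
   have a: "\<alpha> \<in> \<Psi>" and rest: "set rest <= \<Psi>" using less.prems Cons by auto
   let ?h = "coroot \<alpha>"
   have "\<exists>x\<in>set rest. \<exists>n<0. x ?h = of_int n"
   proof (rule ccontr)
    assume no: "\<not> ?thesis"
    have "\<exists>m\<ge>0. sum_list (map (%b. b ?h) rest) = of_int m" using rest no
    proof (induction rest)
     case (Cons x xs)
     obtain n where n: "x ?h = of_int n" using cartan_integer[of \<alpha> x] Psi_Phi a Cons.prems by auto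
     have "n \<ge> 0" using Cons.prems(2) n by (metis list.set_intros(1) not_le)
     moreover obtain m where "m \<ge> 0" "sum_list (map (%b. b ?h) xs) = of_int m" using Cons by auto
     ultimately show ?case using n by (intro exI[of _ "n + m"]) simp
    qed (auto intro: exI[of _ 0])
    then obtain m where m: "m \<ge> 0" "sum_list (map (%b. b ?h) rest) = of_int m" by blast
    have "0 = sum_list bs ?h" using less.prems(2) by simp
    also have "\<dots> = 2 + of_int m" using m root_coroot[OF Psi_Phi[OF a]] by (simp add: Cons sum_list_apply)
    finally have "(of_int (2 + m) :: complex) = of_int 0" by simp
    thus False using m(1) unfolding of_int_eq_iff by simp
   qed
   then obtain x n where x: "x \<in> set rest" "x ?h = of_int n" "n < 0" by blast
   have xP: "x \<in> \<Psi>" using x rest by blast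
   have "x ~= - \<alpha>" using Psi_opposite[OF a] xP by blast
   hence "x + \<alpha> \<in> \<Phi>" by (rule root_add[OF Psi_Phi[OF a] Psi_Phi[OF xP] _ x(2,3)])
   hence xa: "x + \<alpha> \<in> \<Psi>" by (rule Psi_closed[OF xP a])
   define bs' where "bs' = (x + \<alpha>) # remove1 x rest"
   have "length bs' < length bs" using x(1) Cons by (simp add: bs'_def length_remove1) (metis Suc_pred length_pos_if_in_set lessI)
   moreover have "set bs' <= \<Psi>" using xa rest set_remove1_subset[of x rest] by (auto simp: bs'_def)
   moreover have "sum_list bs' = 0" using less.prems(2) Cons sum_list_map_remove1[OF x(1), of "%b. b"] by (simp add: bs'_def algebra_simps)
   ultimately have "bs' = []" by (rule less.hyps)
   thus ?thesis by (simp add: bs'_def)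
  qed simp
 qed
qed

text \<open>This is where maximality of the Borel subalgebra enters. If neither root were positive,
  one of them could be added to the positive roots without losing pointedness, and the resulting
  algebra would be solvable and strictly larger.\<close>

lemma Psi_total: assumes "\<alpha> \<in> \<Phi>" shows "\<alpha> \<in> \<Psi> \<or> - \<alpha> \<in> \<Psi>"
proof (rule ccontr)
 assume no: "\<not> ?thesis"
 have split: "\<exists>cs m. set cs <= \<Psi> \<and> sum_list bs = sum_list cs + of_nat m *\<^sub>C \<delta> \<and> (m = 0 --> bs = cs)"
  if "set bs <= insert \<delta> \<Psi>" for bs \<delta> using that
 proof (induction bs)
  case Nil
  show ?case by (intro exI[of _ "[]"] exI[of _ 0]) simp
 next
  case (Cons b bs)
  from Cons.prems have "set bs <= insert \<delta> \<Psi>" by simp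
  then obtain cs m where c: "set cs <= \<Psi>" "sum_list bs = sum_list cs + of_nat m *\<^sub>C \<delta>" "m = 0 --> bs = cs" using Cons.IH by blast
  show ?case
  proof (cases "b \<in> \<Psi>")
   case True
   thus ?thesis using c by (intro exI[of _ "b # cs"] exI[of _ m]) (auto simp: algebra_simps)
  next
   case False
   hence "b = \<delta>" using Cons.prems by auto
   thus ?thesis using c by (intro exI[of _ cs] exI[of _ "Suc m"]) (simp add: scaleC_add_left algebra_simps)
  qed
 qed
 have pt: "pointed (insert \<alpha> \<Psi>) \<or> pointed (insert (- \<alpha>) \<Psi>)"
 proof (rule ccontr)
  assume np: "\<not> ?thesis"
  have ex: "\<exists>cs m. set cs <= \<Psi> \<and> m > 0 \<and> sum_list cs + of_nat m *\<^sub>C \<delta> = 0"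
   if nb: "\<not> pointed (insert \<delta> \<Psi>)" for \<delta>
  proof -
   obtain bs where bs: "set bs <= insert \<delta> \<Psi>" "sum_list bs = 0" "bs ~= []" using nb unfolding pointed_def by blast
   obtain cs m where c: "set cs <= \<Psi>" "sum_list bs = sum_list cs + of_nat m *\<^sub>C \<delta>" "m = 0 --> bs = cs" using split[OF bs(1)] by blast
   have "m ~= 0" using c bs Psi_pointed unfolding pointed_def by auto
   thus ?thesis using c bs by auto
  qed
  obtain cs m where c: "set cs <= \<Psi>" "m > 0" "sum_list cs + of_nat m *\<^sub>C \<alpha> = 0" using ex np by blast
  obtain ds k where d: "set ds <= \<Psi>" "k > 0" "sum_list ds + of_nat k *\<^sub>C - \<alpha> = 0" using ex np by blast
  have rep: "set (concat (replicate k bs)) <= set bs"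
   "sum_list (concat (replicate k bs)) = of_nat k *\<^sub>C sum_list bs" for k and bs :: "('g => complex) list"
   by (induction k) (auto simp: scaleC_add_left)
  have cs: "sum_list cs = - (of_nat m *\<^sub>C \<alpha>)" using c(3) by (simp add: eq_neg_iff_add_eq_0)
  have ds: "sum_list ds = of_nat k *\<^sub>C \<alpha>" using d(3) by simp
  \<comment> \<open>Repeating the two relations \<open>k\<close> and \<open>m\<close> times cancels
    the multiples of \<alpha>.\<close>
  define l where "l = concat (replicate k cs) @ concat (replicate m ds)"
  have "sum_list l = 0" unfolding l_def sum_list_append rep cs ds by (simp add: scaleC_scaleC mult.commute)
  moreover have "set l <= \<Psi>" using rep(1)[of k cs] rep(1)[of m ds] c d by (auto simp: l_def)
  ultimately have "l = []" using Psi_pointed unfolding pointed_def by blast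
  hence "cs = []" using d(2) by (cases k) (auto simp: l_def)
  hence "of_nat m *\<^sub>C \<alpha> = 0" using c by simp
  thus False using c(2) Phi_nz[OF assms] by simp
 qed
 then obtain \<epsilon> where e: "\<epsilon> = \<alpha> \<or> \<epsilon> = - \<alpha>" "pointed (insert \<epsilon> \<Psi>)" by blast
 have ePhi: "\<epsilon> \<in> \<Phi>" and eP: "\<epsilon> \<notin> \<Psi>" using e assms Phi_uminus no by auto
 \<comment> \<open>All roots among the nonempty sums: this closes the enlarged set under sums that
   are roots, as \<open>pointed_solvable\<close> requires.\<close>
 define X where "X = {\<gamma>\<in>\<Phi>. \<exists>bs. set bs <= insert \<epsilon> \<Psi> \<and> bs ~= [] \<and> \<gamma> = sum_list bs}"
 have inX: "\<gamma> \<in> X" if "\<gamma> \<in> insert \<epsilon> \<Psi>" for \<gamma>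
  using that ePhi Psi_Phi unfolding X_def by (auto intro!: exI[of _ "[\<gamma>]"])
 have exp: "\<exists>cs. set cs <= insert \<epsilon> \<Psi> \<and> sum_list cs = sum_list bs \<and> (bs ~= [] --> cs ~= [])" if "set bs <= X" for bs
  using that
 proof (induction bs)
  case (Cons b bs)
  obtain cs where "set cs <= insert \<epsilon> \<Psi>" "sum_list cs = sum_list bs" using Cons by auto
  moreover obtain ds where "set ds <= insert \<epsilon> \<Psi>" "ds ~= []" "b = sum_list ds" using Cons.prems by (auto simp: X_def)
  ultimately show ?case by (intro exI[of _ "ds @ cs"]) auto
 qed (auto intro: exI[of _ "[]"])
 have "pointed X" unfolding pointed_def
 proof (intro allI impI)
  fix bs assume bs: "set bs <= X" "sum_list bs = 0"
  obtain cs where "set cs <= insert \<epsilon> \<Psi>" "sum_list cs = sum_list bs" "bs ~= [] --> cs ~= []" using exp[OF bs(1)] by blast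
  thus "bs = []" using e(2) bs(2) unfolding pointed_def by auto
 qed
 moreover have "\<beta> + \<gamma> \<in> X" if "\<beta> \<in> X" "\<gamma> \<in> X" "\<beta> + \<gamma> \<in> \<Phi>" for \<beta> \<gamma>
  using exp[of "[\<beta>, \<gamma>]"] that by (auto simp: X_def)
 moreover have "X <= \<Phi>" by (auto simp: X_def)
 ultimately have sol: "lie_subalgebra (root_alg X)" "solvable (root_alg X)" using pointed_solvable by blast+
 have "root_alg \<Psi> <= root_alg X" unfolding root_alg_def by (rule span_mono) (use inX in blast)
 hence "B <= root_alg X" by (rule ord_eq_le_trans[OF B_eq])
 hence "root_alg X = B" using B_max sol by blast
 moreover have "gsp \<epsilon> <= root_alg X" unfolding root_alg_def using inX[of \<epsilon>] by (intro subsetI span_base) blast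
 ultimately have "\<epsilon> \<in> \<Psi>" using ePhi by (simp add: pos_roots_def)
 thus False using eP by blast
qed

section \<open>The positive cone, simple roots and heights\<close>

definition Qp :: "('g => complex) set" where
 "Qp = {sum_list bs | bs. set bs <= \<Psi>}"

lemma Qp_0: "0 \<in> Qp" unfolding Qp_def by (auto intro!: exI[of _ "[]"])

lemma Qp_Psi: "\<beta> \<in> \<Psi> ==> \<beta> \<in> Qp" unfolding Qp_def by (auto intro!: exI[of _ "[\<beta>]"])

lemma Qp_add: "\<beta> \<in> Qp ==> \<gamma> \<in> Qp ==> \<beta> + \<gamma> \<in> Qp"
 unfolding Qp_def by clarify (metis set_append Un_least sum_list_append)

lemma Qp_pointed: "\<gamma> \<in> Qp ==> - \<gamma> \<in> Qp ==> \<gamma> = 0"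
proof -
 assume "\<gamma> \<in> Qp" "- \<gamma> \<in> Qp"
 then obtain bs cs where bc: "set bs <= \<Psi>" "set cs <= \<Psi>" "\<gamma> = sum_list bs" "- \<gamma> = sum_list cs" unfolding Qp_def by blast
 hence "sum_list (bs @ cs) = 0" by (metis add.right_inverse sum_list_append)
 moreover have "set (bs @ cs) <= \<Psi>" using bc by simp
 ultimately have "bs @ cs = []" using Psi_pointed unfolding pointed_def by blast
 thus ?thesis using bc by simp
qed

lemma Qp_dual: "\<gamma> \<in> Qp ==> \<gamma> \<in> dual H"
proof -
 have "set bs <= \<Psi> ==> sum_list bs \<in> dual H" for bs
  by (induction bs) (auto simp: dual_closed(1) intro!: dual_closed(2) intro: Phi_dual Psi_Phi)
 thus "\<gamma> \<in> Qp ==> \<gamma> \<in> dual H" by (auto simp: Qp_def)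
qed

lemma root_Qp: "\<gamma> \<in> \<Phi> ==> \<gamma> \<in> Qp ==> \<gamma> \<in> \<Psi>" using Psi_total[of \<gamma>] Qp_Psi Qp_pointed Phi_nz by blast

definition \<Delta> :: "('g => complex) set" where
 "\<Delta> = {\<alpha>\<in>\<Psi>. \<not> (\<exists>\<beta>\<in>\<Psi>. \<exists>\<gamma>\<in>\<Psi>. \<alpha> = \<beta> + \<gamma>)}"

lemma Delta_Psi: "\<alpha> \<in> \<Delta> ==> \<alpha> \<in> \<Psi>" by (simp add: \<Delta>_def)

lemma Delta_Phi: "\<alpha> \<in> \<Delta> ==> \<alpha> \<in> \<Phi>" using Delta_Psi Psi_Phi by blast

lemma Delta_minus: "\<alpha> \<in> \<Delta> ==> \<beta> \<in> \<Psi> ==> \<beta> - \<alpha> \<in> \<Phi> ==> \<beta> - \<alpha> \<in> \<Psi>"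
proof (rule ccontr)
 assume a: "\<alpha> \<in> \<Delta>" "\<beta> \<in> \<Psi>" "\<beta> - \<alpha> \<in> \<Phi>" "\<beta> - \<alpha> \<notin> \<Psi>"
 hence "\<alpha> - \<beta> \<in> \<Psi>" using Psi_total[of "\<beta> - \<alpha>"] by simp
 moreover have "\<alpha> = \<beta> + (\<alpha> - \<beta>)" by simp
 ultimately show False using a unfolding \<Delta>_def by blast
qed

text \<open>Subtracting \<alpha> step by step never leaves the positive roots, since a simple root
  is not a sum of two positive ones; adding multiples of \<alpha> stays in the positive
  cone.\<close>

lemma simple_reflection_Psi:
 assumes a: "\<alpha> \<in> \<Delta>" and b: "\<beta> \<in> \<Psi>" "\<beta> ~= \<alpha>"
 shows "\<beta> - \<beta> (coroot \<alpha>) *\<^sub>C \<alpha> \<in> \<Psi> - {\<alpha>}"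
proof -
 have aP: "\<alpha> \<in> \<Phi>" and bP: "\<beta> \<in> \<Phi>" using a b Delta_Phi Psi_Phi by auto
 have b2: "\<beta> ~= - \<alpha>" using Psi_opposite[OF Delta_Psi[OF a]] b by blast
 obtain n where n: "\<beta> (coroot \<alpha>) = of_int n" using cartan_integer[OF aP bP] by blast
 have "\<beta> - of_int n *\<^sub>C \<alpha> \<in> \<Psi>"
 proof (cases "n \<ge> 0")
  case True
  have "\<beta> - of_nat j *\<^sub>C \<alpha> \<in> \<Psi>" if "int j \<le> n" for j using that
  proof (induction j)
   case 0 thus ?case using b by simp
  next
   case (Suc j)
   have eq: "\<beta> - of_nat (Suc j) *\<^sub>C \<alpha> = (\<beta> - of_nat j *\<^sub>C \<alpha>) - \<alpha>" by (simp add: scaleC_add_left)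
   have "\<beta> - of_int (int (Suc j)) *\<^sub>C \<alpha> \<in> \<Phi>" by (rule root_minus_multiple[OF aP bP b(2) b2 n]) (use Suc.prems in auto)
   hence Phi: "(\<beta> - of_nat j *\<^sub>C \<alpha>) - \<alpha> \<in> \<Phi>" using eq by (simp only: of_int_of_nat_eq)
   have "\<beta> - of_nat j *\<^sub>C \<alpha> \<in> \<Psi>" by (rule Suc.IH) (use Suc.prems in linarith)
   thus ?case unfolding eq by (rule Delta_minus[OF a _ Phi])
  qed
  from this[of "nat n"] show ?thesis using True by (simp add: of_nat_nat)
 next
  case False
  have "\<beta> - of_int n *\<^sub>C \<alpha> \<in> \<Phi>" by (rule root_minus_multiple[OF aP bP b(2) b2 n]) (use False in auto)
  moreover have "\<beta> - of_int n *\<^sub>C \<alpha> = sum_list (\<beta> # replicate (nat (- n)) \<alpha>)"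
  proof -
   have "sum_list (replicate k \<alpha>) = of_nat k *\<^sub>C \<alpha>" for k by (induction k) (simp_all add: scaleC_add_left)
   moreover have "(of_nat (nat (- n)) :: complex) = - of_int n" using False by simp
   ultimately show ?thesis by (simp only: sum_list.Cons) simp
  qed
  hence "\<beta> - of_int n *\<^sub>C \<alpha> \<in> Qp"
   unfolding Qp_def using b Delta_Psi[OF a] by (auto intro!: exI[of _ "\<beta> # replicate (nat (- n)) \<alpha>"])
  ultimately show ?thesis by (rule root_Qp)
 qed
 moreover have "\<beta> - of_int n *\<^sub>C \<alpha> ~= \<alpha>"
 proof
  assume "\<beta> - of_int n *\<^sub>C \<alpha> = \<alpha>"
  hence "\<beta> = of_int (n + 1) *\<^sub>C \<alpha>" by (simp add: scaleC_add_left algebra_simps)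
  thus False using multiple_pm1[OF aP bP] b b2 by blast
 qed
 ultimately show ?thesis unfolding n by simp
qed

text \<open>Induction on the number of positive roots below \<beta> in the order given by
  \<open>Qp\<close>; heights become available only through this lemma.\<close>

lemma Psi_simple_sum:
 assumes "\<beta> \<in> \<Psi>" shows "\<exists>bs. set bs <= \<Delta> \<and> bs ~= [] \<and> \<beta> = sum_list bs" using assms
proof (induction "card {\<delta>\<in>\<Psi>. \<beta> - \<delta> \<in> Qp}" arbitrary: \<beta> rule: less_induct)
 case less
 show ?case
 proof (cases "\<beta> \<in> \<Delta>")
  case True
  thus ?thesis by (intro exI[of _ "[\<beta>]"]) simp
 next
  case False
  then obtain b1 b2 where b: "b1 \<in> \<Psi>" "b2 \<in> \<Psi>" "\<beta> = b1 + b2" using less.prems by (auto simp: \<Delta>_def)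
  have small: "card {\<delta>\<in>\<Psi>. b1 - \<delta> \<in> Qp} < card {\<delta>\<in>\<Psi>. \<beta> - \<delta> \<in> Qp}"
   if b: "b1 \<in> \<Psi>" "b2 \<in> \<Psi>" "\<beta> = b1 + b2" for b1 b2
  proof (rule psubset_card_mono)
   show "finite {\<delta>\<in>\<Psi>. \<beta> - \<delta> \<in> Qp}" using finite_Psi by simp
   have "b1 - \<delta> \<in> Qp ==> \<beta> - \<delta> \<in> Qp" for \<delta>
    using Qp_add[of "b1 - \<delta>" b2] Qp_Psi[OF b(2)] unfolding b(3) by (simp add: algebra_simps)
   moreover have "b1 - \<beta> \<notin> Qp" using Qp_pointed[OF Qp_Psi[OF b(2)]] Phi_nz[OF Psi_Phi[OF b(2)]] unfolding b(3) by auto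
   moreover have "\<beta> - \<beta> \<in> Qp" using Qp_0 by simp
   ultimately show "{\<delta>\<in>\<Psi>. b1 - \<delta> \<in> Qp} \<subset> {\<delta>\<in>\<Psi>. \<beta> - \<delta> \<in> Qp}" using less.prems by blast
  qed
  obtain bs where bs: "set bs <= \<Delta>" "bs ~= []" "b1 = sum_list bs" using less.hyps[OF small[OF b] b(1)] by blast
  have "\<beta> = b2 + b1" using b(3) by (simp add: add.commute)
  then obtain cs where cs: "set cs <= \<Delta>" "cs ~= []" "b2 = sum_list cs" using less.hyps[OF small[OF b(2,1)] b(2)] by blast
  show ?thesis using bs cs b by (intro exI[of _ "bs @ cs"]) simp
 qed
qed

definition srefl :: "('g => complex) => ('g => complex) => ('g => complex)" where
 "srefl \<alpha> \<beta> = \<beta> - \<beta> (coroot \<alpha>) *\<^sub>C \<alpha>"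

lemma srefl_apply: "srefl \<alpha> \<beta> x = \<beta> x - \<beta> (coroot \<alpha>) * \<alpha> x"
 by (simp add: srefl_def scaleC_fun_apply scaleC_complex)

lemma srefl_coroot: "\<alpha> \<in> \<Phi> ==> srefl \<alpha> \<beta> (coroot \<alpha>) = - \<beta> (coroot \<alpha>)"
 by (simp add: srefl_apply root_coroot)

lemma srefl_srefl: "\<alpha> \<in> \<Phi> ==> srefl \<alpha> (srefl \<alpha> \<beta>) = \<beta>" by (simp add: fun_eq_iff srefl_apply root_coroot)

lemma srefl_Psi: "\<alpha> \<in> \<Delta> ==> \<beta> \<in> \<Psi> - {\<alpha>} ==> srefl \<alpha> \<beta> \<in> \<Psi> - {\<alpha>}"
 unfolding srefl_def using simple_reflection_Psi by blast

lemma srefl_sum: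
 assumes "\<alpha> \<in> \<Delta>"
 shows "(\<Sum>\<beta>\<in>\<Psi> - {\<alpha>}. f (srefl \<alpha> \<beta>)) = (\<Sum>\<beta>\<in>\<Psi> - {\<alpha>}. f \<beta>)"
 by (rule sum.reindex_bij_witness[of _ "srefl \<alpha>" "srefl \<alpha>"])
  (use srefl_Psi[OF assms] srefl_srefl[OF Delta_Phi[OF assms]] in auto)

text \<open>The simple reflection permutes the positive roots other than \<alpha> and negates their
  values at the coroot, so these cancel.\<close>

lemma sum_Psi_coroot:
 assumes a: "\<alpha> \<in> \<Delta>" shows "(\<Sum>\<beta>\<in>\<Psi>. \<beta> (coroot \<alpha>)) = 2"
proof -
 have "(\<Sum>\<beta>\<in>\<Psi> - {\<alpha>}. \<beta> (coroot \<alpha>)) = (\<Sum>\<beta>\<in>\<Psi> - {\<alpha>}. - \<beta> (coroot \<alpha>))"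
  using srefl_sum[OF a, of "%\<beta>. \<beta> (coroot \<alpha>)"] srefl_coroot[OF Delta_Phi[OF a]] by simp
 hence "(\<Sum>\<beta>\<in>\<Psi> - {\<alpha>}. \<beta> (coroot \<alpha>)) = 0" by (simp add: sum_negf eq_neg_iff_add_eq_0)
 thus ?thesis using sum.remove[OF finite_Psi Delta_Psi[OF a], of "%\<beta>. \<beta> (coroot \<alpha>)"] root_coroot[OF Delta_Phi[OF a]] by simp
qed

lemma tv_srefl:
 assumes "\<alpha> \<in> \<Phi>" "\<beta> \<in> repr"
 shows "tv (srefl \<alpha> \<beta>) = tv \<beta> - \<beta> (coroot \<alpha>) *\<^sub>C tv \<alpha>"
proof -
 have "srefl \<alpha> \<beta> = \<beta> + (- \<beta> (coroot \<alpha>)) *\<^sub>C \<alpha>" by (simp add: srefl_def)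
 thus ?thesis using tv_add[OF assms(2) conjunct1[OF tv_scale[OF Phi_repr[OF assms(1)]]], of "- \<beta> (coroot \<alpha>)"]
   tv_scale[OF Phi_repr[OF assms(1)], of "- \<beta> (coroot \<alpha>)"] by simp
qed

lemma root_coroot_srefl:
 assumes a: "\<alpha> \<in> \<Phi>" and b: "\<beta> \<in> \<Phi>" shows "\<alpha> (coroot (srefl \<alpha> \<beta>)) = - \<alpha> (coroot \<beta>)"
proof -
 let ?c = "\<beta> (coroot \<alpha>)" and ?s = "srefl \<alpha> \<beta>"
 have sPhi: "?s \<in> \<Phi>" using reflect_root[OF a b] by (simp add: srefl_def)
 have tH: "tv \<alpha> \<in> H" "tv \<beta> \<in> H" using tv(1) Phi_repr a b by auto
 have c: "?c * \<alpha> (tv \<alpha>) = 2 * \<beta> (tv \<alpha>)" using dual_coroot[OF Phi_dual[OF b] a] root_tv_nonzero[OF a] by simp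
 have sym: "\<alpha> (tv \<beta>) = \<beta> (tv \<alpha>)" using tv_symmetric Phi_repr a b by blast
 have lin: "\<gamma> (tv ?s) = \<gamma> (tv \<beta>) - ?c * \<gamma> (tv \<alpha>)" if "\<gamma> \<in> \<Phi>" for \<gamma>
 proof -
  have "tv ?s = tv \<beta> + (- ?c) *\<^sub>C tv \<alpha>" using tv_srefl[OF a Phi_repr[OF b]] by simp
  thus ?thesis using H_dual_linear(1)[OF Phi_dual[OF that] tH(2), of "(- ?c) *\<^sub>C tv \<alpha>"]
    H_dual_linear(2)[OF Phi_dual[OF that] tH(1), of "- ?c"]
    subspace_scale[OF H_sub tH(1), of "- ?c"] by simp
 qed
 have 1: "\<alpha> (tv ?s) = - \<alpha> (tv \<beta>)" using lin[OF a] c sym by simp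
 have "?s (tv ?s) = (\<beta> (tv \<beta>) - ?c * \<beta> (tv \<alpha>)) - ?c * (\<alpha> (tv \<beta>) - ?c * \<alpha> (tv \<alpha>))"
  by (simp only: srefl_apply lin[OF a] lin[OF b])
 also have "\<dots> = \<beta> (tv \<beta>)" unfolding c sym by (simp add: algebra_simps)
 finally have 2: "?s (tv ?s) = \<beta> (tv \<beta>)" .
 show ?thesis using dual_coroot[OF Phi_dual[OF a] sPhi] dual_coroot[OF Phi_dual[OF a] b] 1 2 by simp
qed

lemma dual_sum: "\<beta> \<in> dual H ==> (!!i. i \<in> I ==> x i \<in> H) ==> \<beta> (\<Sum>i\<in>I. x i) = (\<Sum>i\<in>I. \<beta> (x i))"
proof (induction I rule: infinite_finite_induct)
 case (insert i I)
 thus ?case using H_dual_linear(1)[OF insert.prems(1), of "x i" "sum x I"]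
  subspace_sum[OF H_sub, of I x] by simp
qed (use H_dual_linear(2)[of \<beta> 0 0] subspace_0[OF H_sub] in simp_all)

text \<open>Twice the half sum of the positive coroots. Every simple root has the value 2 on it, so
  evaluation at \<open>Hel\<close> is twice the height.\<close>

definition Hel :: 'g where "Hel = (\<Sum>\<beta>\<in>\<Psi>. coroot \<beta>)"

lemma Hel_H: "Hel \<in> H" and Hel_derived: "Hel \<in> derived" unfolding Hel_def
 by (intro subspace_sum H_sub brk_span_subspace coroot_H coroot_derived Psi_Phi; assumption)+

lemma simple_Hel: assumes a: "\<alpha> \<in> \<Delta>" shows "\<alpha> Hel = 2"
proof -
 have "(\<Sum>\<beta>\<in>\<Psi> - {\<alpha>}. \<alpha> (coroot \<beta>)) = (\<Sum>\<beta>\<in>\<Psi> - {\<alpha>}. \<alpha> (coroot (srefl \<alpha> \<beta>)))"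
  by (rule srefl_sum[OF a, symmetric])
 also have "\<dots> = (\<Sum>\<beta>\<in>\<Psi> - {\<alpha>}. - \<alpha> (coroot \<beta>))"
  by (intro sum.cong refl root_coroot_srefl Delta_Phi[OF a]) (use Psi_Phi in blast)
 finally have "(\<Sum>\<beta>\<in>\<Psi> - {\<alpha>}. \<alpha> (coroot \<beta>)) = 0" by (simp add: sum_negf eq_neg_iff_add_eq_0)
 moreover have "\<alpha> Hel = (\<Sum>\<beta>\<in>\<Psi>. \<alpha> (coroot \<beta>))"
  unfolding Hel_def by (rule dual_sum[OF Phi_dual[OF Delta_Phi[OF a]]]) (use coroot_H Psi_Phi in blast)
 ultimately show ?thesis using sum.remove[OF finite_Psi Delta_Psi[OF a], of "%\<beta>. \<alpha> (coroot \<beta>)"] root_coroot[OF Delta_Phi[OF a]]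
  by simp
qed

lemma Qp_ht: "\<gamma> \<in> Qp ==> \<exists>n. \<gamma> Hel = of_nat n \<and> (n = 0 --> \<gamma> = 0)"
proof -
 have simple: "set bs <= \<Delta> ==> sum_list bs Hel = of_nat (2 * length bs)" for bs by (induction bs) (auto simp: simple_Hel)
 have pos: "\<exists>n. \<beta> Hel = of_nat (Suc n)" if b: "\<beta> \<in> \<Psi>" for \<beta>
 proof -
  obtain bs where bs: "set bs <= \<Delta>" "bs ~= []" "\<beta> = sum_list bs" using Psi_simple_sum[OF b] by blast
  obtain m where m: "length bs = Suc m" using bs(2) by (cases bs) auto
  have "\<beta> Hel = of_nat (Suc (Suc (2 * m)))" unfolding bs(3) simple[OF bs(1)] m by simp
  thus ?thesis by blast
 qed
 have "set bs <= \<Psi> ==> \<exists>n. sum_list bs Hel = of_nat n \<and> (n = 0 --> bs = [])" for bs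
 proof (induction bs)
  case (Cons b bs)
  obtain n where n: "b Hel = of_nat (Suc n)" using pos[of b] Cons.prems by auto
  obtain m where m: "sum_list bs Hel = of_nat m" using Cons by auto
  show ?case using n m by (intro exI[of _ "Suc n + m"]) simp
 qed (auto intro: exI[of _ 0])
 thus "\<gamma> \<in> Qp ==> \<exists>n. \<gamma> Hel = of_nat n \<and> (n = 0 --> \<gamma> = 0)" unfolding Qp_def by fastforce
qed

abbreviation "\<rho>0 \<equiv> half_sum H B"

lemma rho_dual: "\<rho>0 \<in> dual H"
proof -
 have "(\<Sum>\<beta>\<in>A. \<beta>) \<in> dual H" if "A <= \<Psi>" "finite A" for A
  using that(2,1) by (induction A rule: finite_induct) (auto simp: dual_closed(1) intro!: dual_closed(2) intro: Phi_dual Psi_Phi)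
 hence "(%x. (1/2) * (\<Sum>\<beta>\<in>\<Psi>. \<beta>) x) \<in> dual H" by (intro dual_closed(5)) (simp add: finite_Psi)
 thus ?thesis by (simp add: half_sum_def sum_fun_apply)
qed

lemma rho_coroot: "\<alpha> \<in> \<Delta> ==> \<rho>0 (coroot \<alpha>) = 1" by (simp add: half_sum_def sum_Psi_coroot)


subsection \<open>The group generated by the simple reflections\<close>

text \<open>The simple reflection extended to the whole algebra. It fixes the center and the root
  spaces, so its composites act on linear functionals of the algebra and not just on functions on
  \<open>H\<close>.\<close>

definition hrefl :: "('g => complex) => 'g => 'g" where
 "hrefl \<alpha> x = x - killing (tv \<alpha>) x *\<^sub>C coroot \<alpha>"

inductive_set G :: "('g => 'g) set" where
 G_id: "id \<in> G"
| G_step: "g \<in> G ==> \<alpha> \<in> \<Delta> ==> g \<circ> hrefl \<alpha> \<in> G"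

lemma hrefl_linear: "clinear (hrefl \<alpha>)" unfolding hrefl_def
 by (intro clinearI) (simp_all add: killing_simps scaleC_add_left scale_right_diff_distrib scaleC_scaleC)

lemma hrefl_H: "\<alpha> \<in> \<Delta> ==> x \<in> H ==> hrefl \<alpha> x \<in> H"
 unfolding hrefl_def using coroot_H[OF Delta_Phi] subspace_diff[OF H_sub]
  subspace_scale[OF H_sub] by blast

lemma killing_tv_coroot: "\<alpha> \<in> \<Phi> ==> killing (tv \<alpha>) (coroot \<alpha>) = 2" using tv(3)[OF Phi_repr coroot_H] root_coroot by simp

lemma hrefl_hrefl: "\<alpha> \<in> \<Delta> ==> hrefl \<alpha> (hrefl \<alpha> x) = x" using killing_tv_coroot[OF Delta_Phi]
 by (simp add: hrefl_def killing_simps scaleC_add_left scale_left_diff_distrib)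

lemma dual_hrefl:
 assumes "\<alpha> \<in> \<Delta>" "\<xi> \<in> dual H" "x \<in> H" shows "\<xi> (hrefl \<alpha> x) = reflection H \<alpha> \<xi> x"
proof -
 have "hrefl \<alpha> x = x + (- \<alpha> x) *\<^sub>C coroot \<alpha>"
  using tv(3)[OF Phi_repr[OF Delta_Phi[OF assms(1)]] assms(3)] by (simp add: hrefl_def)
 thus ?thesis using H_dual_linear(1)[OF assms(2,3), of "(- \<alpha> x) *\<^sub>C coroot \<alpha>"]
   H_dual_linear(2)[OF assms(2) coroot_H[OF Delta_Phi[OF assms(1)]], of "- \<alpha> x"]
   subspace_scale[OF H_sub coroot_H[OF Delta_Phi[OF assms(1)]], of "- \<alpha> x"]
  by (simp add: reflection_eq[OF assms(2) Delta_Phi[OF assms(1)]] scaleC_fun_apply scaleC_complex)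
qed

lemma G_linear: "g \<in> G ==> clinear g"
proof (induction rule: G.induct)
 case G_id thus ?case using clinear_id by (simp add: id_def)
next
 case (G_step g \<alpha>)
 thus ?case using clinear_compose[OF G_step.IH hrefl_linear[of \<alpha>]] by (simp add: comp_def)
qed

lemma G_H: "g \<in> G ==> x \<in> H ==> g x \<in> H" by (induction arbitrary: x rule: G.induct) (auto simp: hrefl_H)

lemma G_left: "g \<in> G ==> \<alpha> \<in> \<Delta> ==> hrefl \<alpha> \<circ> g \<in> G"
proof (induction rule: G.induct)
 case G_id
 thus ?case using G.G_step[OF G.G_id] by simp
next
 case (G_step g \<beta>)
 have "(hrefl \<alpha> \<circ> g) \<circ> hrefl \<beta> \<in> G" by (rule G.G_step[OF G_step.IH[OF G_step.prems] G_step.hyps(2)])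
 thus ?case by (simp only: comp_assoc)
qed

text \<open>Otherwise some functional vanishes on all \<open>tv \<beta>\<close> and on the center
  but not at \<open>x\<close>. Killing duality represents it, as far as values on \<open>H\<close>
  matter, by an element of \<open>H\<close> on which all roots vanish. This element is central and
  pairs to 0 with \<open>x\<close>.\<close>

lemma H_span: assumes "x \<in> H" shows "\<exists>t\<in>cspan (tv ` \<Phi>). x - t \<in> krad"
proof -
 have key: "\<exists>y0\<in>H. \<forall>z\<in>H. killing z y = killing z y0" for y
 proof -
  have "y \<in> cspan (H \<union> (\<Union>\<beta>\<in>\<Phi>. gsp \<beta>))" using root_space_decomposition_UNIV by blast
  thus ?thesis
  proof (induction rule: span_induct_alt)
   case base
   show ?case using subspace_0[OF H_sub] by blast
  next
   case (step c x y)
   then obtain y0 where y0: "y0 \<in> H" "!!z. z \<in> H ==> killing z y = killing z y0" by blast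
   show ?case
   proof (cases "x \<in> H")
    case True
    thus ?thesis using y0 subspace_add[OF H_sub subspace_scale[OF H_sub True, of c]]
     by (intro bexI[of _ "c *\<^sub>C x + y0"]) (auto simp: killing_simps)
   next
    case False
    then obtain \<beta> where b: "\<beta> \<in> \<Phi>" "x \<in> gsp \<beta>" using step.hyps by blast
    have "killing z x = 0" if "z \<in> H" for z using killing_gsp[of z 0 x \<beta>] that root_space_0 b dual_closed(1) Phi_dual Phi_nz by simp
    thus ?thesis using y0 by (intro bexI[of _ y0]) (auto simp: killing_simps)
   qed
  qed
 qed
 have k: "csubspace (krad :: 'g set)" by (rule krad_subspace[OF fd])
 let ?W = "{t + z | t z. t \<in> cspan (tv ` \<Phi>) \<and> z \<in> krad}"
 have W: "csubspace ?W" by (rule complex_vector.subspace_sums[OF subspace_span k])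
 have inW: "t \<in> ?W" "z \<in> ?W" if "t \<in> cspan (tv ` \<Phi>)" "z \<in> krad" for t z
  using that span_zero[of "tv ` \<Phi>"] subspace_0[OF k] by force+
 have "x \<in> ?W"
 proof (rule ccontr)
  assume "x \<notin> ?W"
  then obtain \<theta> where th: "clinear \<theta>" "\<theta> x = (1::complex)" "!!w. w \<in> ?W ==> \<theta> w = 0"
   by (rule clinear_zero_outside[OF W]) (rule that; assumption)
  obtain d where d: "!!y. killing d y = \<theta> y" using riesz[OF th(1)] th(3)[OF inW(2)[OF span_zero]] by metis
  obtain y0 where y0: "y0 \<in> H" "!!z. z \<in> H ==> killing z d = killing z y0" using key by blast
  have "\<beta> y0 = 0" if "\<beta> \<in> \<Phi>" for \<beta>
   using tv(1,3)[OF Phi_repr[OF that]] y0 d[of "tv \<beta>"] ksym[of d "tv \<beta>"] th(3)[OF inW(1)[OF span_base subspace_0[OF k]]] that by auto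
  hence "y0 \<in> krad" by (rule krad_if_roots_vanish[OF y0(1)])
  thus False using y0(2)[OF assms] krad_killing0 d[of x] th(2) ksym[of d x] by simp
 qed
 then obtain t z where "x = t + z" "t \<in> cspan (tv ` \<Phi>)" "z \<in> krad" by blast
 thus ?thesis by (intro bexI[of _ t]) simp_all
qed

lemma hrefl_tv: assumes a: "\<alpha> \<in> \<Delta>" and b: "\<beta> \<in> repr" "\<beta> \<in> dual H" shows "hrefl \<alpha> (tv \<beta>) = tv (srefl \<alpha> \<beta>)"
proof -
 note aP = Delta_Phi[OF a]
 have "killing (tv \<alpha>) (tv \<beta>) = \<beta> (tv \<alpha>)"
  using tv(3)[OF Phi_repr[OF aP] tv(1)[OF b(1)]] tv_symmetric[OF b(1) Phi_repr[OF aP]] by simp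
 hence "killing (tv \<alpha>) (tv \<beta>) *\<^sub>C coroot \<alpha> = \<beta> (coroot \<alpha>) *\<^sub>C tv \<alpha>"
  using dual_coroot[OF b(2) aP] by (simp add: coroot_def scaleC_scaleC mult.commute)
 thus ?thesis by (simp add: hrefl_def tv_srefl[OF aP b(1)])
qed

lemma srefl_Phi: "\<alpha> \<in> \<Phi> ==> \<beta> \<in> \<Phi> ==> srefl \<alpha> \<beta> \<in> \<Phi>" unfolding srefl_def by (rule reflect_root)

lemma G_tv: "g \<in> G ==> \<beta> \<in> \<Phi> ==> \<exists>\<gamma>\<in>\<Phi>. g (tv \<beta>) = tv \<gamma>"
 by (induction arbitrary: \<beta> rule: G.induct) (auto simp: hrefl_tv srefl_Phi Delta_Phi Phi_repr Phi_dual)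

lemma G_fix:
 assumes "g \<in> G" shows "z \<in> krad ==> g z = z" "\<beta> \<in> \<Phi> ==> z \<in> gsp \<beta> ==> g z = z"
proof -
 show "z \<in> krad ==> g z = z" using assms by (induction rule: G.induct) (auto simp: hrefl_def krad_killing0)
 have 0: "hrefl \<alpha> z = z" if "\<alpha> \<in> \<Delta>" "\<beta> \<in> \<Phi>" "z \<in> gsp \<beta>" for \<alpha>
  using killing_gsp[of "tv \<alpha>" 0 z \<beta>] that tv(1)[OF Phi_repr[OF Delta_Phi[OF that(1)]]]
   root_space_0 dual_closed(1) Phi_dual Phi_nz by (simp add: hrefl_def)
 show "\<beta> \<in> \<Phi> ==> z \<in> gsp \<beta> ==> g z = z" using assms by (induction rule: G.induct) (auto simp: 0)
qed

text \<open>An element of \<open>G\<close> maps the finite set of the \<open>tv \<beta>\<close> into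
  itself and fixes the center and the root spaces, so its restriction to that set determines
  it.\<close>

lemma finite_G: "finite G"
proof -
 have "inj_on (%g. restrict g (tv ` \<Phi>)) G"
 proof (rule inj_onI, rule ext)
  fix g g' x assume g: "g \<in> G" "g' \<in> G" "restrict g (tv ` \<Phi>) = restrict g' (tv ` \<Phi>)"
  have tveq: "g t = g' t" if "t \<in> tv ` \<Phi>" for t using fun_cong[OF g(3), of t] that by simp
  have span: "g t = g' t" if "t \<in> cspan (tv ` \<Phi>)" for t by (rule clinear_eq_on_span[OF G_linear[OF g(1)] G_linear[OF g(2)] tveq that])
  show "g x = g' x"
  proof (rule clinear_eq_on_span[OF G_linear[OF g(1)] G_linear[OF g(2)]])
   show "x \<in> cspan (H \<union> (\<Union>\<beta>\<in>\<Phi>. gsp \<beta>))" using root_space_decomposition_UNIV by blast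
   fix y assume "y \<in> H \<union> (\<Union>\<beta>\<in>\<Phi>. gsp \<beta>)"
   thus "g y = g' y"
   proof
    assume "y \<in> H"
    then obtain t where t: "t \<in> cspan (tv ` \<Phi>)" "y - t \<in> krad" using H_span by blast
    have "g ((y - t) + t) = g' ((y - t) + t)" unfolding clinear_add[OF G_linear[OF g(1)]] clinear_add[OF G_linear[OF g(2)]]
     using span[OF t(1)] G_fix(1)[OF g(1) t(2)] G_fix(1)[OF g(2) t(2)] by simp
    thus ?thesis by simp
   next
    assume "y \<in> (\<Union>\<beta>\<in>\<Phi>. gsp \<beta>)"
    thus ?thesis using G_fix(2)[OF g(1)] G_fix(2)[OF g(2)] by auto
   qed
  qed
 qed
 moreover have "(%g. restrict g (tv ` \<Phi>)) ` G <= (\<Pi>\<^sub>E t\<in>tv ` \<Phi>. tv ` \<Phi>)" using G_tv by fastforce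
 ultimately show ?thesis using finite_roots finite_PiE[of "tv ` \<Phi>" "%_. tv ` \<Phi>"] finite_subset finite_imageD by blast
qed

lemma G_bij_left: "\<alpha> \<in> \<Delta> ==> bij_betw (%g. hrefl \<alpha> \<circ> g) G G"
 by (rule bij_betw_byWitness[where f' = "%g. hrefl \<alpha> \<circ> g"]) (use G_left hrefl_hrefl in \<open>auto simp: fun_eq_iff\<close>)

lemma G_weyl:
 assumes "g \<in> G"
 shows "\<exists>w\<in>weyl_group H. \<forall>\<xi>\<in>dual H. w \<xi> \<in> dual H \<and> (\<forall>x\<in>H. w \<xi> x = \<xi> (g x))" using assms
proof (induction rule: G.induct)
 case G_id
 show ?case by (intro bexI[of _ id] weyl_group.weyl_id) simp
next
 case (G_step g \<alpha>)
 then obtain w where w: "w \<in> weyl_group H" "!!\<xi>. \<xi> \<in> dual H ==> w \<xi> \<in> dual H"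
  "!!\<xi> x. \<xi> \<in> dual H ==> x \<in> H ==> w \<xi> x = \<xi> (g x)" by blast
 have "reflection H \<alpha> \<circ> w \<in> weyl_group H" by (rule weyl_group.weyl_refl[OF w(1) Delta_Phi[OF G_step.hyps(2)]])
 moreover have "(reflection H \<alpha> \<circ> w) \<xi> \<in> dual H \<and> (\<forall>x\<in>H. (reflection H \<alpha> \<circ> w) \<xi> x = \<xi> ((g \<circ> hrefl \<alpha>) x))"
  if xi: "\<xi> \<in> dual H" for \<xi>
 proof
  show "(reflection H \<alpha> \<circ> w) \<xi> \<in> dual H" using w(2)[OF xi] Phi_dual[OF Delta_Phi[OF G_step.hyps(2)]]
   by (simp only: o_apply reflection_eq[OF w(2)[OF xi] Delta_Phi[OF G_step.hyps(2)]] dual_closed(3) dual_scaleC)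
  show "\<forall>x\<in>H. (reflection H \<alpha> \<circ> w) \<xi> x = \<xi> ((g \<circ> hrefl \<alpha>) x)"
  proof
   fix x assume x: "x \<in> H"
   have "(reflection H \<alpha> \<circ> w) \<xi> x = w \<xi> (hrefl \<alpha> x)" using dual_hrefl[OF G_step.hyps(2) w(2)[OF xi] x] by simp
   thus "(reflection H \<alpha> \<circ> w) \<xi> x = \<xi> ((g \<circ> hrefl \<alpha>) x)" using w(3)[OF xi hrefl_H[OF G_step.hyps(2) x]] by simp
  qed
 qed
 ultimately show ?case by blast
qed

end

section \<open>A Poincare-Birkhoff-Witt theorem for induced modules\<close>

definition ext :: "('k => 'v::complex_vector => 'w::complex_vector) => ('k \<Rightarrow>\<^sub>0 'v) => 'w" where
 "ext F p = (\<Sum>k\<in>Poly_Mapping.keys p. F k (Poly_Mapping.lookup p k))"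

lemma ext_superset:
 assumes "!!k. F k 0 = 0" "finite A" "Poly_Mapping.keys p <= A" shows "ext F p = (\<Sum>k\<in>A. F k (Poly_Mapping.lookup p k))"
 unfolding ext_def using assms by (intro sum.mono_neutral_left) (auto simp: in_keys_iff)

lemma ext_single: assumes "F k 0 = 0" shows "ext F (Poly_Mapping.single k v) = F k v" using assms by (cases "v = 0") (simp_all add: ext_def)

lemma ext_linear:
 fixes F :: "'k => 'v::complex_vector => 'w::complex_vector"
 assumes "!!k. clinear (F k)" shows "clinear (ext F)"
proof (rule clinearI)
 fix p q :: "'k \<Rightarrow>\<^sub>0 'v" and c
 have F0: "F k 0 = 0" for k by (rule clinear_zero[OF assms])
 let ?A = "Poly_Mapping.keys p \<union> Poly_Mapping.keys q"
 have k: "Poly_Mapping.keys (p + q) <= ?A" by (rule Poly_Mapping.keys_add)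
 show "ext F (p + q) = ext F p + ext F q" using k by (simp add: ext_superset[where F = F and A = ?A, OF F0] lookup_add clin[OF assms] sum.distrib)
 have "Poly_Mapping.keys (c *\<^sub>C p) <= Poly_Mapping.keys p" by (auto simp: in_keys_iff)
 thus "ext F (c *\<^sub>C p) = c *\<^sub>C ext F p"
  by (simp add: ext_superset[where F = F and A = "Poly_Mapping.keys p", OF F0] scale_sum_right clin[OF assms])
qed

lemma single_linear: "clinear (Poly_Mapping.single k :: 'v::complex_vector => _)"
proof (rule clinearI)
 show "Poly_Mapping.single k (c *\<^sub>C x) = c *\<^sub>C Poly_Mapping.single k x" for c and x :: 'v
  by (intro poly_mapping_eqI) (simp add: lookup_single when_def)
qed (simp add: single_add)

lemma clinear_sum_fun: "(!!i. i \<in> A ==> clinear (f i)) ==> clinear (%x. \<Sum>i\<in>A. f i x)"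
 by (intro clinearI) (simp_all add: clin sum.distrib scale_sum_right)

text \<open>\<open>b\<close> is a basis of a complement of \<open>P\<close>, with coordinates
  \<open>c\<close> that vanish on \<open>P\<close>. The induced module is modelled by sorted words
  in these letters with coefficients in the inducing module.\<close>

locale induced_module =
 fixes n :: nat and b :: "nat => 'g::lie_algebra" and c :: "nat => 'g => complex" and P :: "'g set" and \<rho> :: "'g => 'v::complex_vector => 'v"
 assumes c_lin: "!!i. clinear (c i)" and c_b: "!!i j. i < n ==> j < n ==> c i (b j) = (if i = j then 1 else 0)"
  and P_eq: "P = {y. \<forall>i<n. c i y = 0}" and P_brk: "!!y z. y \<in> P ==> z \<in> P ==> brk y z \<in> P" and rho: "lie_module P \<rho> UNIV"
begin

text \<open>For \<open>m = n\<close> this is the component of \<open>y\<close> in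
  \<open>P\<close>.\<close>

definition big :: "nat => 'g => 'g" where
 "big m y = y - (\<Sum>i<m. c i y *\<^sub>C b i)"

lemma big_linear: "clinear (big m)" by (intro clinearI) (simp_all add: big_def clinC[OF c_lin] sum.distrib
   scaleC_add_left scale_sum_right scale_right_diff_distrib scaleC_scaleC)

lemma c_big: assumes "m \<le> n" "i < n" shows "c i (big m y) = (if i < m then 0 else c i y)"
proof -
 have "c i (big m y) = c i y - (\<Sum>j<m. c j y * c i (b j))" by (simp add: big_def clinC[OF c_lin] complex_vector_pair.linear_sum[OF c_lin])
 also have "(\<Sum>j<m. c j y * c i (b j)) = (\<Sum>j<m. if j = i then c i y else 0)" using assms by (intro sum.cong) (auto simp: c_b)
 finally show ?thesis by simp
qed

lemma big_P: "big n y \<in> P" by (simp add: P_eq c_big)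

lemma rho_linear: "clinear (%v. \<rho> (big n y) v)" "clinear (%y. \<rho> (big n y) v)"
 using rho big_P big_linear by (intro clinearI; simp add: lie_module_def clin[OF big_linear])+

text \<open>The leading term of the action: letters are sorted into the word, and all corrections
  have lower degree.\<close>

definition lo :: "'g => nat list => 'v => nat list \<Rightarrow>\<^sub>0 'v" where
 "lo y S v = (\<Sum>i<n. Poly_Mapping.single (insort i S) (c i y *\<^sub>C v))"

lemma lo_linear: "clinear (lo y S)" "clinear (%y. lo y S v)" unfolding lo_def by (rule clinear_sum_fun, rule clinear_compose[OF single_linear],
   (intro clinearI; simp add: clinC[OF c_lin] scaleC_add_left scaleC_add_right scaleC_scaleC mult.commute))+

text \<open>The action of \<open>y\<close> on monomials of length at most \<open>m\<close>. For a monomial starting with \<open>\<mu>\<close>,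
 letters up to \<open>\<mu>\<close> are put in front, and the rest \<open>y'\<close> of \<open>y\<close> is commuted past \<open>b \<mu>\<close>.\<close>

primrec pact :: "nat => 'g => nat list => 'v => nat list \<Rightarrow>\<^sub>0 'v" where
 "pact 0 y S v = lo y [] v + Poly_Mapping.single [] (\<rho> (big n y) v)"
| "pact (Suc m) y S v = (if length S \<le> m then pact m y S v else
   let \<mu> = hd S; T = tl S; y' = big (Suc \<mu>) y in
   lo y S v + ext (pact m (b \<mu>)) (pact m y' T v - lo y' T v) + pact m (brk y' (b \<mu>)) T v)"

lemma pact_linear: "clinear (pact m y S) \<and> clinear (%y. pact m y S v)"
proof (induction m arbitrary: y S v)
 case 0
 show ?case using clinear_plus[OF lo_linear(1) clinear_compose[OF single_linear rho_linear(1)]]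
   clinear_plus[OF lo_linear(2) clinear_compose[OF single_linear rho_linear(2)]] by simp
next
 case (Suc m)
 note l1 = conjunct1[OF Suc.IH] and l2 = conjunct2[OF Suc.IH]
 have e: "clinear (ext (pact m z))" for z by (rule ext_linear[OF l1])
 have brk: "clinear (%y. brk (big k y) z)" for k z by (intro clinearI) (simp_all add: clin[OF big_linear] brk_add_left brk_scaleC_left)
 show ?case
 proof (cases "length S \<le> m")
  case True thus ?thesis using l1 l2 by simp
 next
  case False
  define \<mu> T where "\<mu> = hd S" and "T = tl S"
  let ?y = "%y. big (Suc \<mu>) y"
  have "clinear (%v. lo y S v + ext (pact m (b \<mu>)) (pact m (?y y) T v - lo (?y y) T v) + pact m (brk (?y y) (b \<mu>)) T v)"
   by (intro clinear_plus lo_linear l1 clinear_compose[OF e] clinear_minus)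
  moreover have "clinear (%y. lo y S v + ext (pact m (b \<mu>)) (pact m (?y y) T v - lo (?y y) T v) + pact m (brk (?y y) (b \<mu>)) T v)"
   by (intro clinear_plus lo_linear clinear_compose[OF l2 brk] clinear_compose[OF e] clinear_minus
     clinear_compose[OF l2 big_linear] clinear_compose[OF lo_linear(2) big_linear])
  ultimately show ?thesis using False by (simp add: \<mu>_def T_def Let_def)
 qed
qed

lemmas pact_lin = conjunct1[OF pact_linear] conjunct2[OF pact_linear]

lemma pact_length: "length S \<le> m ==> pact m y S v = pact (length S) y S v"
proof (induction m)
 case (Suc m)
 thus ?case by (cases "length S = Suc m") auto
qed simp

definition good :: "nat list => bool" where "good S \<longleftrightarrow> sorted S \<and> set S <= {..<n}"

lemma good_simps: "good []" "good (i # S) \<longleftrightarrow> i < n \<and> good S \<and> (\<forall>j\<in>set S. i \<le> j)"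
 "i < n ==> good S ==> good (insort i S)" by (auto simp: good_def sorted_insort set_insort_key)

text \<open>Unsorted words are sent to 0, which makes this a representation on the whole type and
  not only on the span of sorted words.\<close>

definition act :: "'g => (nat list \<Rightarrow>\<^sub>0 'v) => nat list \<Rightarrow>\<^sub>0 'v" where
 "act y = ext (%S v. if good S then pact (length S) y S v else 0)"

lemma act_linear: "clinear (act y)" "clinear (%y. act y p)"
proof -
 have l: "clinear (%v. if good S then pact (length S) y S v else 0)"
  "clinear (%y. if good S then pact (length S) y S v else 0)" for y S v using pact_lin clinear_const_0 by (cases "good S"; simp)+
 show "clinear (act y)" unfolding act_def by (rule ext_linear[OF l(1)])
 show "clinear (%y. act y p)" unfolding act_def ext_def by (rule clinear_sum_fun[OF l(2)])
qed

lemmas act_simps = clin[OF act_linear(1)] clin[OF act_linear(2)]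

lemma act_single: "good S ==> act y (Poly_Mapping.single S v) = pact (length S) y S v"
 and act_bad: "\<not> good S ==> act y (Poly_Mapping.single S v) = 0" by (simp_all add: act_def ext_single clin[OF pact_lin(1)])

definition deg :: "nat => (nat list \<Rightarrow>\<^sub>0 'v) set" where
 "deg m = {p. \<forall>k\<in>Poly_Mapping.keys p. good k \<and> length k \<le> m}"

lemma deg_subspace: "csubspace (deg m)"
proof (rule csubspaceI)
 show "p + q \<in> deg m" if "p \<in> deg m" "q \<in> deg m" for p q using that Poly_Mapping.keys_add[of p q] unfolding deg_def by blast
qed (auto simp: deg_def in_keys_iff)

lemma single_deg: "good S ==> length S \<le> m ==> Poly_Mapping.single S v \<in> deg m" by (auto simp: deg_def)

lemma deg_induct:
 assumes "p \<in> deg m" "csubspace U" "!!S v. good S ==> length S \<le> m ==> Poly_Mapping.single S v \<in> U" shows "p \<in> U"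
proof -
 have "p = (\<Sum>k\<in>Poly_Mapping.keys p. Poly_Mapping.single k (Poly_Mapping.lookup p k))"
  by (intro poly_mapping_eqI) (simp add: lookup_sum lookup_single when_def in_keys_iff)
 also have "\<dots> \<in> U" using assms(1) by (intro subspace_sum assms(2,3)) (auto simp: deg_def)
 finally show ?thesis .
qed

lemma lo_deg: "good S ==> lo y S v \<in> deg (Suc (length S))" unfolding lo_def by (intro subspace_sum deg_subspace single_deg) (auto simp: good_simps)

lemma ext_pact: assumes "p \<in> deg m" shows "ext (pact m y) p = act y p"
proof -
 have "p \<in> {p. ext (pact m y) p = act y p}"
 proof (rule deg_induct[OF assms])
  show "csubspace {p. ext (pact m y) p = act y p}" by (intro csubspaceI) (simp_all add: clin[OF ext_linear[OF pact_lin(1)]] act_simps)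
 qed (simp add: ext_single clin[OF pact_lin(1)] act_single, rule pact_length)
 thus ?thesis by simp
qed

lemma act_Cons:
 assumes "good (\<mu> # T)" shows "act y (Poly_Mapping.single (\<mu> # T) v) = lo y (\<mu> # T) v +
   ext (pact (length T) (b \<mu>)) (act (big (Suc \<mu>) y) (Poly_Mapping.single T v) - lo (big (Suc \<mu>) y) T v)
   + act (brk (big (Suc \<mu>) y) (b \<mu>)) (Poly_Mapping.single T v)" using assms by (simp add: act_single good_simps Let_def)

text \<open>This makes the recursion consistent. The term to which \<open>b \<mu>\<close> is applied
  has degree at most the length of \<open>T\<close>, and there the bounded recursion agrees with
  \<open>act\<close> by \<open>ext_pact\<close>.\<close>

lemma act_deg0: "good S ==> act y (Poly_Mapping.single S v) - lo y S v \<in> deg (length S)"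
proof (induction "length S" arbitrary: S y v rule: less_induct)
 case less
 have step: "act y p \<in> deg (Suc m)" if p: "p \<in> deg m" and m: "m < length S" for p m y
 proof -
  have "p \<in> {p. act y p \<in> deg (Suc m)}"
  proof (rule deg_induct[OF p])
   show "csubspace {p. act y p \<in> deg (Suc m)}" using deg_subspace[of "Suc m"] by (intro csubspaceI) (simp_all add: act_simps subspace_def)
   fix T v assume T: "good T" "length T \<le> m"
   have "act y (Poly_Mapping.single T v) - lo y T v \<in> deg (length T)" using less.hyps[of T] T m by simp
   hence "act y (Poly_Mapping.single T v) - lo y T v \<in> deg (Suc (length T))" unfolding deg_def by fastforce
   hence "(act y (Poly_Mapping.single T v) - lo y T v) + lo y T v \<in> deg (Suc (length T))"
    using lo_deg[OF T(1)] by (rule subspace_add[OF deg_subspace])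
   thus "Poly_Mapping.single T v \<in> {p. act y p \<in> deg (Suc m)}" using T unfolding deg_def by fastforce
  qed
  thus ?thesis by simp
 qed
 show ?case
 proof (cases S)
  case Nil
  have "act y (Poly_Mapping.single [] v) - lo y [] v = Poly_Mapping.single [] (\<rho> (big n y) v)"
   using act_single[of "[]" y v] by (simp add: good_simps)
  thus ?thesis using Nil by (simp add: single_deg good_simps)
 next
  case (Cons \<mu> T)
  hence g: "good (\<mu> # T)" "good T" using less.prems by (auto simp: good_simps)
  have w: "act y (Poly_Mapping.single T v) - lo y T v \<in> deg (length T)" for y using less.hyps[of T] Cons g by simp
  have "ext (pact (length T) (b \<mu>)) (act (big (Suc \<mu>) y) (Poly_Mapping.single T v) - lo (big (Suc \<mu>) y) T v) \<in> deg (length S)"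
   using step[OF w, of "b \<mu>"] unfolding ext_pact[OF w] by (simp add: Cons)
  moreover have "act (brk (big (Suc \<mu>) y) (b \<mu>)) (Poly_Mapping.single T v) \<in> deg (length S)"
   using step[OF single_deg[OF g(2) order_refl]] Cons by simp
  ultimately have "ext (pact (length T) (b \<mu>)) (act (big (Suc \<mu>) y) (Poly_Mapping.single T v) - lo (big (Suc \<mu>) y) T v)
    + act (brk (big (Suc \<mu>) y) (b \<mu>)) (Poly_Mapping.single T v) \<in> deg (length S)" by (rule subspace_add[OF deg_subspace])
  moreover have "l + e + a - l = e + a" for l e a :: "nat list \<Rightarrow>\<^sub>0 'v" by simp
  ultimately show ?thesis unfolding Cons act_Cons[OF g(1)] by (simp only:)
 qed
qed

lemma act_front:
 assumes "good (i # S)" shows "act (b i) (Poly_Mapping.single S v) = Poly_Mapping.single (i # S) v"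
proof -
 have i: "i < n" "good S" "insort i S = i # S" using assms by (auto simp: good_simps insort_is_Cons)
 have "lo (b i) S v = (\<Sum>j<n. if j = i then Poly_Mapping.single (insort i S) v else 0)"
  unfolding lo_def using i by (intro sum.cong) (auto simp: c_b scaleC_one)
 hence lo: "lo (b i) S v = Poly_Mapping.single (i # S) v" using i by simp
 show ?thesis
 proof (cases S)
  case Nil
  have "c j (b i) *\<^sub>C b j = (if j = i then b i else 0)" if "j < n" for j using that i by (simp add: c_b scaleC_one)
  hence "(\<Sum>j<n. c j (b i) *\<^sub>C b j) = b i" using i by simp
  hence "big n (b i) = 0" by (simp add: big_def)
  thus ?thesis using Nil lo clinear_zero[OF rho_linear(2), of v] clinear_zero[OF big_linear] by (simp add: act_single good_simps)
 next
  case (Cons \<mu> T)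
  hence "i \<le> \<mu>" "\<mu> < n" using assms by (auto simp: good_simps)
  hence "(\<Sum>j<Suc \<mu>. c j (b i) *\<^sub>C b j) = (\<Sum>j<Suc \<mu>. if j = i then b i else 0)"
   using i by (intro sum.cong) (auto simp: c_b scaleC_one)
  hence "big (Suc \<mu>) (b i) = 0" using \<open>i \<le> \<mu>\<close> by (simp add: big_def)
  thus ?thesis
   using lo act_Cons[of \<mu> T "b i" v] i Cons by (simp add: act_simps clin[OF lo_linear(2)] brk_simps clin[OF ext_linear[OF pact_lin(1)]])
 qed
qed

definition comm :: "(nat list \<Rightarrow>\<^sub>0 'v) => 'g => 'g => bool" where
 "comm p y z \<longleftrightarrow> act (brk y z) p = act y (act z p) - act z (act y p)"

lemma comm_sym: "comm p y z ==> comm p z y" unfolding comm_def brk_anti[of z y] by (simp add: act_simps)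

lemma comm_subspace: "csubspace {p. comm p y z}" "csubspace {y. comm p y z}" "csubspace {z. comm p y z}"
 by (intro csubspaceI; simp add: comm_def act_simps brk_simps scale_right_diff_distrib)+

text \<open>Here the recursion for the word \<open>\<mu> # T\<close> is the commutation relation
  itself. The letters of \<open>y\<close> above \<mu> are sorted in behind \<mu>, which is why no
  smaller letter may occur in \<open>y\<close>.\<close>

lemma comm_first:
 assumes g: "good (\<mu> # T)" and y: "!!i. i < \<mu> ==> c i y = 0" shows "comm (Poly_Mapping.single T v) y (b \<mu>)"
proof -
 have mu: "\<mu> < n" "good T" "!!j. j \<in> set T ==> \<mu> \<le> j" using g by (auto simp: good_simps)
 define y' where "y' = big (Suc \<mu>) y"
 have c': "c i y' = 0" if "i \<le> \<mu>" for i using that mu by (simp add: y'_def c_big)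
 have y'': "big (Suc \<mu>) y' = y'" using c' by (simp add: big_def)
 have "act (b \<mu>) (Poly_Mapping.single (insort i T) (c i y' *\<^sub>C v)) = Poly_Mapping.single (insort i (\<mu> # T)) (c i y' *\<^sub>C v)"
  if "i < n" for i
 proof (cases "i \<le> \<mu>")
  case True thus ?thesis by (simp add: c' act_simps)
 next
  case False
  have "act (b \<mu>) (Poly_Mapping.single (insort i T) (c i y' *\<^sub>C v)) = Poly_Mapping.single (\<mu> # insort i T) (c i y' *\<^sub>C v)"
   by (rule act_front) (use False mu that in \<open>auto simp: good_simps set_insort_key\<close>)
  thus ?thesis using False by simp
 qed
 hence lo: "act (b \<mu>) (lo y' T v) = lo y' (\<mu> # T) v" by (simp add: lo_def complex_vector_pair.linear_sum[OF act_linear(1)])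
 have "comm (Poly_Mapping.single T v) y' (b \<mu>)" unfolding comm_def act_front[OF g] act_Cons[OF g] y'' ext_pact[OF act_deg0[OF mu(2)]]
  by (simp add: act_simps lo)
 moreover have "comm (Poly_Mapping.single T v) (b \<mu>) (b \<mu>)" by (simp add: comm_def brk_self act_simps)
 ultimately have "comm (Poly_Mapping.single T v) (c \<mu> y *\<^sub>C b \<mu> + y') (b \<mu>)"
  using comm_subspace(2) by (metis (mono_tags) subspace_add subspace_scale mem_Collect_eq)
 moreover have "c \<mu> y *\<^sub>C b \<mu> + y' = y" using y by (simp add: y'_def big_def)
 ultimately show ?thesis by simp
qed

text \<open>Both arguments split into letters below \<open>m\<close> and a rest without them. For
  two letters the one with the larger index takes the role of \<open>y\<close> in
  \<open>first\<close>.\<close>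

lemma comm_pairs:
 assumes first: "!!i y. i < m ==> (!!j. j < i ==> c j y = 0) ==> comm p y (b i)"
  and rest: "!!y z. (!!i. i < m ==> c i y = 0) ==> (!!i. i < m ==> c i z = 0) ==> comm p y z" and m: "m \<le> n" shows "comm p y z"
proof -
 let ?S = "b ` {..<m} \<union> {y. \<forall>i<m. c i y = 0}"
 have span: "y \<in> cspan ?S" for y
 proof -
  have "big m y \<in> cspan ?S" using m by (intro span_base) (auto simp: c_big)
  moreover have "(\<Sum>i<m. c i y *\<^sub>C b i) \<in> cspan ?S" by (intro span_sum span_scale span_base) auto
  ultimately have "big m y + (\<Sum>i<m. c i y *\<^sub>C b i) \<in> cspan ?S" by (rule span_add)
  thus ?thesis by (simp add: big_def)
 qed
 have one: "comm p (b i) y" if "i < m" "y \<in> ?S" for i y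
 proof (cases "y \<in> b ` {..<m}")
  case True
  then obtain j where j: "y = b j" "j < m" by auto
  show ?thesis
  proof (cases "j \<le> i")
   case True
   thus ?thesis unfolding j(1) by (intro first) (use j that m in \<open>auto simp: c_b\<close>)
  next
   case False
   thus ?thesis unfolding j(1) by (intro comm_sym[OF first]) (use j that m in \<open>auto simp: c_b\<close>)
  qed
 next
  case False
  thus ?thesis using that by (intro comm_sym[OF first]) auto
 qed
 have "comm p y z" if "y \<in> ?S" "z \<in> ?S" for y z using that one[of _ z] comm_sym[OF one[of _ y]] rest[of y z] by auto
 hence "comm p y z" if "y \<in> ?S" for y z
  using span_in_subspace[OF comm_subspace(3) _ span] that by (metis (no_types, lifting) mem_Collect_eq subsetI)
 thus ?thesis using span_in_subspace[OF comm_subspace(2) _ span] by (metis (no_types, lifting) mem_Collect_eq subsetI)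
qed

text \<open>Induction on the length. Only \<open>y\<close> and \<open>z\<close> without letters up
  to \<mu> are not covered by \<open>comm_first\<close>; both are moved past the first letter, and
  the Jacobi identity together with the relation on the shorter word finishes.\<close>

lemma comm_single: "good S ==> comm (Poly_Mapping.single S v) y z"
proof (induction "length S" arbitrary: S v y z rule: less_induct)
 case less
 show ?case
 proof (cases S)
  case Nil
  show ?thesis
  proof (rule comm_pairs[of n])
   fix y z assume yz: "!!i. i < n ==> c i y = 0" "!!i. i < n ==> c i z = 0"
   hence P: "y \<in> P" "z \<in> P" "brk y z \<in> P" using P_brk by (auto simp: P_eq)
   have "act x (Poly_Mapping.single [] v) = Poly_Mapping.single [] (\<rho> x v)" if "x \<in> P" for x v
    using that by (simp add: act_single good_simps lo_def big_def P_eq)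
   thus "comm (Poly_Mapping.single S v) y z" using rho P by (simp add: Nil comm_def lie_module_def single_diff)
  qed (use Nil in \<open>auto intro!: comm_first simp: good_simps\<close>)
 next
  case (Cons \<mu> T)
  let ?p = "Poly_Mapping.single T v"
  have g: "good (\<mu> # T)" "good T" "\<mu> < n" using less.prems Cons by (auto simp: good_simps)
  have IH: "comm q y z" if "q \<in> deg (length T)" for q y z using deg_induct[OF that comm_subspace(1)] less.hyps Cons by fastforce
  show ?thesis
  proof (rule comm_pairs[of "Suc \<mu>"])
   fix i y assume "i < Suc \<mu>" "!!j. j < i ==> c j y = 0"
   thus "comm (Poly_Mapping.single S v) y (b i)" unfolding Cons using g by (intro comm_first) (auto simp: good_simps)
  next
   \<comment> \<open>When this formula is antisymmetrized in \<open>y\<close> and \<open>z\<close>,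
     the two mixed terms cancel.\<close>
   have half: "act y (act z (act (b \<mu>) ?p)) = act (b \<mu>) (act y (act z ?p)) + act (brk y (b \<mu>)) (act z ?p)
     + act (brk z (b \<mu>)) (act y ?p) + act (brk y (brk z (b \<mu>))) ?p"
    if y: "\<forall>i<Suc \<mu>. c i y = 0" and z: "\<forall>i<Suc \<mu>. c i z = 0" for y z :: 'g
   proof -
    have 1: "act z (act (b \<mu>) ?p) = act (b \<mu>) (act z ?p) + act (brk z (b \<mu>)) ?p"
     using IH[OF single_deg[OF g(2) order_refl], of v z "b \<mu>"] by (simp add: comm_def)
    have "lo z T v \<in> {q. comm q y (b \<mu>)}" unfolding lo_def
    proof (rule subspace_sum[OF comm_subspace(1)])
     fix i assume i: "i \<in> {..<n}"
     show "Poly_Mapping.single (insort i T) (c i z *\<^sub>C v) \<in> {q. comm q y (b \<mu>)}"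
     proof (cases "i \<le> \<mu>")
      case True thus ?thesis using z by (simp add: comm_def act_simps)
     next
      case False
      thus ?thesis using g i y by (auto intro!: comm_first simp: good_simps set_insort_key)
     qed
    qed
    moreover have "act z ?p - lo z T v \<in> {q. comm q y (b \<mu>)}" using IH act_deg0[OF g(2)] by blast
    ultimately have "(act z ?p - lo z T v) + lo z T v \<in> {q. comm q y (b \<mu>)}" by (intro subspace_add[OF comm_subspace(1)])
    hence 2: "act y (act (b \<mu>) (act z ?p)) = act (b \<mu>) (act y (act z ?p)) + act (brk y (b \<mu>)) (act z ?p)" by (simp add: comm_def)
    have 3: "act y (act (brk z (b \<mu>)) ?p) = act (brk z (b \<mu>)) (act y ?p) + act (brk y (brk z (b \<mu>))) ?p"
     using IH[OF single_deg[OF g(2) order_refl], of v y "brk z (b \<mu>)"] by (simp add: comm_def)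
    show ?thesis by (simp add: 1 2 3 act_simps)
   qed
   fix y z assume yz: "!!i. i < Suc \<mu> ==> c i y = 0" "!!i. i < Suc \<mu> ==> c i z = 0"
   hence y: "\<forall>i<Suc \<mu>. c i y = 0" and z: "\<forall>i<Suc \<mu>. c i z = 0" by auto
   have 4: "act (brk y z) (act (b \<mu>) ?p) = act (b \<mu>) (act (brk y z) ?p) + act (brk (brk y z) (b \<mu>)) ?p"
    using IH[OF single_deg[OF g(2) order_refl], of v "brk y z" "b \<mu>"] by (simp add: comm_def)
   have 5: "act (brk y z) ?p = act y (act z ?p) - act z (act y ?p)" using IH[OF single_deg[OF g(2) order_refl], of v y z] by (simp add: comm_def)
   show "comm (Poly_Mapping.single S v) y z" unfolding comm_def Cons act_front[OF g(1), symmetric] 4 half[OF y z] half[OF z y]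
    by (simp add: 5 act_simps brk_brk)
  qed (use g in simp)
 qed
qed

lemma act_rep: "lie_rep act"
proof -
 have "comm p y z" for p y z
 proof (induction p rule: poly_mapping_induct_single)
  case 1 show ?case by (simp add: comm_def act_simps)
 next
  case (2 p k v)
  have "comm (Poly_Mapping.single k v) y z" using comm_single by (cases "good k") (auto simp: comm_def act_bad act_simps)
  thus ?case using 2 subspace_add[OF comm_subspace(1), of _ y z p] by blast
 qed
 thus ?thesis using act_linear by (simp add: lie_rep_def comm_def)
qed

lemma act_P: "x \<in> P ==> act x (Poly_Mapping.single [] v) = Poly_Mapping.single [] (\<rho> x v)"
 by (simp add: act_single good_simps lo_def big_def P_eq)

text \<open>Since \<open>K\<close> is spanned modulo \<open>P\<close> by the letters in
  \<open>I\<close>, its action never produces another letter. This bounds the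
  \<open>K\<close>-submodule generated by \<open>V'\<close>, so that a vector can be shown to lie
  outside it.\<close>

lemma act_stable:
 fixes V' :: "'v set"
 assumes K: "lie_subalgebra K" and bK: "!!i. i \<in> I ==> b i \<in> K" and cK: "!!i y. i < n ==> i \<notin> I ==> y \<in> K ==> c i y = 0"
  and V': "csubspace V'" "!!x v. x \<in> K ==> x \<in> P ==> v \<in> V' ==> \<rho> x v \<in> V'"
 defines "N \<equiv> {p. \<forall>k\<in>Poly_Mapping.keys p. set k <= I \<and> Poly_Mapping.lookup p k \<in> V'}"
 assumes "y \<in> K" "p \<in> N" shows "act y p \<in> N"
proof -
 have Ks: "csubspace K" and Kb: "!!x y. x \<in> K ==> y \<in> K ==> brk x y \<in> K" using K by (auto simp: lie_subalgebra_def)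
 have N': "p \<in> N \<longleftrightarrow> (\<forall>k. (set k <= I --> Poly_Mapping.lookup p k \<in> V') \<and> (\<not> set k <= I --> Poly_Mapping.lookup p k = 0))" for p
  using subspace_0[OF V'(1)] by (force simp: N_def in_keys_iff)
 have N: "csubspace N" using V'(1) by (intro csubspaceI) (auto simp: N' lookup_add subspace_def)
 have sN: "Poly_Mapping.single k v \<in> N" if "set k <= I" "v \<in> V'" for k v using that by (auto simp: N_def)
 have bigK: "big m y \<in> K" if "m \<le> n" "y \<in> K" for m y unfolding big_def
 proof (intro subspace_diff[OF Ks] that subspace_sum[OF Ks])
  fix i assume "i \<in> {..<m}"
  thus "c i y *\<^sub>C b i \<in> K" using that cK[of i y] bK[of i] subspace_scale[OF Ks] subspace_0[OF Ks] by (cases "i \<in> I") auto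
 qed
 have lo: "lo y k v \<in> N" if "y \<in> K" "set k <= I" "v \<in> V'" for y k v unfolding lo_def
 proof (rule subspace_sum[OF N])
  fix i assume "i \<in> {..<n}"
  thus "Poly_Mapping.single (insort i k) (c i y *\<^sub>C v) \<in> N" using that cK[of i y] subspace_scale[OF V'(1)] subspace_0[OF N]
   by (cases "i \<in> I") (auto intro!: sN simp: set_insort_key)
 qed
 have pact: "pact m y k v \<in> N" if "y \<in> K" "good k" "length k \<le> m" "set k <= I" "v \<in> V'" for m y k v using that
 proof (induction m arbitrary: y k v)
  case 0
  thus ?case using V'(2)[OF bigK big_P] by (auto intro!: subspace_add[OF N] lo sN)
 next
  case (Suc m)
  show ?case
  proof (cases "length k \<le> m")
   case True thus ?thesis using Suc by simp
  next
   case False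
   then obtain \<mu> T where k: "k = \<mu> # T" by (cases k) auto
   have g: "good T" "\<mu> < n" "set T <= I" "\<mu> \<in> I" using Suc.prems k by (auto simp: good_simps)
   have y': "big (Suc \<mu>) y \<in> K" using bigK[of "Suc \<mu>"] g Suc.prems by simp
   have e: "ext (pact m (b \<mu>)) p \<in> N" if p: "p \<in> N" "p \<in> deg m" for p unfolding ext_def using p
    by (intro subspace_sum[OF N] Suc.IH bK g) (auto simp: N_def deg_def)
   have T: "length T = m" using False Suc.prems k by simp
   have gk: "pact m (big (Suc \<mu>) y) T v - lo (big (Suc \<mu>) y) T v \<in> deg m"
    using act_deg0[OF g(1), of "big (Suc \<mu>) y" v] T by (simp add: act_single g)
   have pm: "pact m z T v \<in> N" if "z \<in> K" for z by (rule Suc.IH) (use that g T Suc.prems in auto)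
   have "pact (Suc m) y k v = lo y k v + ext (pact m (b \<mu>)) (pact m (big (Suc \<mu>) y) T v - lo (big (Suc \<mu>) y) T v)
     + pact m (brk (big (Suc \<mu>) y) (b \<mu>)) T v" using False by (simp add: k Let_def)
   thus ?thesis using subspace_add[OF N subspace_add[OF N
     lo[OF Suc.prems(1,4,5)] e[OF subspace_diff[OF N pm[OF y'] lo[OF y' g(3) Suc.prems(5)]] gk]] pm[OF Kb[OF y' bK[OF g(4)]]]] by simp
  qed
 qed
 have "(if good k then pact (length k) y k (Poly_Mapping.lookup p k) else 0) \<in> N" if "k \<in> Poly_Mapping.keys p" for k
 proof (cases "good k")
  case True
  show ?thesis using that assms(8) by (simp add: True) (rule pact[OF assms(7) True], auto simp: N_def)
 qed (use subspace_0[OF N] in simp)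
 thus ?thesis unfolding act_def ext_def by (intro subspace_sum[OF N])
qed

end

text \<open>A basis of \<open>P\<close> is extended first by elements of \<open>K\<close> until it
  spans \<open>P + K\<close>, then to the whole space; \<open>I\<close> marks the letters taken from
  \<open>K\<close>.\<close>

lemma adapted_basis:
 fixes P K :: "'g::complex_vector set"
 assumes fd: "fin_dim (UNIV :: 'g set)" and P: "csubspace P"
 obtains n :: nat and b :: "nat => 'g" and c and I where "!!i. clinear (c i)" "!!i j. i < n ==> j < n ==> c i (b j) = (if i = j then 1 else (0::complex))"
  "P = {y. \<forall>i<n. c i y = 0}" "I <= {..<n}" "!!i. i \<in> I ==> b i \<in> K"
  "!!i y. i < n ==> i \<notin> I ==> y \<in> K ==> c i y = 0"
proof -
 obtain BP where BP: "finite BP" "complex_vector.independent BP" "BP <= P" "cspan BP = P"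
  using fin_dim_basis[OF fin_dim_subset[OF fd subset_UNIV] P] by blast
 obtain B1 where B1: "BP <= B1" "B1 <= BP \<union> K" "complex_vector.independent B1" "BP \<union> K <= cspan B1"
  by (rule complex_vector.maximal_independent_subset_extend[of BP "BP \<union> K"]) (use BP(2) in auto)
 obtain B where B: "B1 <= B" "complex_vector.independent B" "UNIV <= cspan B"
  by (rule complex_vector.maximal_independent_subset_extend[of B1 UNIV]) (use B1(3) in auto)
 have fB: "finite B" using fin_dim_independent[OF fd B(2)] by blast
 define n where "n = card (B - BP)"
 obtain b where b: "bij_betw b {..<n} (B - BP)" using ex_bij_betw_nat_finite[of "B - BP"] fB unfolding n_def by (auto simp: atLeast0LessThan)
 define r where "r i y = coords B y (b i)" for i y
 have inB: "b i \<in> B" "b i \<notin> BP" if "i < n" for i using b that by (auto simp: bij_betw_def)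
 have rspan: "r i y = 0" if "y \<in> cspan S" "S <= B" "b i \<notin> S" for i y S
  using complex_vector.representation_extend[OF B(2) that(1,2)] complex_vector.representation_ne_zero[of S y "b i"] that(3) unfolding r_def by metis
 have all: "y \<in> cspan B" for y using B(3) by auto
 have lin: "clinear (r i)" for i using B(2) all by (intro clinearI)
   (simp_all add: r_def complex_vector.representation_add representation_scale scaleC_complex)
 show thesis
 proof (rule that[of r n b "{i. i < n \<and> b i \<in> B1}"])
  show "clinear (r i)" for i by (rule lin)
  show "r i (b j) = (if i = j then 1 else 0)" if "i < n" "j < n" for i j using that complex_vector.representation_basis[OF B(2) inB(1)[OF that(2)]] b
   by (auto simp: r_def bij_betw_def inj_on_def)
  show "P = {y. \<forall>i<n. r i y = 0}"
  proof safe
   fix y i assume "y \<in> P" "i < n"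
   thus "r i y = 0" using rspan[of y BP i] BP(4) B1(1) B(1) inB by auto
  next
   fix y assume y: "\<forall>i<n. r i y = 0"
   have "y = (\<Sum>v\<in>B. coords B y v *\<^sub>C v)" using sum_representation_eq[OF B(2) all fB order_refl, of y] by simp
   also have "\<dots> \<in> P"
   proof (rule subspace_sum[OF P])
    fix v assume v: "v \<in> B"
    show "coords B y v *\<^sub>C v \<in> P"
    proof (cases "v \<in> BP")
     case True thus ?thesis using BP(3) subspace_scale[OF P] by blast
    next
     case False
     then obtain i where "i < n" "v = b i" using b v by (auto simp: bij_betw_def)
     thus ?thesis using y subspace_0[OF P] by (simp add: r_def)
    qed
   qed
   finally show "y \<in> P" .
  qed
  show "b i \<in> K" if "i \<in> {i. i < n \<and> b i \<in> B1}" for i using that B1(2) inB by blast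
  show "r i y = 0" if "i < n" "i \<notin> {i. i < n \<and> b i \<in> B1}" "y \<in> K" for i y using rspan[of y B1 i] B1(4) B(1) that by auto
 qed auto
qed

lemma linear_extension:
 fixes W N :: "'g::complex_vector set" and f :: "'g => complex"
 assumes W: "csubspace W" and N: "csubspace N" and WN: "W \<inter> N <= {0}"
  and f: "!!x y. x \<in> W ==> y \<in> W ==> f (x + y) = f x + f y" "!!c x. x \<in> W ==> f (c *\<^sub>C x) = c * f x"
 obtains \<phi> where "clinear \<phi>" "!!x. x \<in> W ==> \<phi> x = f x" "!!x. x \<in> N ==> \<phi> x = 0"
proof -
 obtain T :: "'g => 'g" where T: "clinear T" "!!x. T x = 0 \<longleftrightarrow> x \<in> N" using clinear_with_kernel[OF N] by blast
 have inj: "inj_on T W"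
  using T(2) WN subspace_diff[OF W] by (intro inj_onI) (auto simp flip: T(2) simp: clin[OF T(1)], metis DiffI IntI T(2) clinear_diff[OF T(1)] eq_iff_diff_eq_0 singletonD subsetD)
 obtain BW where BW: "BW <= W" "complex_vector.independent BW" "W <= cspan BW" by (rule maximal_independent_subset)
 have BWs: "cspan BW = W" using BW span_minimal[OF BW(1) W] by blast
 have ind: "complex_vector.independent (T ` BW)" using complex_vector_pair.linear_independent_injective_image[OF T(1) BW(2)] inj BWs by simp
 define g where "g = complex_vector_pair.construct (T ` BW) (%v. f (inv_into W T v))"
 have g: "clinear g" unfolding g_def by (rule complex_vector_pair.linear_construct[OF ind])
 have gT: "g (T v) = f v" if "v \<in> BW" for v unfolding g_def complex_vector_pair.construct_basis[OF ind imageI[OF that]]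
  using that BW(1) inv_into_f_f[OF inj, of v] by auto
 show thesis
 proof (rule that[of "%x. g (T x)"])
  show "clinear (%x. g (T x))" by (rule clinear_compose[OF g T(1)])
  show "g (T x) = 0" if "x \<in> N" for x using that clinear_zero[OF g] iffD2[OF T(2)] by metis
  fix x assume "x \<in> W"
  hence "x \<in> cspan BW" using BWs by simp
  hence "x \<in> W \<and> g (T x) = f x"
  proof (induction rule: span_induct_alt)
   case base
   show ?case using f(2)[of 0 0] subspace_0[OF W] by (simp add: clin[OF T(1)] clin[OF g])
  next
   case (step c x y)
   thus ?case using BW(1) gT[of x] f(1)[of "c *\<^sub>C x" y] f(2)[of x c] subspace_add[OF W] subspace_scale[OF W]
    by (auto simp: clin[OF T(1)] clinC[OF g])
  qed
  thus "g (T x) = f x" by blast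
 qed
qed

section \<open>Enveloping algebra\<close>

lemma uea_abs: obtains q where "u = abs_uea q" by (metis Quotient3_abs_rep[OF Quotient3_uea])

lemma uea_in_linear: "clinear uea_in" by (intro clinearI uea_in_add uea_in_scaleC)

lemmas uin = clin[OF uea_in_linear]

definition uword :: "'g::lie_algebra list => 'g uea" where
 "uword xs = prod_list (map uea_in xs)"

lemma uword_simps: "uword [] = 1" "uword (x # xs) = uea_in x * uword xs" "uword (xs @ ys) = uword xs * uword ys" by (simp_all add: uword_def)

lemma abs_wd: "abs_uea (wd xs) = uword xs"
proof (induction xs)
 case Nil
 show ?case by (simp add: uword_simps one_uea.abs_eq flip: single_one) (simp add: zero_word_def)
next
 case (Cons x xs)
 have "wd (x # xs) = wd [x] * wd xs" by (simp add: mult_single plus_word_def)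
 thus ?case using Cons by (simp add: uword_simps uea_in.abs_eq flip: times_uea.abs_eq)
qed

lemma uea_span: "u \<in> cspan (range uword)"
proof -
 obtain q where q: "u = abs_uea q" by (rule uea_abs)
 have "abs_uea q \<in> cspan (range uword)"
 proof (induction q rule: poly_mapping_induct_single)
  case 1 show ?case using span_zero by (metis zero_uea.abs_eq)
 next
  case (2 p k c)
  have "Poly_Mapping.single k c = c *\<^sub>C wd (letters k)" by (intro poly_mapping_eqI) (simp add: lookup_single when_def scaleC_complex)
  hence "abs_uea (Poly_Mapping.single k c + p) = c *\<^sub>C uword (letters k) + abs_uea p"
   using abs_wd[of "letters k"] by (simp flip: plus_uea.abs_eq scaleC_uea.abs_eq)
  thus ?case using 2 span_add span_scale span_base by (metis rangeI)
 qed
 thus ?thesis using q by simp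
qed

lemma uea_induct:
 assumes "csubspace S" "1 \<in> S" "!!x u. u \<in> S ==> uea_in x * u \<in> S" shows "u \<in> S"
proof (rule span_in_subspace[OF assms(1) _ uea_span])
 have "uword xs \<in> S" for xs by (induction xs) (simp_all add: uword_simps assms)
 thus "range uword <= S" by blast
qed

lemma mult_linear: "clinear (%u. u * v)" "clinear (%u. v * u)" for v :: "'a::complex_algebra_1"
 by (intro clinearI; simp add: algebra_simps mult_scaleC_left mult_scaleC_right)+

text \<open>Evaluated on a representative; for a representation \<open>a\<close> the defining ideal
  acts by 0, so the choice does not matter.\<close>

definition uact :: "('g::lie_algebra => 'n::complex_vector => 'n) => 'g uea => 'n => 'n" where
 "uact a u p = lin_ext (%w. foldr a (letters w) p) (rep_uea u)"

context
 fixes a :: "'g::lie_algebra => 'n::complex_vector => 'n"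
 assumes a: "lie_rep a"
begin

lemma foldr_linear: "clinear (foldr a xs)"
proof (induction xs)
 case (Cons x xs)
 have "clinear (%p. a x (foldr a xs p))" by (rule clinear_compose[OF _ Cons]) (use a in \<open>simp add: lie_rep_def\<close>)
 thus ?case by (simp add: comp_def)
qed (simp add: clinear_id[folded id_def] id_def clinear_id)

lemma uact_abs: "uact a (abs_uea q) p = lin_ext (%w. foldr a (letters w) p) q" and uact_mult: "uact a (u * v) p = uact a u (uact a v p)"
proof -
 define E where "E q p = lin_ext (%w. foldr a (letters w) p) q" for q p
 have Elin: "clinear (E q)" for q unfolding E_def lin_ext_def by (intro clinear_sum_fun clinear_scale_fun foldr_linear)
 note Es = clin[OF Elin]
 have Eq: "E (q + q') p = E q p + E q' p" "E (c *\<^sub>C q) p = c *\<^sub>C E q p" "E (q - q') p = E q p - E q' p" "E 0 p = 0" for q q' p c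
  by (simp_all add: E_def lin_ext_add lin_ext_scaleC lin_ext_diff)
 have single: "E (Poly_Mapping.single k c * q) p = c *\<^sub>C foldr a (letters k) (E q p)" for k c q p
  by (induction q rule: poly_mapping_induct_single)
   (simp_all add: Eq distrib_left clin[OF foldr_linear] scaleC_add_right mult_single,
    simp add: E_def plus_word_def scaleC_scaleC clin[OF foldr_linear])
 have mult: "E (q * q') p = E q (E q' p)" for q q' p by (induction q rule: poly_mapping_induct_single)
   (simp_all add: distrib_right Eq single, simp add: E_def)
 have ideal: "E q p = 0" if "q \<in> uea_ideal" for q p using that
  by (induction arbitrary: p) (simp_all add: Eq mult Es, simp_all add: E_def scaleC_one rep_simps[OF a])
 have abs: "uact a (abs_uea q) p = E q p" for q p
 proof -
  have "rep_uea (abs_uea q) - q \<in> uea_ideal" by (rule rep_abs_rsp_left[OF Quotient3_uea]) (simp add: uea_ideal_zero)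
  hence "E (rep_uea (abs_uea q) - q) p = 0" by (rule ideal)
  thus ?thesis by (simp add: Eq) (simp add: uact_def E_def)
 qed
 thus "uact a (abs_uea q) p = lin_ext (%w. foldr a (letters w) p) q" by (simp add: E_def)
 obtain q q' where "u = abs_uea q" "v = abs_uea q'" by (metis uea_abs)
 thus "uact a (u * v) p = uact a u (uact a v p)" by (simp add: times_uea.abs_eq abs mult)
qed

lemma uact_linear: "clinear (uact a u)" "clinear (%u. uact a u p)"
proof -
 show "clinear (uact a u)" unfolding uact_def lin_ext_def by (intro clinear_sum_fun clinear_scale_fun foldr_linear)
 show "clinear (%u. uact a u p)"
 proof (rule clinearI)
  fix u v :: "'g uea" and c
  obtain q q' where "u = abs_uea q" "v = abs_uea q'" by (metis uea_abs)
  thus "uact a (u + v) p = uact a u p + uact a v p" "uact a (c *\<^sub>C u) p = c *\<^sub>C uact a u p"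
   by (simp_all add: plus_uea.abs_eq scaleC_uea.abs_eq uact_abs lin_ext_add lin_ext_scaleC)
 qed
qed

lemma uact_in: "uact a (uea_in x) p = a x p" by (simp add: uea_in.abs_eq uact_abs scaleC_one)

lemma uact_1: "uact a 1 p = p" using uact_abs[of "wd []" p] by (simp add: abs_wd uword_simps scaleC_one)

lemmas uact_simps = uact_in uact_1 uact_mult clin[OF uact_linear(1)] clin[OF uact_linear(2)]

lemma uact_stable:
 assumes "csubspace S" "!!x p. p \<in> S ==> a x p \<in> S" "p \<in> S" shows "uact a u p \<in> S"
proof -
 have "u \<in> {u. uact a u p \<in> S}"
 proof (rule uea_induct)
  show "csubspace {u. uact a u p \<in> S}" using assms(1) by (intro csubspaceI) (auto simp: uact_simps subspace_def)
 qed (auto simp: uact_simps assms)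
 thus ?thesis by simp
qed

end

section \<open>Harish-Chandra projections\<close>

text \<open>The commutator with a word is the sum of the words in which one letter \<open>x\<close>
  is replaced by \<open>brk e x\<close>. Only membership in a subspace is recorded, so this sum is
  never written out.\<close>

lemma uword_commute:
 assumes "csubspace S" "!!l1 x l2. l = l1 @ x # l2 ==> uword (l1 @ brk e x # l2) \<in> S" shows "uea_in e * uword l - uword l * uea_in e \<in> S"
 using assms
proof (induction l arbitrary: S)
 case Nil
 thus ?case by (simp add: uword_simps subspace_0)
next
 case (Cons y l)
 have "csubspace {u. uea_in y * u \<in> S}" using Cons.prems(1) by (intro csubspaceI) (auto simp: subspace_def distrib_left mult_scaleC_right)
 moreover have "uword (l1 @ brk e x # l2) \<in> {u. uea_in y * u \<in> S}" if "l = l1 @ x # l2" for l1 x l2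
  using Cons.prems(2)[of "y # l1" x l2] that by (simp add: uword_simps)
 ultimately have "uea_in y * (uea_in e * uword l - uword l * uea_in e) \<in> S" using Cons.IH by blast
 moreover have "uword (brk e y # l) \<in> S" using Cons.prems(2)[of "[]" y l] by simp
 ultimately have "uea_in y * (uea_in e * uword l - uword l * uea_in e) + uword (brk e y # l) \<in> S" by (rule subspace_add[OF Cons.prems(1)])
 thus ?case by (simp add: uword_simps uea_in_brk algebra_simps)
qed

context borel_lie
begin

abbreviation "hp \<equiv> cspan (tv ` \<Phi>)"

lemma hp_H: "t \<in> hp ==> t \<in> H" using tv(1)[OF Phi_repr] by (intro span_in_subspace[OF H_sub, of "tv ` \<Phi>"]) auto

text \<open>A linear model of the dual of \<open>H\<close>. Elements of \<open>dual H\<close> vanish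
  outside \<open>H\<close> and are in general not linear on the whole algebra.\<close>

definition hstar :: "('g => complex) set" where
 "hstar = {\<mu>. clinear \<mu> \<and> (\<forall>\<beta>\<in>\<Phi>. \<forall>x\<in>gsp \<beta>. \<mu> x = 0)}"

lemma hstar_linear: "\<mu> \<in> hstar ==> clinear \<mu>" and hstar_gsp: "\<mu> \<in> hstar ==> \<beta> \<in> \<Phi> ==> x \<in> gsp \<beta> ==> \<mu> x = 0"
 by (auto simp: hstar_def)

lemma hstar_add: "\<mu> \<in> hstar ==> \<nu> \<in> hstar ==> (%x. \<mu> x + \<nu> x) \<in> hstar"
 and hstar_scale: "\<mu> \<in> hstar ==> (%x. c * \<mu> x) \<in> hstar"
 and hstar_diff: "\<mu> \<in> hstar ==> \<nu> \<in> hstar ==> (%x. \<mu> x - \<nu> x) \<in> hstar"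
 unfolding hstar_def by (auto intro!: clinearI simp: clinC scaleC_complex algebra_simps)

lemma hstar_ext:
 assumes "f \<in> dual H" obtains \<mu> where "\<mu> \<in> hstar" "!!x. x \<in> H ==> \<mu> x = f x"
proof -
 let ?N = "cspan (\<Union>\<beta>\<in>\<Phi>. gsp \<beta>)"
 have "H \<inter> ?N <= {0}" using gsp_disjoint[of 0 \<Phi>] Phi_dual Phi_nz dual_closed(1) root_space_0 by blast
 then obtain \<phi> where "clinear \<phi>" "!!x. x \<in> H ==> \<phi> x = f x" "!!x. x \<in> ?N ==> \<phi> x = 0"
  using linear_extension[OF H_sub subspace_span, of "\<Union>\<beta>\<in>\<Phi>. gsp \<beta>" f] H_dual_linear[OF assms] by metis
 thus thesis using span_base[of _ "\<Union>\<beta>\<in>\<Phi>. gsp \<beta>"] by (intro that[of \<phi>]) (simp_all add: hstar_def, blast)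
qed

lemma killing_hstar: "\<alpha> \<in> \<Phi> ==> killing (tv \<alpha>) \<in> hstar"
 using killing_gsp[of "tv \<alpha>" 0 _ _] tv(1)[OF Phi_repr] root_space_0 dual_closed(1) Phi_dual Phi_nz killing_lin(2) by (auto simp: hstar_def)

lemma hstar_G: "g \<in> G ==> \<mu> \<in> hstar ==> (%x. \<mu> (g x)) \<in> hstar"
 using clinear_compose[OF hstar_linear G_linear] hstar_gsp by (simp add: hstar_def G_fix(2))

subsection \<open>Polynomials on the dual of the Cartan subalgebra\<close>

text \<open>Polynomials of degree at most \<open>m\<close> in the evaluations at points of
  \<open>hp\<close>. Only their values on \<open>hstar\<close> matter, hence the rule
  \<open>Pol_cong\<close>.\<close>

inductive Pol :: "nat => (('g => complex) => complex) => bool" where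
 Pol_const: "Pol m (%_. c)"
| Pol_add: "Pol m p ==> Pol m q ==> Pol m (%\<mu>. p \<mu> + q \<mu>)"
| Pol_eval: "t \<in> hp ==> Pol m p ==> Pol (Suc m) (%\<mu>. \<mu> t * p \<mu>)"
| Pol_cong: "Pol m p ==> (!!\<mu>. \<mu> \<in> hstar ==> p \<mu> = q \<mu>) ==> Pol m q"

lemma Pol_mono: assumes "Pol m p" "m \<le> n" shows "Pol n p"
proof -
 have step: "Pol (Suc m) p" if "Pol m p" for m p using that by (induction rule: Pol.induct) (auto intro: Pol.intros)
 from assms(2) show ?thesis by (induction rule: dec_induct) (use assms(1) step in auto)
qed

lemma Pol_scale: "Pol m p ==> Pol m (%\<mu>. c * p \<mu>)"
proof (induction rule: Pol.induct)
 case (Pol_eval t m p)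
 show ?case by (rule Pol_cong[OF Pol.Pol_eval[OF Pol_eval(1,3)]]) (simp add: mult_ac)
next
 case (Pol_cong m p q) thus ?case by (auto intro: Pol.Pol_cong)
qed (auto intro: Pol.intros simp: distrib_left)

lemma Pol_diff: "Pol m p ==> Pol m q ==> Pol m (%\<mu>. p \<mu> - q \<mu>)" using Pol_add[OF _ Pol_scale[of m q "-1"], of p] by simp

lemma Pol_sum: "(!!i. i \<in> I ==> Pol m (p i)) ==> Pol m (%\<mu>. \<Sum>i\<in>I. p i \<mu>)"
 by (induction I rule: infinite_finite_induct) (auto intro: Pol_const Pol_add)

lemma Pol_mult: "Pol m p ==> Pol n q ==> Pol (m + n) (%\<mu>. p \<mu> * q \<mu>)"
proof (induction rule: Pol.induct)
 case (Pol_const m c) thus ?case by (auto intro: Pol_mono Pol_scale)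
next
 case (Pol_add m p p') thus ?case using Pol.Pol_add[of "m + n"] by (simp add: distrib_right)
next
 case (Pol_eval t m p) thus ?case using Pol.Pol_eval[of t "m + n"] by (simp add: mult.assoc)
next
 case (Pol_cong m p p') thus ?case by (auto intro: Pol.Pol_cong)
qed

lemma Pol_power: "t \<in> hp ==> Pol m (%\<mu>. \<mu> t ^ m)" by (induction m) (auto intro: Pol.intros)

text \<open>Translation does not change the leading part, so the difference drops in degree. For
  \<open>m = 0\<close> the truncated \<open>m - 1\<close> is harmless, because the difference is
  then 0 on \<open>hstar\<close>.\<close>

lemma Pol_shift:
 assumes "Pol m p" "c \<in> hstar" shows "Pol (m - 1) (%\<mu>. p (%x. \<mu> x + c x) - p \<mu>)" using assms
proof (induction rule: Pol.induct)
 case (Pol_const m c) thus ?case using Pol.Pol_const[of "m - 1" 0] by simp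
next
 case (Pol_add m p q) thus ?case using Pol.Pol_add[of "m - 1" "%\<mu>. p (%x. \<mu> x + c x) - p \<mu>" "%\<mu>. q (%x. \<mu> x + c x) - q \<mu>"]
  by (simp add: algebra_simps)
next
 case (Pol_cong m p q)
 show ?case by (rule Pol.Pol_cong[OF Pol_cong(3)[OF Pol_cong(4)]]) (simp add: Pol_cong(2,4) hstar_add)
next
 case (Pol_eval t m p)
 define r where "r = (%\<mu>. p (%x. \<mu> x + c x) - p \<mu>)"
 have r: "Pol m (%\<mu>. c t * (p \<mu> + r \<mu>))" using Pol_eval by (intro Pol_scale Pol.Pol_add) (auto simp: r_def intro: Pol_mono)
 have "Pol m (%\<mu>. \<mu> t * r \<mu>)"
 proof (cases m)
  case 0
  have "Pol 0 q ==> c \<in> hstar ==> \<mu> \<in> hstar ==> q (%x. \<mu> x + c x) = q \<mu>" for q \<mu>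
   by (induction "0::nat" q rule: Pol.induct) (auto simp: hstar_add)
  hence "r \<mu> = 0" if "\<mu> \<in> hstar" for \<mu> using that Pol_eval 0 by (simp add: r_def)
  thus ?thesis by (intro Pol.Pol_cong[OF Pol.Pol_const[of m 0]]) simp
 next
  case (Suc k)
  thus ?thesis using Pol.Pol_eval[OF Pol_eval(1), of k r] Pol_eval by (simp add: r_def)
 qed
 from Pol.Pol_add[OF this r] show ?case by (simp add: r_def algebra_simps)
qed

lemma G_hp: assumes "g \<in> G" "t \<in> hp" shows "g t \<in> hp"
proof (rule clinear_span_in[OF G_linear[OF assms(1)] subspace_span _ assms(2)])
 fix x assume "x \<in> tv ` \<Phi>"
 then obtain \<beta> where "\<beta> \<in> \<Phi>" "x = tv \<beta>" by blast
 thus "g x \<in> hp" using G_tv[OF assms(1)] span_base[of _ "tv ` \<Phi>"] by (metis imageI)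
qed

lemma Pol_G: assumes "Pol m p" "g \<in> G" shows "Pol m (%\<mu>. p (%x. \<mu> (g x)))" using assms(1)
proof (induction rule: Pol.induct)
 case (Pol_cong m p q) thus ?case by (intro Pol.Pol_cong[OF Pol_cong(3)]) (simp add: hstar_G[OF assms(2)])
qed (auto intro: Pol.intros G_hp[OF assms(2)])

lemma Pol_line:
 assumes "Pol m p" "\<mu> \<in> hstar" "\<eta> \<in> hstar" shows "\<exists>q. \<forall>s. p (%x. \<mu> x + s * \<eta> x) = poly q s" using assms
proof (induction rule: Pol.induct)
 case (Pol_const m c) thus ?case by (intro exI[of _ "[:c:]"]) simp
next
 case (Pol_add m p q) thus ?case by (metis poly_add)
next
 case (Pol_eval t m p)
 then obtain q where "\<forall>s. p (%x. \<mu> x + s * \<eta> x) = poly q s" by blast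
 thus ?case by (intro exI[of _ "[:\<mu> t, \<eta> t:] * q"]) (simp add: algebra_simps)
next
 case (Pol_cong m p q) thus ?case by (metis hstar_add hstar_scale)
qed

subsection \<open>The left ideal of a Verma module\<close>

text \<open>The enveloping algebra modulo this left ideal is the Verma module of highest weight
  \<mu>.\<close>

definition Iv :: "('g => complex) => 'g uea set" where
 "Iv \<mu> = cspan ({u * uea_in e | u e. \<exists>\<beta>\<in>\<Psi>. e \<in> gsp \<beta>} \<union> {u * (uea_in t - \<mu> t *\<^sub>C 1) | u t. t \<in> H})"

lemma Iv_sub: "csubspace (Iv \<mu>)" unfolding Iv_def by simp

lemma Iv_e: "\<beta> \<in> \<Psi> ==> e \<in> gsp \<beta> ==> u * uea_in e \<in> Iv \<mu>"
 and Iv_t: "t \<in> H ==> u * (uea_in t - \<mu> t *\<^sub>C 1) \<in> Iv \<mu>" unfolding Iv_def by (rule span_base; blast)+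

lemma Iv_left: "v \<in> Iv \<mu> ==> u * v \<in> Iv \<mu>" unfolding Iv_def by (rule clinear_span_in[OF mult_linear(2) subspace_span])
  (auto intro!: span_base simp flip: mult.assoc)

definition hw :: "('g => 'n::complex_vector => 'n) => ('g => complex) => 'n => bool" where
 "hw a \<mu> w \<longleftrightarrow> (\<forall>\<beta>\<in>\<Psi>. \<forall>e\<in>gsp \<beta>. a e w = 0) \<and> (\<forall>t\<in>H. a t w = \<mu> t *\<^sub>C w)"

lemma Iv_hw: "lie_rep a ==> hw a \<mu> w ==> u \<in> Iv \<mu> ==> uact a u w = 0" unfolding Iv_def
 by (rule clinear_eq_on_span[OF uact_linear(2) clinear_const_0]) (auto simp: uact_simps hw_def)

text \<open>Letters tagged with their weights. Those of weight 0 must come from \<open>hp\<close>,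
  which keeps projections polynomial in points of \<open>hp\<close>; brackets with root vectors
  respect this, as \<open>[e, f]\<close> is a multiple of \<open>tv \<beta>\<close>.\<close>

definition lets :: "('g \<times> ('g => complex)) set" where
 "lets = {(y, \<gamma>). \<gamma> \<in> dual H \<and> y \<in> gsp \<gamma> \<and> (\<gamma> = 0 --> y \<in> hp)}"

abbreviation "wt l \<equiv> sum_list (map snd l)"
abbreviation "uw l \<equiv> uword (map fst l)"

lemma lets_brk:
 assumes "\<beta> \<in> \<Phi>" "e \<in> gsp \<beta>" "(y, \<gamma>) \<in> lets" shows "(brk e y, \<beta> + \<gamma>) \<in> lets"
proof -
 have "brk e y \<in> hp" if "\<beta> + \<gamma> = 0"
 proof -
  have "\<gamma> = - \<beta>" using that by (simp add: add_eq_0_iff)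
  hence "brk e y = killing e y *\<^sub>C tv \<beta>" using brk_ef[OF assms(1,2)] assms(3) by (simp add: lets_def)
  thus ?thesis using assms(1) by (simp add: span_scale span_base)
 qed
 thus ?thesis using assms root_space_brk[OF assms(2)] dual_closed(2) Phi_dual by (auto simp: lets_def)
qed

lemma uw_commute:
 assumes "csubspace S" "\<beta> \<in> \<Phi>" "e \<in> gsp \<beta>" "set l <= lets"
  and "!!l'. set l' <= lets ==> length l' = length l ==> wt l' = \<beta> + wt l ==> uw l' \<in> S" shows "uea_in e * uw l - uw l * uea_in e \<in> S"
proof (rule uword_commute[OF assms(1)])
 fix l1 x l2 assume "map fst l = l1 @ x # l2"
 then obtain k1 \<gamma> k2 where l: "l = k1 @ (x, \<gamma>) # k2" "l1 = map fst k1" "l2 = map fst k2"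
  by (auto simp: map_eq_append_conv map_eq_Cons_conv)
 show "uword (l1 @ brk e x # l2) \<in> S" using assms(5)[of "k1 @ (brk e x, \<beta> + \<gamma>) # k2"] assms(4) lets_brk[OF assms(2,3), of x \<gamma>]
  by (simp add: l algebra_simps)
qed

lemma lets_cases:
 assumes "(y, \<gamma>) \<in> lets"
 obtains "\<gamma> = 0" "y \<in> hp" "y \<in> H" | "\<gamma> \<in> \<Psi>" "y \<in> gsp \<gamma>" | "\<gamma> ~= 0" "- \<gamma> \<in> \<Psi>" | "\<gamma> ~= 0" "y = 0"
 using assms gsp_zero[of \<gamma>] Psi_total[of \<gamma>] hp_H unfolding lets_def by blast

text \<open>Such a word leads out of the weights of the Verma module. A first letter from a positive
  root space is moved to the right end, where it falls into the ideal; the commutators are shorter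
  words of the same total weight.\<close>

lemma uw_kill: "set l <= lets ==> - wt l \<notin> Qp ==> uw l \<in> Iv \<mu>"
proof (induction "length l" arbitrary: l rule: less_induct)
 case less
 show ?case
 proof (cases l)
  case Nil thus ?thesis using less.prems Qp_0 by simp
 next
  case (Cons z r)
  obtain y \<gamma> where z: "z = (y, \<gamma>)" by (cases z)
  have y: "(y, \<gamma>) \<in> lets" and r: "set r <= lets" using less.prems Cons z by auto
  have l: "uw l = uea_in y * uw r" "wt l = \<gamma> + wt r" by (simp_all add: Cons z uword_simps)
  from y show ?thesis
  proof (cases rule: lets_cases)
   case 1
   thus ?thesis using less.hyps[of r] less.prems r Cons l by (simp add: Iv_left)
  next
   case 2
   have "uea_in y * uw r - uw r * uea_in y \<in> Iv \<mu>"
    using less.hyps less.prems Cons l by (intro uw_commute[OF Iv_sub Psi_Phi[OF 2(1)] 2(2) r]) auto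
   hence "(uea_in y * uw r - uw r * uea_in y) + uw r * uea_in y \<in> Iv \<mu>" by (rule subspace_add[OF Iv_sub _ Iv_e[OF 2]])
   thus ?thesis by (simp add: l)
  next
   case 3
   have "- wt r \<notin> Qp"
   proof
    assume "- wt r \<in> Qp"
    hence "- wt r + - \<gamma> \<in> Qp" by (rule Qp_add[OF _ Qp_Psi[OF 3(2)]])
    thus False using less.prems l by (simp add: algebra_simps)
   qed
   thus ?thesis using less.hyps[of r] r Cons l by (simp add: Iv_left)
  next
   case 4 thus ?thesis by (simp add: l uin subspace_0[OF Iv_sub])
  qed
 qed
qed

text \<open>The Harish-Chandra projection as a congruence, without a normal form of
  \<open>u\<close>: on a highest weight vector of weight \<mu> the element \<open>u\<close> acts by
  \<open>p \<mu>\<close>.\<close>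

definition HC :: "'g uea => (('g => complex) => complex) => bool" where
 "HC u p \<longleftrightarrow> (\<forall>\<mu>\<in>hstar. u - p \<mu> *\<^sub>C 1 \<in> Iv \<mu>)"

lemma HC_add: assumes "HC u p" "HC v q" shows "HC (u + v) (%\<mu>. p \<mu> + q \<mu>)"
proof -
 have "(u - p \<mu> *\<^sub>C 1) + (v - q \<mu> *\<^sub>C 1) \<in> Iv \<mu>" if "\<mu> \<in> hstar" for \<mu>
  using assms that by (intro subspace_add[OF Iv_sub]) (auto simp: HC_def)
 thus ?thesis by (simp add: HC_def scaleC_add_left algebra_simps)
qed

lemma HC_scale: assumes "HC u p" shows "HC (c *\<^sub>C u) (%\<mu>. c * p \<mu>)"
proof -
 have "c *\<^sub>C (u - p \<mu> *\<^sub>C 1) \<in> Iv \<mu>" if "\<mu> \<in> hstar" for \<mu>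
  using assms that by (intro subspace_scale[OF Iv_sub]) (auto simp: HC_def)
 thus ?thesis by (simp add: HC_def scale_right_diff_distrib scaleC_scaleC)
qed

lemma HC_0: "(!!\<mu>. \<mu> \<in> hstar ==> u \<in> Iv \<mu>) ==> HC u (%_. 0)" by (simp add: HC_def)

lemma HC_t: assumes "t \<in> H" "HC u p" shows "HC (uea_in t * u) (%\<mu>. \<mu> t * p \<mu>)"
proof -
 have "uea_in t * (u - p \<mu> *\<^sub>C 1) + p \<mu> *\<^sub>C (1 * (uea_in t - \<mu> t *\<^sub>C 1)) \<in> Iv \<mu>" if "\<mu> \<in> hstar" for \<mu>
  using assms that by (intro subspace_add[OF Iv_sub] subspace_scale[OF Iv_sub] Iv_left Iv_t) (auto simp: HC_def)
 thus ?thesis by (simp add: HC_def algebra_simps mult_scaleC_right scale_right_diff_distrib scaleC_scaleC)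
qed

lemma HC_subspace: "csubspace {u. \<exists>p. Pol m p \<and> HC u p}"
proof (rule csubspaceI)
 show "0 \<in> {u. \<exists>p. Pol m p \<and> HC u p}" using HC_0[of 0] Pol_const[of m 0] subspace_0[OF Iv_sub] by auto
qed (use HC_add HC_scale Pol_add Pol_scale in blast)+

text \<open>The degree drops as soon as a letter has nonzero weight, because moving a positive
  letter to the right end leaves only shorter words. So only words in \<open>hp\<close> contribute
  to leading terms.\<close>

lemma HC_word:
 "set l <= lets ==> wt l = 0 ==> \<exists>p. Pol (if \<forall>x\<in>set l. snd x = 0 then length l else length l - 1) p \<and> HC (uw l) p"
proof (induction "length l" arbitrary: l rule: less_induct)
 case less
 show ?case
 proof (cases l)
  case Nil
  have "HC (1 :: 'g uea) (%_. 1)" by (simp add: HC_def scaleC_one subspace_0[OF Iv_sub])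
  thus ?thesis using Nil Pol_const[of 0 1] by (auto simp: uword_simps)
 next
  case (Cons z r)
  obtain y \<gamma> where z: "z = (y, \<gamma>)" by (cases z)
  have y: "(y, \<gamma>) \<in> lets" and r: "set r <= lets" using less.prems Cons z by auto
  have l: "uw l = uea_in y * uw r" "\<gamma> + wt r = 0" using less.prems(2) by (simp_all add: Cons z uword_simps)
  from y show ?thesis
  proof (cases rule: lets_cases)
   case 1
   then obtain p where p: "Pol (if \<forall>x\<in>set r. snd x = 0 then length r else length r - 1) p" "HC (uw r) p"
    using less.hyps[of r] r Cons l by auto
   have "Pol (if \<forall>x\<in>set l. snd x = 0 then length l else length l - 1) (%\<mu>. \<mu> y * p \<mu>)"
    using Pol_eval[OF 1(2) p(1)] 1(1) by (cases r) (auto simp: Cons z split: if_splits)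
   moreover have "HC (uw l) (%\<mu>. \<mu> y * p \<mu>)" using HC_t[OF 1(3) p(2)] l by simp
   ultimately show ?thesis by blast
  next
   case 2
   let ?S = "{u. \<exists>p. Pol (length r) p \<and> HC u p}"
   have "uea_in y * uw r - uw r * uea_in y \<in> ?S"
   proof (rule uw_commute[OF HC_subspace Psi_Phi[OF 2(1)] 2(2) r])
    fix l' assume l': "set l' <= lets" "length l' = length r" "wt l' = \<gamma> + wt r"
    then obtain p where "Pol (if \<forall>x\<in>set l'. snd x = 0 then length l' else length l' - 1) p" "HC (uw l') p"
     using less.hyps[of l'] Cons l by auto
    thus "uw l' \<in> ?S" using l'(2) Pol_mono[of _ p "length r"] by (auto split: if_splits)
   qed
   moreover have "uw r * uea_in y \<in> ?S" using HC_0[OF Iv_e[OF 2]] Pol_const by blast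
   ultimately have "(uea_in y * uw r - uw r * uea_in y) + uw r * uea_in y \<in> ?S" by (rule subspace_add[OF HC_subspace])
   moreover have "\<gamma> ~= 0" using Phi_nz[OF Psi_Phi[OF 2(1)]] .
   ultimately show ?thesis by (auto simp: Cons z uword_simps)
  next
   case 3
   have "wt r = - \<gamma>" using l(2) by (simp add: add_eq_0_iff)
   hence "- wt r \<notin> Qp" using Qp_pointed[of "- \<gamma>"] Qp_Psi[OF 3(2)] 3(1) by auto
   hence "HC (uw l) (%_. 0)" using uw_kill[OF r] by (intro HC_0) (simp add: l Iv_left)
   thus ?thesis using Pol_const by blast
  next
   case 4
   hence "HC (uw l) (%_. 0)" by (intro HC_0) (simp add: l uin subspace_0[OF Iv_sub])
   thus ?thesis using Pol_const by blast
  qed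
 qed
qed

end

section \<open>Invariance of central characters\<close>

context borel_lie
begin

text \<open>Induction on the height: a positive root that is not simple is a sum of two lower ones,
  and the bracket of their root spaces is nonzero in a one-dimensional space.\<close>

lemma positive_generated:
 assumes K: "csubspace K" "!!x y. x \<in> K ==> y \<in> K ==> brk x y \<in> K"
  and D: "!!\<alpha>. \<alpha> \<in> \<Delta> ==> gsp \<alpha> <= K" and b: "\<beta> \<in> \<Psi>" shows "gsp \<beta> <= K"
proof -
 obtain n where "\<beta> Hel = of_nat n" using Qp_ht[OF Qp_Psi[OF b]] by blast
 thus ?thesis using b
 proof (induction n arbitrary: \<beta> rule: less_induct)
  case (less n)
  show ?case
  proof (cases "\<beta> \<in> \<Delta>")
   case False
   then obtain \<gamma> \<delta> where g: "\<gamma> \<in> \<Psi>" "\<delta> \<in> \<Psi>" "\<beta> = \<gamma> + \<delta>" using less.prems(2) by (auto simp: \<Delta>_def)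
   obtain i j where ij: "\<gamma> Hel = of_nat i" "\<delta> Hel = of_nat j" "i ~= 0" "j ~= 0"
    using Qp_ht[OF Qp_Psi[OF g(1)]] Qp_ht[OF Qp_Psi[OF g(2)]] Phi_nz[OF Psi_Phi[OF g(1)]] Phi_nz[OF Psi_Phi[OF g(2)]] by blast
   have "of_nat n = (of_nat (i + j) :: complex)" using less.prems(1) ij by (simp add: g(3))
   hence n: "n = i + j" unfolding of_nat_eq_iff .
   obtain e v where e: "e \<in> gsp \<gamma>" "e ~= 0" and v: "v \<in> gsp \<delta>" "v ~= 0" using gsp_nonzero Psi_Phi g by meson
   have "brk e v ~= 0" using brk_gsp_nonzero[OF Psi_Phi[OF g(1)] Psi_Phi[OF g(2)]] Psi_Phi[OF less.prems(2)] e v g(3) by blast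
   moreover have "brk e v \<in> K" using K(2) less.IH[OF _ ij(1) g(1)] less.IH[OF _ ij(2) g(2)] n ij e v by auto
   moreover have "brk e v \<in> gsp \<beta>" using root_space_brk[OF e(1) v(1)] g(3) by simp
   ultimately show ?thesis using gsp_inter_subspace[OF K(1) Psi_Phi[OF less.prems(2)]] by blast
  qed (rule D)
 qed
qed

lemma simple_triple:
 assumes "\<alpha> \<in> \<Delta>"
 obtains e f where "e \<in> gsp \<alpha>" "f \<in> gsp (- \<alpha>)" "e ~= 0" "f ~= 0" "brk e f = coroot \<alpha>"
proof -
 obtain e where e: "e \<in> gsp \<alpha>" "e ~= 0" using gsp_nonzero[OF Delta_Phi[OF assms]] by blast
 obtain f where f: "f \<in> gsp (- \<alpha>)" "brk e f = coroot \<alpha>" using sl2_triple[OF Delta_Phi[OF assms] e] by blast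
 have "coroot \<alpha> ~= 0"
  using root_coroot[OF Delta_Phi[OF assms]] H_dual_linear(2)[OF Phi_dual[OF Delta_Phi[OF assms]] subspace_0[OF H_sub], of 0] by auto
 hence "f ~= 0" using f(2) by (auto simp: brk_simps)
 thus thesis using that e f by blast
qed

lemma weight_lower:
 assumes a: "lie_rep a" and t: "t \<in> H" and f: "f \<in> gsp \<gamma>" and w: "a t w = m *\<^sub>C w"
 shows "a t ((a f ^^ k) w) = (m + of_nat k * \<gamma> t) *\<^sub>C (a f ^^ k) w"
proof (induction k)
 case (Suc k)
 have "brk t f = \<gamma> t *\<^sub>C f" using f t by (simp add: root_space_def)
 moreover have "a t (a f ((a f ^^ k) w)) = a (brk t f) ((a f ^^ k) w) + a f (a t ((a f ^^ k) w))" by (simp add: rep_simps[OF a])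
 ultimately have "a t (a f ((a f ^^ k) w)) = \<gamma> t *\<^sub>C a f ((a f ^^ k) w) + (m + of_nat k * \<gamma> t) *\<^sub>C a f ((a f ^^ k) w)"
  by (simp add: Suc rep_simps[OF a])
 thus ?case by (simp flip: scaleC_add_left) (simp add: algebra_simps)
qed (simp add: w)

text \<open>The string formula shows that \<open>e\<close> kills the vector. For another simple root
  \<beta> the difference \<beta> - \<alpha> is not a root, so its root vectors commute with
  \<open>f\<close>. Simple root vectors generate the other positive ones.\<close>

lemma hw_lower:
 assumes a: "lie_rep a" and w: "hw a \<mu> w" and al: "\<alpha> \<in> \<Delta>" and ef: "e \<in> gsp \<alpha>" "f \<in> gsp (- \<alpha>)" "e ~= 0" "brk e f = coroot \<alpha>"
  and n: "\<mu> (coroot \<alpha>) = of_nat n" shows "hw a (%x. \<mu> x - of_nat (Suc n) * killing (tv \<alpha>) x) ((a f ^^ Suc n) w)"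
proof -
 note aP = Delta_Phi[OF al]
 let ?v = "(a f ^^ Suc n) w"
 have "brk (coroot \<alpha>) f = - 2 *\<^sub>C f" using ef(2) coroot_H[OF aP] root_coroot[OF aP] by (simp add: root_space_def)
 from sl2_string(2)[OF a ef(4) this, of w "\<mu> (coroot \<alpha>)" n]
 have e0: "a e ?v = 0" using w Delta_Psi[OF al] ef(1) coroot_H[OF aP] by (simp add: hw_def n)
 let ?K = "{x. a x ?v = 0}"
 have "gsp \<beta> <= ?K" if "\<beta> \<in> \<Psi>" for \<beta>
 proof (rule positive_generated[OF _ _ _ that])
  show "csubspace ?K" by (intro csubspaceI) (auto simp del: funpow.simps simp: rep_simps[OF a])
  show "!!x y. x \<in> ?K ==> y \<in> ?K ==> brk x y \<in> ?K" by (simp del: funpow.simps add: rep_simps[OF a])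
  fix \<beta> assume b: "\<beta> \<in> \<Delta>"
  show "gsp \<beta> <= ?K"
  proof
   fix x assume x: "x \<in> gsp \<beta>"
   show "x \<in> ?K"
   proof (cases "\<beta> = \<alpha>")
    case True
    then obtain c where "x = c *\<^sub>C e" using gsp_dim_one[OF aP ef(1,3)] x by blast
    thus ?thesis using e0 by (simp del: funpow.simps add: rep_simps[OF a])
   next
    case False
    have "\<beta> + - \<alpha> \<notin> \<Phi>"
    proof
     assume "\<beta> + - \<alpha> \<in> \<Phi>"
     hence "\<beta> - \<alpha> \<in> \<Psi>" using Delta_minus[OF al Delta_Psi[OF b]] by (metis diff_conv_add_uminus)
     moreover have "\<beta> = \<alpha> + (\<beta> - \<alpha>)" by (simp only: add_diff_eq add_diff_cancel_left')
     ultimately show False using b Delta_Psi[OF al] unfolding \<Delta>_def by blast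
    qed
    moreover have "\<beta> + - \<alpha> ~= 0" using False by (metis add_eq_0_iff minus_equation_iff neg_eq_iff_add_eq_0)
    moreover have "\<beta> + - \<alpha> \<in> dual H" using Phi_dual Delta_Phi al b dual_closed(2) Phi_uminus by blast
    ultimately have "brk x f = 0" using root_space_brk[OF x ef(2)] gsp_zero by blast
    hence "a x (a f v) = a f (a x v)" for v using rep_simps(11)[OF a, of x f v] by (simp add: rep_simps[OF a])
    hence "a x ((a f ^^ k) w) = 0" for k using w x Delta_Psi[OF b] by (induction k) (auto simp: hw_def rep_simps[OF a])
    thus ?thesis by blast
   qed
  qed
 qed
 moreover have "a t ?v = (\<mu> t - of_nat (Suc n) * killing (tv \<alpha>) t) *\<^sub>C ?v" if "t \<in> H" for t
  using weight_lower[OF a that ef(2), of w "\<mu> t" "Suc n"] w that tv(3)[OF Phi_repr[OF aP] that] by (simp del: funpow.simps add: hw_def)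
 ultimately show ?thesis unfolding hw_def by blast
qed

lemma hstar_B: assumes m: "\<mu> \<in> hstar" and "x \<in> B" "y \<in> B" shows "\<mu> (brk x y) = 0"
proof -
 have m0: "\<mu> v = 0" if "v \<in> gsp \<gamma>" "\<gamma> \<in> dual H" "\<gamma> ~= 0" for v \<gamma>
  using that hstar_gsp[OF m] gsp_zero[of \<gamma>] clinear_zero[OF hstar_linear[OF m]] by (cases "\<gamma> \<in> \<Phi>") auto
 have pair: "\<mu> (brk x y) = 0" if "x \<in> gsp \<beta>" "y \<in> gsp \<gamma>" "\<beta> \<in> insert 0 \<Psi>" "\<gamma> \<in> insert 0 \<Psi>" for x y \<beta> \<gamma>
 proof (cases "\<beta> + \<gamma> = 0")
  case True
  have "\<beta> \<in> Qp" "\<gamma> \<in> Qp" using that Qp_0 Qp_Psi by auto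
  hence "\<beta> = 0 \<and> \<gamma> = 0" using True Qp_pointed[of \<beta>] by (metis add_cancel_left_left minus_unique)
  thus ?thesis using that H_abelian root_space_0 clinear_zero[OF hstar_linear[OF m]] by simp
 next
  case False
  have "\<beta> + \<gamma> \<in> dual H" using that Phi_dual Psi_Phi dual_closed(1,2) by (metis insertE)
  thus ?thesis using m0[OF root_space_brk[OF that(1,2)]] False by blast
 qed
 let ?S = "\<Union>\<beta>\<in>insert 0 \<Psi>. gsp \<beta>"
 have S: "B = cspan ?S" using B_eq by (simp add: root_alg_def root_space_0)
 have lin: "clinear (%x. \<mu> (brk x y))" "clinear (%y. \<mu> (brk x y))" for x y
  using clinear_compose[OF hstar_linear[OF m] clinear_brk] hstar_linear[OF m] by (auto intro!: clinearI simp: brk_add_left brk_scaleC_left clin)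
 have SS: "\<mu> (brk x y) = 0" if xy: "x \<in> ?S" "y \<in> ?S" for x y
 proof -
  obtain \<beta> \<gamma> where "\<beta> \<in> insert 0 \<Psi>" "x \<in> gsp \<beta>" "\<gamma> \<in> insert 0 \<Psi>" "y \<in> gsp \<gamma>" using xy by (elim UN_E)
  thus ?thesis by (intro pair)
 qed
 have "\<mu> (brk x y) = 0" if x: "x \<in> ?S" for x
  using clinear_eq_on_span[of "%y. \<mu> (brk x y)" "%_. 0" ?S y] lin(2) clinear_const_0 SS[OF x] assms(3) S by simp
 thus ?thesis using clinear_eq_on_span[of "%x. \<mu> (brk x y)" "%_. 0" ?S x] lin(1) clinear_const_0 assms(2) S by simp
qed

text \<open>Induction from the character \<mu> of \<open>B\<close>. The basis is adapted to the line
  of \<open>f\<close>, so for a negative root vector \<open>f\<close> its powers on the generator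
  are, up to nonzero scalars, words in a single letter.\<close>

lemma verma_exists:
 assumes m: "\<mu> \<in> hstar"
 shows "\<exists>(a :: 'g => (nat list \<Rightarrow>\<^sub>0 complex) => _) w. lie_rep a \<and> hw a \<mu> w \<and> w ~= 0 \<and>
  (\<forall>\<beta>\<in>\<Psi>. f \<in> gsp (- \<beta>) --> f ~= 0 --> (\<forall>k. (a f ^^ k) w ~= 0))"
proof -
 obtain n :: nat and b :: "nat => 'g" and c and I where bc: "!!i. clinear (c i)" "!!i j. i < n ==> j < n ==> c i (b j) = (if i = j then 1 else (0::complex))"
  "B = {y. \<forall>i<n. c i y = 0}" "I <= {..<n}" "!!i. i \<in> I ==> b i \<in> cspan {f}"
  "!!i y. i < n ==> i \<notin> I ==> y \<in> cspan {f} ==> c i y = 0"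
  by (rule adapted_basis[OF fd B_sub, where K = "cspan {f}"]) (rule that; assumption)
 interpret V: induced_module n b c B "%x v. \<mu> x * v" by (rule induced_module.intro[OF bc(1,2,3) B_brk])
   (simp_all add: hstar_B[OF m] lie_module_def algebra_simps scaleC_complex clinC[OF hstar_linear[OF m]])
 let ?w = "Poly_Mapping.single [] 1 :: nat list \<Rightarrow>\<^sub>0 complex"
 have wB: "V.act x ?w = \<mu> x *\<^sub>C ?w" if "x \<in> B" for x
  using V.act_P[OF that, of 1] clinear_scale[OF single_linear, of "[]" "\<mu> x" "1::complex"] by (simp add: scaleC_complex)
 have "hw V.act \<mu> ?w" unfolding hw_def using wB Psi_B HB hstar_gsp[OF m Psi_Phi] by (auto simp: subset_iff)
 moreover have "(V.act f ^^ k) ?w ~= 0" if b: "\<beta> \<in> \<Psi>" and f: "f \<in> gsp (- \<beta>)" "f ~= 0" for \<beta> k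
 proof -
  have "f \<notin> B" using gsp_inter_subspace[OF B_sub Phi_uminus[OF Psi_Phi[OF b]] f(1)] f(2) Psi_opposite[OF b]
    Phi_uminus[OF Psi_Phi[OF b]] by (auto simp: pos_roots_def)
  then obtain i where i: "i < n" "c i f ~= 0" using bc(3) by auto
  hence "i \<in> I" using bc(6)[of i f] span_base by blast
  then obtain s where s: "b i = s *\<^sub>C f" using bc(5)[of i] by (auto simp: complex_vector.span_singleton)
  have bk: "(V.act (b i) ^^ k) ?w = Poly_Mapping.single (replicate k i) 1"
  proof (induction k)
   case (Suc k)
   have "V.good (i # replicate k i)" using i(1) by (auto simp: V.good_def)
   thus ?case using Suc V.act_front by simp
  qed simp
  have "(V.act (b i) ^^ k) ?w = s ^ k *\<^sub>C (V.act f ^^ k) ?w" by (induction k) (simp_all add: s rep_simps[OF V.act_rep] scaleC_scaleC scaleC_one)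
  thus ?thesis using bk by (metis complex_vector.scale_zero_right single_zero zero_neq_one lookup_single_eq lookup_zero)
 qed
 moreover have "?w ~= 0" by (metis lookup_single_eq lookup_zero zero_neq_one)
 ultimately show ?thesis using V.act_rep by blast
qed

lemma HC_hw: "HC u p ==> \<mu> \<in> hstar ==> lie_rep a ==> hw a \<mu> w ==> uact a u w = p \<mu> *\<^sub>C w"
 using Iv_hw[of a \<mu> w "u - p \<mu> *\<^sub>C 1"] by (simp add: HC_def uact_simps)

text \<open>If \<open>\<mu> (coroot \<alpha>)\<close> is a natural number, the Verma module has a
  singular vector of the reflected weight, and \<open>z\<close> acts on it by the same scalar. The
  line through \<mu> in direction \<alpha> contains infinitely many such weights, and a polynomial
  identity extends from them to the whole line.\<close>

lemma HC_dot:
 assumes z: "z \<in> uea_center" "HC z p" and p: "Pol m p" and al: "\<alpha> \<in> \<Delta>" and mu: "\<mu> \<in> hstar"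
 shows "p (%x. \<mu> x - (\<mu> (coroot \<alpha>) + 1) * killing (tv \<alpha>) x) = p \<mu>"
proof -
 note aP = Delta_Phi[OF al]
 let ?k = "killing (tv \<alpha>)"
 have k: "?k \<in> hstar" "?k (coroot \<alpha>) = 2" using killing_hstar[OF aP] killing_tv_coroot[OF aP] by auto
 obtain e f where ef: "e \<in> gsp \<alpha>" "f \<in> gsp (- \<alpha>)" "e ~= 0" "f ~= 0" "brk e f = coroot \<alpha>" using simple_triple[OF al] by blast
 have int: "p (%x. \<nu> x - (\<nu> (coroot \<alpha>) + 1) * ?k x) = p \<nu>" if nu: "\<nu> \<in> hstar" "\<nu> (coroot \<alpha>) = of_nat n" for \<nu> n
 proof -
  obtain a :: "'g => (nat list \<Rightarrow>\<^sub>0 complex) => _" and w where a: "lie_rep a" "hw a \<nu> w" "(a f ^^ Suc n) w ~= 0"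
   using verma_exists[OF nu(1), of f] Delta_Psi[OF al] ef by blast
  let ?nu = "%x. \<nu> x - of_nat (Suc n) * ?k x"
  have "hw a ?nu ((a f ^^ Suc n) w)" by (rule hw_lower[OF a(1,2) al ef(1-3,5) nu(2)])
  hence 1: "uact a z ((a f ^^ Suc n) w) = p ?nu *\<^sub>C (a f ^^ Suc n) w" by (intro HC_hw[OF z(2)] hstar_diff nu hstar_scale k a)
  have "uact a z (a f v) = a f (uact a z v)" for v
   using uact_mult[OF a(1), of z "uea_in f" v] uact_mult[OF a(1), of "uea_in f" z v] z(1) by (simp add: uact_in[OF a(1)] uea_center_def)
  hence "uact a z ((a f ^^ j) w) = (a f ^^ j) (uact a z w)" for j by (induction j) simp_all
  also have "(a f ^^ j) (uact a z w) = p \<nu> *\<^sub>C (a f ^^ j) w" for j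
   unfolding HC_hw[OF z(2) nu(1) a(1,2)] by (rule clinear_scale[OF clinear_funpow]) (use a in \<open>simp add: lie_rep_def\<close>)
  finally have "p ?nu *\<^sub>C (a f ^^ Suc n) w = p \<nu> *\<^sub>C (a f ^^ Suc n) w" by (simp only: 1[symmetric])
  hence "p ?nu = p \<nu>" using a(3) scale_cancel_right by blast
  thus ?thesis by (simp add: nu(2) add.commute)
 qed
 let ?c = "\<mu> (coroot \<alpha>)"
 obtain q where q: "!!s. p (%x. \<mu> x + s * ?k x) = poly q s" using Pol_line[OF p mu k(1)] by blast
 \<comment> \<open>The parameter at which the coroot takes the value \<open>n\<close>, since
   \<open>?k (coroot \<alpha>) = 2\<close>.\<close>
 define s where "s n = (of_nat n - ?c) / 2" for n :: nat
 \<comment> \<open>In the parameter of the line the dot reflection sends \<open>s\<close> to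
   \<open>- ?c - 1 - s\<close>.\<close>
 define d where "d = q - pcompose q [:- ?c - 1, - 1:]"
 have "poly d (s n) = 0" for n
 proof -
  let ?nu = "%x. \<mu> x + s n * ?k x"
  have nu: "?nu \<in> hstar" "?nu (coroot \<alpha>) = of_nat n" by (rule hstar_add[OF mu hstar_scale[OF k(1)]], simp add: s_def k(2) field_simps)
  have "(%x. ?nu x - (?nu (coroot \<alpha>) + 1) * ?k x) = (%x. \<mu> x + (- ?c - 1 - s n) * ?k x)" by (simp add: fun_eq_iff k(2) algebra_simps)
  with int[OF nu] have "poly q (- ?c - 1 - s n) = poly q (s n)" by (simp only: q)
  moreover have "poly [:- ?c - 1, - 1:] (s n) = - ?c - 1 - s n" by simp
  ultimately show ?thesis by (simp only: d_def poly_diff poly_pcompose diff_self)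
 qed
 hence "range s <= {x. poly d x = 0}" by auto
 moreover have "infinite (range s)" by (rule range_inj_infinite) (auto simp: s_def inj_on_def)
 ultimately have "d = 0" using poly_roots_finite finite_subset by blast
 hence "poly d 0 = 0" by simp
 hence "poly q 0 = poly q (- ?c - 1)" by (simp add: d_def poly_pcompose)
 moreover have "(%x. \<mu> x - (?c + 1) * ?k x) = (%x. \<mu> x + (- ?c - 1) * ?k x)" by (simp add: fun_eq_iff algebra_simps)
 ultimately show ?thesis using q[of 0] q[of "- ?c - 1"] by simp
qed

definition rh :: "'g => complex" where "rh = (SOME r. r \<in> hstar \<and> (\<forall>x\<in>H. r x = \<rho>0 x))"

lemma rh: "rh \<in> hstar" "x \<in> H ==> rh x = \<rho>0 x"
proof -
 have "\<exists>r. r \<in> hstar \<and> (\<forall>x\<in>H. r x = \<rho>0 x)" by (rule hstar_ext[OF rho_dual]) blast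
 from someI_ex[OF this, folded rh_def] show "rh \<in> hstar" "x \<in> H ==> rh x = \<rho>0 x" by auto
qed

text \<open>Turns invariance under the dot action into invariance under the linear action of
  \<open>G\<close>.\<close>

definition unshift :: "(('g => complex) => complex) => ('g => complex) => complex" where
 "unshift p \<eta> = p (%x. \<eta> x - rh x)"

lemma HC_invariant:
 assumes z: "z \<in> uea_center" "HC z p" and p: "Pol m p" and g: "g \<in> G" and eta: "\<eta> \<in> hstar"
 shows "unshift p (%x. \<eta> (g x)) = unshift p \<eta>" using g eta
proof (induction arbitrary: \<eta> rule: G.induct)
 case G_id show ?case by (simp add: id_def)
next
 case (G_step g \<alpha>)
 have e: "(%x. \<eta> (g x)) \<in> hstar" by (rule hstar_G[OF G_step(1,4)])
 define \<xi> where "\<xi> = (%x. \<eta> (g x))"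
 have xi: "\<xi> \<in> hstar" using e by (simp add: \<xi>_def)
 have "(%x. \<xi> (hrefl \<alpha> x) - rh x) = (%x. (\<xi> x - rh x) - ((\<xi> (coroot \<alpha>) - rh (coroot \<alpha>)) + 1) * killing (tv \<alpha>) x)"
  using rh(2)[OF coroot_H[OF Delta_Phi[OF G_step(2)]]] rho_coroot[OF G_step(2)] by (simp add: fun_eq_iff hrefl_def clinC[OF hstar_linear[OF xi]])
 hence "unshift p (%x. \<xi> (hrefl \<alpha> x)) = unshift p \<xi>" using HC_dot[OF z p G_step(2) hstar_diff[OF xi rh(1)]] by (simp add: unshift_def)
 thus ?case using G_step.IH[OF G_step.prems] by (simp add: \<xi>_def)
qed

end

section \<open>Finite-dimensional highest weight representations\<close>

text \<open>Raise \<open>v\<close> to the top of its string in \<open>k\<close> steps, then lower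
  \<open>n + k\<close> times to reach the reflected weight. The top has eigenvalue
  \<open>n + 2 k\<close>, so no coefficient met on the way down vanishes.\<close>

lemma sl2_reflect:
 assumes a: "lie_rep a" and ef: "brk e f = h" "brk h f = - 2 *\<^sub>C f" "brk h e = 2 *\<^sub>C e"
  and v: "v ~= 0" "a h v = of_nat n *\<^sub>C v" "(a e ^^ m) v = 0" shows "\<exists>k. (a f ^^ (n + k)) ((a e ^^ k) v) ~= 0"
proof (rule sl2_top[OF a ef v])
 fix k assume k: "(a e ^^ k) v ~= 0" "(a e ^^ Suc k) v = 0" "a h ((a e ^^ k) v) = (of_nat n + 2 * of_nat k) *\<^sub>C (a e ^^ k) v"
 have "(of_nat n + 2 * of_nat k :: complex) ~= of_nat j" if "j < n + k" for j
  using that by (metis add_left_imp_eq le_add2 mult_2 not_add_less1 of_nat_add of_nat_eq_iff add.assoc)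
 thus ?thesis using sl2_string_nonzero[OF a ef(1,2) k(1) _ k(3), of "n + k"] k(2) by auto
qed

lemma lie_module_simps:
 assumes "lie_module K a UNIV" "x \<in> K" shows "clinear (a x)" "y \<in> K ==> a (x + y) p = a x p + a y p" "a (c *\<^sub>C x) p = c *\<^sub>C a x p"
  "y \<in> K ==> a (brk x y) p = a x (a y p) - a y (a x p)" "a 0 p = 0"
proof -
 show s: "a (c *\<^sub>C x) p = c *\<^sub>C a x p" for c using assms by (simp add: lie_module_def)
 show "clinear (a x)" "y \<in> K ==> a (x + y) p = a x p + a y p"
  "y \<in> K ==> a (brk x y) p = a x (a y p) - a y (a x p)" using assms by (auto simp: lie_module_def intro!: clinearI)
 show "a 0 p = 0" using s[of 0] by simp
qed

text \<open>The submodule generated by a common eigenvector \<open>w\<close> of \<open>E\<close>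
  needs only words in \<open>F\<close>: any other letter is commuted towards \<open>w\<close>, where
  \<open>E\<close> acts by scalars.\<close>

lemma words_stable:
 assumes m: "lie_module K a UNIV" and K: "lie_subalgebra K" "K = cspan (F \<union> E)"
  and w: "!!x. x \<in> E ==> \<exists>c. a x w = c *\<^sub>C w" and x: "x \<in> K" and p: "p \<in> cspan ((%fs. foldr a fs w) ` lists F)"
 shows "a x p \<in> cspan ((%fs. foldr a fs w) ` lists F)" (is "_ \<in> ?W")
proof -
 have FK: "F <= K" "E <= K" unfolding K(2) using span_superset[of "F \<union> E"] by auto
 have base: "foldr a fs w \<in> ?W" if "fs \<in> lists F" for fs by (rule span_base[OF imageI[OF that]])
 have words: "a x (foldr a fs w) \<in> ?W" if "fs \<in> lists F" "x \<in> K" for fs x using that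
 proof (induction fs arbitrary: x)
  case Nil
  have "x \<in> cspan (F \<union> E)" using Nil.prems K(2) by blast
  hence "x \<in> K \<and> a x w \<in> ?W"
  proof (induction rule: span_induct_alt)
   case base
   show ?case using lie_module_simps(5)[OF m x] by (simp add: K(2) span_zero)
  next
   case (step c y z)
   have "a y w \<in> ?W"
   proof (cases "y \<in> F")
    case True thus ?thesis using base[of "[y]"] by simp
   next
    case False
    then obtain c where "a y w = c *\<^sub>C w" using w step.hyps by blast
    thus ?thesis using base[of "[]"] span_scale by simp
   qed
   moreover have "y \<in> K" "z \<in> K" using step FK by auto
   ultimately show ?case using step.IH K(1) by (simp add: lie_module_simps[OF m] lie_subalgebra_def span_add
      span_scale subspace_scale subspace_add)
  qed
  thus ?case by simp
 next
  case (Cons f fs)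
  let ?v = "foldr a fs w"
  have f: "f \<in> F" "f \<in> K" "fs \<in> lists F" using Cons FK by auto
  have fW: "a f q \<in> ?W" if "q \<in> ?W" for q
  proof (rule clinear_span_in[OF lie_module_simps(1)[OF m f(2)] subspace_span _ that])
   fix v assume "v \<in> (%fs. foldr a fs w) ` lists F"
   then obtain gs where "v = foldr a gs w" "gs \<in> lists F" by blast
   thus "a f v \<in> ?W" using base[of "f # gs"] f by simp
  qed
  have "a x (a f ?v) = a f (a x ?v) + a (brk x f) ?v" using lie_module_simps(4)[OF m Cons.prems f(2)] by simp
  also have "\<dots> \<in> ?W" using Cons.IH Cons.prems f(2) K(1) by (intro span_add fW) (auto simp: lie_subalgebra_def)
  finally show ?case by simp
 qed
 show ?thesis by (rule clinear_span_in[OF lie_module_simps(1)[OF m x] subspace_span _ p]) (use words x in blast)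
qed

text \<open>The Leibniz rule for \<open>a y\<close>, by induction on the sum of the exponents. It
  spreads local nilpotency of \<open>a y\<close> from a generator to the whole module.\<close>

lemma locally_nilpotent_stable:
 assumes a: "lie_rep a" shows "(brk y ^^ d) x = 0 ==> (a y ^^ m) v = 0 ==> (a y ^^ (d + m)) (a x v) = 0"
proof (induction "d + m" arbitrary: d m x v)
 case 0
 thus ?case by (simp add: rep_simps[OF a])
next
 case (Suc n)
 have z: "(a y ^^ j) 0 = 0" for j by (induction j) (simp_all add: rep_simps[OF a])
 have lin: "clinear (a y ^^ j)" for j by (rule clinear_funpow) (use a in \<open>simp add: lie_rep_def\<close>)
 show ?case
 proof (cases "d = 0 \<or> m = 0")
  case True thus ?thesis using Suc.prems z by (auto simp: rep_simps[OF a])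
 next
  case False
  then obtain d' m' where dm: "d = Suc d'" "m = Suc m'" by (meson not0_implies_Suc)
  have "a y (a x v) = a (brk y x) v + a x (a y v)" by (simp add: rep_simps[OF a])
  moreover have "(a y ^^ (d' + m)) (a (brk y x) v) = 0" using Suc.hyps(1)[of d' m "brk y x" v] Suc.hyps(2) Suc.prems dm by (simp add: funpow_swap1)
  moreover have "(a y ^^ (d + m')) (a x (a y v)) = 0" using Suc.hyps(1)[of d m' x "a y v"] Suc.hyps(2) Suc.prems dm by (simp add: funpow_swap1)
  ultimately have "(a y ^^ (d' + m)) (a y (a x v)) = 0" using dm by (simp add: clin[OF lin] rep_simps[OF a])
  thus ?thesis using dm by (simp add: funpow_swap1)
 qed
qed

context borel_lie
begin

definition nv :: "('g => complex) => 'g" where "nv \<beta> = (SOME y. y \<in> gsp (- \<beta>) \<and> y ~= 0)"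

lemma nv: assumes "\<beta> \<in> \<Psi>" shows "nv \<beta> \<in> gsp (- \<beta>)" "nv \<beta> ~= 0" "y \<in> gsp (- \<beta>) ==> \<exists>c. y = c *\<^sub>C nv \<beta>"
proof -
 note m = Phi_uminus[OF Psi_Phi[OF assms]]
 have "\<exists>y. y \<in> gsp (- \<beta>) \<and> y ~= 0" using gsp_nonzero[OF m] by blast
 from someI_ex[OF this, folded nv_def] show *: "nv \<beta> \<in> gsp (- \<beta>)" "nv \<beta> ~= 0" by auto
 show "y \<in> gsp (- \<beta>) ==> \<exists>c. y = c *\<^sub>C nv \<beta>" by (rule gsp_dim_one[OF m *])
qed

definition Mod :: "('g => 'n::complex_vector => 'n) => 'n => 'n set" where
 "Mod a w = cspan ((%bs. foldr a (map nv bs) w) ` {bs. set bs <= \<Psi>})"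

lemma Mod_sub: "csubspace (Mod a w)" by (simp add: Mod_def)

lemma Mod_base: "set bs <= \<Psi> ==> foldr a (map nv bs) w \<in> Mod a w" unfolding Mod_def by (rule span_base) blast

lemma Mod_stable:
 assumes a: "lie_rep a" and w: "hw a \<mu> w" and p: "p \<in> Mod a w" shows "a x p \<in> Mod a w"
proof -
 let ?F = "nv ` \<Psi>" and ?E = "H \<union> (\<Union>\<beta>\<in>\<Psi>. gsp \<beta>)"
 have M: "Mod a w = cspan ((%fs. foldr a fs w) ` lists ?F)" unfolding Mod_def lists_image image_image unfolding lists_eq_set ..
 have "H \<union> (\<Union>\<beta>\<in>\<Phi>. gsp \<beta>) <= cspan (?F \<union> ?E)"
 proof
  fix x assume "x \<in> H \<union> (\<Union>\<beta>\<in>\<Phi>. gsp \<beta>)"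
  then consider "x \<in> ?E" | \<beta> where "- \<beta> \<in> \<Psi>" "x \<in> gsp (- (- \<beta>))" using Psi_total by fastforce
  thus "x \<in> cspan (?F \<union> ?E)"
  proof cases
   case 2
   then obtain c where "x = c *\<^sub>C nv (- \<beta>)" using nv(3) by blast
   moreover have "nv (- \<beta>) \<in> ?F \<union> ?E" using 2(1) by blast
   ultimately show ?thesis using span_scale span_base by metis
  qed (rule span_base, blast)
 qed
 hence "UNIV = cspan (?F \<union> ?E)" using span_minimal[OF _ subspace_span] root_space_decomposition_UNIV by blast
 moreover have "\<exists>c. a x w = c *\<^sub>C w" if x: "x \<in> ?E" for x
 proof (cases "x \<in> H")
  case False
  hence "a x w = 0 *\<^sub>C w" using x w by (auto simp: hw_def)
  thus ?thesis by blast
 qed (use w in \<open>auto simp: hw_def\<close>)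
 moreover have "lie_module UNIV a UNIV" by (simp add: lie_module_def rep_simps[OF a])
 ultimately show ?thesis using p unfolding M by (intro words_stable[of UNIV a ?F ?E]) (auto simp: lie_subalgebra_def)
qed

lemma word_weight:
 assumes a: "lie_rep a" and w: "w \<in> wtsp H a lam" and bs: "set bs <= \<Psi>" shows "foldr a (map nv bs) w \<in> wtsp H a (lam - sum_list bs)"
 using bs
proof (induction bs)
 case (Cons \<beta> bs)
 have bs: "set bs <= \<Psi>" and b: "\<beta> \<in> \<Psi>" using Cons.prems by auto
 note v = Cons.IH[OF bs]
 have "a t (a (nv \<beta>) v) = ((lam - sum_list bs) t + - \<beta> t) *\<^sub>C a (nv \<beta>) v"
  if t: "t \<in> H" and v: "a t v = (lam - sum_list bs) t *\<^sub>C v" for t v using weight_lower[OF a t nv(1)[OF b] v, of 1] by simp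
 thus ?case using v by (simp add: wtsp_def algebra_simps)
qed (use w in simp)

lemma rep_H: "lie_rep a ==> h \<in> H ==> clinear (a h)" by (simp add: lie_rep_def)

lemma Mod_weights:
 assumes a: "lie_rep a" and w: "w \<in> wtsp H a lam" "lam \<in> dual H"
  and v: "v \<in> Mod a w" "v \<in> wtsp H a \<nu>" "v ~= 0" "\<nu> \<in> dual H" shows "lam - \<nu> \<in> Qp"
proof (rule ccontr)
 assume n: "lam - \<nu> \<notin> Qp"
 let ?A = "{lam - q | q. q \<in> Qp}"
 have "v \<in> cspan (\<Union>\<gamma>\<in>?A. wtsp H a \<gamma>)"
 proof (rule span_in_subspace[OF subspace_span _ v(1)[unfolded Mod_def]], rule subsetI)
  fix x assume "x \<in> (%bs. foldr a (map nv bs) w) ` {bs. set bs <= \<Psi>}"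
  then obtain bs where bs: "set bs <= \<Psi>" "x = foldr a (map nv bs) w" by blast
  have "lam - sum_list bs \<in> ?A" using bs(1) by (auto simp: Qp_def)
  thus "x \<in> cspan (\<Union>\<gamma>\<in>?A. wtsp H a \<gamma>)" using word_weight[OF a w(1) bs(1)] bs(2) by (intro span_base) blast
 qed
 hence sp: "v \<in> cspan (\<Union>\<gamma>\<in>?A. wtsp H a \<gamma>)" .
 have nA: "\<nu> \<notin> ?A"
 proof
  assume "\<nu> \<in> ?A"
  then obtain q where "\<nu> = lam - q" "q \<in> Qp" by blast
  thus False using n by simp
 qed
 have dl: "\<gamma> \<in> dual H" if "\<gamma> \<in> insert \<nu> ?A" for \<gamma> using that
 proof
  assume "\<gamma> \<in> ?A"
  then obtain q where q: "\<gamma> = lam - q" "q \<in> Qp" by blast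
  show ?thesis unfolding q(1) by (rule dual_closed(3)[OF w(2) Qp_dual[OF q(2)]])
 qed (use v(4) in simp)
 have "v = 0" by (rule wtsp_disjoint[of H a \<nu> ?A v, OF rep_H[OF a] dual_distinct[OF dl dl] nA v(2) sp])
 thus False using v by blast
qed

section \<open>The root lattice and the action of the reflection group on it\<close>

definition Ql :: "('g => complex) set" where "Ql = {sum_list bs | bs. set bs <= \<Phi>}"

lemma Ql_induct [consumes 1]:
 assumes "q \<in> Ql" "P 0" "!!q \<beta>. q \<in> Ql ==> P q ==> \<beta> \<in> \<Phi> ==> P (\<beta> + q)" shows "P q"
proof -
 have "set bs <= \<Phi> ==> P (sum_list bs)" for bs
 proof (induction bs)
  case (Cons \<beta> bs)
  have "P (\<beta> + sum_list bs)" by (rule assms(3)) (use Cons in \<open>auto simp: Ql_def\<close>)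
  thus ?case by (simp only: sum_list.Cons)
 qed (use assms(2) in simp)
 thus ?thesis using assms(1) by (auto simp: Ql_def)
qed

lemma Ql_0: "0 \<in> Ql" and Ql_add: "p \<in> Ql ==> q \<in> Ql ==> p + q \<in> Ql" and Phi_Ql: "\<beta> \<in> \<Phi> ==> \<beta> \<in> Ql"
proof -
 show "0 \<in> Ql" unfolding Ql_def by (auto intro!: exI[of _ "[]"])
 show "p \<in> Ql ==> q \<in> Ql ==> p + q \<in> Ql" unfolding Ql_def by clarify (metis set_append Un_least sum_list_append)
 show "\<beta> \<in> \<Phi> ==> \<beta> \<in> Ql" unfolding Ql_def by (auto intro!: exI[of _ "[\<beta>]"])
qed

lemma Ql_uminus: "q \<in> Ql ==> - q \<in> Ql"
proof (induction rule: Ql_induct)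
 case 1 show ?case unfolding minus_zero by (rule Ql_0)
next
 case (2 q \<beta>)
 show ?case unfolding minus_add_distrib by (rule Ql_add[OF Phi_Ql[OF Phi_uminus[OF 2(2)]] 2(3)])
qed

lemma Qp_Ql: "q \<in> Qp ==> q \<in> Ql" using Psi_Phi by (auto simp: Qp_def Ql_def)

lemma Ql_repr: "q \<in> Ql ==> q \<in> repr" and Ql_dual: "q \<in> Ql ==> q \<in> dual H"
proof -
 show *: "q \<in> Ql ==> q \<in> repr" by (induction rule: Ql_induct) (use tv_zero tv_add Phi_repr in blast)+
 thus "q \<in> Ql ==> q \<in> dual H" using repr_dual by blast
qed

lemma Ql_tv: "q \<in> Ql ==> tv q \<in> hp"
proof (induction rule: Ql_induct)
 case 1 thus ?case using tv_zero span_zero by metis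
next
 case (2 q \<beta>)
 hence "tv (\<beta> + q) = tv \<beta> + tv q" using tv_add Phi_repr Ql_repr by blast
 thus ?case using 2 span_add span_base by (metis imageI)
qed

lemma Ql_coroot: "q \<in> Ql ==> \<alpha> \<in> \<Phi> ==> \<exists>k::int. q (coroot \<alpha>) = of_int k"
proof (induction rule: Ql_induct)
 case 1 thus ?case by (intro exI[of _ 0]) simp
next
 case (2 q \<beta>)
 then obtain i j where "q (coroot \<alpha>) = of_int i" "\<beta> (coroot \<alpha>) = of_int j" using cartan_integer by blast
 thus ?case by (intro exI[of _ "j + i"]) simp
qed

lemma Ql_scale: "\<alpha> \<in> \<Phi> ==> of_int k *\<^sub>C \<alpha> \<in> Ql"
proof -
 assume a: "\<alpha> \<in> \<Phi>"
 have n: "of_nat n *\<^sub>C \<alpha> \<in> Ql" for n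
 proof (induction n)
  case (Suc n)
  have "of_nat (Suc n) *\<^sub>C \<alpha> = \<alpha> + of_nat n *\<^sub>C \<alpha>" by (simp only: of_nat_Suc scaleC_add_left scaleC_one)
  thus ?case using Ql_add[OF Phi_Ql[OF a] Suc] by metis
 qed (metis Ql_0 complex_vector.scale_zero_left of_nat_0)
 show ?thesis using n[of "nat k"] Ql_uminus[OF n[of "nat (- k)"]] by (cases "k \<ge> 0") (simp_all flip: complex_vector.scale_minus_left)
qed

lemma Ql_srefl: "q \<in> Ql ==> \<alpha> \<in> \<Phi> ==> srefl \<alpha> q \<in> Ql"
 using Ql_coroot[of q \<alpha>] Ql_add[of q "- (q (coroot \<alpha>) *\<^sub>C \<alpha>)"] Ql_uminus Ql_scale
 unfolding srefl_def by (metis diff_conv_add_uminus)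

definition gact :: "('g => 'g) => ('g => complex) => ('g => complex)" where
 "gact g q = (%x. if x \<in> H then q (g x) else 0)"

lemma gact_step:
 assumes d: "gact g q \<in> dual H" and al: "\<alpha> \<in> \<Delta>" shows "gact (g \<circ> hrefl \<alpha>) q = srefl \<alpha> (gact g q)"
proof
 fix x
 show "gact (g \<circ> hrefl \<alpha>) q x = srefl \<alpha> (gact g q) x"
 proof (cases "x \<in> H")
  case True
  thus ?thesis using dual_hrefl[OF al d True] hrefl_H[OF al True] by (simp add: reflection_eq[OF d Delta_Phi[OF al]] srefl_def) (simp add: gact_def)
 next
  case False
  thus ?thesis using H_dual_linear(3)[OF Phi_dual[OF Delta_Phi[OF al]] False] by (simp add: gact_def srefl_apply)
 qed
qed

lemma gact_invariant:
 assumes S: "S <= Ql" "!!q \<alpha>. q \<in> S ==> \<alpha> \<in> \<Delta> ==> srefl \<alpha> q \<in> S" and "g \<in> G" "q \<in> S"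
 shows "gact g q \<in> S" using assms(3,4)
proof (induction arbitrary: q rule: G.induct)
 case G_id
 have "gact id q = q" using H_dual_linear(3)[of q] Ql_dual S(1) G_id by (auto simp: gact_def fun_eq_iff)
 thus ?case using G_id by metis
next
 case (G_step g \<alpha>)
 note IH = G_step.IH[OF G_step.prems]
 have "gact (g \<circ> hrefl \<alpha>) q = srefl \<alpha> (gact g q)" by (rule gact_step[OF _ G_step(2)]) (use IH S(1) Ql_dual in blast)
 thus ?case using S(2)[OF IH G_step(2)] by metis
qed

text \<open>The sum is fixed by all simple reflections, so every simple root and hence every root
  vanishes on it. It is then central and lies in the derived algebra.\<close>

lemma sum_G_Hel: "(\<Sum>g\<in>G. g Hel) = 0"
proof -
 let ?S = "\<Sum>g\<in>G. g Hel"
 have tvd: "tv ` \<Phi> <= H \<inter> derived" using tv Phi_repr by blast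
 have "Hel \<in> hp" unfolding Hel_def coroot_def by (intro span_sum span_scale span_base) (use Psi_Phi in auto)
 hence S: "?S \<in> hp" using G_hp by (intro span_sum) blast
 have fixS: "hrefl \<alpha> ?S = ?S" if "\<alpha> \<in> \<Delta>" for \<alpha>
  using sum.reindex_bij_betw[OF G_bij_left[OF that], of "%g. g Hel"] by (simp add: complex_vector_pair.linear_sum[OF hrefl_linear])
 have simple: "\<alpha> ?S = 0" if a: "\<alpha> \<in> \<Delta>" for \<alpha>
 proof -
  note aP = Delta_Phi[OF a]
  have "killing (tv \<alpha>) ?S *\<^sub>C coroot \<alpha> = 0" using fixS[OF a] by (simp add: hrefl_def)
  hence "killing (tv \<alpha>) ?S = 0" using killing_tv_coroot[OF aP] by (auto simp: killing_simps)
  thus ?thesis using tv(3)[OF Phi_repr[OF aP] hp_H[OF S]] by simp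
 qed
 have pos: "\<beta> ?S = 0" if "\<beta> \<in> \<Psi>" for \<beta>
 proof -
  obtain bs where "set bs <= \<Delta>" "\<beta> = sum_list bs" using Psi_simple_sum[OF \<open>\<beta> \<in> \<Psi>\<close>] by blast
  moreover have "set bs <= \<Delta> ==> sum_list bs ?S = 0" for bs by (induction bs) (auto simp: simple)
  ultimately show ?thesis by simp
 qed
 have "\<beta> ?S = 0" if "\<beta> \<in> \<Phi>" for \<beta> using Psi_total[OF that] pos[of \<beta>] pos[of "- \<beta>"] by auto
 hence "?S \<in> krad" by (rule krad_if_roots_vanish[OF hp_H[OF S]])
 moreover have "hp <= derived" using tvd by (intro span_minimal) (auto simp: brk_span_def)
 ultimately show ?thesis using krad_inter_derived S by blast
qed

lemma ad_root_nilpotent: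
 assumes b: "\<beta> \<in> \<Phi>" and y: "y \<in> gsp \<beta>" shows "\<exists>d. (brk y ^^ d) x = 0"
proof -
 have lin: "clinear (brk y ^^ d)" for d by (rule clinear_funpow[OF clinear_brk])
 have mono: "(brk y ^^ (d + e)) x = 0" if "(brk y ^^ d) x = 0" for d e x using that clin(4)[OF lin] by (metis add.commute comp_apply funpow_add)
 have gam: "\<exists>d. (brk y ^^ d) x = 0" if x: "x \<in> gsp \<gamma>" and g: "\<gamma> \<in> dual H" for x \<gamma>
 proof -
  have w: "(brk y ^^ d) x \<in> gsp (\<gamma> + of_nat d *\<^sub>C \<beta>)" for d
  proof (induction d)
   case (Suc d)
   have "\<beta> + (\<gamma> + of_nat d *\<^sub>C \<beta>) = \<gamma> + of_nat (Suc d) *\<^sub>C \<beta>"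
    by (simp only: of_nat_Suc scaleC_add_left scaleC_one ac_simps)
   thus ?case using root_space_brk[OF y Suc] by (simp only: funpow.simps comp_apply)
  qed (metis x add.right_neutral complex_vector.scale_zero_left funpow_0 of_nat_0)
  have "inj (%d::nat. \<gamma> + of_nat d *\<^sub>C \<beta>)" using Phi_nz[OF b] by (intro injI) (auto simp: scale_cancel_right)
  hence "\<not> range (%d::nat. \<gamma> + of_nat d *\<^sub>C \<beta>) <= insert 0 \<Phi>"
   using finite_roots by (metis finite_insert finite_subset range_inj_infinite)
  then obtain d :: nat where "\<gamma> + of_nat d *\<^sub>C \<beta> \<notin> insert 0 \<Phi>" by blast
  moreover have "\<gamma> + of_nat d *\<^sub>C \<beta> \<in> dual H" by (intro dual_closed(2) g dual_scaleC Phi_dual b)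
  ultimately have "gsp (\<gamma> + of_nat d *\<^sub>C \<beta>) = {0}" using gsp_zero by blast
  thus ?thesis using w[of d] by blast
 qed
 have "x \<in> cspan (H \<union> (\<Union>\<beta>\<in>\<Phi>. gsp \<beta>))" using root_space_decomposition_UNIV by blast
 thus ?thesis
 proof (induction rule: span_induct_alt)
  case base thus ?case by (intro exI[of _ 0]) simp
 next
  case (step c u v)
  have "\<exists>d. (brk y ^^ d) u = 0" using step.hyps gam root_space_0 dual_closed(1) Phi_dual by blast
  then obtain d e where "(brk y ^^ d) u = 0" "(brk y ^^ e) v = 0" using step.IH by blast
  hence "(brk y ^^ (d + e)) (c *\<^sub>C u + v) = 0" using mono[of d u e] mono[of e v d] by (simp add: clin[OF lin] add.commute)
  thus ?case by blast
 qed
qed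

end

context borel_lie
begin

lemma Mod_self: "w \<in> Mod a w" using Mod_base[of "[]" a w] by simp

text \<open>The simple quotient of a Verma module. The functional \<epsilon> is 1 at
  \<open>w\<close> and 0 on the other weight spaces, \<open>K\<close> is the largest submodule on
  which it vanishes, and \<open>T\<close> models the quotient on a complement. The singular vector
  obtained by lowering \<open>w\<close> generates only smaller weights, so it lies in
  \<open>K\<close>.\<close>

lemma simple_quotient:
 assumes lam: "lam \<in> Ql" "\<forall>\<alpha>\<in>\<Delta>. \<exists>n. lam (coroot \<alpha>) = of_nat n"
 shows "\<exists>(b :: 'g => (nat list \<Rightarrow>\<^sub>0 complex) => _) w. lie_rep b \<and> w ~= 0 \<and> hw b lam w \<and>
  (\<forall>\<alpha>\<in>\<Delta>. \<forall>f\<in>gsp (- \<alpha>). \<exists>k. (b f ^^ k) w = 0)"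
proof -
 note ld = Ql_dual[OF lam(1)]
 obtain \<mu> where mu: "\<mu> \<in> hstar" "!!x. x \<in> H ==> \<mu> x = lam x" using hstar_ext[OF ld] by metis
 obtain a :: "'g => (nat list \<Rightarrow>\<^sub>0 complex) => _" and w where a: "lie_rep a" and w: "hw a \<mu> w" "w ~= 0"
  and fw: "!!\<beta> k. \<beta> \<in> \<Psi> ==> 0 \<in> gsp (- \<beta>)"
  using verma_exists[OF mu(1), of 0] subspace_0[OF root_space_subspace] by metis
 let ?A = "{\<nu> \<in> dual H. \<nu> ~= lam}"
 define W where "W = cspan (\<Union>\<nu>\<in>?A. wtsp H a \<nu>)"
 have "w \<notin> W"
 proof
  assume "w \<in> W"
  have d: "\<nu> \<in> dual H" if "\<nu> \<in> insert lam ?A" for \<nu> using that ld by blast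
  have "lam \<notin> ?A" by blast
  moreover have "w \<in> wtsp H a lam" using w mu by (simp add: hw_def wtsp_def)
  ultimately have "w = 0" using \<open>w \<in> W\<close> wtsp_disjoint[of H a lam ?A w, OF rep_H[OF a] dual_distinct[OF d d]] unfolding W_def by blast
  thus False using w by blast
 qed
 moreover have "csubspace W" by (simp add: W_def)
 ultimately obtain \<epsilon> where eps: "clinear \<epsilon>" "\<epsilon> w = (1::complex)" "!!v. v \<in> W ==> \<epsilon> v = 0"
  using clinear_zero_outside by blast
 define K where "K = {n. \<forall>u. \<epsilon> (uact a u n) = 0}"
 have K: "csubspace K" unfolding K_def by (intro csubspaceI) (simp_all add: uact_simps[OF a] clinC[OF eps(1)])
 have Ka: "a x n \<in> K" if "n \<in> K" for x n using that uact_mult[OF a, of _ "uea_in x" n] by (simp add: K_def uact_in[OF a]) metis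
 obtain T :: "(nat list \<Rightarrow>\<^sub>0 complex) => _" where T: "clinear T" "!!n. T n = 0 \<longleftrightarrow> n \<in> K" "!!n. n - T n \<in> K"
  by (rule clinear_with_kernel[OF K]) (rule that; assumption)
 define b where "b x n = T (a x n)" for x n
 have bT: "b x (T n) = b x n" for x n
 proof -
  have "T (a x (n - T n)) = 0" using T(2) Ka[OF T(3)] by blast
  thus ?thesis by (simp add: b_def rep_simps[OF a] clin[OF T(1)])
 qed
 have b: "lie_rep b" unfolding lie_rep_def
 proof (intro conjI allI)
  show "clinear (b x)" for x unfolding b_def by (rule clinear_compose[OF T(1)]) (use a in \<open>simp add: lie_rep_def\<close>)
  show "clinear (%x. b x p)" for p unfolding b_def by (rule clinear_compose[OF T(1)]) (use a in \<open>simp add: lie_rep_def\<close>)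
  have "b x (b y p) = T (a x (a y p))" for x y p using bT[of x "a y p"] by (simp add: b_def)
  thus "b (brk x y) p = b x (b y p) - b y (b x p)" for x y p by (simp add: b_def rep_simps(11)[OF a] clin[OF T(1)])
 qed
 have pow: "(b x ^^ k) (T n) = T ((a x ^^ k) n)" for x k n by (induction k) (simp_all add: bT, simp add: b_def)
 have kill: "\<exists>k. (b f ^^ k) (T w) = 0" if al: "\<alpha> \<in> \<Delta>" and f: "f \<in> gsp (- \<alpha>)" for \<alpha> f
 proof -
  obtain e g where eg: "e \<in> gsp \<alpha>" "g \<in> gsp (- \<alpha>)" "e ~= 0" "g ~= 0" "brk e g = coroot \<alpha>" by (rule simple_triple[OF al])
  obtain c where c: "f = c *\<^sub>C g" using gsp_dim_one[OF Phi_uminus[OF Delta_Phi[OF al]] eg(2,4) f] by blast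
  obtain n where n: "lam (coroot \<alpha>) = of_nat n" using bspec[OF lam(2) al] by blast
  let ?v = "(a g ^^ Suc n) w"
  let ?nu = "%x. \<mu> x - of_nat (Suc n) * killing (tv \<alpha>) x"
  have hv: "hw a ?nu ?v" by (rule hw_lower[OF a w(1) al eg(1-3,5)]) (use n mu(2)[OF coroot_H[OF Delta_Phi[OF al]]] in simp)
  define lam' where "lam' = lam - of_nat (Suc n) *\<^sub>C \<alpha>"
  have v: "?v \<in> wtsp H a lam'" using hv mu tv(3)[OF Phi_repr[OF Delta_Phi[OF al]]]
   by (simp del: funpow.simps of_nat_Suc add: hw_def wtsp_def lam'_def scaleC_fun_apply scaleC_complex)
  have word: "foldr a (map nv bs) ?v \<in> W" if bs: "set bs <= \<Psi>" for bs
  proof -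
   have q: "sum_list bs \<in> Qp" using bs by (auto simp: Qp_def)
   have m: "of_nat m *\<^sub>C \<alpha> \<in> Qp" for m
   proof (induction m)
    case (Suc m)
    have "of_nat (Suc m) *\<^sub>C \<alpha> = \<alpha> + of_nat m *\<^sub>C \<alpha>" by (simp only: of_nat_Suc scaleC_add_left scaleC_one)
    thus ?case using Qp_add[OF Qp_Psi[OF Delta_Psi[OF al]] Suc] by metis
   qed (metis Qp_0 complex_vector.scale_zero_left of_nat_0)
   have "lam' - sum_list bs ~= lam"
   proof
    assume "lam' - sum_list bs = lam"
    hence "- (of_nat (Suc n) *\<^sub>C \<alpha>) = sum_list bs"
     unfolding lam'_def by (metis add_diff_cancel_left' diff_add_cancel diff_conv_add_uminus)
    hence "of_nat (Suc n) *\<^sub>C \<alpha> = 0" using Qp_pointed[OF m[of "Suc n"]] q by metis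
    thus False using Phi_nz[OF Delta_Phi[OF al]] by (metis complex_vector.scale_eq_0_iff of_nat_neq_0)
   qed
   moreover have "lam' - sum_list bs \<in> dual H" unfolding lam'_def by (intro dual_closed(3) ld dual_scaleC Phi_dual Delta_Phi al Qp_dual q)
   ultimately show ?thesis unfolding W_def using word_weight[OF a v bs] by (intro span_base) blast
  qed
  have "Mod a ?v <= W" unfolding Mod_def by (rule span_minimal) (use word W_def in auto)
  moreover have "uact a u ?v \<in> Mod a ?v" for u by (rule uact_stable[OF a Mod_sub Mod_stable[OF a hv]]) (assumption | rule Mod_self)+
  ultimately have "?v \<in> K" using eps(3) by (auto simp: K_def simp del: funpow.simps)
  hence "(b g ^^ Suc n) (T w) = 0" unfolding pow using T(2) by blast
  moreover have "(b f ^^ k) p = c ^ k *\<^sub>C (b g ^^ k) p" for k p by (induction k) (simp_all add: c rep_simps[OF b] scaleC_scaleC scaleC_one)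
  ultimately show ?thesis by (intro exI[of _ "Suc n"]) (simp del: funpow.simps)
 qed
 have "\<epsilon> (uact a 1 w) ~= 0" using eps uact_1[OF a] by simp
 hence "T w ~= 0" using T(2) by (auto simp: K_def)
 moreover have "hw b lam (T w)" using w mu bT clin[OF T(1)] unfolding hw_def by (simp add: b_def)
 ultimately show ?thesis using b kill by blast
qed

lemma ht_length: "set bs <= \<Psi> ==> \<exists>m\<ge>length bs. sum_list bs Hel = of_nat m"
proof (induction bs)
 case (Cons \<beta> bs)
 then obtain m where m: "m \<ge> length bs" "sum_list bs Hel = of_nat m" by auto
 obtain k where k: "\<beta> Hel = of_nat k" "k ~= 0" using Qp_ht[OF Qp_Psi] Phi_nz[OF Psi_Phi] Cons.prems by (metis list.set_intros(1) subsetD)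
 thus ?case using m by (intro exI[of _ "k + m"]) auto
qed (auto intro!: exI[of _ 0])

text \<open>Simple root vectors act locally nilpotently on the simple quotient, so its weights are
  stable under simple reflections. Averaging over the group bounds their depth below
  \<open>lam\<close>, and only finitely many words in lowering operators survive. The matrix form is
  what the construction of central elements takes as input.\<close>

lemma fd_rep:
 assumes lam: "lam \<in> Ql" "\<forall>\<alpha>\<in>\<Delta>. \<exists>n. lam (coroot \<alpha>) = of_nat n"
 shows "\<exists>(I :: (nat list \<Rightarrow>\<^sub>0 complex) set) \<pi> \<tau>. finite I \<and> (\<forall>i j. clinear (%y. \<pi> y i j)) \<and>
  (\<forall>x y. \<forall>i\<in>I. \<forall>j\<in>I. \<pi> (brk x y) i j = (\<Sum>k\<in>I. \<pi> x i k * \<pi> y k j - \<pi> y i k * \<pi> x k j)) \<and>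
  (\<forall>h\<in>H. \<forall>i\<in>I. \<forall>j\<in>I. \<pi> h i j = (if i = j then \<tau> i h else 0)) \<and>
  lam \<in> \<tau> ` I \<and> (\<forall>i\<in>I. lam - \<tau> i \<in> Qp) \<and> (\<forall>\<alpha>\<in>\<Delta>. \<forall>i\<in>I. srefl \<alpha> (\<tau> i) \<in> \<tau> ` I)"
proof -
 obtain b :: "'g => (nat list \<Rightarrow>\<^sub>0 complex) => _" and w where b: "lie_rep b" and w: "w ~= 0" "hw b lam w"
  and fnil: "!!\<alpha> f. \<alpha> \<in> \<Delta> ==> f \<in> gsp (- \<alpha>) ==> \<exists>k. (b f ^^ k) w = 0"
  using simple_quotient[OF lam] by metis
 define M where "M = Mod b w"
 have M: "csubspace M" and Mb: "p \<in> M ==> b x p \<in> M" for x p unfolding M_def using Mod_sub Mod_stable[OF b w(2)] by auto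
 have Mpow: "p \<in> M ==> (b x ^^ k) p \<in> M" for x p k by (induction k) (simp_all add: Mb)
 have wM: "w \<in> M" by (simp add: M_def Mod_self)
 have wl: "w \<in> wtsp H b lam" using w by (simp add: hw_def wtsp_def)
 have nil: "\<exists>k. (b y ^^ k) p = 0" if y: "y \<in> gsp \<gamma>" "\<gamma> = \<alpha> \<or> \<gamma> = - \<alpha>" and al: "\<alpha> \<in> \<Delta>" and p: "p \<in> M" for y \<alpha> \<gamma> p
 proof -
  let ?L = "{p. \<exists>k. (b y ^^ k) p = 0}"
  have gP: "\<gamma> \<in> \<Phi>" using y(2) Delta_Phi[OF al] Phi_uminus by blast
  have "csubspace ?L" using geig_subspace[of "b y" 0] b by (simp add: geig_zero_iff[abs_def] lie_rep_def geig_def)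
  moreover have "\<exists>k. (b y ^^ k) w = 0" using y(2)
  proof
   assume "\<gamma> = \<alpha>"
   hence "(b y ^^ 1) w = 0" using y(1) w(2) Delta_Psi[OF al] by (simp add: hw_def)
   thus ?thesis by blast
  qed (use fnil[OF al] y in blast)
  hence "foldr b (map nv bs) w \<in> ?L" for bs
  proof (induction bs)
   case (Cons \<beta> bs)
   then obtain k where "(b y ^^ k) (foldr b (map nv bs) w) = 0" by blast
   moreover obtain d where "(brk y ^^ d) (nv \<beta>) = 0" using ad_root_nilpotent[OF gP y(1)] by blast
   ultimately have "(b y ^^ (d + k)) (b (nv \<beta>) (foldr b (map nv bs) w)) = 0" by (intro locally_nilpotent_stable[OF b])
   thus ?case by (simp only: list.map foldr.simps comp_apply mem_Collect_eq) (rule exI)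
  qed simp
  hence "(%bs. foldr b (map nv bs) w) ` {bs. set bs <= \<Psi>} <= ?L" by blast
  ultimately show ?thesis using span_in_subspace[of ?L _ p] p unfolding M_def Mod_def by blast
 qed
 define \<Omega> where "\<Omega> = {\<nu> \<in> dual H. \<exists>v\<in>M. v ~= 0 \<and> v \<in> wtsp H b \<nu>}"
 have OQ: "lam - \<nu> \<in> Qp" if "\<nu> \<in> \<Omega>" for \<nu>
  using that Mod_weights[OF b wl Ql_dual[OF lam(1)]] unfolding \<Omega>_def M_def by blast
 have OQl: "\<Omega> <= Ql"
 proof
  fix \<nu> assume "\<nu> \<in> \<Omega>"
  hence "lam + - (lam - \<nu>) \<in> Ql" by (intro Ql_add lam(1) Ql_uminus Qp_Ql OQ)
  moreover have "lam + - (lam - \<nu>) = \<nu>" by (metis add_diff_cancel_left' diff_add_cancel diff_conv_add_uminus minus_diff_eq)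
  ultimately show "\<nu> \<in> Ql" by metis
 qed
 have Oref: "srefl \<alpha> \<nu> \<in> \<Omega>" if n: "\<nu> \<in> \<Omega>" and al: "\<alpha> \<in> \<Delta>" for \<nu> \<alpha>
 proof -
  note aP = Delta_Phi[OF al]
  obtain v where v: "v \<in> M" "v ~= 0" "v \<in> wtsp H b \<nu>" using n by (auto simp: \<Omega>_def)
  obtain e f where ef: "e \<in> gsp \<alpha>" "f \<in> gsp (- \<alpha>)" "brk e f = coroot \<alpha>" by (rule simple_triple[OF al])
  obtain c where c: "\<nu> (coroot \<alpha>) = of_int c" using Ql_coroot[OF _ aP] OQl n by blast
  have hv: "b (coroot \<alpha>) v = of_int c *\<^sub>C v" using v(3) coroot_H[OF aP] c by (simp add: wtsp_def)
  have he: "brk (coroot \<alpha>) e = 2 *\<^sub>C e" "brk (coroot \<alpha>) f = - 2 *\<^sub>C f"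
   using ef coroot_H[OF aP] root_coroot[OF aP] by (auto simp: root_space_def)
  have wt: "b t ((b x ^^ j) ((b y ^^ k) v)) = (\<nu> t + of_nat k * \<gamma> t + of_nat j * \<delta> t) *\<^sub>C ((b x ^^ j) ((b y ^^ k) v))"
   if "t \<in> H" "x \<in> gsp \<delta>" "y \<in> gsp \<gamma>" for t x y \<delta> \<gamma> j k
   by (intro weight_lower[OF b that(1,2)] weight_lower[OF b that(1,3)]) (use v(3) that in \<open>simp add: wtsp_def\<close>)
  have string: "\<exists>u\<in>M. u ~= 0 \<and> u \<in> wtsp H b (srefl \<alpha> \<nu>)"
   if xy: "x \<in> gsp \<delta>" "y \<in> gsp (- \<delta>)" "\<delta> = \<alpha> \<or> \<delta> = - \<alpha>" "brk x y = h" "brk h y = - 2 *\<^sub>C y" "brk h x = 2 *\<^sub>C x"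
    and m: "b h v = of_nat m *\<^sub>C v" "!!t. srefl \<alpha> \<nu> t = \<nu> t - of_nat m * \<delta> t" for x y h \<delta> m
  proof -
   obtain j where "(b x ^^ j) v = 0" using nil[OF xy(1,3) al v(1)] by blast
   then obtain k where k: "(b y ^^ (m + k)) ((b x ^^ k) v) ~= 0" using sl2_reflect[OF b xy(4-6) v(2) m(1)] by blast
   have "b t ((b y ^^ (m + k)) ((b x ^^ k) v)) = srefl \<alpha> \<nu> t *\<^sub>C ((b y ^^ (m + k)) ((b x ^^ k) v))" if "t \<in> H" for t
    unfolding wt[OF that xy(2,1)] m(2) by (simp add: algebra_simps)
   thus ?thesis using k Mpow[OF Mpow[OF v(1)]] unfolding wtsp_def by blast
  qed
  have "\<exists>u\<in>M. u ~= 0 \<and> u \<in> wtsp H b (srefl \<alpha> \<nu>)"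
  proof (cases "c \<ge> 0")
   case True
   thus ?thesis using string[OF ef(1,2) _ ef(3) he(2,1), of "nat c"] hv c by (simp add: srefl_apply)
  next
   case False
   hence "b (- coroot \<alpha>) v = of_nat (nat (- c)) *\<^sub>C v" using hv by (simp add: rep_simps[OF b])
   moreover have "brk f e = - coroot \<alpha>" "brk (- coroot \<alpha>) e = - 2 *\<^sub>C e" "brk (- coroot \<alpha>) f = 2 *\<^sub>C f"
    using ef(3) he brk_anti[of f e] by (simp_all add: brk_simps)
   ultimately show ?thesis using string[of f "- \<alpha>" e "- coroot \<alpha>" "nat (- c)"] ef False c by (simp add: srefl_apply)
  qed
  moreover have "srefl \<alpha> \<nu> \<in> dual H" using Ql_dual Ql_srefl OQl n aP by blast
  ultimately show ?thesis by (simp add: \<Omega>_def)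
 qed
 define L where "L = Re (lam Hel)"
 define N where "N = nat \<lceil>real (card G) * L\<rceil>"
 \<comment> \<open>The values \<open>\<nu> (g Hel)\<close> have real part at most \<open>L\<close>
   and add up to 0 over \<open>G\<close>. So the single nonnegative term
   \<open>L - Re (\<nu> Hel)\<close> is at most the total \<open>card G * L\<close>.\<close>
 have height: "m \<le> N" if n: "\<nu> \<in> \<Omega>" and m: "(lam - \<nu>) Hel = of_nat m" for \<nu> m
 proof -
  have le: "Re (\<nu> (g Hel)) \<le> L" if g: "g \<in> G" for g
  proof -
   have "gact g \<nu> \<in> \<Omega>" by (rule gact_invariant[OF OQl Oref g n])
   then obtain k where "(lam - gact g \<nu>) Hel = of_nat k" using Qp_ht[OF OQ] by blast
   hence "lam Hel - \<nu> (g Hel) = of_nat k" using Hel_H by (simp add: gact_def)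
   hence "Re (lam Hel - \<nu> (g Hel)) \<ge> 0" by simp
   thus ?thesis by (simp add: L_def)
  qed
  have "\<nu> (\<Sum>g\<in>G. g Hel) = (\<Sum>g\<in>G. \<nu> (g Hel))" by (rule dual_sum) (use OQl Ql_dual n G_H Hel_H in blast)+
  hence "Re (\<Sum>g\<in>G. \<nu> (g Hel)) = 0"
   using H_dual_linear(2)[of \<nu> 0 0] OQl Ql_dual n subspace_0[OF H_sub] by (simp add: sum_G_Hel subset_iff)
  hence "(\<Sum>g\<in>G. L - Re (\<nu> (g Hel))) = real (card G) * L" by (simp add: sum_subtractf)
  moreover have "L - Re (\<nu> (id Hel)) \<le> (\<Sum>g\<in>G. L - Re (\<nu> (g Hel)))" by (rule member_le_sum[OF G.G_id _ finite_G]) (use le in simp)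
  moreover have "Re (lam Hel - \<nu> Hel) = real m" using m by simp
  ultimately have "real m \<le> real (card G) * L" by (simp add: L_def)
  thus ?thesis unfolding N_def by linarith
 qed
 define E where "E = (%bs. foldr b (map nv bs) w) ` {bs. set bs <= \<Psi> \<and> length bs \<le> N}"
 have fE: "finite E" unfolding E_def using finite_lists_length_le[OF finite_Psi] by blast
 have EM: "E <= M" unfolding E_def M_def using Mod_base by blast
 have wordO: "lam - sum_list bs \<in> \<Omega> \<and> length bs \<le> N" if bs: "set bs <= \<Psi>" and nz: "foldr b (map nv bs) w ~= 0" for bs
 proof -
  have O: "lam - sum_list bs \<in> \<Omega>" unfolding \<Omega>_def M_def
  proof (intro CollectI conjI bexI)
   show "lam - sum_list bs \<in> dual H" by (rule dual_closed(3)[OF Ql_dual[OF lam(1)] Qp_dual]) (use bs in \<open>auto simp: Qp_def\<close>)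
  qed (use nz Mod_base[OF bs] word_weight[OF b wl bs] in auto)
  obtain m where "m \<ge> length bs" "sum_list bs Hel = of_nat m" using ht_length[OF bs] by blast
  thus ?thesis using O height[OF O, of m] by simp
 qed
 have ME: "M = cspan E"
 proof
  show "M <= cspan E" unfolding M_def Mod_def
  proof (rule span_minimal[OF _ subspace_span], rule subsetI)
   fix x assume "x \<in> (%bs. foldr b (map nv bs) w) ` {bs. set bs <= \<Psi>}"
   then obtain bs where "set bs <= \<Psi>" "x = foldr b (map nv bs) w" by blast
   thus "x \<in> cspan E" using wordO[of bs] span_base[of x E] span_zero by (cases "x = 0") (auto simp: E_def)
  qed
 qed (use EM M span_minimal in blast)
 obtain I where I: "I <= E" "complex_vector.independent I" "E <= cspan I" using maximal_independent_subset[of E] by metis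
 have IM: "cspan I = M" using I EM ME span_minimal[OF I(3)] span_mono[OF I(1)] by auto
 have fI: "finite I" using I fE finite_subset by blast
 have "\<exists>\<nu>\<in>\<Omega>. i \<in> wtsp H b \<nu>" if i: "i \<in> I" for i
 proof -
  have "i ~= 0" using I(2) i complex_vector.dependent_zero by blast
  moreover obtain bs where bs: "i = foldr b (map nv bs) w" "set bs <= \<Psi>" using i I(1) unfolding E_def by blast
  ultimately show ?thesis using wordO[OF bs(2)] word_weight[OF b wl bs(2)] by blast
 qed
 then obtain \<tau> where tau: "!!i. i \<in> I ==> \<tau> i \<in> \<Omega>" "!!i. i \<in> I ==> i \<in> wtsp H b (\<tau> i)" by metis
 have Otau: "\<Omega> = \<tau> ` I"
 proof
  show "\<Omega> <= \<tau> ` I"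
  proof (rule subsetI, rule ccontr)
   fix \<nu> assume n: "\<nu> \<in> \<Omega>" "\<nu> \<notin> \<tau> ` I"
   then obtain v where v: "v \<in> M" "v ~= 0" "v \<in> wtsp H b \<nu>" by (auto simp: \<Omega>_def)
   have "I <= (\<Union>\<gamma>\<in>\<tau> ` I. wtsp H b \<gamma>)" using tau(2) by blast
   hence "v \<in> cspan (\<Union>\<gamma>\<in>\<tau> ` I. wtsp H b \<gamma>)" using v(1) IM span_mono by blast
   moreover have d: "\<gamma> \<in> dual H" if "\<gamma> \<in> insert \<nu> (\<tau> ` I)" for \<gamma> using that n tau(1) unfolding \<Omega>_def by blast
   ultimately have "v = 0" using wtsp_disjoint[of H b \<nu> "\<tau> ` I" v, OF rep_H[OF b] dual_distinct[OF d d] n(2) v(3)] by blast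
   thus False using v(2) by blast
  qed
 qed (use tau in blast)
 define \<pi> where "\<pi> y i j = (if j \<in> I then coords I (b y j) i else 0)" for y i j
 have jM: "b y j \<in> cspan I" if "j \<in> I" for y j using that Mb IM span_base by blast
 note rep = complex_vector.representation_add[OF I(2)] representation_scale[OF I(2)]
  complex_vector.representation_diff[OF I(2)] complex_vector.representation_sum[OF I(2)]
 have lin: "clinear (%y. \<pi> y i j)" for i j using jM by (intro clinearI) (simp_all add: \<pi>_def rep_simps[OF b] rep scaleC_complex)
 have exp: "b y j = (\<Sum>k\<in>I. \<pi> y k j *\<^sub>C k)" if "j \<in> I" for y j
  using sum_representation_eq[OF I(2) jM[OF that] fI order_refl] that by (simp add: \<pi>_def)
 have prod: "coords I (b x (b y j)) i = (\<Sum>k\<in>I. \<pi> x i k * \<pi> y k j)" if "j \<in> I" for x y i j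
 proof -
  have "clinear (b x)" using b by (simp add: lie_rep_def)
  hence "b x (b y j) = (\<Sum>k\<in>I. \<pi> y k j *\<^sub>C b x k)" unfolding exp[OF that, of y] by (simp add: complex_vector_pair.linear_sum clin)
  thus ?thesis using jM by (simp add: rep span_scale) (simp add: \<pi>_def mult.commute cong: sum.cong)
 qed
 have brk: "\<pi> (brk x y) i j = (\<Sum>k\<in>I. \<pi> x i k * \<pi> y k j - \<pi> y i k * \<pi> x k j)" if "j \<in> I" for x y i j
 proof -
  have m: "b x (b y j) \<in> cspan I" for x y using Mb IM span_base[OF that] by blast
  have "\<pi> (brk x y) i j = coords I (b x (b y j)) i - coords I (b y (b x j)) i" using that m by (simp add: \<pi>_def rep_simps(11)[OF b] rep)
  thus ?thesis by (simp add: prod[OF that] sum_subtractf)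
 qed
 have diag: "\<pi> h i j = (if i = j then \<tau> i h else 0)" if "h \<in> H" "i \<in> I" "j \<in> I" for h i j
 proof -
  have "b h j = \<tau> j h *\<^sub>C j" using tau(2)[OF that(3)] that(1) by (simp add: wtsp_def)
  thus ?thesis using that span_base[OF that(3)] by (simp add: \<pi>_def rep complex_vector.representation_basis[OF I(2) that(3)])
 qed
 have "lam \<in> \<Omega>" using wM w(1) wl Ql_dual[OF lam(1)] by (auto simp: \<Omega>_def)
 hence "lam \<in> \<tau> ` I \<and> (\<forall>i\<in>I. lam - \<tau> i \<in> Qp) \<and> (\<forall>\<alpha>\<in>\<Delta>. \<forall>i\<in>I. srefl \<alpha> (\<tau> i) \<in> \<tau> ` I)"
  using OQ Oref tau(1) unfolding Otau[symmetric] by blast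
 thus ?thesis using fI lin brk diag by (intro exI[of _ I] exI[of _ \<pi>] exI[of _ \<tau>]) simp
qed

end

section \<open>Central elements from matrix coefficients\<close>

context borel_lie
begin

lemma hp_derived: "hp <= derived" using tv(2)[OF Phi_repr] by (intro span_minimal) (auto simp: brk_span_def)

lemma derived_sub: "csubspace derived" by (simp add: brk_span_def)

lemma brk_derived: "brk x y \<in> derived" unfolding brk_span_def by (rule span_base) blast

lemma krad_derived: "\<exists>d\<in>derived. x - d \<in> krad"
proof -
 let ?S = "{x. \<exists>d\<in>derived. x - d \<in> krad}"
 have k: "csubspace (krad :: 'g set)" by (intro csubspaceI) (simp_all add: krad_iff' killing_simps)
 have S: "csubspace ?S"
 proof (rule csubspaceI)
  show "0 \<in> ?S" using subspace_0[OF k] subspace_0[OF derived_sub] by force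
  fix x y and c assume "x \<in> ?S" "y \<in> ?S"
  then obtain d e where de: "d \<in> derived" "x - d \<in> krad" "e \<in> derived" "y - e \<in> krad" by blast
  have "(x - d) + (y - e) \<in> krad" "c *\<^sub>C (x - d) \<in> krad" using de subspace_add[OF k] subspace_scale[OF k] by auto
  hence "(x + y) - (d + e) \<in> krad" "c *\<^sub>C x - c *\<^sub>C d \<in> krad" by (simp_all add: algebra_simps scale_right_diff_distrib)
  thus "x + y \<in> ?S" "c *\<^sub>C x \<in> ?S" using de subspace_add[OF derived_sub] subspace_scale[OF derived_sub] by blast+
 qed
 have "x \<in> cspan (H \<union> (\<Union>\<beta>\<in>\<Phi>. gsp \<beta>))" using root_space_decomposition_UNIV by blast
 moreover have "H \<union> (\<Union>\<beta>\<in>\<Phi>. gsp \<beta>) <= ?S"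
 proof
  fix y assume "y \<in> H \<union> (\<Union>\<beta>\<in>\<Phi>. gsp \<beta>)"
  then consider "y \<in> H" | \<beta> where "\<beta> \<in> \<Phi>" "y \<in> gsp \<beta>" by blast
  thus "y \<in> ?S"
  proof cases
   case 1 thus ?thesis using H_span hp_derived by blast
  next
   case 2
   hence "brk (coroot \<beta>) y = 2 *\<^sub>C y" using coroot_H root_coroot by (simp add: root_space_def)
   hence "y = (1/2) *\<^sub>C brk (coroot \<beta>) y" by (simp add: scaleC_scaleC scaleC_one)
   hence "y \<in> derived" using brk_derived subspace_scale[OF derived_sub] by metis
   thus ?thesis using subspace_0[OF k] by force
  qed
 qed
 ultimately show ?thesis using span_in_subspace[OF S] by blast
qed

lemma derived_eqI:
 assumes "x \<in> derived" "y \<in> derived" "!!z. killing x z = killing y z" shows "x = y"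
proof -
 have "x - y \<in> krad" by (simp add: krad_iff' killing_simps assms(3))
 moreover have "x - y \<in> derived" by (rule subspace_diff[OF derived_sub assms(1,2)])
 ultimately have "x - y = 0" by (rule krad_inter_derived)
 thus ?thesis by simp
qed

lemma Ql_krad: "q \<in> Ql ==> c \<in> krad ==> q c = 0"
proof (induction rule: Ql_induct)
 case (2 q \<beta>)
 obtain e where "e \<in> gsp \<beta>" "e ~= 0" using gsp_nonzero[OF 2(2)] by blast
 hence "\<beta> c = 0" using krad_brk0(1)[OF 2(4), of e] krad_H 2(4) by (auto simp: root_space_def)
 thus ?case using 2 by simp
qed simp

lemma central_if_commutes:
 assumes "!!y. uea_in y * z = z * uea_in y" shows "z \<in> uea_center"
proof -
 have "u \<in> {u. z * u = u * z}" for u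
 proof (rule uea_induct)
  show "csubspace {u. z * u = u * z}" by (intro csubspaceI) (simp_all add: algebra_simps mult_scaleC_left mult_scaleC_right)
 qed (simp_all add: assms mult.assoc, metis assms mult.assoc)
 thus ?thesis by (simp add: uea_center_def)
qed

text \<open>Let \<open>X\<close> be the matrix whose entries represent the coefficients of \<pi>
  through the Killing form. Its bracket with \<open>y\<close> is a matrix commutator with
  \<open>\<pi> y\<close>, so traces of its powers are central. The entry \<open>X i j\<close> has
  weight \<open>\<tau> j - \<tau> i\<close> and \<open>X i i = tv (\<tau> i)\<close>, so products
  with a factor of nonzero weight contribute only lower degree.\<close>

lemma matrix_central:
 fixes I :: "'i set" and \<pi> :: "'g => 'i => 'i => complex" and \<tau> :: "'i => 'g => complex"
 assumes I: "finite I" and lin: "!!i j. clinear (%y. \<pi> y i j)"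
  and hom: "!!x y i j. i \<in> I ==> j \<in> I ==> \<pi> (brk x y) i j = (\<Sum>k\<in>I. \<pi> x i k * \<pi> y k j - \<pi> y i k * \<pi> x k j)"
  and diag: "!!h i j. h \<in> H ==> i \<in> I ==> j \<in> I ==> \<pi> h i j = (if i = j then \<tau> i h else 0)"
  and Q: "!!i. i \<in> I ==> \<tau> i \<in> Ql"
 shows "\<exists>z\<in>uea_center. \<exists>p. HC z (%\<mu>. (\<Sum>i\<in>I. \<mu> (tv (\<tau> i)) ^ m) + p \<mu>) \<and> Pol (m - 1) p"
proof -
 have "\<exists>d\<in>derived. \<forall>y. killing d y = \<pi> y i j" if "i \<in> I" "j \<in> I" for i j
 proof -
  obtain d where d: "!!y. killing d y = \<pi> y i j"
  proof (rule riesz[OF lin[of i j]])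
   show "\<pi> x i j = 0" if "x \<in> krad" for x using diag[of x i j] krad_H that Ql_krad[OF Q] \<open>i \<in> I\<close> \<open>j \<in> I\<close> by auto
  qed (rule that)
  obtain d' where "d' \<in> derived" "d - d' \<in> krad" using krad_derived by blast
  thus ?thesis using d by (intro bexI[of _ d']) (auto simp: krad_iff' killing_simps)
 qed
 \<comment> \<open>Inside the derived algebra an element is determined by its Killing pairings,
   which makes the bracket formula for \<open>X\<close> provable.\<close>
 then obtain X where X: "!!i j. i \<in> I ==> j \<in> I ==> X i j \<in> derived"
  "!!i j y. i \<in> I ==> j \<in> I ==> killing (X i j) y = \<pi> y i j" by metis
 have brkX: "brk y (X i j) = (\<Sum>k\<in>I. \<pi> y k j *\<^sub>C X i k - \<pi> y i k *\<^sub>C X k j)" if ij: "i \<in> I" "j \<in> I" for y i j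
 proof (rule derived_eqI[OF brk_derived])
  show "(\<Sum>k\<in>I. \<pi> y k j *\<^sub>C X i k - \<pi> y i k *\<^sub>C X k j) \<in> derived"
   by (intro subspace_sum[OF derived_sub] subspace_diff[OF derived_sub]
     subspace_scale[OF derived_sub] X ij)
  fix z
  have "killing (brk y (X i j)) z = - killing (X i j) (brk y z)" using kinv[of "X i j" y z] brk_anti[of y "X i j"] by (simp add: killing_simps)
  also have "\<dots> = (\<Sum>k\<in>I. \<pi> z i k * \<pi> y k j - \<pi> y i k * \<pi> z k j)" by (simp add: X(2) hom ij flip: sum_negf)
  also have "\<dots> = killing (\<Sum>k\<in>I. \<pi> y k j *\<^sub>C X i k - \<pi> y i k *\<^sub>C X k j) z"
   by (simp add: complex_vector_pair.linear_sum[OF killing_lin(1)] killing_simps X(2) ij mult.commute cong: sum.cong)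
  finally show "killing (brk y (X i j)) z = killing (\<Sum>k\<in>I. \<pi> y k j *\<^sub>C X i k - \<pi> y i k *\<^sub>C X k j) z" .
 qed
 have td: "\<tau> j - \<tau> i \<in> dual H" if "i \<in> I" "j \<in> I" for i j using that by (intro dual_closed(3) Ql_dual Q)
 have XH: "X i j = (if i = j then tv (\<tau> i) else 0)" if "X i j \<in> H" "i \<in> I" "j \<in> I" for i j
 proof -
  have "tv (if i = j then \<tau> i else 0) = X i j" using that X by (intro tv_eqI) (auto simp: diag)
  thus ?thesis using tv_zero by metis
 qed
 have Xg: "X i j \<in> gsp (\<tau> j - \<tau> i)" if ij: "i \<in> I" "j \<in> I" for i j unfolding root_space_def
 proof (rule CollectI, rule ballI)
  fix h assume h: "h \<in> H"
  have "brk h (X i j) = (\<Sum>k\<in>I. (if k = j then \<tau> j h *\<^sub>C X i j else 0) - (if k = i then \<tau> i h *\<^sub>C X i j else 0))"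
   unfolding brkX[OF ij] by (rule sum.cong) (auto simp: diag h ij)
  thus "brk h (X i j) = (\<tau> j - \<tau> i) h *\<^sub>C X i j" using I ij by (simp add: sum_subtractf scale_left_diff_distrib)
 qed
 have Xl: "(X i j, \<tau> j - \<tau> i) \<in> lets" if ij: "i \<in> I" "j \<in> I" for i j
 proof -
  have "X i j \<in> hp" if "\<tau> j - \<tau> i = 0"
  proof -
   have h: "X i j \<in> H" using Xg[OF ij] root_space_0 unfolding that by blast
   show ?thesis unfolding XH[OF h ij] using Ql_tv[OF Q[OF ij(1)]] span_zero by (cases "i = j") simp_all
  qed
  thus ?thesis using Xg[OF ij] td[OF ij] by (auto simp: lets_def)
 qed
 have Xii: "X i i = tv (\<tau> i)" if "i \<in> I" for i using XH[OF _ that that] Xg[OF that that] root_space_0 by (metis diff_self)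
 \<comment> \<open>\<open>M m\<close> is the \<open>m\<close>-th power of the matrix with entries
   \<open>uea_in (X i j)\<close>.\<close>
 define M where "M = rec_nat (%i j. if i = j then 1 else 0) (%_ N i j. \<Sum>k\<in>I. uea_in (X i k) * N k j)"
 have M: "M 0 i j = (if i = j then 1 else 0)" "M (Suc m) i j = (\<Sum>k\<in>I. uea_in (X i k) * M m k j)" for m i j by (simp_all add: M_def)
 have comm: "uea_in y * M m i j - M m i j * uea_in y = (\<Sum>k\<in>I. \<pi> y k j *\<^sub>C M m i k - \<pi> y i k *\<^sub>C M m k j)"
  if ij: "i \<in> I" "j \<in> I" for y m i j using ij
 proof (induction m arbitrary: i j)
  case 0
  have "(\<Sum>k\<in>I. \<pi> y k j *\<^sub>C M 0 i k - \<pi> y i k *\<^sub>C M 0 k j) =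
   (\<Sum>k\<in>I. (if k = i then \<pi> y i j *\<^sub>C 1 else 0) - (if k = j then \<pi> y i j *\<^sub>C 1 else 0))" by (rule sum.cong) (auto simp: M)
  thus ?case using 0 I by (simp add: sum_subtractf M(1))
 next
  case (Suc m)
  let ?x = "%k. uea_in (X i k)"
  have 1: "uea_in y * ?x l = ?x l * uea_in y + (\<Sum>k\<in>I. \<pi> y k l *\<^sub>C ?x k - \<pi> y i k *\<^sub>C uea_in (X k l))" if "l \<in> I" for l
   using uea_in_brk[of y "X i l"] brkX[OF Suc.prems(1) that, of y] by (simp add: complex_vector_pair.linear_sum[OF uea_in_linear] uin algebra_simps)
  have "uea_in y * M (Suc m) i j - M (Suc m) i j * uea_in y =
    (\<Sum>l\<in>I. (uea_in y * ?x l - ?x l * uea_in y) * M m l j + ?x l * (uea_in y * M m l j - M m l j * uea_in y))"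
   by (simp add: M sum_distrib_left sum_distrib_right algebra_simps flip: sum_subtractf)
  also have "\<dots> = (\<Sum>l\<in>I. (\<Sum>k\<in>I. \<pi> y k l *\<^sub>C ?x k - \<pi> y i k *\<^sub>C uea_in (X k l)) * M m l j
    + ?x l * (\<Sum>k\<in>I. \<pi> y k j *\<^sub>C M m l k - \<pi> y l k *\<^sub>C M m k j))" by (rule sum.cong) (simp_all add: 1 Suc)
  also have "\<dots> = (\<Sum>l\<in>I. \<Sum>k\<in>I. \<pi> y k l *\<^sub>C (?x k * M m l j)) - (\<Sum>l\<in>I. \<Sum>k\<in>I. \<pi> y i k *\<^sub>C (uea_in (X k l) * M m l j))
    + ((\<Sum>l\<in>I. \<Sum>k\<in>I. \<pi> y k j *\<^sub>C (?x l * M m l k)) - (\<Sum>l\<in>I. \<Sum>k\<in>I. \<pi> y l k *\<^sub>C (?x l * M m k j)))"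
   by (simp add: sum_subtractf sum.distrib sum_distrib_left sum_distrib_right left_diff_distrib right_diff_distrib
     mult_scaleC_left mult_scaleC_right)
  also have "(\<Sum>l\<in>I. \<Sum>k\<in>I. \<pi> y l k *\<^sub>C (?x l * M m k j)) = (\<Sum>l\<in>I. \<Sum>k\<in>I. \<pi> y k l *\<^sub>C (?x k * M m l j))"
   by (rule sum.swap)
  also have "(\<Sum>l\<in>I. \<Sum>k\<in>I. \<pi> y i k *\<^sub>C (uea_in (X k l) * M m l j)) = (\<Sum>k\<in>I. \<pi> y i k *\<^sub>C M (Suc m) k j)"
   by (subst sum.swap) (simp add: M scale_sum_right)
  also have "(\<Sum>l\<in>I. \<Sum>k\<in>I. \<pi> y k j *\<^sub>C (?x l * M m l k)) = (\<Sum>k\<in>I. \<pi> y k j *\<^sub>C M (Suc m) i k)"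
   by (subst sum.swap) (simp add: M scale_sum_right)
  finally show ?case by (simp add: sum_subtractf)
 qed
 define z where "z = (\<Sum>i\<in>I. M m i i)"
 have "uea_in y * z - z * uea_in y = 0" for y
 proof -
  have "uea_in y * z - z * uea_in y = (\<Sum>i\<in>I. uea_in y * M m i i - M m i i * uea_in y)"
   by (simp add: z_def sum_distrib_left sum_distrib_right sum_subtractf)
  also have "\<dots> = (\<Sum>i\<in>I. \<Sum>k\<in>I. \<pi> y k i *\<^sub>C M m i k) - (\<Sum>i\<in>I. \<Sum>k\<in>I. \<pi> y i k *\<^sub>C M m k i)"
   by (simp add: comm sum_subtractf)
  also have "(\<Sum>i\<in>I. \<Sum>k\<in>I. \<pi> y k i *\<^sub>C M m i k) = (\<Sum>i\<in>I. \<Sum>k\<in>I. \<pi> y i k *\<^sub>C M m k i)" by (rule sum.swap)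
  finally show ?thesis by simp
 qed
 hence zc: "z \<in> uea_center" using central_if_commutes right_minus_eq by blast
 \<comment> \<open>Words of length \<open>m\<close> with a letter of nonzero weight; for \<gamma> =
   0 their projections have degree below \<open>m\<close>.\<close>
 define W where "W m \<gamma> = cspan {uw l | l. set l <= lets \<and> length l = m \<and> wt l = \<gamma> \<and> (\<exists>x\<in>set l. snd x ~= 0)}" for m \<gamma>
 have Wb: "uw l \<in> W m \<gamma>" if "set l <= lets" "length l = m" "wt l = \<gamma>" "\<exists>x\<in>set l. snd x ~= 0" for l m \<gamma>
  unfolding W_def by (rule span_base) (use that in blast)
 have Ws: "csubspace (W m \<gamma>)" for m \<gamma> by (simp add: W_def)
 have Wl: "uea_in y * u \<in> W (Suc m) (\<delta> + \<gamma>)" if "u \<in> W m \<gamma>" "(y, \<delta>) \<in> lets" for y u m \<gamma> \<delta>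
 proof (rule clinear_span_in[OF mult_linear(2) Ws _ that(1)[unfolded W_def]])
  fix x assume "x \<in> {uw l | l. set l <= lets \<and> length l = m \<and> wt l = \<gamma> \<and> (\<exists>x\<in>set l. snd x ~= 0)}"
  then obtain l where l: "x = uw l" "set l <= lets" "length l = m" "wt l = \<gamma>" "\<exists>x\<in>set l. snd x ~= 0" by blast
  have "uw ((y, \<delta>) # l) \<in> W (Suc m) (\<delta> + \<gamma>)" by (rule Wb) (use l that(2) in auto)
  thus "uea_in y * x \<in> W (Suc m) (\<delta> + \<gamma>)" by (simp add: l(1) uword_simps)
 qed
 have MW: "M m i j - (if i = j then uea_in (X i i) ^ m else 0) \<in> W m (\<tau> j - \<tau> i)" if ij: "i \<in> I" "j \<in> I" for m i j using ij
 proof (induction m arbitrary: i)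
  case 0 thus ?case by (simp add: M subspace_0[OF Ws])
 next
  case (Suc m)
  let ?d = "%k m. if k = j then uea_in (X k k) ^ m else 0"
  have e: "(\<tau> k - \<tau> i) + (\<tau> j - \<tau> k) = \<tau> j - \<tau> i" for k by (simp add: fun_eq_iff)
  have "uea_in (X i k) * M m k j - (if k = i then ?d i (Suc m) else 0) \<in> W (Suc m) (\<tau> j - \<tau> i)" if k: "k \<in> I" for k
  proof -
   have 1: "uea_in (X i k) * (M m k j - ?d k m) \<in> W (Suc m) (\<tau> j - \<tau> i)"
    using Wl[OF Suc.IH[OF k ij(2)] Xl[OF Suc.prems(1) k]] unfolding e .
   show ?thesis
   proof (cases "k = i")
    case True
    hence "uea_in (X i k) * M m k j - ?d i (Suc m) = uea_in (X i k) * (M m k j - ?d k m)" by (simp add: algebra_simps)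
    thus ?thesis using 1 True by simp
   next
    case False
    have 2: "uea_in (X i k) * ?d k m \<in> W (Suc m) (\<tau> j - \<tau> i)"
    proof (cases "k = j \<and> \<tau> k - \<tau> i ~= 0")
     case True
     let ?l = "(X i k, \<tau> k - \<tau> i) # replicate m (X k k, 0)"
     have "(X k k, 0) \<in> lets" using Xl[OF k k] by (metis diff_self)
     hence "set ?l <= lets" using Xl[OF Suc.prems(1) k] by (auto simp: set_replicate_conv_if)
     moreover have "sum_list (replicate m (0 :: 'g => complex)) = 0" by (induction m) (simp_all only: replicate.simps sum_list.Nil sum_list.Cons add_0)
     hence "wt ?l = \<tau> j - \<tau> i" using True by (simp only: list.map map_replicate snd_conv sum_list.Cons add_0_right)
     moreover have "uw ?l = uea_in (X i k) * ?d k m" using True by (simp add: uword_def prod_list_replicate)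
     moreover have "\<exists>x\<in>set ?l. snd x ~= 0" using True by (metis list.set_intros(1) snd_conv)
     ultimately show ?thesis using Wb[of ?l "Suc m"] by (metis length_Cons length_replicate)
    next
     case F: False
     \<comment> \<open>An off-diagonal entry between equal weights lies in \<open>H\<close>, and it
       vanishes because \<pi> is diagonal on \<open>H\<close>.\<close>
     have "X i k = 0" if "k = j"
     proof -
      have "\<tau> k - \<tau> i = 0" using F that by blast
      hence "X i k \<in> H" using Xg[OF Suc.prems(1) k] root_space_0 by metis
      thus ?thesis using XH[OF _ Suc.prems(1) k] False by auto
     qed
     hence "uea_in (X i k) * ?d k m = 0" by (auto simp: uin)
     thus ?thesis using subspace_0[OF Ws] by metis
    qed
    have "uea_in (X i k) * (M m k j - ?d k m) + uea_in (X i k) * ?d k m \<in> W (Suc m) (\<tau> j - \<tau> i)" by (rule subspace_add[OF Ws 1 2])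
    thus ?thesis using False by (simp add: right_diff_distrib)
   qed
  qed
  hence "(\<Sum>k\<in>I. uea_in (X i k) * M m k j - (if k = i then ?d i (Suc m) else 0)) \<in> W (Suc m) (\<tau> j - \<tau> i)"
   by (rule subspace_sum[OF Ws])
  moreover have "(\<Sum>k\<in>I. uea_in (X i k) * M m k j - (if k = i then ?d i (Suc m) else 0)) = M (Suc m) i j - ?d i (Suc m)"
   using I Suc.prems(1) by (simp add: sum_subtractf M(2))
  ultimately show ?case by (simp only:)
 qed
 have "W m 0 <= {u. \<exists>p. Pol (m - 1) p \<and> HC u p}" unfolding W_def
 proof (rule span_minimal[OF _ HC_subspace], clarify)
  fix l y and \<gamma> :: "'g => complex" assume "set l <= lets" "wt l = 0" "(y, \<gamma>) \<in> set l" "snd (y, \<gamma>) ~= 0" "m = length l"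
  thus "\<exists>p. Pol (length l - 1) p \<and> HC (uw l) p" using HC_word[of l] by (auto split: if_splits)
 qed
 moreover have "(\<Sum>i\<in>I. M m i i - uea_in (X i i) ^ m) \<in> W m 0"
 proof (rule subspace_sum[OF Ws])
  fix i assume "i \<in> I"
  thus "M m i i - uea_in (X i i) ^ m \<in> W m 0" using MW[of i i m] by (simp only: diff_self if_True simp_thms)
 qed
 ultimately obtain p where p: "Pol (m - 1) p" "HC (\<Sum>i\<in>I. M m i i - uea_in (X i i) ^ m) p" by blast
 have pow: "HC (uea_in t ^ m) (%\<mu>. \<mu> t ^ m)" if "t \<in> H" for t
 proof (induction m)
  case 0 show ?case by (simp add: HC_def scaleC_one subspace_0[OF Iv_sub])
 qed (use HC_t[OF that] in simp)
 have "HC (\<Sum>i\<in>J. uea_in (X i i) ^ m) (%\<mu>. \<Sum>i\<in>J. \<mu> (tv (\<tau> i)) ^ m)" if "finite J" "J <= I" for J using that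
 proof (induction J rule: finite_induct)
  case (insert i J)
  thus ?case using HC_add[OF pow[of "X i i"]] Xii hp_H[OF Ql_tv[OF Q]] by simp
 qed (simp add: HC_def subspace_0[OF Iv_sub])
 from HC_add[OF this[OF I order_refl] p(2)] have "HC z (%\<mu>. (\<Sum>i\<in>I. \<mu> (tv (\<tau> i)) ^ m) + p \<mu>)"
  by (simp add: z_def sum_subtractf)
 thus ?thesis using zc p(1) by blast
qed

end

section \<open>Separation by central characters\<close>

text \<open>Otherwise a functional that is 0 on \<open>W\<close> and 1 at \<open>v j\<close> would
  turn the curve into a nonzero polynomial with every natural number as a root.\<close>

lemma curve_coefficients:
 assumes W: "csubspace W" and c: "!!k::nat. (\<Sum>j\<le>n. of_nat k ^ j *\<^sub>C v j) \<in> W" and j: "j \<le> n" shows "v j \<in> W"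
proof (rule ccontr)
 assume "v j \<notin> W"
 then obtain \<phi> where phi: "clinear \<phi>" "\<phi> (v j) = (1::complex)" "!!w. w \<in> W ==> \<phi> w = 0"
  by (rule clinear_zero_outside[OF W]) (rule that; assumption)
 define p where "p = (\<Sum>j\<le>n. monom (\<phi> (v j)) j)"
 have "poly p (of_nat k) = 0" for k
 proof -
  have "poly p (of_nat k) = \<phi> (\<Sum>j\<le>n. of_nat k ^ j *\<^sub>C v j)"
   by (simp add: p_def poly_sum poly_monom complex_vector_pair.linear_sum[OF phi(1)] clinC[OF phi(1)] mult.commute)
  thus ?thesis using phi(3)[OF c] by simp
 qed
 hence "range (of_nat :: nat => complex) <= {x. poly p x = 0}" by auto
 moreover have "infinite (range (of_nat :: nat => complex))" by (intro range_inj_infinite inj_of_nat)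
 ultimately have "p = 0" using poly_roots_finite finite_subset by blast
 hence "coeff p j = 0" by simp
 thus False using j phi(2) by (simp add: p_def coeff_sum sum.If_cases[of "{..n}" "%i. i = j"] cong: if_cong)
qed

context borel_lie
begin

definition inv :: "(('g => complex) => complex) => bool" where
 "inv q \<longleftrightarrow> (\<forall>g\<in>G. \<forall>\<eta>\<in>hstar. q (%x. \<eta> (g x)) = q \<eta>)"

lemma G_sum_right: assumes "\<alpha> \<in> \<Delta>" shows "(\<Sum>g\<in>G. f (g \<circ> hrefl \<alpha>)) = (\<Sum>g\<in>G. f g)"
 by (rule sum.reindex_bij_witness[of _ "%g. g \<circ> hrefl \<alpha>" "%g. g \<circ> hrefl \<alpha>"])
  (use G.G_step assms hrefl_hrefl in \<open>auto simp: fun_eq_iff\<close>)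

lemma G_bij: "h \<in> G ==> bij_betw (%g. h \<circ> g) G G"
proof (induction rule: G.induct)
 case (G_step g \<alpha>)
 show ?case using bij_betw_trans[OF G_bij_left[OF G_step(2)] G_step(3)] by (simp add: comp_def)
qed (simp add: bij_betw_def)

lemma inv_sum: "inv (%\<eta>. \<Sum>g\<in>G. q (%x. \<eta> (g x)))" and inv_prod: "inv (%\<eta>. \<Prod>g\<in>G. q (%x. \<eta> (g x)))"
 using sum.reindex_bij_betw[OF G_bij, of _ "%g. q (%x. _ (g x))"] prod.reindex_bij_betw[OF G_bij, of _ "%g. q (%x. _ (g x))"] by (auto simp: inv_def)

definition orb :: "nat => ('g => complex) => ('g => complex) => complex" where
 "orb m lam \<eta> = (\<Sum>g\<in>G. \<eta> (g (tv lam)) ^ m)"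

lemma gact_Ql: "g \<in> G ==> lam \<in> Ql ==> gact g lam \<in> Ql" using gact_invariant[of Ql] Ql_srefl Delta_Phi by blast

lemma orb_gact: assumes "g \<in> G" "lam \<in> Ql" shows "orb m (gact g lam) = orb m lam"
proof -
 have "gact g lam \<in> {q \<in> Ql. orb m q = orb m lam}"
 proof (rule gact_invariant)
  fix q \<alpha> assume "q \<in> {q \<in> Ql. orb m q = orb m lam}" "\<alpha> \<in> \<Delta>"
  hence q: "q \<in> Ql" "orb m q = orb m lam" "\<alpha> \<in> \<Delta>" by auto
  have "orb m (srefl \<alpha> q) = orb m q"
  proof
   fix \<eta>
   show "orb m (srefl \<alpha> q) \<eta> = orb m q \<eta>"
    using G_sum_right[OF q(3), of "%g. \<eta> (g (tv q)) ^ m"] by (simp add: orb_def q(1,3) Ql_repr Ql_dual flip: hrefl_tv)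
  qed
  thus "srefl \<alpha> q \<in> {q \<in> Ql. orb m q = orb m lam}" using q Ql_srefl Delta_Phi by auto
 qed (use assms in auto)
 thus ?thesis by blast
qed

text \<open>The last clause supplies the natural number on which the induction over dominant weights
  runs.\<close>

definition dominant :: "('g => complex) => bool" where
 "dominant lam \<longleftrightarrow> lam \<in> Ql \<and> (\<forall>\<alpha>\<in>\<Delta>. \<exists>n. lam (coroot \<alpha>) = of_nat n) \<and> (\<exists>n. lam Hel = of_nat n)"

text \<open>A point of maximal height in the orbit is dominant, since reflecting at a negative
  Cartan integer would raise the height. This maximum is not negative, because the heights add up to
  0 over \<open>G\<close>.\<close>

lemma dominant_rep: assumes "lam \<in> Ql" shows "\<exists>g\<in>G. dominant (gact g lam)"
proof -
 have "\<exists>k::int. q Hel = of_int k" if q: "q \<in> Ql" for q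
 proof -
  have "\<exists>k::int. (\<Sum>\<beta>\<in>S. q (coroot \<beta>)) = of_int k" if "finite S" "S <= \<Psi>" for S using that
  proof (induction S rule: finite_induct)
   case (insert \<beta> S)
   then obtain i j where "(\<Sum>\<beta>\<in>S. q (coroot \<beta>)) = of_int i" "q (coroot \<beta>) = of_int j" using Ql_coroot[OF q Psi_Phi, of \<beta>] by auto
   thus ?case using insert by (intro exI[of _ "j + i"]) simp
  qed (auto intro: exI[of _ 0])
  thus ?thesis using dual_sum[OF Ql_dual[OF q], of \<Psi> coroot] coroot_H Psi_Phi finite_Psi unfolding Hel_def by auto
 qed
 then obtain ht where ht: "!!q. q \<in> Ql ==> q Hel = of_int (ht q)" by metis
 let ?S = "(%g. ht (gact g lam)) ` G"
 have S: "finite ?S" "?S ~= {}" using finite_G G.G_id by auto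
 obtain g where g: "g \<in> G" "ht (gact g lam) = Max ?S" using Max_in[OF S] by auto
 let ?l = "gact g lam"
 have lQ: "?l \<in> Ql" by (rule gact_Ql[OF g(1) assms])
 have max: "ht (gact h lam) \<le> ht ?l" if "h \<in> G" for h using Max_ge[OF S(1)] g(2) that by auto
 have "\<exists>n. ?l (coroot \<alpha>) = of_nat n" if a: "\<alpha> \<in> \<Delta>" for \<alpha>
 proof -
  obtain k where k: "?l (coroot \<alpha>) = of_int k" using Ql_coroot[OF lQ Delta_Phi[OF a]] by blast
  have r: "srefl \<alpha> ?l = gact (g \<circ> hrefl \<alpha>) lam" using gact_step[OF Ql_dual[OF lQ] a] by simp
  have "of_int (ht (srefl \<alpha> ?l)) = (of_int (ht ?l - 2 * k) :: complex)"
   using ht[OF lQ] ht[OF Ql_srefl[OF lQ Delta_Phi[OF a]]] by (simp add: srefl_apply k simple_Hel[OF a] algebra_simps)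
  hence "ht (srefl \<alpha> ?l) = ht ?l - 2 * k" unfolding of_int_eq_iff .
  moreover have "ht (srefl \<alpha> ?l) \<le> ht ?l" unfolding r by (rule max[OF G.G_step[OF g(1) a]])
  ultimately have "k \<ge> 0" by simp
  thus ?thesis using k by (intro exI[of _ "nat k"]) simp
 qed
 moreover have "ht ?l \<ge> 0"
 proof (rule ccontr)
  assume "\<not> ht ?l \<ge> 0"
  hence "(\<Sum>g\<in>G. ht (gact g lam)) < (\<Sum>g\<in>G. 0)" using max finite_G G.G_id by (intro sum_strict_mono) force+
  moreover have "(of_int (\<Sum>g\<in>G. ht (gact g lam)) :: complex) = (\<Sum>g\<in>G. lam (g Hel))"
   using ht gact_Ql assms Hel_H by (auto intro!: sum.cong simp: gact_def simp flip: ht)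
  moreover have "(\<Sum>g\<in>G. lam (g Hel)) = lam (\<Sum>g\<in>G. g Hel)" by (rule dual_sum[symmetric]) (use Ql_dual assms G_H Hel_H in auto)
  moreover have "lam 0 = 0" using H_dual_linear(2)[OF Ql_dual[OF assms] subspace_0[OF H_sub], of 0] by simp
  ultimately have "(\<Sum>g\<in>G. ht (gact g lam)) < 0" "(of_int (\<Sum>g\<in>G. ht (gact g lam)) :: complex) = of_int 0"
   by (simp_all del: of_int_sum add: sum_G_Hel)
  thus False unfolding of_int_eq_iff by simp
 qed
 hence "\<exists>n. ?l Hel = of_nat n" using ht[OF lQ] by (intro exI[of _ "nat (ht ?l)"]) simp
 ultimately show ?thesis using g(1) lQ by (auto simp: dominant_def)
qed

text \<open>Homogeneous polynomials of degree \<open>m\<close>, written as combinations of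
  \<open>m\<close>-th powers of linear forms from the root lattice; that every product of linear
  forms is of this kind is polarization.\<close>

definition Pw :: "nat => (('g => complex) => complex) set" where
 "Pw m = cspan {h. \<exists>lam\<in>Ql. \<forall>\<eta>\<in>hstar. h \<eta> = \<eta> (tv lam) ^ m}"

lemma Pw_sub: "csubspace (Pw m)" by (simp add: Pw_def)

lemma Pw_base: "lam \<in> Ql ==> (!!\<eta>. \<eta> \<in> hstar ==> h \<eta> = \<eta> (tv lam) ^ m) ==> h \<in> Pw m"
 unfolding Pw_def by (rule span_base) blast

lemma Pw_cong: assumes "h \<in> Pw m" "!!\<eta>. \<eta> \<in> hstar ==> h' \<eta> = h \<eta>" shows "h' \<in> Pw m"
proof -
 let ?k = "%\<eta>::'g => complex. \<eta> (tv 0) ^ m"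
 have "h + ((%\<eta>. h' \<eta> - h \<eta> + ?k \<eta>) - ?k) \<in> Pw m"
  by (intro subspace_add[OF Pw_sub] subspace_diff[OF Pw_sub] assms(1) Pw_base[OF Ql_0]) (simp_all add: assms(2))
 moreover have "h + ((%\<eta>. h' \<eta> - h \<eta> + ?k \<eta>) - ?k) = h'" by (simp add: fun_eq_iff)
 ultimately show ?thesis by simp
qed

text \<open>Polarization: the powers of the forms for \<open>k \<beta> + lam\<close> are a
  polynomial curve in \<open>k\<close> inside \<open>Pw (Suc m)\<close>, and its linear coefficient
  is \<open>Suc m\<close> times the desired product.\<close>

lemma Pw_eval_root: assumes b: "\<beta> \<in> \<Phi>" and h: "h \<in> Pw m" shows "(%\<eta>. \<eta> (tv \<beta>) * h \<eta>) \<in> Pw (Suc m)"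
proof -
 have base: "(%\<eta>. \<eta> (tv \<beta>) * \<eta> (tv lam) ^ m) \<in> Pw (Suc m)" if l: "lam \<in> Ql" for lam
 proof -
  define v where "v j = (%\<eta>::'g => complex. of_nat (Suc m choose j) * \<eta> (tv \<beta>) ^ j * \<eta> (tv lam) ^ (Suc m - j))" for j
  have "(\<Sum>j\<le>Suc m. of_nat k ^ j *\<^sub>C v j) \<in> Pw (Suc m)" for k :: nat
  proof (rule Pw_base)
   have kb: "of_nat k *\<^sub>C \<beta> \<in> Ql" using Ql_scale[OF b, of "int k"] by simp
   thus "of_nat k *\<^sub>C \<beta> + lam \<in> Ql" by (rule Ql_add[OF _ l])
   have "tv (of_nat k *\<^sub>C \<beta> + lam) = of_nat k *\<^sub>C tv \<beta> + tv lam"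
    using tv_add[OF Ql_repr[OF kb] Ql_repr[OF l]] tv_scale[OF Phi_repr[OF b]] by metis
   thus "(\<Sum>j\<le>Suc m. of_nat k ^ j *\<^sub>C v j) \<eta> = \<eta> (tv (of_nat k *\<^sub>C \<beta> + lam)) ^ Suc m" if "\<eta> \<in> hstar" for \<eta>
    by (simp del: sum.atMost_Suc power_Suc binomial_Suc_Suc add: clinC[OF hstar_linear[OF that]] binomial_ring sum_fun_apply
      scaleC_fun_apply scaleC_complex v_def power_mult_distrib mult_ac)
  qed
  hence "v 1 \<in> Pw (Suc m)" by (rule curve_coefficients[OF Pw_sub]) simp
  hence "(1 / of_nat (Suc m)) *\<^sub>C v 1 \<in> Pw (Suc m)" by (rule subspace_scale[OF Pw_sub])
  thus ?thesis by (rule Pw_cong) (simp del: of_nat_Suc add: v_def scaleC_fun_apply scaleC_complex)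
 qed
 have "clinear (%h. %\<eta>::'g => complex. \<eta> (tv \<beta>) * h \<eta>)"
  by (intro clinearI) (simp_all add: fun_eq_iff scaleC_fun_apply scaleC_complex algebra_simps)
 thus ?thesis
 proof (rule clinear_span_in[OF _ Pw_sub _ h[unfolded Pw_def]])
  fix f assume "f \<in> {h. \<exists>lam\<in>Ql. \<forall>\<eta>\<in>hstar. h \<eta> = \<eta> (tv lam) ^ m}"
  then obtain lam where "lam \<in> Ql" "\<forall>\<eta>\<in>hstar. f \<eta> = \<eta> (tv lam) ^ m" by blast
  thus "(%\<eta>. \<eta> (tv \<beta>) * f \<eta>) \<in> Pw (Suc m)" using Pw_cong[OF base] by simp
 qed
qed

lemma Pw_eval: assumes t: "t \<in> hp" and h: "h \<in> Pw m" shows "(%\<eta>. \<eta> t * h \<eta>) \<in> Pw (Suc m)" using t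
proof (induction rule: span_induct_alt)
 case base
 show ?case by (rule Pw_cong[OF subspace_0[OF Pw_sub]]) (simp add: clinC[OF hstar_linear])
next
 case (step c x y)
 then obtain \<beta> where b: "\<beta> \<in> \<Phi>" "x = tv \<beta>" by blast
 have "c *\<^sub>C (%\<eta>. \<eta> (tv \<beta>) * h \<eta>) + (%\<eta>. \<eta> y * h \<eta>) \<in> Pw (Suc m)"
  by (rule subspace_add[OF Pw_sub subspace_scale[OF Pw_sub Pw_eval_root[OF b(1) h]] step(2)])
 thus ?case by (rule Pw_cong) (simp add: b clinC[OF hstar_linear] scaleC_fun_apply scaleC_complex algebra_simps)
qed

text \<open>Splits off the leading homogeneous part. For \<open>m = 0\<close> nothing may remain, as
  the truncated \<open>m - 1\<close> would not express a lower degree.\<close>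

lemma Pol_split: "Pol m q ==> \<exists>h\<in>Pw m. if m = 0 then \<forall>\<eta>\<in>hstar. q \<eta> = h \<eta> else Pol (m - 1) (%\<eta>. q \<eta> - h \<eta>)"
proof (induction rule: Pol.induct)
 case (Pol_const m c)
 show ?case
 proof (cases "m = 0")
  case True
  have "c *\<^sub>C (%_. 1) \<in> Pw m" by (rule subspace_scale[OF Pw_sub Pw_base[OF Ql_0]]) (simp add: True)
  thus ?thesis using True by (intro bexI[of _ "c *\<^sub>C (%_. 1)"]) (auto simp: scaleC_fun_apply scaleC_complex)
 next
  case False
  thus ?thesis using Pol.Pol_const subspace_0[OF Pw_sub] by (intro bexI[of _ 0]) auto
 qed
next
 case (Pol_add m p q)
 then obtain h k where "h \<in> Pw m" "if m = 0 then \<forall>\<eta>\<in>hstar. p \<eta> = h \<eta> else Pol (m - 1) (%\<eta>. p \<eta> - h \<eta>)"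
  "k \<in> Pw m" "if m = 0 then \<forall>\<eta>\<in>hstar. q \<eta> = k \<eta> else Pol (m - 1) (%\<eta>. q \<eta> - k \<eta>)" by blast
 thus ?case using Pol.Pol_add[of "m - 1" "%\<eta>. p \<eta> - h \<eta>" "%\<eta>. q \<eta> - k \<eta>"] subspace_add[OF Pw_sub, of h m k]
  by (intro bexI[of _ "h + k"]) (auto split: if_splits simp: algebra_simps)
next
 case (Pol_eval t m p)
 then obtain h where h: "h \<in> Pw m" "if m = 0 then \<forall>\<eta>\<in>hstar. p \<eta> = h \<eta> else Pol (m - 1) (%\<eta>. p \<eta> - h \<eta>)" by blast
 have "Pol m (%\<eta>. \<eta> t * p \<eta> - \<eta> t * h \<eta>)"
 proof (cases m)
  case 0
  thus ?thesis using h(2) by (intro Pol_cong[OF Pol.Pol_const[of m 0]]) simp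
 next
  case (Suc k)
  thus ?thesis using h(2) Pol.Pol_eval[OF Pol_eval(1), of k "%\<eta>. p \<eta> - h \<eta>"] by (simp add: algebra_simps)
 qed
 thus ?case using Pw_eval[OF Pol_eval(1) h(1)] by (intro bexI[of _ "%\<eta>. \<eta> t * h \<eta>"]) auto
next
 case (Pol_cong m p q)
 then obtain h where h: "h \<in> Pw m" "if m = 0 then \<forall>\<eta>\<in>hstar. p \<eta> = h \<eta> else Pol (m - 1) (%\<eta>. p \<eta> - h \<eta>)" by blast
 thus ?case using Pol_cong(2) Pol.Pol_cong[of "m - 1" "%\<eta>. p \<eta> - h \<eta>"] by (intro bexI[of _ h]) (auto split: if_splits)
qed

context
 fixes \<xi> \<zeta> assumes hs: "\<xi> \<in> hstar" "\<zeta> \<in> hstar"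
  and cent: "!!z p. z \<in> uea_center ==> HC z p ==> unshift p \<xi> = unshift p \<zeta>"
begin

text \<open>Induction on the height of a dominant \<open>lam\<close>. The degree \<open>m\<close>
  central element of the simple module with highest weight \<open>lam\<close> has the power sum of
  its weights as leading term. Averaging makes this a sum of orbit sums, those equal to that of
  \<open>lam\<close> and those of lower dominant weights; the terms of lower degree are settled by
  \<open>IH\<close>.\<close>

lemma orb_eq:
 assumes IH: "!!r. Pol (m - 1) r ==> inv r ==> r \<xi> = r \<zeta>" and lam: "lam \<in> Ql" shows "orb m lam \<xi> = orb m lam \<zeta>"
proof -
 have "orb m lam \<xi> = orb m lam \<zeta>" if "dominant lam" "lam Hel = of_nat n" for lam n using that
 proof (induction n arbitrary: lam rule: less_induct)
  case (less n)
  have lQ: "lam \<in> Ql" using less.prems by (simp add: dominant_def)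
  have "\<forall>\<alpha>\<in>\<Delta>. \<exists>n. lam (coroot \<alpha>) = of_nat n" using less.prems(1) by (simp add: dominant_def)
  from fd_rep[OF lQ this] show ?case
  proof (elim exE conjE, goal_cases)
  case (1 I \<pi> \<tau>)
  note I = 1(1) and t = 1(5) bspec[OF 1(6)] bspec[OF bspec[OF 1(7)]]
  have lin: "!!i j. clinear (%y. \<pi> y i j)"
   and hom: "!!x y i j. i \<in> I ==> j \<in> I ==> \<pi> (brk x y) i j = (\<Sum>k\<in>I. \<pi> x i k * \<pi> y k j - \<pi> y i k * \<pi> x k j)"
   and diag: "!!h i j. h \<in> H ==> i \<in> I ==> j \<in> I ==> \<pi> h i j = (if i = j then \<tau> i h else 0)" using 1(2-4) by blast+
  have tQ: "\<tau> i \<in> Ql" if "i \<in> I" for i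
  proof -
   have "lam + - (lam - \<tau> i) \<in> Ql" by (intro Ql_add lQ Ql_uminus Qp_Ql t(2) that)
   moreover have "lam + - (lam - \<tau> i) = \<tau> i" by (simp add: fun_eq_iff)
   ultimately show ?thesis by metis
  qed
  obtain z p where z: "z \<in> uea_center" and zp: "HC z (%\<mu>. (\<Sum>i\<in>I. \<mu> (tv (\<tau> i)) ^ m) + p \<mu>)" and p: "Pol (m - 1) p"
   using matrix_central[OF I lin hom diag tQ, of m] by blast
  define s where "s = (%\<mu>::'g => complex. \<Sum>i\<in>I. \<mu> (tv (\<tau> i)) ^ m)"
  define f where "f = (%\<mu>. s \<mu> + p \<mu>)"
  define q where "q = unshift f"
  have sP: "Pol m s" unfolding s_def by (rule Pol_sum) (use Pol_power Ql_tv tQ in blast)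
  have fP: "Pol m f" unfolding f_def by (rule Pol_add[OF sP Pol_mono[OF p]]) simp
  have fz: "HC z f" using zp by (simp add: f_def s_def)
  have qz: "q \<xi> = q \<zeta>" unfolding q_def by (rule cent[OF z fz])
  have qi: "inv q" unfolding inv_def q_def using HC_invariant[OF z fz fP] by blast
  have "Pol (m - 1) (%\<eta>. f (%x. \<eta> x + (%x. - 1 * rh x) x) - f \<eta>)" by (rule Pol_shift[OF fP hstar_scale[OF rh(1)]])
  hence "Pol (m - 1) (%\<eta>. (q \<eta> - f \<eta>) + p \<eta>)" by (intro Pol_add p) (simp add: q_def unshift_def)
  hence qs: "Pol (m - 1) (%\<eta>. q \<eta> - s \<eta>)" by (simp add: f_def)
  \<comment> \<open>The average of \<open>q - s\<close> is invariant of degree at most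
    \<open>m - 1\<close>, so \<open>IH\<close> applies to it.\<close>
  define r where "r = (%\<eta>. \<Sum>g\<in>G. q (%x. \<eta> (g x)) - s (%x. \<eta> (g x)))"
  have "r \<xi> = r \<zeta>" by (rule IH) (use Pol_sum[OF Pol_G[OF qs]] inv_sum[of "%\<eta>. q \<eta> - s \<eta>"] in \<open>auto simp: r_def\<close>)
  moreover have "of_nat (card G) * q \<eta> - r \<eta> = (\<Sum>i\<in>I. orb m (\<tau> i) \<eta>)" if "\<eta> \<in> hstar" for \<eta>
  proof -
   have "(\<Sum>g\<in>G. q (%x. \<eta> (g x))) = (\<Sum>g\<in>G. q \<eta>)" by (rule sum.cong) (use qi that in \<open>auto simp: inv_def\<close>)
   moreover have "(\<Sum>i\<in>I. orb m (\<tau> i) \<eta>) = (\<Sum>g\<in>G. s (%x. \<eta> (g x)))" unfolding orb_def s_def by (rule sum.swap)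
   ultimately show ?thesis by (simp add: r_def sum_subtractf)
  qed
  ultimately have tot: "(\<Sum>i\<in>I. orb m (\<tau> i) \<xi>) = (\<Sum>i\<in>I. orb m (\<tau> i) \<zeta>)" using qz hs by metis
  \<comment> \<open>The indices with the same orbit sum as \<open>lam\<close>; the highest weight is
    among them, so \<open>card J\<close> can be divided out.\<close>
  define J where "J = {i \<in> I. orb m (\<tau> i) = orb m lam}"
  have other: "orb m (\<tau> i) \<xi> = orb m (\<tau> i) \<zeta>" if i: "i \<in> I - J" for i
  proof -
   obtain g where g: "g \<in> G" "dominant (gact g (\<tau> i))" using dominant_rep tQ i by blast
   let ?l = "gact g (\<tau> i)"
   have o: "orb m ?l = orb m (\<tau> i)" using orb_gact[OF g(1)] tQ i by blast
   have "?l \<in> \<tau> ` I" by (rule gact_invariant[OF _ _ g(1)]) (use tQ t(3) i in auto)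
   hence q: "lam - ?l \<in> Qp" using t(2) by auto
   have ne: "lam - ?l ~= 0"
   proof
    assume "lam - ?l = 0"
    hence "?l = lam" by (rule sym[OF iffD2[OF eq_iff_diff_eq_0]])
    thus False using o i unfolding J_def by simp
   qed
   obtain k where k: "(lam - ?l) Hel = of_nat k" "k ~= 0" using Qp_ht[OF q] ne by blast
   obtain l where l: "?l Hel = of_nat l" using g(2) by (auto simp: dominant_def)
   have "(of_nat n :: complex) = of_nat (k + l)" using k l less.prems(2) by (simp add: algebra_simps)
   hence "n = k + l" unfolding of_nat_eq_iff .
   thus ?thesis using less.IH[OF _ g(2) l] k(2) o by simp
  qed
  have fJ: "finite J" "J <= I" using I by (auto simp: J_def)
  have "(\<Sum>i\<in>I. orb m (\<tau> i) \<eta>) = (\<Sum>i\<in>I - J. orb m (\<tau> i) \<eta>) + of_nat (card J) * orb m lam \<eta>" for \<eta>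
   using sum.subset_diff[OF fJ(2) I, of "%i. orb m (\<tau> i) \<eta>"] by (simp add: J_def)
  hence "of_nat (card J) * orb m lam \<xi> = of_nat (card J) * orb m lam \<zeta>" using tot other by simp
  moreover have "card J ~= 0" using t(1) fJ(1) by (auto simp: J_def)
  ultimately show ?case by simp
  qed
 qed
 moreover obtain g where "g \<in> G" "dominant (gact g lam)" using dominant_rep[OF lam] by blast
 ultimately show ?thesis using orb_gact[OF _ lam] unfolding dominant_def by metis
qed

text \<open>Averaging turns the leading part of an invariant into a combination of orbit sums, which
  agree by \<open>orb_eq\<close>; the remainder has lower degree.\<close>

lemma inv_eq: "Pol m q ==> inv q ==> q \<xi> = q \<zeta>"
proof (induction m arbitrary: q)
 case 0
 have "Pol m p ==> m = 0 ==> \<exists>c. \<forall>\<eta>\<in>hstar. p \<eta> = c" for m p by (induction rule: Pol.induct) (blast, metis, simp, metis)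
 thus ?case using 0 hs by metis
next
 case (Suc m)
 let ?A = "%f (\<eta>::'g => complex). \<Sum>g\<in>G. f (%x. \<eta> (g x)) :: complex"
 obtain h where h: "h \<in> Pw (Suc m)" "Pol m (%\<eta>. q \<eta> - h \<eta>)" using Pol_split[OF Suc.prems(1)] by auto
 have "?A h \<xi> - ?A h \<zeta> \<in> {0}"
 proof (rule clinear_span_in[OF _ _ _ h(1)[unfolded Pw_def], of "%h. ?A h \<xi> - ?A h \<zeta>"])
  show "clinear (%h. ?A h \<xi> - ?A h \<zeta>)" by (intro clinearI) (simp_all add: sum.distrib scaleC_fun_apply scaleC_complex sum_distrib_left right_diff_distrib)
  fix f assume "f \<in> {h. \<exists>lam\<in>Ql. \<forall>\<eta>\<in>hstar. h \<eta> = \<eta> (tv lam) ^ Suc m}"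
  then obtain lam where l: "lam \<in> Ql" "\<forall>\<eta>\<in>hstar. f \<eta> = \<eta> (tv lam) ^ Suc m" by blast
  hence "?A f \<eta> = orb (Suc m) lam \<eta>" if "\<eta> \<in> hstar" for \<eta> unfolding orb_def by (intro sum.cong refl) (use hstar_G that in simp)
  thus "?A f \<xi> - ?A f \<zeta> \<in> {0}" using orb_eq[of "Suc m", simplified, OF Suc.IH l(1)] hs by simp
 qed (simp add: csubspaceI)
 moreover have "?A (%\<eta>. q \<eta> - h \<eta>) \<xi> = ?A (%\<eta>. q \<eta> - h \<eta>) \<zeta>" by (rule Suc.IH[OF Pol_sum[OF Pol_G[OF h(2)]] inv_sum])
 moreover have "?A q \<eta> = of_nat (card G) * q \<eta>" if "\<eta> \<in> hstar" for \<eta> using Suc.prems(2) that by (simp add: inv_def)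
 moreover have "card G ~= 0" using finite_G G.G_id by auto
 ultimately show ?case using hs by (simp add: sum_subtractf)
qed

end

text \<open>A difference on the center of the algebra is detected by a central element of degree
  one. Otherwise the shifted weights already lie in different orbits as seen on \<open>hp\<close>,
  and an invariant polynomial with values 1 and 0 at them contradicts \<open>inv_eq\<close>.\<close>

lemma central_separation:
 assumes mu: "\<mu> \<in> hstar" and nu: "\<nu> \<in> hstar" and ne: "!!g. g \<in> G ==> \<exists>x\<in>H. \<mu> (g x) + rh (g x) - rh x ~= \<nu> x"
 shows "\<exists>z\<in>uea_center. \<exists>p. HC z p \<and> p \<mu> ~= p \<nu>"
proof (rule ccontr, cases "\<exists>c\<in>krad. \<mu> c ~= \<nu> c")
 case True
 then obtain c where c: "c \<in> krad" "\<mu> c ~= \<nu> c" by blast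
 have "HC (1 :: 'g uea) (%_. 1)" by (simp add: HC_def scaleC_one subspace_0[OF Iv_sub])
 hence "HC (uea_in c) (%\<mu>. \<mu> c)" using HC_t[of c "1 :: 'g uea" "%_. 1"] krad_H c(1) by auto
 moreover have "uea_in c \<in> uea_center"
 proof (rule central_if_commutes)
  show "uea_in y * uea_in c = uea_in c * uea_in y" for y using uea_in_brk[of y c] krad_brk0(2)[OF c(1), of y] by (simp add: uin)
 qed
 moreover assume "\<not> ?thesis"
 ultimately show False using c by blast
next
 case False
 assume no: "\<not> ?thesis"
 define \<xi> \<zeta> where "\<xi> = (%x. \<mu> x + rh x)" and "\<zeta> = (%x. \<nu> x + rh x)"
 have hs: "\<xi> \<in> hstar" "\<zeta> \<in> hstar" unfolding \<xi>_def \<zeta>_def using hstar_add mu nu rh(1) by auto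
 note lin = clinC[OF hstar_linear[OF hs(1)]] clinC[OF hstar_linear[OF hs(2)]]
 have "\<exists>t\<in>hp. \<xi> (g t) ~= \<zeta> t" if g: "g \<in> G" for g
 proof -
  obtain x where x: "x \<in> H" "\<mu> (g x) + rh (g x) - rh x ~= \<nu> x" using ne[OF g] by blast
  obtain t where t: "t \<in> hp" "x - t \<in> krad" using H_span[OF x(1)] by blast
  have gx: "g x = (x - t) + g t" using G_fix(1)[OF g t(2)] by (simp add: clin[OF G_linear[OF g]] algebra_simps)
  have "\<xi> (x - t) = \<zeta> (x - t)" using False t(2) by (simp add: \<xi>_def \<zeta>_def)
  hence "\<xi> (g x) - \<zeta> x = \<xi> (g t) - \<zeta> t" by (simp add: gx lin)
  moreover have "\<xi> (g x) ~= \<zeta> x" using x(2) by (simp add: \<xi>_def \<zeta>_def algebra_simps)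
  ultimately show ?thesis using t(1) by (intro bexI[of _ t]) auto
 qed
 then obtain t where t: "!!g. g \<in> G ==> t g \<in> hp \<and> \<xi> (g (t g)) ~= \<zeta> (t g)" by metis
 \<comment> \<open>Affine in \<eta>, with value 0 at the translate of \<xi> by \<open>g\<close> and
   value 1 at \<zeta>.\<close>
 define l where "l g \<eta> = (\<eta> (t g) - \<xi> (g (t g))) / (\<zeta> (t g) - \<xi> (g (t g)))" for g and \<eta> :: "'g => complex"
 have "\<exists>m. Pol m (l g)" if "g \<in> G" for g
 proof -
  have "Pol 1 (%\<eta>. (1 / (\<zeta> (t g) - \<xi> (g (t g)))) * (\<eta> (t g) * 1 - \<xi> (g (t g))))"
   using Pol_eval[of "t g" 0 "%_. 1"] t[OF that] by (intro Pol_scale Pol_diff Pol_const) (auto intro: Pol_const)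
  thus ?thesis unfolding l_def by (intro exI[of _ 1]) (simp add: divide_simps)
 qed
 have Pprod: "\<exists>m. Pol m (%\<eta>. \<Prod>i\<in>S. f i \<eta>)" if "!!i. i \<in> S ==> \<exists>m. Pol m (f i)" for S and f :: "('g => 'g) => _"
  using that
 proof (induction S rule: infinite_finite_induct)
  case (insert i S) thus ?case using Pol_mult by simp blast
 qed (auto intro: Pol_const)
 have P1: "\<exists>m. Pol m (%\<eta>. 1 - \<eta>' \<eta>)" if "\<exists>m. Pol m \<eta>'" for \<eta>' using that Pol_diff[OF Pol_const] by blast
 define E where "E = (%\<eta>. \<Prod>g\<in>G. l g \<eta>)"
 obtain m where E: "Pol m E" unfolding E_def using Pprod[of G l] \<open>!!g. g \<in> G ==> \<exists>m. Pol m (l g)\<close> by blast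
 have E0: "E (%x. \<xi> (g x)) = 0" if "g \<in> G" for g unfolding E_def by (rule prod_zero[OF finite_G]) (use that in \<open>auto simp: l_def\<close>)
 have E1: "E \<zeta> = 1" unfolding E_def by (rule prod.neutral) (use t in \<open>force simp: l_def\<close>)
 \<comment> \<open>\<open>E\<close> is 1 at \<zeta> and 0 on the orbit of \<xi>; the product over
   \<open>G\<close> makes \<open>1 - E\<close> invariant.\<close>
 define Q where "Q = (%\<eta>. \<Prod>g\<in>G. 1 - E (%x. \<eta> (g x)))"
 have "\<exists>m. Pol m Q" unfolding Q_def by (intro Pprod P1) (use Pol_G[OF E] in blast)
 then obtain k where k: "Pol k Q" by blast
 have "Q \<xi> = Q \<zeta>"
 proof (rule inv_eq[OF hs _ k])
  show "unshift p \<xi> = unshift p \<zeta>" if "z \<in> uea_center" "HC z p" for z p using no that by (auto simp: unshift_def \<xi>_def \<zeta>_def)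
  show "inv Q" unfolding Q_def by (rule inv_prod)
 qed
 moreover have "Q \<xi> = 1" unfolding Q_def by (rule prod.neutral) (use E0 in simp)
 moreover have "Q \<zeta> = 0" unfolding Q_def by (rule prod_zero[OF finite_G]) (use E1 G.G_id in \<open>auto intro!: bexI[of _ id]\<close>)
 ultimately show False by simp
qed

end

section \<open>Modules over a parabolic subalgebra\<close>

lemma int_sum_list:
 assumes "!!b. b \<in> set bs ==> \<exists>k\<ge>0. b x = (of_int k :: complex)" shows "\<exists>k\<ge>0. sum_list bs x = of_int k" using assms
proof (induction bs)
 case (Cons b bs)
 obtain i where "i \<ge> 0" "sum_list bs x = of_int i" using Cons by auto
 moreover obtain j where "j \<ge> 0" "b x = of_int j" using Cons.prems[of b] by auto
 ultimately show ?case by (intro exI[of _ "j + i"]) auto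
qed (auto intro: exI[of _ 0])

locale parabolic_module = borel_lie ty H B for ty :: "'g::lie_algebra itself" and H B :: "'g set" +
 fixes P :: "'g set" and a :: "'g => 'v::complex_vector => 'v"
 assumes P_alg: "lie_subalgebra P" and BP: "B <= P" and am: "lie_module P a UNIV" and fdV: "fin_dim (UNIV :: 'v set)"
begin

lemma P_sub: "csubspace P" and P_brk: "x \<in> P ==> y \<in> P ==> brk x y \<in> P" using P_alg by (auto simp: lie_subalgebra_def)

lemma HP: "x \<in> H ==> x \<in> P" using HB BP by blast

lemmas a_lin = lie_module_simps(1)[OF am]
lemmas a_simps = clin[OF a_lin] lie_module_simps(2-)[OF am]

definition "\<Psi>P = {\<beta>\<in>\<Phi>. gsp \<beta> <= P}"
definition "lev = {\<beta>\<in>\<Psi>P. - \<beta> \<in> \<Psi>P}"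
definition "nr = \<Psi>P - lev"

abbreviation "L \<equiv> levi H P"

lemma P_eq: "P = cspan (H \<union> (\<Union>\<beta>\<in>\<Psi>P. gsp \<beta>))"
 using H_stable_root_alg[OF P_sub _ P_brk] HP unfolding root_alg_def \<Psi>P_def by blast

lemma levi_eq: "L = cspan (H \<union> (\<Union>\<beta>\<in>lev. gsp \<beta>))"
proof -
 have "\<Union>{gsp \<beta> | \<beta>. \<beta> \<in> \<Phi> \<and> gsp \<beta> <= P \<and> gsp (- \<beta>) <= P} = (\<Union>\<beta>\<in>lev. gsp \<beta>)"
  using Phi_uminus by (auto simp: lev_def \<Psi>P_def)
 thus ?thesis by (simp add: levi_def)
qed

lemma Psi_P: "\<beta> \<in> \<Psi> ==> \<beta> \<in> \<Psi>P" using Psi_Phi Psi_B BP by (auto simp: \<Psi>P_def)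

lemma Psi_P_add: "\<beta> \<in> \<Psi>P ==> \<gamma> \<in> \<Psi>P ==> \<beta> + \<gamma> \<in> \<Phi> ==> \<beta> + \<gamma> \<in> \<Psi>P"
 using brk_closed_roots[OF P_sub P_brk] by (auto simp: \<Psi>P_def)

lemma nr_add: assumes "\<gamma> \<in> nr" "\<delta> \<in> \<Psi>P" "\<gamma> + \<delta> \<in> \<Phi>" shows "\<gamma> + \<delta> \<in> nr"
proof -
 have P: "\<gamma> + \<delta> \<in> \<Psi>P" using assms Psi_P_add by (auto simp: nr_def)
 have "- (\<gamma> + \<delta>) \<notin> \<Psi>P"
 proof
  assume m: "- (\<gamma> + \<delta>) \<in> \<Psi>P"
  have e: "- (\<gamma> + \<delta>) + \<delta> = - \<gamma>" by (simp add: fun_eq_iff)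
  have "- \<gamma> \<in> \<Phi>" using assms(1) Phi_uminus by (auto simp: nr_def \<Psi>P_def)
  hence "- \<gamma> \<in> \<Psi>P" using Psi_P_add[OF m assms(2)] unfolding e by blast
  thus False using assms(1) by (auto simp: nr_def lev_def)
 qed
 thus ?thesis using P by (auto simp: nr_def lev_def)
qed

text \<open>As for pointedness of the positive roots: evaluating a zero sum at the coroot of
  \<gamma> yields a summand with a negative Cartan integer, which is absorbed into \<gamma>. The new
  root is again in \<open>nr\<close>, so the other summands may be any roots of
  \<open>P\<close>.\<close>

lemma nr_sum_nonzero: "\<gamma> \<in> nr ==> set bs <= \<Psi>P ==> \<gamma> + sum_list bs ~= 0"
proof (induction "length bs" arbitrary: \<gamma> bs rule: less_induct)
 case less
 have gP: "\<gamma> \<in> \<Phi>" using less.prems(1) by (auto simp: nr_def \<Psi>P_def)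
 show ?case
 proof
  assume z: "\<gamma> + sum_list bs = 0"
  have "\<exists>\<delta>\<in>set bs. \<not> (\<exists>k\<ge>0. \<delta> (coroot \<gamma>) = (of_int k :: complex))"
  proof (rule ccontr)
   assume "\<not> ?thesis"
   then obtain k where "k \<ge> 0" "sum_list bs (coroot \<gamma>) = of_int k" using int_sum_list[of bs "coroot \<gamma>"] by blast
   hence "of_int (2 + k) = (of_int 0 :: complex)" using root_coroot[OF gP] fun_cong[OF z, of "coroot \<gamma>"] by simp
   thus False unfolding of_int_eq_iff using \<open>k \<ge> 0\<close> by simp
  qed
  then obtain \<delta> where d: "\<delta> \<in> set bs" "\<not> (\<exists>k\<ge>0. \<delta> (coroot \<gamma>) = (of_int k :: complex))" by blast
  have dP: "\<delta> \<in> \<Psi>P" "\<delta> \<in> \<Phi>" using d(1) less.prems(2) by (auto simp: \<Psi>P_def)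
  obtain n where n: "\<delta> (coroot \<gamma>) = of_int n" using cartan_integer[OF gP dP(2)] by blast
  hence "n < 0" using d(2) by (metis linorder_not_le)
  moreover have "\<delta> ~= - \<gamma>" using less.prems(1) dP(1) by (auto simp: nr_def lev_def)
  ultimately have "\<delta> + \<gamma> \<in> \<Phi>" using root_add[OF gP dP(2) _ n] by blast
  hence "\<gamma> + \<delta> \<in> nr" using nr_add[OF less.prems(1) dP(1)] by (simp only: add.commute)
  moreover have "set (remove1 \<delta> bs) <= \<Psi>P" using less.prems(2) set_remove1_subset by fast
  moreover have "length (remove1 \<delta> bs) < length bs" using d(1) length_pos_if_in_set[OF d(1)] by (simp add: length_remove1)
  ultimately have "\<gamma> + \<delta> + sum_list (remove1 \<delta> bs) ~= 0" using less.hyps by blast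
  moreover have "\<gamma> + \<delta> + sum_list (remove1 \<delta> bs) = \<gamma> + sum_list bs"
   using sum_list_map_remove1[OF d(1), of "%x. x"] by (simp only: add.assoc list.map_ident)
  ultimately show False using z by metis
 qed
qed

lemma L_P: "L <= P" unfolding levi_eq by (rule span_minimal[OF _ P_sub]) (use HP in \<open>auto simp: lev_def \<Psi>P_def\<close>)

lemma L_alg: "lie_subalgebra L"
proof -
 let ?S = "H \<union> (\<Union>\<beta>\<in>lev. gsp \<beta>)"
 have lP: "\<beta> \<in> \<Phi>" if "\<beta> \<in> lev" for \<beta> using that by (auto simp: lev_def \<Psi>P_def)
 have sub: "csubspace L" by (simp add: levi_eq)
 have bs: "x \<in> L" if "x \<in> ?S" for x unfolding levi_eq by (rule span_base[OF that])
 have gen: "brk x y \<in> L" if xy: "x \<in> ?S" "y \<in> ?S" for x y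
 proof (cases "x \<in> H \<or> y \<in> H")
  case True
  have "brk h z \<in> L" if "h \<in> H" "z \<in> ?S" for h z
  proof (cases "z \<in> H")
   case True thus ?thesis using bs H_brk that by blast
  next
   case False
   then obtain \<beta> where "\<beta> \<in> lev" "z \<in> gsp \<beta>" using \<open>z \<in> ?S\<close> by blast
   hence "brk h z = \<beta> h *\<^sub>C z" using \<open>h \<in> H\<close> by (simp add: root_space_def)
   thus ?thesis using subspace_scale[OF sub bs[OF \<open>z \<in> ?S\<close>]] by simp
  qed
  hence "brk x y \<in> L \<or> brk y x \<in> L" using True xy by blast
  thus ?thesis using brk_anti[of x y] subspace_neg[OF sub, of "brk y x"] by auto
 next
  case False
  then obtain \<beta> \<gamma> where b: "\<beta> \<in> lev" "x \<in> gsp \<beta>" and g: "\<gamma> \<in> lev" "y \<in> gsp \<gamma>" using xy by blast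
  have xg: "brk x y \<in> gsp (\<beta> + \<gamma>)" using root_space_brk b g by blast
  consider "\<beta> + \<gamma> = 0" | "\<beta> + \<gamma> \<in> \<Phi>" | "brk x y = 0"
   using xg gsp_zero[of "\<beta> + \<gamma>"] dual_closed(2)[of \<beta> \<gamma>] Phi_dual lP b g by blast
  thus ?thesis
  proof cases
   case 1 thus ?thesis using xg root_space_0 bs by (metis UnI1)
  next
   case 2
   have "- \<beta> + - \<gamma> \<in> \<Phi>" using Phi_uminus[OF 2] by (simp only: minus_add_distrib)
   hence "- \<beta> + - \<gamma> \<in> \<Psi>P" using Psi_P_add b g unfolding lev_def by blast
   hence "- (\<beta> + \<gamma>) \<in> \<Psi>P" unfolding minus_add_distrib .
   hence "\<beta> + \<gamma> \<in> lev" using Psi_P_add[OF _ _ 2] b g unfolding lev_def by blast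
   thus ?thesis using bs xg by blast
  next
   case 3 thus ?thesis using subspace_0[OF sub] by simp
  qed
 qed
 show ?thesis unfolding lie_subalgebra_def
 proof (intro conjI ballI)
  show "brk x y \<in> L" if "x \<in> L" "y \<in> L" for x y by (rule brk_in_ideal[OF sub gen]) (use that in \<open>auto simp: levi_eq\<close>)
 qed (rule sub)
qed

lemma LM: "lie_module L a UNIV" using am L_P unfolding lie_module_def by blast

lemma weight_shift: "\<gamma> \<in> \<Psi>P \<or> \<gamma> = 0 ==> e \<in> gsp \<gamma> ==> v \<in> wtsp H a \<nu> ==> a e v \<in> wtsp H a (\<nu> + \<gamma>)"
proof -
 assume g: "\<gamma> \<in> \<Psi>P \<or> \<gamma> = 0" and e: "e \<in> gsp \<gamma>" and v: "v \<in> wtsp H a \<nu>"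
 have eP: "e \<in> P" using g e root_space_0 HP by (auto simp: \<Psi>P_def)
 have "a t (a e v) = (\<nu> + \<gamma>) t *\<^sub>C a e v" if t: "t \<in> H" for t
 proof -
  have "a t (a e v) = a (brk t e) v + a e (a t v)" using a_simps(8)[OF HP[OF t] eP] by simp
  thus ?thesis using e v t by (simp add: root_space_def wtsp_def a_simps eP scaleC_add_left)
 qed
 thus ?thesis by (simp add: wtsp_def)
qed

lemma a_H: "h \<in> H ==> clinear (a h)" using a_lin HP by blast

text \<open>Highest weight vectors for the Levi part, with 0 included so that their dimension can
  count components.\<close>

definition Sing :: "('g => complex) => 'v set" where
 "Sing \<nu> = {v \<in> wtsp H a \<nu>. \<forall>\<beta>\<in>lev \<inter> \<Psi>. \<forall>e\<in>gsp \<beta>. a e v = 0}"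

lemma lev_P: "\<beta> \<in> lev ==> e \<in> gsp \<beta> ==> e \<in> L" "\<beta> \<in> lev ==> e \<in> gsp \<beta> ==> e \<in> P"
proof -
 show *: "\<beta> \<in> lev ==> e \<in> gsp \<beta> ==> e \<in> L" unfolding levi_eq by (rule span_base) blast
 thus "\<beta> \<in> lev ==> e \<in> gsp \<beta> ==> e \<in> P" using L_P by blast
qed

lemma H_L: "x \<in> H ==> x \<in> L" unfolding levi_eq by (rule span_base) blast

lemma lev_root: assumes "\<beta> \<in> \<Phi>" "gsp \<beta> <= L" shows "\<beta> \<in> lev"
proof (rule ccontr)
 assume n: "\<beta> \<notin> lev"
 obtain e where e: "e \<in> gsp \<beta>" "e ~= 0" using gsp_nonzero[OF assms(1)] by blast
 have "L = cspan (\<Union>\<gamma>\<in>insert 0 lev. gsp \<gamma>)" by (simp add: levi_eq root_space_0)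
 hence "e \<in> cspan (\<Union>\<gamma>\<in>insert 0 lev. gsp \<gamma>)" using e assms(2) by blast
 moreover have "insert 0 lev <= dual H" using Phi_dual dual_closed(1) by (auto simp: lev_def \<Psi>P_def)
 ultimately have "e = 0" using gsp_disjoint[OF Phi_dual[OF assms(1)] _ _ e(1), of "insert 0 lev"] n Phi_nz[OF assms(1)] by blast
 thus False using e by blast
qed

lemma span_eigen:
 assumes W: "csubspace W" and X: "!!x. x \<in> X ==> x \<in> P \<and> (\<exists>c. a x v - c *\<^sub>C v \<in> W)" and x: "x \<in> cspan X"
 shows "x \<in> P \<and> (\<exists>c. a x v - c *\<^sub>C v \<in> W)" using x
proof (induction rule: span_induct_alt)
 case base
 show ?case using subspace_0[OF P_sub] a_simps(9)[OF subspace_0[OF P_sub]] subspace_0[OF W] by (auto intro!: exI[of _ 0])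
next
 case (step k x y)
 then obtain c d where cd: "x \<in> P" "a x v - c *\<^sub>C v \<in> W" "y \<in> P" "a y v - d *\<^sub>C v \<in> W" using X by blast
 have kx: "k *\<^sub>C x \<in> P" by (rule subspace_scale[OF P_sub cd(1)])
 have "k *\<^sub>C (a x v - c *\<^sub>C v) + (a y v - d *\<^sub>C v) \<in> W" by (intro subspace_add[OF W] subspace_scale[OF W] cd)
 hence "a (k *\<^sub>C x + y) v - (k * c + d) *\<^sub>C v \<in> W"
  by (simp add: a_simps kx cd scale_right_diff_distrib scaleC_add_left scaleC_scaleC algebra_simps)
 thus ?case using subspace_add[OF P_sub kx cd(3)] by blast
qed

text \<open>A root vector moves a weight vector to a different weight, so it can multiply it only by
  the scalar 0.\<close>

lemma singular_Sing:
 assumes v: "v \<in> wtsp H a \<nu>" shows "singular scaleC a (B \<inter> L) v \<longleftrightarrow> v \<in> Sing \<nu>"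
proof
 assume s: "singular scaleC a (B \<inter> L) v"
 have "a e v = 0" if b: "\<beta> \<in> lev \<inter> \<Psi>" and e: "e \<in> gsp \<beta>" for \<beta> e
 proof (rule ccontr)
  assume nz: "a e v ~= 0"
  have "e \<in> B \<inter> L" using b e Psi_B lev_P by blast
  hence "a e (1 *\<^sub>C v) \<in> range (%c. c *\<^sub>C v)" using s unfolding singular_def by blast
  then obtain c where c: "a e v = c *\<^sub>C v" by (auto simp: scaleC_one)
  obtain h where h: "h \<in> H" "\<beta> h ~= 0" using dual_distinct[OF Phi_dual dual_closed(1), of \<beta>] Phi_nz[of \<beta>] b Psi_Phi by auto
  have "a h (a e v) = (\<nu> h + \<beta> h) *\<^sub>C a e v" using weight_shift[OF _ e v] b h(1) by (simp add: lev_def wtsp_def)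
  moreover have "a h (a e v) = \<nu> h *\<^sub>C a e v" using v h(1) HP[OF h(1)] by (simp add: c wtsp_def a_simps scaleC_scaleC mult.commute)
  ultimately show False using nz h(2) scale_cancel_right by simp
 qed
 thus "v \<in> Sing \<nu>" using v by (simp add: Sing_def)
next
 assume s: "v \<in> Sing \<nu>"
 have BL: "csubspace (B \<inter> L)" "!!x w. x \<in> H ==> w \<in> B \<inter> L ==> brk x w \<in> B \<inter> L"
  using B_alg L_alg HB H_L unfolding lie_subalgebra_def by (blast intro: complex_vector.subspace_inter)+
 have "B \<inter> L = root_alg {\<beta>\<in>\<Phi>. gsp \<beta> <= B \<inter> L}" by (rule H_stable_root_alg[OF BL(1) _ BL(2)]) (use HB H_L in blast)
 also have "\<dots> <= cspan (H \<union> (\<Union>\<beta>\<in>lev \<inter> \<Psi>. gsp \<beta>))"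
  unfolding root_alg_def by (rule span_mono) (use lev_root in \<open>auto simp: pos_roots_def\<close>)
 finally have BLs: "B \<inter> L <= cspan (H \<union> (\<Union>\<beta>\<in>lev \<inter> \<Psi>. gsp \<beta>))" .
 have "x \<in> P \<and> (\<exists>c. a x v = c *\<^sub>C v)" if "x \<in> B \<inter> L" for x
 proof -
  have "x \<in> P \<and> (\<exists>c. a x v - c *\<^sub>C v \<in> {0})"
  proof (rule span_eigen[OF _ _ subsetD[OF BLs that]])
   fix y assume "y \<in> H \<union> (\<Union>\<beta>\<in>lev \<inter> \<Psi>. gsp \<beta>)"
   hence "y \<in> H \<or> y \<in> P \<and> a y v - 0 *\<^sub>C v \<in> {0}" using s lev_P by (auto simp: Sing_def)
   thus "y \<in> P \<and> (\<exists>c. a y v - c *\<^sub>C v \<in> {0})" using v HP by (auto simp: wtsp_def)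
  qed simp
  thus ?thesis by auto
 qed
 thus "singular scaleC a (B \<inter> L) v" unfolding singular_def by (force simp: a_simps scaleC_scaleC)
qed

lemma hw_iff: assumes "\<nu> \<in> dual H"
 shows "irr_highest_weight L H B a \<nu> U \<longleftrightarrow> irreducible_module L a U \<and> (\<exists>v\<in>U. v ~= 0 \<and> v \<in> Sing \<nu>)"
proof -
 have w: "weight_vector H a \<nu> v \<longleftrightarrow> v \<in> wtsp H a \<nu>" for v by (simp add: weight_vector_def wtsp_def)
 have "v \<in> Sing \<nu> ==> v \<in> wtsp H a \<nu>" for v by (simp add: Sing_def)
 thus ?thesis unfolding irr_highest_weight_def w using singular_Sing fin_dim_subset[OF fdV] by blast
qed

text \<open>By irreducibility the words in lowering operators applied to \<open>u\<close> span
  \<open>U\<close>, and all nonempty ones have weights strictly below \<nu>.\<close>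

lemma Sing_irreducible:
 assumes nu: "\<nu> \<in> dual H" and U: "irreducible_module L a U" and u: "u \<in> U" "u ~= 0" "u \<in> Sing \<nu>"
  and v: "v \<in> U" "v \<in> wtsp H a \<nu>" shows "\<exists>c. v = c *\<^sub>C u"
proof -
 let ?F = "\<Union>\<beta>\<in>lev \<inter> \<Psi>. gsp (- \<beta>)" and ?E = "H \<union> (\<Union>\<beta>\<in>lev \<inter> \<Psi>. gsp \<beta>)"
 define W where "W = cspan ((%fs. foldr a fs u) ` lists ?F)"
 have LFE: "L = cspan (?F \<union> ?E)"
 proof -
  have neg: "- \<beta> \<in> lev" if "\<beta> \<in> lev" for \<beta> using that Phi_uminus by (auto simp: lev_def)
  have "?F \<union> ?E = H \<union> (\<Union>\<beta>\<in>lev. gsp \<beta>)"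
  proof
   show "?F \<union> ?E <= H \<union> (\<Union>\<beta>\<in>lev. gsp \<beta>)" using neg by blast
   show "H \<union> (\<Union>\<beta>\<in>lev. gsp \<beta>) <= ?F \<union> ?E"
   proof
    fix x assume "x \<in> H \<union> (\<Union>\<beta>\<in>lev. gsp \<beta>)"
    then consider "x \<in> H" | \<beta> where "\<beta> \<in> lev" "x \<in> gsp \<beta>" by blast
    thus "x \<in> ?F \<union> ?E"
    proof cases
     case (2 \<beta>)
     hence "\<beta> \<in> \<Phi>" by (simp add: lev_def \<Psi>P_def)
     hence "\<beta> \<in> \<Psi> \<or> (- \<beta> \<in> \<Psi> \<and> x \<in> gsp (- (- \<beta>)))" using Psi_total 2(2) by simp
     thus ?thesis using 2 neg by blast
    qed blast
   qed
  qed
  thus ?thesis using levi_eq by simp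
 qed
 have E: "\<exists>c. a x u = c *\<^sub>C u" if "x \<in> ?E" for x
 proof (cases "x \<in> H")
  case False
  hence "a x u = 0 *\<^sub>C u" using that u(3) by (auto simp: Sing_def)
  thus ?thesis by blast
 qed (use u(3) in \<open>auto simp: Sing_def wtsp_def\<close>)
 have st: "a x p \<in> W" if "x \<in> L" "p \<in> W" for x p using words_stable[OF LM L_alg LFE E that(1)] that(2) unfolding W_def by blast
 have UL: "lie_module L a U" using U by (simp add: irreducible_module_def)
 have Us: "csubspace U" using UL by (simp add: lie_module_def)
 have FL: "?F <= L" using span_superset[of "?F \<union> ?E"] unfolding LFE[symmetric] by blast
 have wordU: "foldr a fs u \<in> U" if "fs \<in> lists ?F" for fs
  using that by (induction fs) (use u(1) UL FL in \<open>auto simp: lie_module_def subset_iff\<close>)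
 have WU: "W <= U" unfolding W_def by (rule span_minimal[OF _ Us]) (use wordU in blast)
 have uW: "u \<in> W" unfolding W_def by (rule span_base) (auto intro: image_eqI[of _ _ "[]"])
 have "lie_module L a W" using LM st unfolding lie_module_def W_def by auto
 hence "W = U" using U WU uW u(2) unfolding irreducible_module_def by blast
 hence vW: "v \<in> W" using v(1) by simp
 let ?A = "{\<nu> - q | q. q \<in> Qp \<and> q ~= 0}"
 have word: "foldr a fs u \<in> wtsp H a (\<nu> - 0) \<and> fs = [] \<or> (\<exists>q\<in>Qp. q ~= 0 \<and> foldr a fs u \<in> wtsp H a (\<nu> - q))" if "fs \<in> lists ?F" for fs
  using that
 proof (induction fs)
  case Nil thus ?case using u(3) by (simp add: Sing_def)
 next
  case (Cons f fs)
  obtain \<beta> where b: "\<beta> \<in> lev" "\<beta> \<in> \<Psi>" "f \<in> gsp (- \<beta>)" using Cons.hyps by blast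
  obtain q where q: "q \<in> Qp" "foldr a fs u \<in> wtsp H a (\<nu> - q)" using Cons.IH Qp_0 by blast
  have "- \<beta> \<in> \<Psi>P" using b(1) by (simp add: lev_def)
  hence "a f (foldr a fs u) \<in> wtsp H a (\<nu> - q + - \<beta>)" using weight_shift b(3) q(2) by blast
  moreover have "\<nu> - q + - \<beta> = \<nu> - (q + \<beta>)" by (simp add: fun_eq_iff)
  moreover have "q + \<beta> \<in> Qp" by (rule Qp_add[OF q(1) Qp_Psi[OF b(2)]])
  moreover have "q + \<beta> ~= 0"
  proof
   assume "q + \<beta> = 0"
   hence "- q = \<beta>" by (rule minus_unique)
   hence "q = 0" using Qp_pointed[OF q(1)] Qp_Psi[OF b(2)] by blast
   thus False using \<open>- q = \<beta>\<close> Phi_nz[OF Psi_Phi[OF b(2)]] by (metis minus_zero)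
  qed
  ultimately show ?case by (metis foldr.simps(2) comp_apply)
 qed
 have "(%fs. foldr a fs u) ` lists ?F <= insert u (\<Union>\<gamma>\<in>?A. wtsp H a \<gamma>)"
 proof
  fix x assume "x \<in> (%fs. foldr a fs u) ` lists ?F"
  then obtain fs where fs: "x = foldr a fs u" "fs \<in> lists ?F" by blast
  show "x \<in> insert u (\<Union>\<gamma>\<in>?A. wtsp H a \<gamma>)"
  proof (cases "fs = []")
   case False
   then obtain q where "q \<in> Qp" "q ~= 0" "x \<in> wtsp H a (\<nu> - q)" using word[OF fs(2)] fs(1) by blast
   thus ?thesis by blast
  qed (use fs in simp)
 qed
 hence "v \<in> cspan (insert u (\<Union>\<gamma>\<in>?A. wtsp H a \<gamma>))" using vW span_mono unfolding W_def by blast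
 then obtain c where c: "v - c *\<^sub>C u \<in> cspan (\<Union>\<gamma>\<in>?A. wtsp H a \<gamma>)" using complex_vector.span_breakdown_eq by blast
 have wu: "u \<in> wtsp H a \<nu>" using u(3) by (simp add: Sing_def)
 have ws: "csubspace (wtsp H a \<nu>)" by (rule wtsp_subspace[OF a_H])
 have "v - c *\<^sub>C u \<in> wtsp H a \<nu>" by (rule subspace_diff[OF ws v(2) subspace_scale[OF ws wu]])
 moreover have nA: "\<nu> \<notin> ?A"
 proof
  assume "\<nu> \<in> ?A"
  then obtain q where "\<nu> = \<nu> - q" "q ~= 0" by blast
  thus False by (metis diff_0_right diff_left_imp_eq)
 qed
 moreover have d: "\<gamma> \<in> dual H" if "\<gamma> \<in> insert \<nu> ?A" for \<gamma> using that nu dual_closed(3)[OF nu Qp_dual] by blast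
 ultimately have "v - c *\<^sub>C u = 0" using wtsp_disjoint[of H a \<nu> ?A, OF a_H dual_distinct[OF d d]] c by blast
 thus ?thesis by auto
qed

end

lemma center_1: "1 \<in> uea_center" and center_scale: "z \<in> uea_center ==> c *\<^sub>C z \<in> uea_center"
 and center_add: "z \<in> uea_center ==> y \<in> uea_center ==> z + y \<in> uea_center"
 by (simp_all add: uea_center_def mult_scaleC_left mult_scaleC_right algebra_simps)

lemma center_mult: "z \<in> uea_center ==> y \<in> uea_center ==> z * y \<in> uea_center" unfolding uea_center_def by (clarify, metis mult.assoc)

context borel_lie
begin

lemma HC_mult:
 assumes z: "z \<in> uea_center" "HC z p" "HC y q" shows "HC (z * y) (%\<mu>. p \<mu> * q \<mu>)"
proof -
 have "y * (z - p \<mu> *\<^sub>C 1) + p \<mu> *\<^sub>C (y - q \<mu> *\<^sub>C 1) \<in> Iv \<mu>" if "\<mu> \<in> hstar" for \<mu>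
  using z that by (intro subspace_add[OF Iv_sub] subspace_scale[OF Iv_sub] Iv_left) (auto simp: HC_def)
 moreover have "z * y = y * z" using z(1) by (simp add: uea_center_def)
 ultimately show ?thesis by (simp add: HC_def algebra_simps mult_scaleC_right scale_right_diff_distrib scaleC_scaleC)
qed

text \<open>A product of separating central elements, one for each point of \<open>T\<close>, each
  normalized to 1 at \<mu>.\<close>

lemma central_interpolation:
 assumes T: "finite T" "T <= hstar" and mu: "\<mu> \<in> hstar"
  and ne: "!!\<nu> g. \<nu> \<in> T ==> g \<in> G ==> \<exists>x\<in>H. \<mu> (g x) + rh (g x) - rh x ~= \<nu> x"
 shows "\<exists>d\<in>uea_center. d - 1 \<in> Iv \<mu> \<and> (\<forall>\<nu>\<in>T. d \<in> Iv \<nu>)"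
proof -
 have "\<exists>d\<in>uea_center. \<exists>p. HC d p \<and> p \<mu> = 1 \<and> (\<forall>\<nu>\<in>T. p \<nu> = 0)" using T ne
 proof (induction T rule: finite_induct)
  case empty
  have "HC (1 :: 'g uea) (%_. 1)" by (simp add: HC_def scaleC_one subspace_0[OF Iv_sub])
  thus ?case by (intro bexI[of _ 1] exI[of _ "%_. 1"]) (auto simp: uea_center_def)
 next
  case (insert \<nu> T)
  then obtain d p where d: "d \<in> uea_center" "HC d p" "p \<mu> = 1" "\<forall>\<nu>\<in>T. p \<nu> = 0" by auto
  obtain z q where z: "z \<in> uea_center" "HC z q" "q \<mu> ~= q \<nu>"
   using central_separation[OF mu _ insert.prems(2)[OF insertI1]] insert.prems(1) by blast
  define s where "s = 1 / (q \<mu> - q \<nu>)"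
  define y where "y = s *\<^sub>C (z + (- q \<nu>) *\<^sub>C 1)"
  have one: "HC (1 :: 'g uea) (%_. 1)" by (simp add: HC_def scaleC_one subspace_0[OF Iv_sub])
  have "HC y (%\<mu>. s * (q \<mu> + (- q \<nu>) * 1))" unfolding y_def by (intro HC_scale HC_add z one)
  hence "HC (d * y) (%\<eta>. p \<eta> * (s * (q \<eta> + (- q \<nu>) * 1)))" by (rule HC_mult[OF d(1,2)])
  moreover have "d * y \<in> uea_center" unfolding y_def by (intro center_mult center_scale center_add d z center_1)
  ultimately show ?case
   using d(3,4) z(3) by (intro bexI[of _ "d * y"] exI[of _ "%\<eta>. p \<eta> * (s * (q \<eta> + (- q \<nu>) * 1))"]) (auto simp: s_def)
 qed
 then obtain d p where d: "d \<in> uea_center" "HC d p" "p \<mu> = 1" "\<forall>\<nu>\<in>T. p \<nu> = 0" by blast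
 have h: "d - p \<nu> *\<^sub>C 1 \<in> Iv \<nu>" if "\<nu> \<in> hstar" for \<nu> using d(2) that by (simp add: HC_def)
 have "d \<in> Iv \<nu>" if "\<nu> \<in> T" for \<nu> using h[of \<nu>] d(4) T(2) that by (auto simp: subset_iff)
 thus ?thesis using h[OF mu] d(3) by (intro bexI[OF _ d(1)]) (simp add: scaleC_one)
qed

end

context parabolic_module
begin

text \<open>A component of highest weight \<nu> contributes one line to \<open>Sing \<nu>\<close>
  and any other component nothing. So the count does not depend on the decomposition, and the
  definite description in \<open>multiplicity\<close> is justified.\<close>

lemma multiplicity_eq:
 assumes S: "irr_decomposition L a UNIV S" and nu: "\<nu> \<in> dual H" shows "card {U\<in>S. irr_highest_weight L H B a \<nu> U} = cdim (Sing \<nu>)"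
proof -
 have fS: "finite S" and irr: "!!U. U \<in> S ==> irreducible_module L a U"
  and ex1: "!!v. \<exists>!f. f \<in> (\<Pi>\<^sub>E U\<in>S. U) \<and> v = (\<Sum>U\<in>S. f U)" using S by (auto simp: irr_decomposition_def)
 have UL: "lie_module L a U" if "U \<in> S" for U using irr[OF that] by (simp add: irreducible_module_def)
 hence Us: "csubspace U" and Ua: "!!x v. x \<in> L ==> v \<in> U ==> a x v \<in> U" if "U \<in> S" for U using that by (auto simp: lie_module_def)
 define c where "c v = (THE f. f \<in> (\<Pi>\<^sub>E U\<in>S. U) \<and> v = (\<Sum>U\<in>S. f U))" for v
 have c: "c v \<in> (\<Pi>\<^sub>E U\<in>S. U)" "v = (\<Sum>U\<in>S. c v U)" for v using theI'[OF ex1[of v]] unfolding c_def by auto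
 have cU: "c v U \<in> U" if "U \<in> S" for v U using c(1) that by auto
 have uniq: "c v U = g U" if g: "!!U. U \<in> S ==> g U \<in> U" "v = (\<Sum>U\<in>S. g U)" and U: "U \<in> S" for v g U
 proof -
  have "restrict g S \<in> (\<Pi>\<^sub>E U\<in>S. U) \<and> v = (\<Sum>U\<in>S. restrict g S U)" using g by auto
  hence "c v = restrict g S" using ex1[of v] c[of v] by blast
  thus ?thesis using U by simp
 qed
 have ca: "c (a x v) U = a x (c v U)" if "x \<in> L" "U \<in> S" for x v U
 proof (rule uniq[OF _ _ that(2)])
  show "a x v = (\<Sum>U\<in>S. a x (c v U))" using c(2)[of v] complex_vector_pair.linear_sum[OF a_lin, of x "c v" S] that(1) L_P by auto
 qed (use Ua cU that in blast)
 have cs: "c (s *\<^sub>C v) U = s *\<^sub>C c v U" if "U \<in> S" for s v U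
  by (rule uniq[OF _ _ that]) (use c(2)[of v] subspace_scale[OF Us] cU in \<open>auto simp flip: scale_sum_right\<close>)
 have c0: "c 0 U = 0" if "U \<in> S" for U using cs[OF that, of 0 0] by simp
 have cSing: "c v U \<in> Sing \<nu>" if v: "v \<in> Sing \<nu>" and U: "U \<in> S" for v U
 proof -
  have "a t (c v U) = \<nu> t *\<^sub>C c v U" if "t \<in> H" for t using v that ca[OF H_L[OF that] U, of v] cs[OF U] by (simp add: Sing_def wtsp_def)
  moreover have "a e (c v U) = 0" if "\<beta> \<in> lev \<inter> \<Psi>" "e \<in> gsp \<beta>" for \<beta> e
   using v that ca[OF lev_P(1) U, of \<beta> e v] c0[OF U] by (auto simp: Sing_def)
  ultimately show ?thesis by (simp add: Sing_def wtsp_def)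
 qed
 let ?N = "{U\<in>S. irr_highest_weight L H B a \<nu> U}"
 have "\<forall>U\<in>?N. \<exists>u. u \<in> U \<and> u ~= 0 \<and> u \<in> Sing \<nu>" using hw_iff[OF nu] by blast
 then obtain u where u: "!!U. U \<in> ?N ==> u U \<in> U \<and> u U ~= 0 \<and> u U \<in> Sing \<nu>" by metis
 have cu: "c (u U) U' = (if U' = U then u U else 0)" if "U \<in> ?N" "U' \<in> S" for U U'
  by (rule uniq[OF _ _ that(2)]) (use that u subspace_0[OF Us] fS in auto)
 have inj: "inj_on u ?N"
 proof (rule inj_onI, rule ccontr)
  fix U U' assume *: "U \<in> ?N" "U' \<in> ?N" "u U = u U'" "U ~= U'"
  thus False using cu[of U U] cu[of U' U] u by auto
 qed
 have "complex_vector.independent (u ` ?N)"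
 proof (rule complex_vector.independent_if_scalars_zero)
  fix r x assume s: "(\<Sum>x\<in>u ` ?N. r x *\<^sub>C x) = 0" and x: "x \<in> u ` ?N"
  then obtain U where U: "U \<in> ?N" "x = u U" by blast
  have "(\<Sum>U\<in>?N. r (u U) *\<^sub>C u U) = 0" using s sum.reindex[OF inj, of "%x. r x *\<^sub>C x"] by simp
  also have "(\<Sum>U\<in>?N. r (u U) *\<^sub>C u U) = (\<Sum>U\<in>S. if U \<in> ?N then r (u U) *\<^sub>C u U else 0)"
   using fS by (intro sum.mono_neutral_cong_left) auto
  finally have "c 0 U = r (u U) *\<^sub>C u U"
   using U u subspace_scale[OF Us] subspace_0[OF Us] by (subst uniq[of "%U. if U \<in> ?N then r (u U) *\<^sub>C u U else 0"]) auto
  thus "r x = 0" using c0[of U] U u by auto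
 qed (use fS in auto)
 moreover have "Sing \<nu> <= cspan (u ` ?N)"
 proof
  fix v assume v: "v \<in> Sing \<nu>"
  have "c v U \<in> cspan (u ` ?N)" if U: "U \<in> S" for U
  proof (cases "c v U = 0")
   case False
   hence N: "U \<in> ?N" using U irr cU[OF U] cSing[OF v U] hw_iff[OF nu] by blast
   have "c v U \<in> wtsp H a \<nu>" using cSing[OF v U] by (simp add: Sing_def)
   then obtain k where "c v U = k *\<^sub>C u U" using Sing_irreducible[OF nu irr[OF U] _ _ _ cU[OF U]] u[OF N] by blast
   thus ?thesis using N by (simp add: span_scale span_base)
  qed (simp add: span_zero)
  hence "(\<Sum>U\<in>S. c v U) \<in> cspan (u ` ?N)" by (rule span_sum)
  thus "v \<in> cspan (u ` ?N)" by (simp only: c(2)[symmetric])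
 qed
 moreover have "u ` ?N <= Sing \<nu>" using u by blast
 ultimately show ?thesis using complex_vector.dim_unique card_image[OF inj] by metis
qed

text \<open>Enlarge \<open>W\<close> by the components one at a time until it contains
  \<open>v\<close>, and write \<open>v = y + z\<close> with \<open>z\<close> in the last component
  \<open>U\<close>. Irreducibility gives \<open>U \<inter> W = {0}\<close>, so \<open>z\<close>,
  which is singular modulo \<open>W\<close>, is singular.\<close>

lemma singular_component:
 assumes "finite T" "!!U. U \<in> T ==> irreducible_module L a U" "!!U. U \<in> T ==> f U \<in> U"
  "csubspace W" "!!x w. x \<in> L ==> w \<in> W ==> a x w \<in> W" "w \<in> W" "v = w + (\<Sum>U\<in>T. f U)"
  "v \<notin> W" "!!\<beta> e. \<beta> \<in> lev \<inter> \<Psi> ==> e \<in> gsp \<beta> ==> a e v \<in> W" and v: "v \<in> wtsp H a \<nu>"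
 shows "\<exists>U\<in>T. \<exists>u\<in>U. u ~= 0 \<and> u \<in> Sing \<nu>" using assms(1-9)
proof (induction T arbitrary: W w rule: finite_induct)
 case (insert U T)
 let ?u = "f U"
 have irr: "irreducible_module L a U" and u: "?u \<in> U" using insert.prems(1,2) by blast+
 hence UL: "lie_module L a U" by (simp add: irreducible_module_def)
 hence U: "csubspace U" "!!x u. x \<in> L ==> u \<in> U ==> a x u \<in> U" by (auto simp: lie_module_def)
 have vs: "v = (w + ?u) + (\<Sum>U\<in>T. f U)" using insert.prems(6) insert.hyps by (simp add: add.assoc)
 define W' where "W' = {x + y | x y. x \<in> W \<and> y \<in> U}"
 have W': "csubspace W'" unfolding W'_def by (rule complex_vector.subspace_sums[OF insert.prems(3) U(1)])
 have stable: "a x z \<in> W'" if "x \<in> L" "z \<in> W'" for x z using that insert.prems(4) U(2) L_P a_simps(1)[of x] unfolding W'_def by blast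
 have WW: "x \<in> W'" if "x \<in> W" for x unfolding W'_def using that subspace_0[OF U(1)] by force
 show ?case
 proof (cases "v \<in> W'")
  case False
  have "\<exists>U\<in>T. \<exists>u\<in>U. u ~= 0 \<and> u \<in> Sing \<nu>"
   by (rule insert.IH[OF _ _ W' stable _ vs False]) (use insert.prems WW u W'_def in blast)+
  thus ?thesis by blast
 next
  case True
  then obtain y z where yz: "v = y + z" "y \<in> W" "z \<in> U" unfolding W'_def by blast
  have "lie_module L a (U \<inter> W)"
   using UL complex_vector.subspace_inter[OF U(1) insert.prems(3)] insert.prems(4) unfolding lie_module_def by blast
  moreover have "\<not> U <= W" using yz insert.prems(3,7) subspace_add by blast
  ultimately have "U \<inter> W = {0}" using irr unfolding irreducible_module_def by blast
  hence zero: "x = 0" if "x \<in> U" "x = r - y'" "r \<in> W" "y' \<in> W" for x r y' using that subspace_diff[OF insert.prems(3)] by blast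
  have "a t z = \<nu> t *\<^sub>C z" if t: "t \<in> H" for t
  proof -
   have "a t z - \<nu> t *\<^sub>C z = 0"
   proof (rule zero)
    show "a t z - \<nu> t *\<^sub>C z \<in> U" by (intro subspace_diff U subspace_scale H_L t yz)
    show "a t z - \<nu> t *\<^sub>C z = \<nu> t *\<^sub>C y - a t y" using v t by (simp add: yz(1) a_simps HP wtsp_def scaleC_add_right algebra_simps)
   qed (use subspace_scale insert.prems(3,4) H_L t yz in blast)+
   thus ?thesis by simp
  qed
  moreover have "a e z = 0" if b: "\<beta> \<in> lev \<inter> \<Psi>" "e \<in> gsp \<beta>" for \<beta> e
  proof (rule zero)
   show "a e z = a e v - a e y" using lev_P(2)[of \<beta> e] b by (simp add: yz(1) a_simps)
  qed (use insert.prems(4,8) U(2) b lev_P yz in blast)+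
  ultimately have "z \<in> Sing \<nu>" by (simp add: Sing_def wtsp_def)
  moreover have "z ~= 0" using yz insert.prems(7) by auto
  ultimately show ?thesis using yz(3) by blast
 qed
qed simp

text \<open>Semisimplicity over the Levi part replaces a vector that is singular modulo
  \<open>W\<close> by a singular one of the same weight inside a component.\<close>

lemma multiplicity_pos:
 assumes pos: "multiplicity L H B a UNIV \<mu> > 0" and nu: "\<nu> \<in> dual H"
  and W: "csubspace W" "!!x w. x \<in> P ==> w \<in> W ==> a x w \<in> W"
  and v: "v \<notin> W" "v \<in> wtsp H a \<nu>" "!!\<beta> e. \<beta> \<in> \<Psi> ==> e \<in> gsp \<beta> ==> a e v \<in> W"
 shows "multiplicity L H B a UNIV \<nu> > 0"
proof (cases "\<exists>S. irr_decomposition L a UNIV S")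
 case False
 \<comment> \<open>Without a decomposition the description is \<open>THE k. False\<close> for every
   weight, so positivity at \<mu> carries over to \<nu>.\<close>
 thus ?thesis using pos unfolding multiplicity_def by simp
next
 case True
 then obtain S where S: "irr_decomposition L a UNIV S" by blast
 hence fS: "finite S" and irr: "!!U. U \<in> S ==> irreducible_module L a U" unfolding irr_decomposition_def by blast+
 obtain f where f: "!!U. U \<in> S ==> f U \<in> U" "v = (\<Sum>U\<in>S. f U)" using S unfolding irr_decomposition_def by (metis PiE_mem UNIV_I)
 have "\<exists>U\<in>S. \<exists>u\<in>U. u ~= 0 \<and> u \<in> Sing \<nu>"
  by (rule singular_component[OF fS irr f(1) W(1) _ subspace_0[OF W(1)] _ v(1) _ v(2)]) (use W(2) L_P f(2) v(3) in auto)
 hence "{U\<in>S. irr_highest_weight L H B a \<nu> U} ~= {}" using hw_iff[OF nu] irr by blast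
 moreover have "multiplicity L H B a UNIV \<nu> = card {U\<in>S. irr_highest_weight L H B a \<nu> U}"
  unfolding multiplicity_def using S multiplicity_eq nu by (intro the_equality) auto
 ultimately show ?thesis using fS by (simp add: card_gt_0_iff)
qed

text \<open>The weight spaces that \<open>p\<close>-words with at least one letter in the nilradical reach from weight \<open>\<mu>\<close>.\<close>

definition Vn :: "('g => complex) => 'v set" where
 "Vn \<mu> = cspan (\<Union>\<delta>\<in>{\<gamma> + sum_list bs | \<gamma> bs. \<gamma> \<in> nr \<and> set bs <= \<Psi>P}. wtsp H a (\<mu> + \<delta>))"

lemma Vn_sub: "csubspace (Vn \<mu>)" by (simp add: Vn_def)

lemma Vn_in: "\<gamma> \<in> nr ==> set bs <= \<Psi>P ==> x \<in> wtsp H a (\<mu> + (\<gamma> + sum_list bs)) ==> x \<in> Vn \<mu>"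
 unfolding Vn_def by (rule span_base) blast

lemma P_stableI:
 assumes W: "csubspace W" and x: "x \<in> P"
  and st: "!!x. x \<in> H ==> a x w \<in> W" "!!\<beta> x. \<beta> \<in> \<Psi>P ==> x \<in> gsp \<beta> ==> a x w \<in> W" shows "a x w \<in> W"
proof -
 have "x \<in> cspan (H \<union> (\<Union>\<beta>\<in>\<Psi>P. gsp \<beta>))" using x P_eq by blast
 hence "x \<in> P \<and> a x w \<in> W"
 proof (induction rule: span_induct_alt)
  case base
  show ?case using subspace_0[OF P_sub] a_simps(9)[OF x] subspace_0[OF W] by simp
 next
  case (step c x y)
  have "x \<in> P" "a x w \<in> W" using step.hyps st HP by (auto simp: \<Psi>P_def)
  thus ?case using step.IH by (simp add: a_simps subspace_add[OF W] subspace_scale[OF W]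
     subspace_add[OF P_sub] subspace_scale[OF P_sub])
 qed
 thus ?thesis by blast
qed

lemma Vn_stable: assumes x: "x \<in> P" and v: "v \<in> Vn \<mu>" shows "a x v \<in> Vn \<mu>"
proof (rule clinear_span_in[OF a_lin[OF x] Vn_sub _ v[unfolded Vn_def]])
 fix w assume "w \<in> (\<Union>\<delta>\<in>{\<gamma> + sum_list bs | \<gamma> bs. \<gamma> \<in> nr \<and> set bs <= \<Psi>P}. wtsp H a (\<mu> + \<delta>))"
 then obtain \<gamma> bs where g: "\<gamma> \<in> nr" "set bs <= \<Psi>P" "w \<in> wtsp H a (\<mu> + (\<gamma> + sum_list bs))" by blast
 show "a x w \<in> Vn \<mu>"
 proof (rule P_stableI[OF Vn_sub x])
  show "a t w \<in> Vn \<mu>" if "t \<in> H" for t using g(3) that subspace_scale[OF Vn_sub Vn_in[OF g]] by (simp add: wtsp_def)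
  fix \<beta> y assume b: "\<beta> \<in> \<Psi>P" "y \<in> gsp \<beta>"
  have "a y w \<in> wtsp H a (\<mu> + (\<gamma> + sum_list bs) + \<beta>)" using weight_shift b g(3) by blast
  moreover have "\<mu> + (\<gamma> + sum_list bs) + \<beta> = \<mu> + (\<gamma> + sum_list (\<beta> # bs))" by (simp add: fun_eq_iff)
  ultimately show "a y w \<in> Vn \<mu>" using Vn_in[OF g(1), of "\<beta> # bs"] b(1) g(2) by auto
 qed
qed

lemma nr_sum_dual: assumes "\<gamma> \<in> nr" "set bs <= \<Psi>P" shows "\<gamma> + sum_list bs \<in> dual H"
proof -
 have "set (\<gamma> # bs) <= \<Phi>" using assms by (auto simp: nr_def \<Psi>P_def)
 hence "sum_list (\<gamma> # bs) \<in> Ql" unfolding Ql_def by blast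
 thus ?thesis using Ql_dual by (metis sum_list.Cons)
qed

lemma Vn_disjoint:
 assumes mu: "\<mu> \<in> dual H" and v: "v \<in> Vn \<mu>" "v \<in> wtsp H a \<mu>" shows "v = 0"
proof -
 let ?A = "{\<mu> + \<delta> | \<delta>. \<exists>\<gamma> bs. \<delta> = \<gamma> + sum_list bs \<and> \<gamma> \<in> nr \<and> set bs <= \<Psi>P}"
 have nA: "\<mu> \<notin> ?A"
 proof
  assume "\<mu> \<in> ?A"
  then obtain \<gamma> bs where d: "\<mu> = \<mu> + (\<gamma> + sum_list bs)" "\<gamma> \<in> nr" "set bs <= \<Psi>P" by blast
  thus False using nr_sum_nonzero[OF d(2,3)] by (metis add_cancel_right_right)
 qed
 have d: "\<nu> \<in> dual H" if "\<nu> \<in> insert \<mu> ?A" for \<nu> using that mu nr_sum_dual dual_closed(2)[OF mu] by blast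
 have "v \<in> cspan (\<Union>\<nu>\<in>?A. wtsp H a \<nu>)" using v(1) unfolding Vn_def by (rule subsetD[OF span_mono, rotated]) blast
 thus ?thesis using wtsp_disjoint[of H a \<mu> ?A v, OF a_H dual_distinct[OF d d] nA v(2)] by blast
qed

text \<open>Among the weights of vectors in \<open>Vn \<mu>\<close> outside \<open>W\<close> take
  one whose value at \<open>Hel\<close> has maximal real part; positive root vectors then lead into
  \<open>W\<close>.\<close>

lemma Vn_step:
 assumes mu: "\<mu> \<in> dual H" and W: "csubspace W" "W \<subset> Vn \<mu>"
 obtains \<nu> x where "\<nu> \<in> dual H" "\<nu> ~= \<mu>" "x \<in> Vn \<mu>" "x \<notin> W" "x \<in> wtsp H a \<nu>"
  "!!\<beta> e. \<beta> \<in> \<Psi> ==> e \<in> gsp \<beta> ==> a e x \<in> W"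
proof -
 define A where "A = {\<nu> \<in> dual H. \<exists>x\<in>Vn \<mu>. x \<notin> W \<and> x \<in> wtsp H a \<nu>}"
 have "finite A"
 proof (rule finite_weights[OF fdV])
  fix \<beta> assume "\<beta> \<in> A"
  then obtain x where x: "x \<notin> W" "x \<in> wtsp H a \<beta>" unfolding A_def by blast
  hence "x ~= 0" using subspace_0[OF W(1)] by blast
  thus "\<exists>v\<in>UNIV. v ~= 0 \<and> (\<forall>h\<in>H. a h v = \<beta> h *\<^sub>C v)" using x(2) by (auto simp: wtsp_def)
 next
  fix \<beta> \<gamma> assume "\<beta> \<in> A" "\<gamma> \<in> A" "\<beta> ~= \<gamma>"
  thus "\<exists>h\<in>H. \<beta> h ~= \<gamma> h" by (intro dual_distinct) (simp_all add: A_def)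
 qed (rule a_H)
 moreover have "A ~= {}"
 proof
  assume e: "A = {}"
  have "Vn \<mu> <= W" unfolding Vn_def
  proof (rule span_minimal[OF _ W(1)], rule subsetI, rule ccontr)
   fix w assume w: "w \<in> (\<Union>\<delta>\<in>{\<gamma> + sum_list bs | \<gamma> bs. \<gamma> \<in> nr \<and> set bs <= \<Psi>P}. wtsp H a (\<mu> + \<delta>))" "w \<notin> W"
   then obtain \<gamma> bs where g: "\<gamma> \<in> nr" "set bs <= \<Psi>P" "w \<in> wtsp H a (\<mu> + (\<gamma> + sum_list bs))" by blast
   have "\<mu> + (\<gamma> + sum_list bs) \<in> dual H" by (rule dual_closed(2)[OF mu nr_sum_dual[OF g(1,2)]])
   hence "\<mu> + (\<gamma> + sum_list bs) \<in> A" using Vn_in[OF g] g(3) w(2) unfolding A_def by blast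
   thus False using e by blast
  qed
  thus False using W(2) by blast
 qed
 ultimately have m: "finite ((%\<eta>. Re (\<eta> Hel)) ` A)" "(%\<eta>. Re (\<eta> Hel)) ` A ~= {}" by auto
 obtain \<nu> where nu0: "\<nu> \<in> A" "Re (\<nu> Hel) = Max ((%\<eta>. Re (\<eta> Hel)) ` A)" using Max_in[OF m] by auto
 have nu: "\<nu> \<in> A" "!!\<eta>. \<eta> \<in> A ==> Re (\<eta> Hel) \<le> Re (\<nu> Hel)" using nu0 Max_ge[OF m(1)] by auto
 obtain x where x: "x \<in> Vn \<mu>" "x \<notin> W" "x \<in> wtsp H a \<nu>" and nd: "\<nu> \<in> dual H" using nu(1) unfolding A_def by blast
 have "a e x \<in> W" if b: "\<beta> \<in> \<Psi>" and e: "e \<in> gsp \<beta>" for \<beta> e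
 proof (rule ccontr)
  assume n: "a e x \<notin> W"
  have "e \<in> P" using b e Psi_B BP by blast
  hence "a e x \<in> Vn \<mu>" using Vn_stable x(1) by blast
  moreover have "a e x \<in> wtsp H a (\<nu> + \<beta>)" using weight_shift e x(3) Psi_P[OF b] by blast
  moreover have "\<nu> + \<beta> \<in> dual H" by (rule dual_closed(2)[OF nd Phi_dual[OF Psi_Phi[OF b]]])
  ultimately have "\<nu> + \<beta> \<in> A" using n unfolding A_def by blast
  hence "Re (\<nu> Hel + \<beta> Hel) \<le> Re (\<nu> Hel)" using nu(2) by fastforce
  moreover obtain k where "\<beta> Hel = of_nat k" "k ~= 0" using Qp_ht[OF Qp_Psi[OF b]] Phi_nz[OF Psi_Phi[OF b]] by blast
  ultimately show False by simp
 qed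
 moreover have "\<nu> ~= \<mu>" using Vn_disjoint[OF mu x(1)] x(2,3) subspace_0[OF W(1)] by blast
 ultimately show thesis using that nd x by blast
qed

end

section \<open>The central element acting on the generalized Verma module\<close>

locale restricted_verma = parabolic_module ty H B "i -` p" "%x. \<rho> (i x)"
 for ty :: "'g::lie_algebra itself" and H B :: "'g set" and i :: "'g => 'k::lie_algebra" and p :: "'k set"
  and \<rho> :: "'k => 'v::complex_vector => 'v" +
 assumes i: "lie_hom i" and fdk: "fin_dim (UNIV :: 'k set)" and p_alg: "lie_subalgebra p" and rhoM: "lie_module p \<rho> UNIV"
begin

abbreviation "M \<equiv> uea_map i"
abbreviation "R \<equiv> tensor_rel p \<rho>"

lemma M_simps: "M (u + v) = M u + M v" "M (c *\<^sub>C u) = c *\<^sub>C M u" "M (u * v) = M u * M v" "M 1 = 1"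
 "M (uea_in x) = uea_in (i x)" "M (u - v) = M u - M v" "M 0 = 0" using uea_map_hom[OF i] clin[of M] by (auto simp: alg_hom_def)

lemma R_sub: "csubspace R" by (simp add: tensor_rel_def)

lemma R_rel:
 "pair (u + u') v - pair u v - pair u' v \<in> R" "pair u (v + v') - pair u v - pair u v' \<in> R"
 "pair (c *\<^sub>C u) v - c *\<^sub>C pair u v \<in> R" "pair u (c *\<^sub>C v) - c *\<^sub>C pair u v \<in> R"
 "x \<in> p ==> pair (u * uea_in x) v - pair u (\<rho> x v) \<in> R" unfolding tensor_rel_def by (rule span_base; blast)+

text \<open>Submodules of the tensor product are handled as subspaces \<open>S\<close> of the free
  space that contain all relations; modulo \<open>S\<close> the symbol \<open>pair u v\<close> is
  linear in both arguments.\<close>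

context
 fixes S :: "('k uea \<times> 'v \<Rightarrow>\<^sub>0 complex) set"
 assumes S: "csubspace S" "R <= S"
begin

lemma mod_R: "x - y \<in> R ==> x \<in> S \<longleftrightarrow> y \<in> S"
proof -
 assume "x - y \<in> R"
 hence d: "x - y \<in> S" using S(2) by blast
 show "x \<in> S \<longleftrightarrow> y \<in> S" using subspace_add[OF S(1) d, of y] subspace_diff[OF S(1) _ d, of x] by auto
qed

lemma mod_add_left: "pair u v \<in> S ==> pair u' v \<in> S ==> pair (u + u') v \<in> S"
 using mod_R[of "pair (u + u') v" "pair u v + pair u' v"] R_rel(1)[of u u' v] subspace_add[OF S(1)] by (simp add: diff_diff_eq)

lemma mod_add_right: "pair u v \<in> S ==> pair u v' \<in> S ==> pair u (v + v') \<in> S"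
 using mod_R[of "pair u (v + v')" "pair u v + pair u v'"] R_rel(2)[of u v v'] subspace_add[OF S(1)] by (simp add: diff_diff_eq)

lemma mod_scale: "pair u v \<in> S ==> pair (c *\<^sub>C u) v \<in> S" "pair u v \<in> S ==> pair u (c *\<^sub>C v) \<in> S"
 using mod_R[OF R_rel(3)] mod_R[OF R_rel(4)] subspace_scale[OF S(1)] by blast+

lemma mod_zero: "pair 0 v \<in> S" "pair u 0 \<in> S" using mod_R[OF R_rel(3)[of 0 0 v]] mod_R[OF R_rel(4)[of u 0 0]] subspace_0[OF S(1)] by simp_all

lemma mod_act: "x \<in> i -` p ==> pair (u * uea_in (i x)) v \<in> S \<longleftrightarrow> pair u (\<rho> (i x) v) \<in> S"
 by (rule mod_R[OF R_rel(5)]) simp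

text \<open>Modulo the submodule \<open>x\<close> is a highest weight vector, so the annihilating
  left ideal of its weight sends 1 \<otimes> x into the submodule.\<close>

lemma Iv_tensor:
 assumes z: "z \<in> Iv \<nu>" and x: "x \<in> wtsp H (%x. \<rho> (i x)) \<nu>"
  and e: "!!\<beta> e u. \<beta> \<in> \<Psi> ==> e \<in> gsp \<beta> ==> pair (M u) (\<rho> (i e) x) \<in> S" shows "pair (M z) x \<in> S"
proof -
 have "z \<in> {z. pair (M z) x \<in> S}"
 proof (rule span_in_subspace[OF _ _ z[unfolded Iv_def]])
  show "csubspace {z. pair (M z) x \<in> S}" by (intro csubspaceI) (auto simp: M_simps mod_zero mod_add_left mod_scale)
  have "pair (M (u * uea_in e)) x \<in> S" if "\<beta> \<in> \<Psi>" "e \<in> gsp \<beta>" for u e \<beta>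
   using mod_act[of e "M u" x] assms(3)[OF that, of u] that Psi_B BP by (auto simp: M_simps)
  moreover have "pair (M (u * (uea_in t - \<nu> t *\<^sub>C 1))) x \<in> S" if t: "t \<in> H" for u t
  proof -
   have tw: "\<rho> (i t) x = \<nu> t *\<^sub>C x" using x t by (simp add: wtsp_def)
   have "pair (M u * uea_in (i t)) x - \<nu> t *\<^sub>C pair (M u) x \<in> R"
    using subspace_add[OF R_sub R_rel(5)[of "i t" "M u" x] R_rel(4)[of "M u" "\<nu> t" x]] HP[OF t] by (simp add: tw)
   moreover have "pair ((- \<nu> t) *\<^sub>C M u) x - (- \<nu> t) *\<^sub>C pair (M u) x \<in> R" by (rule R_rel(3))
   ultimately have "(pair (M u * uea_in (i t)) x - \<nu> t *\<^sub>C pair (M u) x) + (pair ((- \<nu> t) *\<^sub>C M u) x - (- \<nu> t) *\<^sub>C pair (M u) x) \<in> R"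
    by (rule subspace_add[OF R_sub])
   hence "pair (M u * uea_in (i t)) x + pair ((- \<nu> t) *\<^sub>C M u) x \<in> S" using S(2) by (simp add: subset_iff)
   moreover have "pair (M u * uea_in (i t) + (- \<nu> t) *\<^sub>C M u) x - (pair (M u * uea_in (i t)) x + pair ((- \<nu> t) *\<^sub>C M u) x) \<in> R"
    using R_rel(1)[of "M u * uea_in (i t)" "(- \<nu> t) *\<^sub>C M u" x] by (simp add: diff_diff_eq)
   ultimately have "pair (M u * uea_in (i t) + (- \<nu> t) *\<^sub>C M u) x \<in> S" using mod_R by blast
   thus ?thesis by (simp add: M_simps right_diff_distrib mult_scaleC_right)
  qed
  ultimately show "{u * uea_in e |u e. \<exists>\<beta>\<in>\<Psi>. e \<in> gsp \<beta>} \<union> {u * (uea_in t - \<nu> t *\<^sub>C 1) |u t. t \<in> H} <= {z. pair (M z) x \<in> S}"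
   by blast
 qed
 thus ?thesis by simp
qed

end

lemmas R_mod = R_sub order_refl[of R]

text \<open>The preimage in the free space of what the small enveloping algebra generates from 1
  \<otimes> W.\<close>

definition Sp :: "'v set => ('k uea \<times> 'v \<Rightarrow>\<^sub>0 complex) set" where
 "Sp W = cspan ({pair (M u) w | u w. w \<in> W} \<union> R)"

lemma Sp: "csubspace (Sp W)" "R <= Sp W" "w \<in> W ==> pair (M u) w \<in> Sp W"
 unfolding Sp_def by (simp, (use span_superset in blast), rule span_base, blast)

definition left :: "'k uea => ('k uea \<times> 'v \<Rightarrow>\<^sub>0 complex) => ('k uea \<times> 'v \<Rightarrow>\<^sub>0 complex)" where
 "left u = lin_ext (%(u', v). pair (u * u') v)"

lemma left_linear: "clinear (left u)" unfolding left_def by (rule linear_lin_ext)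

lemma left_pair: "left u (pair u' v) = pair (u * u') v" by (simp add: left_def scaleC_one)

lemma left_R: "x \<in> R ==> left u x \<in> R" unfolding tensor_rel_def by (erule clinear_span_in[OF left_linear subspace_span, rotated])
  (auto intro!: span_base simp: clin[OF left_linear] left_pair distrib_left mult_scaleC_right mult.assoc[symmetric], blast+)

definition killed :: "'g uea => nat => 'v set => bool" where
 "killed d k W \<longleftrightarrow> (\<forall>w\<in>W. \<forall>u. pair (M (d ^ k * u)) w \<in> R)"

lemma killed_mono: "killed d k W ==> k \<le> l ==> killed d l W" unfolding killed_def by (metis le_add_diff_inverse mult.assoc power_add)

lemma killed_Sp: assumes "killed d k W" "x \<in> Sp W" shows "left (M (d ^ k)) x \<in> R"
 by (rule clinear_span_in[OF left_linear R_sub _ assms(2)[unfolded Sp_def]])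
  (use assms(1) left_R in \<open>auto simp: left_pair killed_def simp flip: M_simps(3)\<close>)

text \<open>Choose a submodule \<open>W\<close> of \<open>Vn \<mu>\<close> of maximal dimension that
  is killed by the power \<open>cdim W\<close> of \<open>d\<close>. If it were proper, some vector
  outside, singular modulo \<open>W\<close>, would have a weight at which \<open>d\<close> vanishes,
  and adjoining such vectors costs one more power of \<open>d\<close> but raises the
  dimension.\<close>

lemma killed_Vn:
 assumes d: "d \<in> uea_center" and mu: "\<mu> \<in> dual H"
  and dI: "!!\<nu> W x. \<nu> \<in> dual H ==> \<nu> ~= \<mu> ==> csubspace W ==> (!!x w. x \<in> i -` p ==> w \<in> W ==> \<rho> (i x) w \<in> W) ==>
   x \<notin> W ==> x \<in> wtsp H (%x. \<rho> (i x)) \<nu> ==> (!!\<beta> e. \<beta> \<in> \<Psi> ==> e \<in> gsp \<beta> ==> \<rho> (i e) x \<in> W) ==> d \<in> Iv \<nu>"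
 shows "killed d (cdim (UNIV :: 'v set)) (Vn \<mu>)"
proof -
 let ?Q = "%W. csubspace W \<and> W <= Vn \<mu> \<and> (\<forall>x\<in>i -` p. \<forall>w\<in>W. \<rho> (i x) w \<in> W) \<and> killed d (cdim W) W"
 have dimV: "cdim C \<le> cdim (UNIV :: 'v set)" for C :: "'v set" by (rule fin_dim_dim_mono[OF fdV complex_vector.subspace_UNIV subset_UNIV])
 have "?Q {0}" using subspace_0[OF Vn_sub] a_simps mod_zero[OF R_mod] by (auto simp: killed_def)
 hence "\<exists>W. ?Q W \<and> (\<forall>D. ?Q D --> cdim D \<le> cdim W)" by (rule max_dim_exists[OF _ dimV])
 then obtain W where W0: "?Q W \<and> (\<forall>D. ?Q D --> cdim D \<le> cdim W)" ..
 hence W: "csubspace W" "W <= Vn \<mu>" "!!x w. x \<in> i -` p ==> w \<in> W ==> \<rho> (i x) w \<in> W" "killed d (cdim W) W"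
  and max: "!!D. ?Q D ==> cdim D \<le> cdim W" by blast+
 have "W = Vn \<mu>"
 proof (rule ccontr)
  assume "W ~= Vn \<mu>"
  hence "W \<subset> Vn \<mu>" using W(2) by blast
  then obtain \<nu> x where x: "\<nu> \<in> dual H" "\<nu> ~= \<mu>" "x \<in> Vn \<mu>" "x \<notin> W" "x \<in> wtsp H (%x. \<rho> (i x)) \<nu>"
   "!!\<beta> e. \<beta> \<in> \<Psi> ==> e \<in> gsp \<beta> ==> \<rho> (i e) x \<in> W" using Vn_step[OF mu W(1)] by metis
  have dnu: "d \<in> Iv \<nu>" by (rule dI[OF x(1,2) W(1,3) x(4-6)])
  \<comment> \<open>Taking everything that \<open>d\<close> moves into \<open>Sp W\<close>, and not
    just the span of \<open>W\<close> and \<open>x\<close>, makes stability under the parabolic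
    subalgebra automatic.\<close>
  define D where "D = {w \<in> Vn \<mu>. \<forall>u. pair (M (d * u)) w \<in> Sp W}"
  have Ds: "csubspace D"
  proof (rule csubspaceI)
   show "0 \<in> D" using subspace_0[OF Vn_sub] mod_zero(2)[OF Sp(1,2)] by (simp add: D_def)
  qed (use subspace_add[OF Vn_sub] subspace_scale[OF Vn_sub] mod_add_right[OF Sp(1,2)] mod_scale(2)[OF Sp(1,2)] in \<open>auto simp: D_def\<close>)
  have Dst: "\<rho> (i y) w \<in> D" if y: "y \<in> i -` p" and w: "w \<in> D" for y w
  proof -
   have "pair (M (d * u)) (\<rho> (i y) w) \<in> Sp W" for u
   proof -
    have "pair (M (d * (u * uea_in y))) w \<in> Sp W" using w unfolding D_def by blast
    thus ?thesis using mod_act[OF Sp(1,2) y, of "M (d * u)" w] by (simp add: M_simps mult.assoc)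
   qed
   thus ?thesis using Vn_stable[OF y] w by (simp add: D_def)
  qed
  have WD: "W <= D" using W(2) Sp(3) by (auto simp: D_def)
  have "pair (M (d * u)) x \<in> Sp W" for u
  proof -
   have "d * u = u * d" using d by (simp add: uea_center_def)
   moreover have "pair (M (u * d)) x \<in> Sp W" by (rule Iv_tensor[OF Sp(1,2) Iv_left[OF dnu] x(5)]) (rule Sp(3)[OF x(6)])
   ultimately show ?thesis by simp
  qed
  hence "x \<in> D" using x(3) by (simp add: D_def)
  hence lt: "cdim W < cdim D" using WD x(4) by (intro fin_dim_psubset_dim[OF fin_dim_subset[OF fdV subset_UNIV] Ds W(1)]) blast
  have "killed d (Suc (cdim W)) D" unfolding killed_def
  proof (intro ballI allI)
   fix w u assume "w \<in> D"
   hence "pair (M (d * u)) w \<in> Sp W" unfolding D_def by blast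
   from killed_Sp[OF W(4) this] show "pair (M (d ^ Suc (cdim W) * u)) w \<in> R"
    by (simp add: left_pair power_Suc2 mult.assoc del: power_Suc flip: M_simps(3))
  qed
  hence "?Q D" using Ds Dst lt killed_mono[of d _ D "cdim D"] by (auto simp: D_def)
  thus False using max[of D] lt by simp
 qed
 thus ?thesis using W(4) killed_mono dimV by blast
qed

text \<open>In the word model with a basis adapted to the range of \<open>i\<close>, everything
  generated from 1 \<otimes> Vn \<mu> has coefficients in \<open>Vn \<mu>\<close>, whereas 1
  \<otimes> v is the empty word with the coefficient \<open>v\<close> outside
  \<open>Vn \<mu>\<close>.\<close>

lemma one_tensor:
 assumes mu: "\<mu> \<in> dual H" and v: "v \<in> wtsp H (%x. \<rho> (i x)) \<mu>" "v ~= 0" shows "pair 1 v \<notin> Sp (Vn \<mu>)"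
proof
 assume pv: "pair 1 v \<in> Sp (Vn \<mu>)"
 have vn: "v \<notin> Vn \<mu>" using Vn_disjoint[OF mu _ v(1)] v(2) by blast
 have ps: "csubspace p" using p_alg by (simp add: lie_subalgebra_def)
 have K: "lie_subalgebra (range i)" using i unfolding lie_hom_def lie_subalgebra_def
  by (auto intro!: csubspaceI) (metis clinear_zero rangeI, metis clinear_add rangeI, metis clinear_scale rangeI, metis rangeI)
 obtain n :: nat and b :: "nat => 'k" and c and I where bc: "!!i. clinear (c i)" "!!i j. i < n ==> j < n ==> c i (b j) = (if i = j then 1 else (0::complex))"
  "p = {y. \<forall>i<n. c i y = 0}" "I <= {..<n}" "!!j. j \<in> I ==> b j \<in> range i"
  "!!j y. j < n ==> j \<notin> I ==> y \<in> range i ==> c j y = 0" by (rule adapted_basis[OF fdk ps, where K = "range i"]) (rule that; assumption)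
 have p_brk: "!!y z. y \<in> p ==> z \<in> p ==> brk y z \<in> p" using p_alg by (simp add: lie_subalgebra_def)
 interpret N: induced_module n b c p \<rho> by (rule induced_module.intro[OF bc(1,2,3) p_brk rhoM])
 note us = uact_simps[OF N.act_rep]
 let ?s = "%v. Poly_Mapping.single [] v :: nat list \<Rightarrow>\<^sub>0 'v"
 note sl = clin[OF single_linear, of "[]"]
 define E where "E = lin_ext (%(u, w). uact N.act u (?s w))"
 have El: "clinear E" unfolding E_def by (rule linear_lin_ext)
 have Ep: "E (pair u w) = uact N.act u (?s w)" for u w by (simp add: E_def scaleC_one)
 have ER: "E x = 0" if "x \<in> R" for x using that unfolding tensor_rel_def by (rule clinear_eq_on_span[OF El clinear_const_0, rotated])
   (auto simp: clin[OF El] Ep us sl N.act_P)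
 define N' where "N' = {q. \<forall>k\<in>Poly_Mapping.keys q. set k <= I \<and> Poly_Mapping.lookup q k \<in> Vn \<mu>}"
 have N's: "csubspace N'"
 proof -
  have "q \<in> N' \<longleftrightarrow> (\<forall>k. (set k <= I --> Poly_Mapping.lookup q k \<in> Vn \<mu>) \<and> (\<not> set k <= I --> Poly_Mapping.lookup q k = 0))" for q
   using subspace_0[OF Vn_sub] by (force simp: N'_def in_keys_iff)
  thus ?thesis using Vn_sub[of \<mu>] by (intro csubspaceI) (auto simp: lookup_add subspace_def)
 qed
 have st: "N.act (i x) q \<in> N'" if "q \<in> N'" for x q unfolding N'_def
  by (rule N.act_stable[OF K bc(5,6) Vn_sub _ rangeI that[unfolded N'_def]]) (use Vn_stable in auto)
 have EM: "E (pair (M u) w) \<in> N'" if w: "w \<in> Vn \<mu>" for u w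
 proof -
  have "u \<in> {u. uact N.act (M u) (?s w) \<in> N'}"
  proof (rule uea_induct)
   show "csubspace {u. uact N.act (M u) (?s w) \<in> N'}" using N's by (intro csubspaceI) (auto simp: M_simps us subspace_def)
   show "1 \<in> {u. uact N.act (M u) (?s w) \<in> N'}" using w by (auto simp: M_simps us N'_def)
  qed (simp add: M_simps us st)
  thus ?thesis by (simp add: Ep)
 qed
 have "E (pair 1 v) \<in> N'" by (rule clinear_span_in[OF El N's _ pv[unfolded Sp_def]]) (use EM ER subspace_0[OF N's] in auto)
 hence "?s v \<in> N'" by (simp add: Ep us)
 thus False using v(2) vn by (auto simp: N'_def)
qed

lemma tensor_eqv_iff: "verma_tensor p \<rho> u v = verma_tensor p \<rho> u' v' \<longleftrightarrow> pair u v - pair u' v' \<in> R"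
 using eq_equiv_class_iff[OF equiv_tensor_eqv, of "pair u v" "pair u' v'"] by (simp add: verma_tensor_def tensor_eqv_def)

lemma scale_tensor: "verma_scale p \<rho> c (verma_tensor p \<rho> u v) = verma_tensor p \<rho> (c *\<^sub>C u) v"
proof -
 have "pair (c *\<^sub>C u) v - c *\<^sub>C pair u v \<in> R" by (rule R_rel(3))
 hence "tensor_eqv p \<rho> `` {pair (c *\<^sub>C u) v} = tensor_eqv p \<rho> `` {c *\<^sub>C pair u v}"
  by (intro equiv_class_eq[OF equiv_tensor_eqv]) (simp add: tensor_eqv_def)
 thus ?thesis by (simp add: verma_tensor_def verma_scale_class)
qed

text \<open>The power \<open>d ^ k\<close> kills everything generated from \<open>Vn \<mu>\<close>
  and is congruent to 1 modulo the left ideal of \<mu>, so it changes 1 \<otimes> v only within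
  \<open>Sp (Vn \<mu>)\<close>. As \<open>B\<close> acts on \<open>v\<close> by scalars modulo
  \<open>Vn \<mu>\<close>, it acts on the image by scalars.\<close>

lemma singular_tensor:
 assumes d: "d \<in> uea_center" "d - 1 \<in> Iv \<mu>'" and mu: "\<mu> \<in> dual H" "!!x. x \<in> H ==> \<mu>' x = \<mu> x"
  and k: "killed d k (Vn \<mu>)" and v: "v \<in> Sing \<mu>" "v ~= 0" shows "let m = verma_act p \<rho> (M (d ^ k)) (verma_tensor p \<rho> 1 v)
  in m \<in> verma_module p \<rho> \<and> m ~= verma_zero p \<rho> \<and>
   singular (verma_scale p \<rho>) (%x. verma_act p \<rho> (uea_in (i x))) B m"
proof -
 define e where "e = d ^ k"
 have ec: "e \<in> uea_center" unfolding e_def by (induction k) (simp_all add: center_1 center_mult d(1))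
 have vw: "v \<in> wtsp H (%x. \<rho> (i x)) \<mu>" "v \<in> wtsp H (%x. \<rho> (i x)) \<mu>'" using v(1) mu(2) by (auto simp: Sing_def wtsp_def)
 have eI: "e - 1 \<in> Iv \<mu>'" unfolding e_def
 proof (induction k)
  case 0 show ?case using subspace_0[OF Iv_sub] by simp
 next
  case (Suc k)
  have "d * (d ^ k - 1) + (d - 1) \<in> Iv \<mu>'" by (intro subspace_add[OF Iv_sub] Iv_left Suc d(2))
  thus ?case by (simp add: algebra_simps)
 qed
 have raise: "\<rho> (i x) v \<in> Vn \<mu>" if "\<beta> \<in> \<Psi>" "x \<in> gsp \<beta>" for \<beta> x
 proof (cases "\<beta> \<in> lev")
  case True
  thus ?thesis using that v(1) subspace_0[OF Vn_sub] by (auto simp: Sing_def)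
 next
  case False
  hence "\<beta> \<in> nr" using Psi_P[OF that(1)] by (simp add: nr_def)
  moreover have "\<rho> (i x) v \<in> wtsp H (%x. \<rho> (i x)) (\<mu> + \<beta>)" using weight_shift[OF _ that(2) vw(1)] Psi_P[OF that(1)] by blast
  ultimately show ?thesis using Vn_in[of \<beta> "[]"] by simp
 qed
 have e0: "pair (M (e * u)) w \<in> R" if "w \<in> Vn \<mu>" for w u using k that by (simp add: killed_def e_def)
 have m: "verma_act p \<rho> (M e) (verma_tensor p \<rho> 1 v) = verma_tensor p \<rho> (M e) v" by (simp add: verma_act_tensor)
 have "pair (M e) v \<notin> R"
 proof
  assume "pair (M e) v \<in> R"
  hence "pair (M e) v \<in> Sp (Vn \<mu>)" using Sp(2) by blast
  moreover have "pair (M (e - 1)) v \<in> Sp (Vn \<mu>)" by (rule Iv_tensor[OF Sp(1,2) eI vw(2)]) (rule Sp(3)[OF raise])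
  hence "pair ((- 1) *\<^sub>C M (e - 1)) v \<in> Sp (Vn \<mu>)" by (rule mod_scale(1)[OF Sp(1,2)])
  ultimately have "pair (M e + (- 1) *\<^sub>C M (e - 1)) v \<in> Sp (Vn \<mu>)" by (rule mod_add_left[OF Sp(1,2)])
  thus False using one_tensor[OF mu(1) vw(1) v(2)] by (simp add: M_simps scaleC_one)
 qed
 hence "verma_tensor p \<rho> (M e) v ~= verma_zero p \<rho>"
  using eq_equiv_class_iff[OF equiv_tensor_eqv, of "pair (M e) v" 0 p \<rho>] by (simp add: verma_tensor_def verma_zero_def tensor_eqv_def)
 moreover have "verma_tensor p \<rho> (M e) v \<in> verma_module p \<rho>" by (simp add: verma_tensor_def verma_module_def quotientI)
 moreover have "singular (verma_scale p \<rho>) (%x. verma_act p \<rho> (uea_in (i x))) B (verma_tensor p \<rho> (M e) v)" unfolding singular_def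
 proof clarsimp
  fix x c assume x: "x \<in> B"
  have "x \<in> cspan (H \<union> (\<Union>\<beta>\<in>\<Psi>. gsp \<beta>))" using x B_eq by (simp add: root_alg_def)
  hence "x \<in> i -` p \<and> (\<exists>s. \<rho> (i x) v - s *\<^sub>C v \<in> Vn \<mu>)"
  proof (rule span_eigen[OF Vn_sub, rotated])
   fix y assume "y \<in> H \<union> (\<Union>\<beta>\<in>\<Psi>. gsp \<beta>)"
   then consider "y \<in> H" | \<beta> where "\<beta> \<in> \<Psi>" "y \<in> gsp \<beta>" by blast
   thus "y \<in> i -` p \<and> (\<exists>s. \<rho> (i y) v - s *\<^sub>C v \<in> Vn \<mu>)"
   proof cases
    case 1
    hence "\<rho> (i y) v - \<mu> y *\<^sub>C v \<in> Vn \<mu>" using vw(1) subspace_0[OF Vn_sub] by (simp add: wtsp_def)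
    thus ?thesis using HP 1 by blast
   next
    case (2 \<beta>)
    have "\<rho> (i y) v - 0 *\<^sub>C v \<in> Vn \<mu>" using raise[OF 2] by simp
    thus ?thesis using Psi_B[OF 2(1)] BP 2(2) by blast
   qed
  qed
  then obtain s where s: "x \<in> i -` p" "\<rho> (i x) v - s *\<^sub>C v \<in> Vn \<mu>" by blast
  define w where "w = \<rho> (i x) v - s *\<^sub>C v"
  have "uea_in (i x) * (c *\<^sub>C M e) = (c *\<^sub>C M e) * uea_in (i x)"
  proof -
   have "M (uea_in x * e) = M (e * uea_in x)" using ec by (simp add: uea_center_def)
   thus ?thesis by (simp add: M_simps mult_scaleC_left mult_scaleC_right)
  qed
  moreover have "pair ((c *\<^sub>C M e) * uea_in (i x)) v - pair ((c * s) *\<^sub>C M e) v \<in> R"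
  proof -
   let ?e = "c *\<^sub>C M e"
   have 1: "pair (?e * uea_in (i x)) v - pair ?e (\<rho> (i x) v) \<in> R" by (rule R_rel(5)) (use s(1) in simp)
   have "\<rho> (i x) v = s *\<^sub>C v + w" by (simp add: w_def)
   hence 2: "pair ?e (\<rho> (i x) v) - pair ?e (s *\<^sub>C v) - pair ?e w \<in> R" using R_rel(2)[of ?e "s *\<^sub>C v" w] by simp
   have 3: "pair ?e w \<in> R" using e0[of w "c *\<^sub>C 1"] s(2) by (simp add: M_simps mult_scaleC_right w_def)
   have 4: "pair ?e (s *\<^sub>C v) - s *\<^sub>C pair ?e v \<in> R" by (rule R_rel(4))
   have 5: "pair (s *\<^sub>C ?e) v - s *\<^sub>C pair ?e v \<in> R" by (rule R_rel(3))
   have "(pair (?e * uea_in (i x)) v - pair ?e (\<rho> (i x) v)) + (pair ?e (\<rho> (i x) v) - pair ?e (s *\<^sub>C v) - pair ?e w) + pair ?e w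
     + (pair ?e (s *\<^sub>C v) - s *\<^sub>C pair ?e v) - (pair (s *\<^sub>C ?e) v - s *\<^sub>C pair ?e v) \<in> R"
    by (intro subspace_add[OF R_sub] subspace_diff[OF R_sub] 1 2 3 4 5)
   thus ?thesis by (simp add: scaleC_scaleC mult.commute)
  qed
  ultimately have "verma_act p \<rho> (uea_in (i x)) (verma_scale p \<rho> c (verma_tensor p \<rho> (M e) v)) = verma_scale p \<rho> (c * s) (verma_tensor p \<rho> (M e) v)"
   by (simp add: scale_tensor verma_act_tensor tensor_eqv_iff)
  thus "verma_act p \<rho> (uea_in (i x)) (verma_scale p \<rho> c (verma_tensor p \<rho> (M e) v)) \<in> range (%c. verma_scale p \<rho> c (verma_tensor p \<rho> (M e) v))"
   by blast
 qed
 ultimately show ?thesis by (simp add: Let_def m flip: e_def)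
qed

end

context parabolic_module
begin

lemma Iv_cong: "(!!x. x \<in> H ==> \<mu> x = \<nu> x) ==> Iv \<mu> = Iv \<nu>"
 unfolding Iv_def by (rule arg_cong[of _ _ cspan]) (force intro: arg_cong2[of _ _ _ _ "(\<union>)"])

text \<open>A group element carrying the shifted \<mu> to the shifted \<nu> would link the two
  weights, so Condition B supplies the hypothesis of the interpolation.\<close>

lemma condition_B_center:
 assumes "condition_B H B n" and mu: "\<mu> \<in> dual H" "n \<mu> > 0" shows "\<exists>d\<in>uea_center. d - 1 \<in> Iv \<mu> \<and>
  (\<forall>\<nu>\<in>dual H. \<nu> ~= \<mu> \<and> n \<nu> > 0 \<and> (\<exists>w. w ~= 0 \<and> w \<in> wtsp H a \<nu>) --> d \<in> Iv \<nu>)"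
proof -
 \<comment> \<open>Restricting to weights that occur in the module makes the set of points
   finite.\<close>
 define T where "T = {\<nu> \<in> dual H. \<nu> ~= \<mu> \<and> n \<nu> > 0 \<and> (\<exists>w. w ~= 0 \<and> w \<in> wtsp H a \<nu>)}"
 have "finite T" by (rule finite_weights[OF fdV a_H]) (use dual_distinct in \<open>auto simp: T_def wtsp_def\<close>)
 have "\<forall>\<nu>. \<nu> \<in> dual H --> (\<exists>\<nu>'. \<nu>' \<in> hstar \<and> (\<forall>x\<in>H. \<nu>' x = \<nu> x))" using hstar_ext by metis
 then obtain E where E: "!!\<nu>. \<nu> \<in> dual H ==> E \<nu> \<in> hstar" "!!\<nu> x. \<nu> \<in> dual H ==> x \<in> H ==> E \<nu> x = \<nu> x" by metis
 have ne: "\<exists>x\<in>H. E \<mu> (g x) + rh (g x) - rh x ~= \<nu>' x" if "\<nu>' \<in> E ` T" and g: "g \<in> G" for \<nu>' g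
 proof (rule ccontr)
  assume eq: "\<not> ?thesis"
  obtain \<nu> where nu: "\<nu> \<in> T" "\<nu>' = E \<nu>" using \<open>\<nu>' \<in> E ` T\<close> by blast
  have nd: "\<nu> \<in> dual H" using nu(1) by (simp add: T_def)
  obtain w where w: "w \<in> weyl_group H" "\<forall>\<xi>\<in>dual H. w \<xi> \<in> dual H \<and> (\<forall>x\<in>H. w \<xi> x = \<xi> (g x))" using G_weyl[OF g] by blast
  have md: "\<mu> + \<rho>0 \<in> dual H" by (rule dual_closed(2)[OF mu(1) rho_dual])
  have "w (\<mu> + \<rho>0) = \<nu> + \<rho>0"
  proof (rule dual_eqI)
   show "w (\<mu> + \<rho>0) x = (\<nu> + \<rho>0) x" if "x \<in> H" for x
   proof -
    have "E \<mu> (g x) + rh (g x) - rh x = \<nu>' x" using eq that by blast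
    hence "(\<mu> + \<rho>0) (g x) = \<nu> x + \<rho>0 x" using E(2)[OF mu(1) G_H[OF g that]] E(2)[OF nd that] rh(2)[OF G_H[OF g that]] rh(2)[OF that] nu(2)
     by (simp add: plus_fun_apply algebra_simps)
    thus ?thesis using w(2) md that by (simp add: plus_fun_apply)
   qed
  qed (use w(2) md dual_closed(2)[OF nd rho_dual] in blast)+
  hence "w (\<mu> + \<rho>0) - \<rho>0 = \<nu>" by (metis add_diff_cancel_right')
  hence "linked H B \<mu> \<nu>" using w(1) unfolding linked_def by blast
  moreover have "\<mu> ~= \<nu>" "n \<nu> > 0" using nu(1) by (auto simp: T_def)
  ultimately show False using assms(1) mu nd unfolding condition_B_def by metis
 qed
 have "\<exists>d\<in>uea_center. d - 1 \<in> Iv (E \<mu>) \<and> (\<forall>\<nu>\<in>E ` T. d \<in> Iv \<nu>)"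
  by (rule central_interpolation) (use \<open>finite T\<close> E(1) mu ne in \<open>auto simp: T_def\<close>)
 moreover have "Iv (E \<nu>) = Iv \<nu>" if "\<nu> \<in> dual H" for \<nu> by (rule Iv_cong) (rule E(2)[OF that])
 ultimately obtain d where d: "d \<in> uea_center" "d - 1 \<in> Iv \<mu>" "\<forall>\<nu>\<in>T. d \<in> Iv (E \<nu>)" using mu(1) by auto
 thus ?thesis using \<open>!!\<nu>. \<nu> \<in> dual H ==> Iv (E \<nu>) = Iv \<nu>\<close> by (intro bexI[of _ d] conjI d) (auto simp: T_def)
qed

end

theorem theorem4p5:
  fixes i :: "'h::lie_algebra \<Rightarrow> 'g::lie_algebra"
    and hb bb pb lb :: "'h set"
    and h b p l :: "'g set"
    and \<rho> :: "'g \<Rightarrow> 'v::complex_vector \<Rightarrow> 'v"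
    and lam :: "'g \<Rightarrow> complex" and \<mu> :: "'h \<Rightarrow> complex"
    and n :: "('h \<Rightarrow> complex) \<Rightarrow> nat"
  assumes "fin_dim (UNIV :: 'h set)" and "reductive (UNIV :: 'h set)"
    and "fin_dim (UNIV :: 'g set)" and "reductive (UNIV :: 'g set)"
    and "lie_hom i" and "inj i" and "reductive_in (range i)"
    and "cartan_subalgebra hb" and "cartan_subalgebra h" and "i ` hb \<subseteq> h"
    and "borel_subalgebra bb" and "hb \<subseteq> bb"
    and "borel_subalgebra b" and "h \<subseteq> b" and "i ` bb \<subseteq> b"
    and "parabolic_subalgebra p" and "b \<subseteq> p"
    and pb_def: "pb = i -` (range i \<inter> p)"
    and l_def: "l = levi h p" and lb_def: "lb = levi hb pb"
    and "lam \<in> dual h" and "dominant_integral l h b lam"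
    and "irr_highest_weight l h b \<rho> lam (UNIV :: 'v set)"
    and "lie_module p \<rho> (UNIV :: 'v set)" and "\<forall>x\<in>nilrad h p. \<forall>v. \<rho> x v = 0"
    and n_def: "n = multiplicity lb hb bb (\<lambda>x. \<rho> (i x)) (UNIV :: 'v set)"
    and "condition_B hb bb n"
    and "\<mu> \<in> dual hb" and "n \<mu> > 0"
  shows "\<exists>d\<in>uea_center. \<forall>v :: 'v.
      v \<noteq> 0 \<and> singular scaleC (\<lambda>x. \<rho> (i x)) (bb \<inter> lb) v \<and>
      weight_vector hb (\<lambda>x. \<rho> (i x)) \<mu> v \<longrightarrow>
      (let m = verma_act p \<rho> (uea_map i d) (verma_tensor p \<rho> 1 v)
       in m \<in> verma_module p \<rho> \<and> m \<noteq> verma_zero p \<rho> \<and>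
          singular (verma_scale p \<rho>) (\<lambda>x. verma_act p \<rho> (uea_in (i x))) bb m)"
proof -
 have pb: "pb = i -` p" by (auto simp: pb_def)
 have p: "lie_subalgebra p" using \<open>parabolic_subalgebra p\<close> by (simp add: parabolic_subalgebra_def)
 interpret i: Vector_Spaces.linear scaleC scaleC i using \<open>lie_hom i\<close> by (simp add: lie_hom_def)
 have ib: "i (brk x y) = brk (i x) (i y)" for x y using \<open>lie_hom i\<close> by (simp add: lie_hom_def)
 interpret restricted_verma "TYPE('h)" hb bb i p \<rho>
 proof unfold_locales
  show "lie_subalgebra (i -` p)" using p subspace_0 subspace_add subspace_scale
   by (auto simp: lie_subalgebra_def ib i.zero i.add i.scale intro!: csubspaceI)
  show "lie_module (i -` p) (%x. \<rho> (i x)) UNIV" using \<open>lie_module p \<rho> UNIV\<close> by (simp add: lie_module_def ib i.add i.scale)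
  show "bb <= i -` p" using \<open>i ` bb <= b\<close> \<open>b <= p\<close> by blast
  show "fin_dim (UNIV :: 'v set)" using \<open>irr_highest_weight l h b \<rho> lam UNIV\<close> by (simp add: irr_highest_weight_def)
 qed (fact assms p)+
 have n: "n = multiplicity L hb bb (%x. \<rho> (i x)) UNIV" by (simp add: n_def lb_def pb)
 obtain d where d: "d \<in> uea_center" "d - 1 \<in> Iv \<mu>"
  "\<forall>\<nu>\<in>dual hb. \<nu> ~= \<mu> \<and> n \<nu> > 0 \<and> (\<exists>w. w ~= 0 \<and> w \<in> wtsp hb (%x. \<rho> (i x)) \<nu>) --> d \<in> Iv \<nu>"
  using condition_B_center[OF \<open>condition_B hb bb n\<close> \<open>\<mu> \<in> dual hb\<close> \<open>n \<mu> > 0\<close>] by blast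
 \<comment> \<open>One exponent serves all vectors \<open>v\<close>: the dimension of the module
   bounds the length of the chain of submodules in \<open>Vn \<mu>\<close>.\<close>
 define k where "k = cdim (UNIV :: 'v set)"
 have "killed d k (Vn \<mu>)" unfolding k_def
 proof (rule killed_Vn[OF d(1) \<open>\<mu> \<in> dual hb\<close>])
  fix \<nu> and W :: "'v set" and x
  assume nu: "\<nu> \<in> dual hb" "\<nu> ~= \<mu>" and W: "csubspace W" "!!x w. x \<in> i -` p ==> w \<in> W ==> \<rho> (i x) w \<in> W"
   and x: "x \<notin> W" "x \<in> wtsp hb (%x. \<rho> (i x)) \<nu>" "!!\<beta> e. \<beta> \<in> \<Psi> ==> e \<in> gsp \<beta> ==> \<rho> (i e) x \<in> W"
  have "n \<nu> > 0" unfolding n by (rule multiplicity_pos[OF _ nu(1) W x]) (use \<open>n \<mu> > 0\<close> n in simp_all)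
  moreover have "x ~= 0" using x(1) subspace_0[OF W(1)] by blast
  ultimately show "d \<in> Iv \<nu>" using d(3) nu x(2) by blast
 qed
 note main = singular_tensor[OF d(1,2) \<open>\<mu> \<in> dual hb\<close> refl this]
 show ?thesis
 proof (intro bexI[of _ "d ^ k"] allI impI)
  show "d ^ k \<in> uea_center" by (induction k) (simp_all add: center_1 center_mult d(1))
  fix v :: 'v
  assume v: "v ~= 0 \<and> singular scaleC (%x. \<rho> (i x)) (bb \<inter> lb) v \<and> weight_vector hb (%x. \<rho> (i x)) \<mu> v"
  hence "v \<in> wtsp hb (%x. \<rho> (i x)) \<mu>" by (simp add: weight_vector_def wtsp_def)
  hence "v \<in> Sing \<mu>" using singular_Sing[of v \<mu>] v by (simp add: lb_def pb)
  thus "let m = verma_act p \<rho> (uea_map i (d ^ k)) (verma_tensor p \<rho> 1 v)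
    in m \<in> verma_module p \<rho> \<and> m ~= verma_zero p \<rho> \<and>
     singular (verma_scale p \<rho>) (%x. verma_act p \<rho> (uea_in (i x))) bb m" using main v by blast
 qed
qed

end
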